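(* Let $\mathcal B$ be a braided tensor category, $A$ a finite abelian group, and $\mathcal C=\bigoplus_{x\in A}\mathcal C_x$ a braided $A$-extension of $\mathcal B$ with braiding $c$. Let $L=\{L_{x,y}\}_{x,y\in A}$ be a $2$-cocycle in $Z^2_{br}(A,\mathrm{Inv}(\mathcal Z_{sym}(\mathcal B)))$. Put $X\,\tilde\otimes\,Y=L_{x,y}\otimes X\otimes Y$ for $X\in\mathcal C_x$, $Y\in\mathcal C_y$. One can choose isomorphisms $$\xi_{x,y,z}:L_{xy,z}\otimes L_{x,y}\xrightarrow{\sim}L_{x,yz}\otimes L_{y,z},\qquad\kappa_{x,y}:L_{x,y}\xrightarrow{\sim}L_{y,x},\qquad x,y,z\in A,$$ so that the associativity isomorphisms $$(X\tilde\otimes Y)\tilde\otimes Z=L_{xy,z}\otimes L_{x,y}\otimes X\otimes Y\otimes Z\xrightarrow{\xi_{x,y,z}}L_{x,yz}\otimes L_{y,z}\otimes X\otimes Y\otimes Z\xrightarrow{c_{L_{y,z},X}}L_{x,yz}\otimes X\otimes L_{y,z}\otimes Y\otimes Z=X\tilde\otimes(Y\tilde\otimes Z)$$ and the braiding isomorphisms $$X\tilde\otimes Y=L_{x,y}\otimes X\otimes Y\xrightarrow{\kappa_{x,y}}L_{y,x}\otimes X\otimes Y\xrightarrow{c_{X,Y}}L_{y,x}\otimes Y\otimes X=Y\tilde\otimes X$$ (for $X\in\mathcal C_x$, $Y\in\mathcal C_y$, $Z\in\mathcal C_z$) satisfy the pentagon and hexagon axioms if and only if $PW^2_{\mathcal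 C}(L)$ is trivial in $H^4_{br}(A,k^\times)$.
   Context: $k$ is an algebraically closed field; tensor categories are $k$-linear and finite. A braided $A$-extension of $\mathcal B$ is a braided tensor category $\mathcal C=\bigoplus_{x\in A}\mathcal C_x$ with $\mathcal C_e=\mathcal B$, all $\mathcal C_x\ne0$, and $\otimes:\mathcal C_x\times\mathcal C_y\to\mathcal C_{xy}$. Associativity constraints of $\mathcal C$ are omitted. $\mathcal Z_{sym}(\mathcal B)$ is the full subcategory of objects $V\in\mathcal B$ with $c_{X,V}c_{V,X}=\mathrm{id}$ for all $X\in\mathcal B$; $\mathrm{Inv}$ denotes the group of isomorphism classes of invertible objects (we also write $L_{x,y}$ for representing objects). A $2$-cocycle $L\in Z^2_{br}(A,\mathrm{Inv}(\mathcal Z_{sym}(\mathcal B)))$ is a (normalised) function $A\times A\to\mathrm{Inv}(\mathcal Z_{sym}(\mathcal B))$ with $L_{xy,z}L_{x,y}=L_{x,yz}L_{y,z}$ and $L_{x,y}=L_{y,x}$ as isomorphism classes. For $Z\in\mathrm{Inv}(\mathcal Z_{sym}(\mathcal B))$ and $x\in A$, $[\mathcal C_x,Z]\in k^\times$ is the scalar with $c_{M,Z}c_{Z,M}=[\mathcal C_x,Z]\,\mathrm{id}_{Z\otimes M}$ for all $M\in\mathcal C_x$. $H^4_{br}(A,k^\times)=H^5(K(A,2),k^\times)$; a $4$-cochain is a triple $(a(x,y,z,w),a(x,y|z),a(x|y,z))$, a $3$-cochain a pair $(a(x,y,z),a(x|y))$, and (written additively) $d:C^3_{br}\to C^4_{br}$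 is $d(a)(x,y,z,w)=a(y,z,w)-a(xy,z,w)+a(x,yz,w)-a(x,y,zw)+a(x,y,z)$, $d(a)(x,y|z)=a(y|z)-a(xy|z)+a(x|z)+a(x,y,z)-a(x,z,y)+a(z,x,y)$, $d(a)(x|y,z)=a(x|y)-a(x|yz)+a(x|z)-a(x,y,z)+a(y,x,z)-a(y,z,x)$. $PW^2_{\mathcal C}(L)$ (second Pontryagin–Whitehead map) is the class of the braided $4$-cocycle with components $$PW^2_{\mathcal C}(L)(x,y,z,w)=c_{L_{x,y},L_{z,w}},\quad PW^2_{\mathcal C}(L)(x,y|z)=1,\quad PW^2_{\mathcal C}(L)(x|y,z)=[\mathcal C_x,L_{y,z}],$$ where braidings of invertible objects of $\mathcal Z_{sym}(\mathcal B)$ are regarded as scalars (using a skeletal model of the symmetric categorical group of invertible objects of $\mathcal Z_{sym}(\mathcal B)$ with trivial associator). *)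

theory Defs
  imports "HOL-Algebra.Group" "HOL-Algebra.FiniteProduct" "HOL-Computational_Algebra.Polynomial"
begin

text \<open>
  Categories are given by a set of objects and hom-sets. Since \<open>Hom\<close> is a separate field, the full
  subcategory on a set of objects is obtained by changing \<open>Obj\<close> alone. \<open>g \<cdot> f\<close> is ``first f, then g''.
\<close>

record ('o, 'm, 'k) linear_cat =
  Obj :: "'o set"
  Hom :: "'o \<Rightarrow> 'o \<Rightarrow> 'm set"
  Idt :: "'o \<Rightarrow> 'm"
  Cmp :: "'m \<Rightarrow> 'm \<Rightarrow> 'm"  (infixr "\<cdot>\<index>" 65)
  Add :: "'m \<Rightarrow> 'm \<Rightarrow> 'm"
  Zero :: "'o \<Rightarrow> 'o \<Rightarrow> 'm"
  Scl :: "'k \<Rightarrow> 'm \<Rightarrow> 'm"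

record ('o, 'm, 'k) monoidal_cat = "('o, 'm, 'k) linear_cat" +
  TObj :: "'o \<Rightarrow> 'o \<Rightarrow> 'o"  (infixr "\<odot>\<index>" 75)
  TMor :: "'m \<Rightarrow> 'm \<Rightarrow> 'm"  (infixr "\<star>\<index>" 75)
  Unit :: "'o"
  Assoc :: "'o \<Rightarrow> 'o \<Rightarrow> 'o \<Rightarrow> 'm"
  LUnit :: "'o \<Rightarrow> 'm"
  RUnit :: "'o \<Rightarrow> 'm"

record ('o, 'm, 'k) braided_cat = "('o, 'm, 'k) monoidal_cat" +
  Braid :: "'o \<Rightarrow> 'o \<Rightarrow> 'm"

definition full_sub :: "('o, 'm, 'k, 'z) linear_cat_scheme \<Rightarrow> 'o set \<Rightarrow> ('o, 'm, 'k, 'z) linear_cat_scheme"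
  where "full_sub C S = C\<lparr>Obj := S\<rparr>"


section \<open>Finite abelian linear categories\<close>

definition hom_group :: "('o, 'm, 'k, 'z) linear_cat_scheme \<Rightarrow> 'o \<Rightarrow> 'o \<Rightarrow> 'm monoid"
  where "hom_group C X Y = \<lparr>carrier = Hom C X Y, monoid.mult = Add C, one = Zero C X Y\<rparr>"

locale linear_category =
  fixes C :: "('o, 'm, 'k::field, 'z) linear_cat_scheme" (structure)
  assumes Hom_disjoint: "\<lbrakk>X \<in> Obj C; Y \<in> Obj C; X' \<in> Obj C; Y' \<in> Obj C; f \<in> Hom C X Y; f \<in> Hom C X' Y'\<rbrakk>
      \<Longrightarrow> X = X' \<and> Y = Y'"
    and Idt_in: "X \<in> Obj C \<Longrightarrow> Idt C X \<in> Hom C X X"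
    and Cmp_in: "\<lbrakk>X \<in> Obj C; Y \<in> Obj C; Z \<in> Obj C; f \<in> Hom C X Y; g \<in> Hom C Y Z\<rbrakk> \<Longrightarrow> g \<cdot> f \<in> Hom C X Z"
    and Cmp_Idt: "\<lbrakk>X \<in> Obj C; Y \<in> Obj C; f \<in> Hom C X Y\<rbrakk> \<Longrightarrow> f \<cdot> Idt C X = f"
    and Idt_Cmp: "\<lbrakk>X \<in> Obj C; Y \<in> Obj C; f \<in> Hom C X Y\<rbrakk> \<Longrightarrow> Idt C Y \<cdot> f = f"
    and Cmp_assoc: "\<lbrakk>W \<in> Obj C; X \<in> Obj C; Y \<in> Obj C; Z \<in> Obj C;
        f \<in> Hom C W X; g \<in> Hom C X Y; h \<in> Hom C Y Z\<rbrakk> \<Longrightarrow> h \<cdot> (g \<cdot> f) = (h \<cdot> g) \<cdot> f"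
    and Hom_group: "\<lbrakk>X \<in> Obj C; Y \<in> Obj C\<rbrakk> \<Longrightarrow> comm_group (hom_group C X Y)"
    and Scl_in: "\<lbrakk>X \<in> Obj C; Y \<in> Obj C; f \<in> Hom C X Y\<rbrakk> \<Longrightarrow> Scl C a f \<in> Hom C X Y"
    and Scl_one: "\<lbrakk>X \<in> Obj C; Y \<in> Obj C; f \<in> Hom C X Y\<rbrakk> \<Longrightarrow> Scl C 1 f = f"
    and Scl_Scl: "\<lbrakk>X \<in> Obj C; Y \<in> Obj C; f \<in> Hom C X Y\<rbrakk> \<Longrightarrow> Scl C a (Scl C b f) = Scl C (a * b) f"
    and Scl_plus: "\<lbrakk>X \<in> Obj C; Y \<in> Obj C; f \<in> Hom C X Y\<rbrakk>
        \<Longrightarrow> Scl C (a + b) f = Add C (Scl C a f) (Scl C b f)"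
    and Scl_Add: "\<lbrakk>X \<in> Obj C; Y \<in> Obj C; f \<in> Hom C X Y; g \<in> Hom C X Y\<rbrakk>
        \<Longrightarrow> Scl C a (Add C f g) = Add C (Scl C a f) (Scl C a g)"
    and Cmp_Add_left: "\<lbrakk>X \<in> Obj C; Y \<in> Obj C; Z \<in> Obj C; f \<in> Hom C X Y; g \<in> Hom C Y Z; h \<in> Hom C Y Z\<rbrakk>
        \<Longrightarrow> Add C g h \<cdot> f = Add C (g \<cdot> f) (h \<cdot> f)"
    and Cmp_Add_right: "\<lbrakk>X \<in> Obj C; Y \<in> Obj C; Z \<in> Obj C; f \<in> Hom C X Y; g \<in> Hom C X Y; h \<in> Hom C Y Z\<rbrakk>
        \<Longrightarrow> h \<cdot> Add C f g = Add C (h \<cdot> f) (h \<cdot> g)"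
    and Cmp_Scl_left: "\<lbrakk>X \<in> Obj C; Y \<in> Obj C; Z \<in> Obj C; f \<in> Hom C X Y; g \<in> Hom C Y Z\<rbrakk>
        \<Longrightarrow> Scl C a g \<cdot> f = Scl C a (g \<cdot> f)"
    and Cmp_Scl_right: "\<lbrakk>X \<in> Obj C; Y \<in> Obj C; Z \<in> Obj C; f \<in> Hom C X Y; g \<in> Hom C Y Z\<rbrakk>
        \<Longrightarrow> g \<cdot> Scl C a f = Scl C a (g \<cdot> f)"

definition inverse_pair :: "('o, 'm, 'k, 'z) linear_cat_scheme \<Rightarrow> 'o \<Rightarrow> 'o \<Rightarrow> 'm \<Rightarrow> 'm \<Rightarrow> bool"
  where "inverse_pair C X Y f g \<longleftrightarrow> f \<in> Hom C X Y \<and> g \<in> Hom C Y X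
    \<and> g \<cdot>\<^bsub>C\<^esub> f = Idt C X \<and> f \<cdot>\<^bsub>C\<^esub> g = Idt C Y"

definition iso_mor :: "('o, 'm, 'k, 'z) linear_cat_scheme \<Rightarrow> 'o \<Rightarrow> 'o \<Rightarrow> 'm \<Rightarrow> bool"
  where "iso_mor C X Y f \<longleftrightarrow> (\<exists>g. inverse_pair C X Y f g)"

definition inv_mor :: "('o, 'm, 'k, 'z) linear_cat_scheme \<Rightarrow> 'o \<Rightarrow> 'o \<Rightarrow> 'm \<Rightarrow> 'm"
  where "inv_mor C X Y f = (THE g. inverse_pair C X Y f g)"

definition isomorphic :: "('o, 'm, 'k, 'z) linear_cat_scheme \<Rightarrow> 'o \<Rightarrow> 'o \<Rightarrow> bool"
  where "isomorphic C X Y \<longleftrightarrow> (\<exists>f. iso_mor C X Y f)"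

definition zero_object :: "('o, 'm, 'k, 'z) linear_cat_scheme \<Rightarrow> 'o \<Rightarrow> bool"
  where "zero_object C X \<longleftrightarrow> X \<in> Obj C \<and> Idt C X = Zero C X X"

definition mono_mor :: "('o, 'm, 'k, 'z) linear_cat_scheme \<Rightarrow> 'o \<Rightarrow> 'o \<Rightarrow> 'm \<Rightarrow> bool"
  where "mono_mor C X Y f \<longleftrightarrow> f \<in> Hom C X Y
    \<and> (\<forall>W\<in>Obj C. \<forall>g\<in>Hom C W X. \<forall>h\<in>Hom C W X. f \<cdot>\<^bsub>C\<^esub> g = f \<cdot>\<^bsub>C\<^esub> h \<longrightarrow> g = h)"

definition epi_mor :: "('o, 'm, 'k, 'z) linear_cat_scheme \<Rightarrow> 'o \<Rightarrow> 'o \<Rightarrow> 'm \<Rightarrow> bool"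
  where "epi_mor C X Y f \<longleftrightarrow> f \<in> Hom C X Y
    \<and> (\<forall>W\<in>Obj C. \<forall>g\<in>Hom C Y W. \<forall>h\<in>Hom C Y W. g \<cdot>\<^bsub>C\<^esub> f = h \<cdot>\<^bsub>C\<^esub> f \<longrightarrow> g = h)"

definition is_kernel :: "('o, 'm, 'k, 'z) linear_cat_scheme \<Rightarrow> 'o \<Rightarrow> 'o \<Rightarrow> 'm \<Rightarrow> 'o \<Rightarrow> 'm \<Rightarrow> bool"
  where "is_kernel C X Y f K j \<longleftrightarrow> K \<in> Obj C \<and> j \<in> Hom C K X \<and> f \<cdot>\<^bsub>C\<^esub> j = Zero C K Y
    \<and> (\<forall>W\<in>Obj C. \<forall>g\<in>Hom C W X. f \<cdot>\<^bsub>C\<^esub> g = Zero C W Y \<longrightarrow> (\<exists>!h. h \<in> Hom C W K \<and> j \<cdot>\<^bsub>C\<^esub> h = g))"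

definition is_cokernel :: "('o, 'm, 'k, 'z) linear_cat_scheme \<Rightarrow> 'o \<Rightarrow> 'o \<Rightarrow> 'm \<Rightarrow> 'o \<Rightarrow> 'm \<Rightarrow> bool"
  where "is_cokernel C X Y f Q p \<longleftrightarrow> Q \<in> Obj C \<and> p \<in> Hom C Y Q \<and> p \<cdot>\<^bsub>C\<^esub> f = Zero C X Q
    \<and> (\<forall>W\<in>Obj C. \<forall>g\<in>Hom C Y W. g \<cdot>\<^bsub>C\<^esub> f = Zero C X W \<longrightarrow> (\<exists>!h. h \<in> Hom C Q W \<and> h \<cdot>\<^bsub>C\<^esub> p = g))"

text \<open>\<open>P\<close> with injections \<open>i x\<close> and projections \<open>p x\<close> is the direct sum of the family \<open>F x\<close>, \<open>x \<in> I\<close>.\<close>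

definition is_biproduct ::
    "('o, 'm, 'k, 'z) linear_cat_scheme \<Rightarrow> 'i set \<Rightarrow> ('i \<Rightarrow> 'o) \<Rightarrow> 'o \<Rightarrow> ('i \<Rightarrow> 'm) \<Rightarrow> ('i \<Rightarrow> 'm) \<Rightarrow> bool"
  where "is_biproduct C I F P i p \<longleftrightarrow> P \<in> Obj C
    \<and> (\<forall>x\<in>I. F x \<in> Obj C \<and> i x \<in> Hom C (F x) P \<and> p x \<in> Hom C P (F x))
    \<and> (\<forall>x\<in>I. \<forall>y\<in>I. p y \<cdot>\<^bsub>C\<^esub> i x = (if x = y then Idt C (F x) else Zero C (F x) (F y)))
    \<and> finprod (hom_group C P P) (\<lambda>x. i x \<cdot>\<^bsub>C\<^esub> p x) I = Idt C P"

locale abelian_category = linear_category +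
  assumes has_zero: "\<exists>X. zero_object C X"
    and has_biproducts: "\<lbrakk>X \<in> Obj C; Y \<in> Obj C\<rbrakk>
        \<Longrightarrow> \<exists>P i p. is_biproduct C (UNIV :: bool set) (\<lambda>b. if b then X else Y) P i p"
    and has_kernels: "\<lbrakk>X \<in> Obj C; Y \<in> Obj C; f \<in> Hom C X Y\<rbrakk> \<Longrightarrow> \<exists>K j. is_kernel C X Y f K j"
    and has_cokernels: "\<lbrakk>X \<in> Obj C; Y \<in> Obj C; f \<in> Hom C X Y\<rbrakk> \<Longrightarrow> \<exists>Q p. is_cokernel C X Y f Q p"
    and mono_normal: "\<lbrakk>X \<in> Obj C; Y \<in> Obj C; mono_mor C X Y f\<rbrakk>
        \<Longrightarrow> \<exists>Z\<in>Obj C. \<exists>g\<in>Hom C Y Z. is_kernel C Y Z g X f"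
    and epi_normal: "\<lbrakk>X \<in> Obj C; Y \<in> Obj C; epi_mor C X Y f\<rbrakk>
        \<Longrightarrow> \<exists>Z\<in>Obj C. \<exists>g\<in>Hom C Z X. is_cokernel C Z X g Y f"

definition simple_object :: "('o, 'm, 'k, 'z) linear_cat_scheme \<Rightarrow> 'o \<Rightarrow> bool"
  where "simple_object C S \<longleftrightarrow> S \<in> Obj C \<and> \<not> zero_object C S
    \<and> (\<forall>Y\<in>Obj C. \<forall>i. mono_mor C Y S i \<longrightarrow> zero_object C Y \<or> iso_mor C Y S i)"

inductive finite_length :: "('o, 'm, 'k, 'z) linear_cat_scheme \<Rightarrow> 'o \<Rightarrow> bool"
  for C where
  "zero_object C X \<Longrightarrow> finite_length C X"
| "\<lbrakk>finite_length C Y; X \<in> Obj C; mono_mor C Y X i; is_cokernel C Y X i S p; simple_object C S\<rbrakk>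
    \<Longrightarrow> finite_length C X"

definition projective_object :: "('o, 'm, 'k, 'z) linear_cat_scheme \<Rightarrow> 'o \<Rightarrow> bool"
  where "projective_object C P \<longleftrightarrow> P \<in> Obj C
    \<and> (\<forall>X\<in>Obj C. \<forall>Y\<in>Obj C. \<forall>e. epi_mor C X Y e \<longrightarrow>
        (\<forall>f\<in>Hom C P Y. \<exists>g\<in>Hom C P X. e \<cdot>\<^bsub>C\<^esub> g = f))"

definition finite_dim_hom :: "('o, 'm, 'k, 'z) linear_cat_scheme \<Rightarrow> 'o \<Rightarrow> 'o \<Rightarrow> bool"
  where "finite_dim_hom C X Y \<longleftrightarrow> (\<exists>b (n::nat). (\<forall>j<n. b j \<in> Hom C X Y)
    \<and> (\<forall>f\<in>Hom C X Y. \<exists>a. f = finprod (hom_group C X Y) (\<lambda>j. Scl C (a j) (b j)) {..<n}))"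

locale finite_abelian_category = abelian_category +
  assumes finite_dim: "\<lbrakk>X \<in> Obj C; Y \<in> Obj C\<rbrakk> \<Longrightarrow> finite_dim_hom C X Y"
    and finite_length: "X \<in> Obj C \<Longrightarrow> finite_length C X"
    and enough_projectives: "X \<in> Obj C \<Longrightarrow> \<exists>P e. projective_object C P \<and> epi_mor C P X e"
    and finitely_many_simples: "\<exists>F\<subseteq>Obj C. finite F \<and> (\<forall>S. simple_object C S \<longrightarrow> (\<exists>T\<in>F. isomorphic C S T))"


section \<open>Braided tensor categories\<close>

text \<open>\<open>Assoc C X Y Z : (X \<odot> Y) \<odot> Z \<rightarrow> X \<odot> (Y \<odot> Z)\<close>.\<close>

definition InvAssoc :: "('o, 'm, 'k, 'z) monoidal_cat_scheme \<Rightarrow> 'o \<Rightarrow> 'o \<Rightarrow> 'o \<Rightarrow> 'm"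
  where "InvAssoc C X Y Z =
    inv_mor C ((X \<odot>\<^bsub>C\<^esub> Y) \<odot>\<^bsub>C\<^esub> Z) (X \<odot>\<^bsub>C\<^esub> (Y \<odot>\<^bsub>C\<^esub> Z)) (Assoc C X Y Z)"

locale monoidal_linear_category = linear_category C
  for C :: "('o, 'm, 'k::field, 'z) monoidal_cat_scheme" (structure) +
  assumes TObj_in: "\<lbrakk>X \<in> Obj C; Y \<in> Obj C\<rbrakk> \<Longrightarrow> X \<odot> Y \<in> Obj C"
    and Unit_in: "Unit C \<in> Obj C"
    and TMor_in: "\<lbrakk>X \<in> Obj C; X' \<in> Obj C; Y \<in> Obj C; Y' \<in> Obj C; f \<in> Hom C X X'; g \<in> Hom C Y Y'\<rbrakk>
        \<Longrightarrow> f \<star> g \<in> Hom C (X \<odot> Y) (X' \<odot> Y')"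
    and TMor_Idt: "\<lbrakk>X \<in> Obj C; Y \<in> Obj C\<rbrakk> \<Longrightarrow> Idt C X \<star> Idt C Y = Idt C (X \<odot> Y)"
    and TMor_Cmp: "\<lbrakk>X \<in> Obj C; X' \<in> Obj C; X'' \<in> Obj C; Y \<in> Obj C; Y' \<in> Obj C; Y'' \<in> Obj C;
        f \<in> Hom C X X'; f' \<in> Hom C X' X''; g \<in> Hom C Y Y'; g' \<in> Hom C Y' Y''\<rbrakk>
        \<Longrightarrow> (f' \<cdot> f) \<star> (g' \<cdot> g) = (f' \<star> g') \<cdot> (f \<star> g)"
    and TMor_Add_left: "\<lbrakk>X \<in> Obj C; X' \<in> Obj C; Y \<in> Obj C; Y' \<in> Obj C;
        f \<in> Hom C X X'; f' \<in> Hom C X X'; g \<in> Hom C Y Y'\<rbrakk> \<Longrightarrow> Add C f f' \<star> g = Add C (f \<star> g) (f' \<star> g)"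
    and TMor_Add_right: "\<lbrakk>X \<in> Obj C; X' \<in> Obj C; Y \<in> Obj C; Y' \<in> Obj C;
        f \<in> Hom C X X'; g \<in> Hom C Y Y'; g' \<in> Hom C Y Y'\<rbrakk> \<Longrightarrow> f \<star> Add C g g' = Add C (f \<star> g) (f \<star> g')"
    and TMor_Scl_left: "\<lbrakk>X \<in> Obj C; X' \<in> Obj C; Y \<in> Obj C; Y' \<in> Obj C; f \<in> Hom C X X'; g \<in> Hom C Y Y'\<rbrakk>
        \<Longrightarrow> Scl C a f \<star> g = Scl C a (f \<star> g)"
    and TMor_Scl_right: "\<lbrakk>X \<in> Obj C; X' \<in> Obj C; Y \<in> Obj C; Y' \<in> Obj C; f \<in> Hom C X X'; g \<in> Hom C Y Y'\<rbrakk>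
        \<Longrightarrow> f \<star> Scl C a g = Scl C a (f \<star> g)"
    and Assoc_iso: "\<lbrakk>X \<in> Obj C; Y \<in> Obj C; Z \<in> Obj C\<rbrakk>
        \<Longrightarrow> iso_mor C ((X \<odot> Y) \<odot> Z) (X \<odot> (Y \<odot> Z)) (Assoc C X Y Z)"
    and Assoc_natural: "\<lbrakk>X \<in> Obj C; X' \<in> Obj C; Y \<in> Obj C; Y' \<in> Obj C; Z \<in> Obj C; Z' \<in> Obj C;
        f \<in> Hom C X X'; g \<in> Hom C Y Y'; h \<in> Hom C Z Z'\<rbrakk>
        \<Longrightarrow> Assoc C X' Y' Z' \<cdot> ((f \<star> g) \<star> h) = (f \<star> (g \<star> h)) \<cdot> Assoc C X Y Z"
    and LUnit_iso: "X \<in> Obj C \<Longrightarrow> iso_mor C (Unit C \<odot> X) X (LUnit C X)"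
    and LUnit_natural: "\<lbrakk>X \<in> Obj C; Y \<in> Obj C; f \<in> Hom C X Y\<rbrakk>
        \<Longrightarrow> LUnit C Y \<cdot> (Idt C (Unit C) \<star> f) = f \<cdot> LUnit C X"
    and RUnit_iso: "X \<in> Obj C \<Longrightarrow> iso_mor C (X \<odot> Unit C) X (RUnit C X)"
    and RUnit_natural: "\<lbrakk>X \<in> Obj C; Y \<in> Obj C; f \<in> Hom C X Y\<rbrakk>
        \<Longrightarrow> RUnit C Y \<cdot> (f \<star> Idt C (Unit C)) = f \<cdot> RUnit C X"
    and pentagon: "\<lbrakk>X \<in> Obj C; Y \<in> Obj C; Z \<in> Obj C; W \<in> Obj C\<rbrakk>
        \<Longrightarrow> Assoc C X Y (Z \<odot> W) \<cdot> Assoc C (X \<odot> Y) Z W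
          = (Idt C X \<star> Assoc C Y Z W) \<cdot> Assoc C X (Y \<odot> Z) W \<cdot> (Assoc C X Y Z \<star> Idt C W)"
    and triangle: "\<lbrakk>X \<in> Obj C; Y \<in> Obj C\<rbrakk>
        \<Longrightarrow> (Idt C X \<star> LUnit C Y) \<cdot> Assoc C X (Unit C) Y = RUnit C X \<star> Idt C Y"

text \<open>\<open>D\<close> is a left dual of \<open>X\<close>, and \<open>X\<close> is a right dual of \<open>D\<close>.\<close>

definition dual_pair :: "('o, 'm, 'k, 'z) monoidal_cat_scheme \<Rightarrow> 'o \<Rightarrow> 'o \<Rightarrow> 'm \<Rightarrow> 'm \<Rightarrow> bool"
  where "dual_pair C X D ev coev \<longleftrightarrow>
    ev \<in> Hom C (D \<odot>\<^bsub>C\<^esub> X) (Unit C) \<and> coev \<in> Hom C (Unit C) (X \<odot>\<^bsub>C\<^esub> D)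
    \<and> RUnit C X \<cdot>\<^bsub>C\<^esub> (Idt C X \<star>\<^bsub>C\<^esub> ev) \<cdot>\<^bsub>C\<^esub> Assoc C X D X \<cdot>\<^bsub>C\<^esub> (coev \<star>\<^bsub>C\<^esub> Idt C X)
        \<cdot>\<^bsub>C\<^esub> inv_mor C (Unit C \<odot>\<^bsub>C\<^esub> X) X (LUnit C X) = Idt C X
    \<and> LUnit C D \<cdot>\<^bsub>C\<^esub> (ev \<star>\<^bsub>C\<^esub> Idt C D) \<cdot>\<^bsub>C\<^esub> InvAssoc C D X D \<cdot>\<^bsub>C\<^esub> (Idt C D \<star>\<^bsub>C\<^esub> coev)
        \<cdot>\<^bsub>C\<^esub> inv_mor C (D \<odot>\<^bsub>C\<^esub> Unit C) D (RUnit C D) = Idt C D"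

text \<open>
  Over an algebraically closed field simplicity of the unit object of a finite rigid category is
  equivalent to its endomorphisms being the scalars; either is used in the literature as an axiom of
  tensor categories, and both are recorded here.
\<close>

locale tensor_category = monoidal_linear_category C + finite_abelian_category C
  for C :: "('o, 'm, 'k::alg_closed_field, 'z) monoidal_cat_scheme" (structure) +
  assumes has_left_duals: "X \<in> Obj C \<Longrightarrow> \<exists>D\<in>Obj C. \<exists>ev coev. dual_pair C X D ev coev"
    and has_right_duals: "X \<in> Obj C \<Longrightarrow> \<exists>D\<in>Obj C. \<exists>ev coev. dual_pair C D X ev coev"
    and Unit_simple: "simple_object C (Unit C)"
    and End_Unit: "Hom C (Unit C) (Unit C) = range (\<lambda>a. Scl C a (Idt C (Unit C)))"

locale braided_tensor_category = tensor_category C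
  for C :: "('o, 'm, 'k::alg_closed_field, 'z) braided_cat_scheme" (structure) +
  assumes Braid_iso: "\<lbrakk>X \<in> Obj C; Y \<in> Obj C\<rbrakk> \<Longrightarrow> iso_mor C (X \<odot> Y) (Y \<odot> X) (Braid C X Y)"
    and Braid_natural: "\<lbrakk>X \<in> Obj C; X' \<in> Obj C; Y \<in> Obj C; Y' \<in> Obj C; f \<in> Hom C X X'; g \<in> Hom C Y Y'\<rbrakk>
        \<Longrightarrow> Braid C X' Y' \<cdot> (f \<star> g) = (g \<star> f) \<cdot> Braid C X Y"
    and hexagon1: "\<lbrakk>X \<in> Obj C; Y \<in> Obj C; Z \<in> Obj C\<rbrakk>
        \<Longrightarrow> Assoc C Y Z X \<cdot> Braid C X (Y \<odot> Z) \<cdot> Assoc C X Y Z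
          = (Idt C Y \<star> Braid C X Z) \<cdot> Assoc C Y X Z \<cdot> (Braid C X Y \<star> Idt C Z)"
    and hexagon2: "\<lbrakk>X \<in> Obj C; Y \<in> Obj C; Z \<in> Obj C\<rbrakk>
        \<Longrightarrow> InvAssoc C Z X Y \<cdot> Braid C (X \<odot> Y) Z \<cdot> InvAssoc C X Y Z
          = (Braid C X Z \<star> Idt C Y) \<cdot> InvAssoc C X Z Y \<cdot> (Idt C X \<star> Braid C Y Z)"

definition sym_center :: "('o, 'm, 'k, 'z) braided_cat_scheme \<Rightarrow> ('o, 'm, 'k, 'z) braided_cat_scheme"
  where "sym_center B = full_sub B
    {V \<in> Obj B. \<forall>X\<in>Obj B. Braid B X V \<cdot>\<^bsub>B\<^esub> Braid B V X = Idt B (V \<odot>\<^bsub>B\<^esub> X)}"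

definition braided_extension ::
    "('a, 'c) monoid_scheme \<Rightarrow> ('o, 'm, 'k::alg_closed_field) braided_cat
      \<Rightarrow> ('o, 'm, 'k) braided_cat \<Rightarrow> ('a \<Rightarrow> 'o set) \<Rightarrow> bool"
  where "braided_extension A B C Cg \<longleftrightarrow> braided_tensor_category C
    \<and> (\<forall>x\<in>carrier A. Cg x \<subseteq> Obj C)
    \<and> (\<forall>x\<in>carrier A. \<forall>y\<in>carrier A. x \<noteq> y \<longrightarrow> (\<forall>X\<in>Cg x. \<forall>Y\<in>Cg y. Hom C X Y = {Zero C X Y}))
    \<and> (\<forall>X\<in>Obj C. \<exists>F i p. (\<forall>x\<in>carrier A. F x \<in> Cg x) \<and> is_biproduct C (carrier A) F X i p)
    \<and> (\<forall>x\<in>carrier A. \<exists>X\<in>Cg x. \<not> zero_object C X)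
    \<and> (\<forall>x\<in>carrier A. \<forall>y\<in>carrier A. \<forall>X\<in>Cg x. \<forall>Y\<in>Cg y. X \<odot>\<^bsub>C\<^esub> Y \<in> Cg (x \<otimes>\<^bsub>A\<^esub> y))
    \<and> B = full_sub C (Cg \<one>\<^bsub>A\<^esub>)"


section \<open>Invertible objects and skeletal models\<close>

definition invertible_object :: "('o, 'm, 'k, 'z) monoidal_cat_scheme \<Rightarrow> 'o \<Rightarrow> bool"
  where "invertible_object D Z \<longleftrightarrow> Z \<in> Obj D
    \<and> (\<exists>W\<in>Obj D. isomorphic D (Z \<odot>\<^bsub>D\<^esub> W) (Unit D) \<and> isomorphic D (W \<odot>\<^bsub>D\<^esub> Z) (Unit D))"

definition iso_class :: "('o, 'm, 'k, 'z) linear_cat_scheme \<Rightarrow> 'o \<Rightarrow> 'o set"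
  where "iso_class D Z = {W \<in> Obj D. isomorphic D Z W}"

definition Inv_group :: "('o, 'm, 'k, 'z) monoidal_cat_scheme \<Rightarrow> 'o set monoid"
  where "Inv_group D =
    \<lparr>carrier = {iso_class D Z | Z. invertible_object D Z},
     monoid.mult = (\<lambda>K K'. {W \<in> Obj D. \<exists>Z\<in>K. \<exists>Z'\<in>K'. isomorphic D (Z \<odot>\<^bsub>D\<^esub> Z') W}),
     one = iso_class D (Unit D)\<rparr>"

text \<open>
  The skeletal categorical group with objects \<open>Inv_group D\<close>, all automorphism groups \<open>k\<^sup>\<times>\<close> and trivial
  associator is a model of the categorical group of invertible objects of \<open>D\<close> via the equivalence
  which sends \<open>K\<close> to \<open>r K\<close> and has the tensor structure \<open>\<phi> K K' : r K \<odot> r K' \<rightarrow> r (K K')\<close>; the last clause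
  is the compatibility of the tensor structure with the trivial associator. The braiding of \<open>K\<close> and \<open>K'\<close>
  in the model is then a scalar, determined by \<open>c(K, K') \<phi> K K' = \<phi> K' K \<cdot> Braid D (r K) (r K')\<close>.
\<close>

definition skeletal_model ::
    "('o, 'm, 'k, 'z) monoidal_cat_scheme \<Rightarrow> ('o set \<Rightarrow> 'o) \<Rightarrow> ('o set \<Rightarrow> 'o set \<Rightarrow> 'm) \<Rightarrow> bool"
  where "skeletal_model D r \<phi> \<longleftrightarrow>
    (\<forall>K\<in>carrier (Inv_group D). r K \<in> K)
    \<and> (\<forall>K\<in>carrier (Inv_group D). \<forall>K'\<in>carrier (Inv_group D).
        iso_mor D (r K \<odot>\<^bsub>D\<^esub> r K') (r (K \<otimes>\<^bsub>Inv_group D\<^esub> K')) (\<phi> K K'))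
    \<and> (\<forall>K\<in>carrier (Inv_group D). \<forall>K'\<in>carrier (Inv_group D). \<forall>K''\<in>carrier (Inv_group D).
        \<phi> (K \<otimes>\<^bsub>Inv_group D\<^esub> K') K'' \<cdot>\<^bsub>D\<^esub> (\<phi> K K' \<star>\<^bsub>D\<^esub> Idt D (r K''))
        = \<phi> K (K' \<otimes>\<^bsub>Inv_group D\<^esub> K'') \<cdot>\<^bsub>D\<^esub> (Idt D (r K) \<star>\<^bsub>D\<^esub> \<phi> K' K'') \<cdot>\<^bsub>D\<^esub> Assoc D (r K) (r K') (r K''))"

definition skeletal_braiding ::
    "('o, 'm, 'k::field, 'z) braided_cat_scheme \<Rightarrow> ('o set \<Rightarrow> 'o) \<Rightarrow> ('o set \<Rightarrow> 'o set \<Rightarrow> 'm)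
      \<Rightarrow> 'o set \<Rightarrow> 'o set \<Rightarrow> 'k"
  where "skeletal_braiding D r \<phi> K K' =
    (THE t. t \<noteq> 0 \<and> \<phi> K' K \<cdot>\<^bsub>D\<^esub> Braid D (r K) (r K') = Scl D t (\<phi> K K'))"

definition component_pairing ::
    "('o, 'm, 'k::field, 'z) braided_cat_scheme \<Rightarrow> 'o set \<Rightarrow> 'o set \<Rightarrow> 'k"
  where "component_pairing C S K =
    (THE t. t \<noteq> 0 \<and> (\<forall>Z\<in>K. \<forall>M\<in>S.
      Braid C M Z \<cdot>\<^bsub>C\<^esub> Braid C Z M = Scl C t (Idt C (Z \<odot>\<^bsub>C\<^esub> M))))"


section \<open>Braided cochains\<close>

text \<open>
  Only the values of a cochain on \<open>carrier A\<close> matter. The coefficients \<open>k\<^sup>\<times>\<close> are written multiplicatively,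
  as the nonzero elements of the field. In the pair \<open>(f, g)\<close> below, \<open>f x y z\<close> is \<open>a(x,y,z)\<close> and \<open>g x y\<close>
  is \<open>a(x|y)\<close>.
\<close>

type_synonym ('a, 'k) cochain3 = "('a \<Rightarrow> 'a \<Rightarrow> 'a \<Rightarrow> 'k) \<times> ('a \<Rightarrow> 'a \<Rightarrow> 'k)"

type_synonym ('a, 'k) cochain4 =
  "('a \<Rightarrow> 'a \<Rightarrow> 'a \<Rightarrow> 'a \<Rightarrow> 'k) \<times> ('a \<Rightarrow> 'a \<Rightarrow> 'a \<Rightarrow> 'k) \<times> ('a \<Rightarrow> 'a \<Rightarrow> 'a \<Rightarrow> 'k)"

definition Z2_br :: "('a, 'c) monoid_scheme \<Rightarrow> ('g, 'd) monoid_scheme \<Rightarrow> ('a \<Rightarrow> 'a \<Rightarrow> 'g) set"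
  where "Z2_br A G = {L.
    (\<forall>x\<in>carrier A. \<forall>y\<in>carrier A. L x y \<in> carrier G \<and> L x y = L y x)
    \<and> (\<forall>x\<in>carrier A. L x \<one>\<^bsub>A\<^esub> = \<one>\<^bsub>G\<^esub> \<and> L \<one>\<^bsub>A\<^esub> x = \<one>\<^bsub>G\<^esub>)
    \<and> (\<forall>x\<in>carrier A. \<forall>y\<in>carrier A. \<forall>z\<in>carrier A.
        L (x \<otimes>\<^bsub>A\<^esub> y) z \<otimes>\<^bsub>G\<^esub> L x y = L x (y \<otimes>\<^bsub>A\<^esub> z) \<otimes>\<^bsub>G\<^esub> L y z)}"

definition C3_br :: "('a, 'c) monoid_scheme \<Rightarrow> ('a, 'k::field) cochain3 set"
  where "C3_br A = {(f, g). (\<forall>x\<in>carrier A. \<forall>y\<in>carrier A. \<forall>z\<in>carrier A. f x y z \<noteq> 0)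
    \<and> (\<forall>x\<in>carrier A. \<forall>y\<in>carrier A. g x y \<noteq> 0)}"

definition d3_br :: "('a, 'c) monoid_scheme \<Rightarrow> ('a, 'k::field) cochain3 \<Rightarrow> ('a, 'k) cochain4"
  where "d3_br A = (\<lambda>(f, g).
    (\<lambda>x y z w. f y z w * inverse (f (x \<otimes>\<^bsub>A\<^esub> y) z w) * f x (y \<otimes>\<^bsub>A\<^esub> z) w
        * inverse (f x y (z \<otimes>\<^bsub>A\<^esub> w)) * f x y z,
     \<lambda>x y z. g y z * inverse (g (x \<otimes>\<^bsub>A\<^esub> y) z) * g x z * f x y z * inverse (f x z y) * f z x y,
     \<lambda>x y z. g x y * inverse (g x (y \<otimes>\<^bsub>A\<^esub> z)) * g x z * inverse (f x y z) * f y x z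
        * inverse (f y z x)))"

definition eq_cochain4 :: "('a, 'c) monoid_scheme \<Rightarrow> ('a, 'k) cochain4 \<Rightarrow> ('a, 'k) cochain4 \<Rightarrow> bool"
  where "eq_cochain4 A = (\<lambda>(p, q, r) (p', q', r').
    \<forall>x\<in>carrier A. \<forall>y\<in>carrier A. \<forall>z\<in>carrier A.
      (\<forall>w\<in>carrier A. p x y z w = p' x y z w) \<and> q x y z = q' x y z \<and> r x y z = r' x y z)"

definition trivial_in_H4_br :: "('a, 'c) monoid_scheme \<Rightarrow> ('a, 'k::field) cochain4 \<Rightarrow> bool"
  where "trivial_in_H4_br A b \<longleftrightarrow> (\<exists>a\<in>C3_br A. eq_cochain4 A b (d3_br A a))"

text \<open>The second Pontryagin--Whitehead cocycle, computed in the skeletal model \<open>(r, \<phi>)\<close>.\<close>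

definition PW2 ::
    "('o, 'm, 'k::field) braided_cat \<Rightarrow> ('o, 'm, 'k) braided_cat \<Rightarrow> ('a \<Rightarrow> 'o set)
      \<Rightarrow> ('o set \<Rightarrow> 'o) \<Rightarrow> ('o set \<Rightarrow> 'o set \<Rightarrow> 'm) \<Rightarrow> ('a \<Rightarrow> 'a \<Rightarrow> 'o set) \<Rightarrow> ('a, 'k) cochain4"
  where "PW2 B C Cg r \<phi> L =
    (\<lambda>x y z w. skeletal_braiding (sym_center B) r \<phi> (L x y) (L z w),
     \<lambda>x y z. 1,
     \<lambda>x y z. component_pairing C (Cg x) (L y z))"


section \<open>The twisted tensor product\<close>

text \<open>
  The degrees \<open>x, y, z\<close> of the arguments \<open>X, Y, Z\<close> are explicit parameters. \<open>R x y\<close> is the chosen object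
  in the class of the 2-cocycle at \<open>(x, y)\<close>. The associativity constraints of \<open>C\<close> are written out.
\<close>

definition tw_obj :: "('o, 'm, 'k, 'z) monoidal_cat_scheme \<Rightarrow> ('a \<Rightarrow> 'a \<Rightarrow> 'o) \<Rightarrow> 'a \<Rightarrow> 'a \<Rightarrow> 'o \<Rightarrow> 'o \<Rightarrow> 'o"
  where "tw_obj C R x y X Y = R x y \<odot>\<^bsub>C\<^esub> (X \<odot>\<^bsub>C\<^esub> Y)"

definition tw_mor :: "('o, 'm, 'k, 'z) monoidal_cat_scheme \<Rightarrow> ('a \<Rightarrow> 'a \<Rightarrow> 'o) \<Rightarrow> 'a \<Rightarrow> 'a \<Rightarrow> 'm \<Rightarrow> 'm \<Rightarrow> 'm"
  where "tw_mor C R x y f g = Idt C (R x y) \<star>\<^bsub>C\<^esub> (f \<star>\<^bsub>C\<^esub> g)"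

definition tw_assoc ::
    "('a, 'c) monoid_scheme \<Rightarrow> ('o, 'm, 'k, 'z) braided_cat_scheme \<Rightarrow> ('a \<Rightarrow> 'a \<Rightarrow> 'o)
      \<Rightarrow> ('a \<Rightarrow> 'a \<Rightarrow> 'a \<Rightarrow> 'm) \<Rightarrow> 'a \<Rightarrow> 'a \<Rightarrow> 'a \<Rightarrow> 'o \<Rightarrow> 'o \<Rightarrow> 'o \<Rightarrow> 'm"
  where "tw_assoc A C R \<xi> x y z X Y Z =
    (let P = R (x \<otimes>\<^bsub>A\<^esub> y) z; Q = R x y; S = R x (y \<otimes>\<^bsub>A\<^esub> z); T = R y z in
      (Idt C S \<star>\<^bsub>C\<^esub> Assoc C X T (Y \<odot>\<^bsub>C\<^esub> Z))
      \<cdot>\<^bsub>C\<^esub> (Idt C S \<star>\<^bsub>C\<^esub> (Braid C T X \<star>\<^bsub>C\<^esub> Idt C (Y \<odot>\<^bsub>C\<^esub> Z)))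
      \<cdot>\<^bsub>C\<^esub> (Idt C S \<star>\<^bsub>C\<^esub> InvAssoc C T X (Y \<odot>\<^bsub>C\<^esub> Z))
      \<cdot>\<^bsub>C\<^esub> Assoc C S T (X \<odot>\<^bsub>C\<^esub> (Y \<odot>\<^bsub>C\<^esub> Z))
      \<cdot>\<^bsub>C\<^esub> (\<xi> x y z \<star>\<^bsub>C\<^esub> Idt C (X \<odot>\<^bsub>C\<^esub> (Y \<odot>\<^bsub>C\<^esub> Z)))
      \<cdot>\<^bsub>C\<^esub> InvAssoc C P Q (X \<odot>\<^bsub>C\<^esub> (Y \<odot>\<^bsub>C\<^esub> Z))
      \<cdot>\<^bsub>C\<^esub> (Idt C P \<star>\<^bsub>C\<^esub> (Idt C Q \<star>\<^bsub>C\<^esub> Assoc C X Y Z))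
      \<cdot>\<^bsub>C\<^esub> (Idt C P \<star>\<^bsub>C\<^esub> Assoc C Q (X \<odot>\<^bsub>C\<^esub> Y) Z))"

definition tw_inv_assoc ::
    "('a, 'c) monoid_scheme \<Rightarrow> ('o, 'm, 'k, 'z) braided_cat_scheme \<Rightarrow> ('a \<Rightarrow> 'a \<Rightarrow> 'o)
      \<Rightarrow> ('a \<Rightarrow> 'a \<Rightarrow> 'a \<Rightarrow> 'm) \<Rightarrow> 'a \<Rightarrow> 'a \<Rightarrow> 'a \<Rightarrow> 'o \<Rightarrow> 'o \<Rightarrow> 'o \<Rightarrow> 'm"
  where "tw_inv_assoc A C R \<xi> x y z X Y Z =
    inv_mor C (tw_obj C R (x \<otimes>\<^bsub>A\<^esub> y) z (tw_obj C R x y X Y) Z)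
      (tw_obj C R x (y \<otimes>\<^bsub>A\<^esub> z) X (tw_obj C R y z Y Z))
      (tw_assoc A C R \<xi> x y z X Y Z)"

definition tw_braid ::
    "('o, 'm, 'k, 'z) braided_cat_scheme \<Rightarrow> ('a \<Rightarrow> 'a \<Rightarrow> 'o) \<Rightarrow> ('a \<Rightarrow> 'a \<Rightarrow> 'm)
      \<Rightarrow> 'a \<Rightarrow> 'a \<Rightarrow> 'o \<Rightarrow> 'o \<Rightarrow> 'm"
  where "tw_braid C R \<kappa> x y X Y =
    (Idt C (R y x) \<star>\<^bsub>C\<^esub> Braid C X Y) \<cdot>\<^bsub>C\<^esub> (\<kappa> x y \<star>\<^bsub>C\<^esub> Idt C (X \<odot>\<^bsub>C\<^esub> Y))"

definition tw_pentagon ::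
    "('a, 'c) monoid_scheme \<Rightarrow> ('o, 'm, 'k, 'z) braided_cat_scheme \<Rightarrow> ('a \<Rightarrow> 'o set) \<Rightarrow> ('a \<Rightarrow> 'a \<Rightarrow> 'o)
      \<Rightarrow> ('a \<Rightarrow> 'a \<Rightarrow> 'a \<Rightarrow> 'm) \<Rightarrow> bool"
  where "tw_pentagon A C Cg R \<xi> \<longleftrightarrow>
    (\<forall>x\<in>carrier A. \<forall>y\<in>carrier A. \<forall>z\<in>carrier A. \<forall>w\<in>carrier A.
     \<forall>X\<in>Cg x. \<forall>Y\<in>Cg y. \<forall>Z\<in>Cg z. \<forall>W\<in>Cg w.
      tw_assoc A C R \<xi> x y (z \<otimes>\<^bsub>A\<^esub> w) X Y (tw_obj C R z w Z W)
        \<cdot>\<^bsub>C\<^esub> tw_assoc A C R \<xi> (x \<otimes>\<^bsub>A\<^esub> y) z w (tw_obj C R x y X Y) Z W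
      = tw_mor C R x (y \<otimes>\<^bsub>A\<^esub> z \<otimes>\<^bsub>A\<^esub> w) (Idt C X) (tw_assoc A C R \<xi> y z w Y Z W)
        \<cdot>\<^bsub>C\<^esub> tw_assoc A C R \<xi> x (y \<otimes>\<^bsub>A\<^esub> z) w X (tw_obj C R y z Y Z) W
        \<cdot>\<^bsub>C\<^esub> tw_mor C R (x \<otimes>\<^bsub>A\<^esub> y \<otimes>\<^bsub>A\<^esub> z) w (tw_assoc A C R \<xi> x y z X Y Z) (Idt C W))"

definition tw_hexagon1 ::
    "('a, 'c) monoid_scheme \<Rightarrow> ('o, 'm, 'k, 'z) braided_cat_scheme \<Rightarrow> ('a \<Rightarrow> 'o set) \<Rightarrow> ('a \<Rightarrow> 'a \<Rightarrow> 'o)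
      \<Rightarrow> ('a \<Rightarrow> 'a \<Rightarrow> 'a \<Rightarrow> 'm) \<Rightarrow> ('a \<Rightarrow> 'a \<Rightarrow> 'm) \<Rightarrow> bool"
  where "tw_hexagon1 A C Cg R \<xi> \<kappa> \<longleftrightarrow>
    (\<forall>x\<in>carrier A. \<forall>y\<in>carrier A. \<forall>z\<in>carrier A. \<forall>X\<in>Cg x. \<forall>Y\<in>Cg y. \<forall>Z\<in>Cg z.
      tw_assoc A C R \<xi> y z x Y Z X
        \<cdot>\<^bsub>C\<^esub> tw_braid C R \<kappa> x (y \<otimes>\<^bsub>A\<^esub> z) X (tw_obj C R y z Y Z)
        \<cdot>\<^bsub>C\<^esub> tw_assoc A C R \<xi> x y z X Y Z
      = tw_mor C R y (z \<otimes>\<^bsub>A\<^esub> x) (Idt C Y) (tw_braid C R \<kappa> x z X Z)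
        \<cdot>\<^bsub>C\<^esub> tw_assoc A C R \<xi> y x z Y X Z
        \<cdot>\<^bsub>C\<^esub> tw_mor C R (x \<otimes>\<^bsub>A\<^esub> y) z (tw_braid C R \<kappa> x y X Y) (Idt C Z))"

definition tw_hexagon2 ::
    "('a, 'c) monoid_scheme \<Rightarrow> ('o, 'm, 'k, 'z) braided_cat_scheme \<Rightarrow> ('a \<Rightarrow> 'o set) \<Rightarrow> ('a \<Rightarrow> 'a \<Rightarrow> 'o)
      \<Rightarrow> ('a \<Rightarrow> 'a \<Rightarrow> 'a \<Rightarrow> 'm) \<Rightarrow> ('a \<Rightarrow> 'a \<Rightarrow> 'm) \<Rightarrow> bool"
  where "tw_hexagon2 A C Cg R \<xi> \<kappa> \<longleftrightarrow>
    (\<forall>x\<in>carrier A. \<forall>y\<in>carrier A. \<forall>z\<in>carrier A. \<forall>X\<in>Cg x. \<forall>Y\<in>Cg y. \<forall>Z\<in>Cg z.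
      tw_inv_assoc A C R \<xi> z x y Z X Y
        \<cdot>\<^bsub>C\<^esub> tw_braid C R \<kappa> (x \<otimes>\<^bsub>A\<^esub> y) z (tw_obj C R x y X Y) Z
        \<cdot>\<^bsub>C\<^esub> tw_inv_assoc A C R \<xi> x y z X Y Z
      = tw_mor C R (z \<otimes>\<^bsub>A\<^esub> x) y (tw_braid C R \<kappa> x z X Z) (Idt C Y)
        \<cdot>\<^bsub>C\<^esub> tw_inv_assoc A C R \<xi> x z y X Z Y
        \<cdot>\<^bsub>C\<^esub> tw_mor C R x (y \<otimes>\<^bsub>A\<^esub> z) (Idt C X) (tw_braid C R \<kappa> y z Y Z))"

end

theory Submission
  imports Defs
begin

text \<open>
  Identify every \<open>L x y\<close> with its representative in the skeletal model. Isomorphisms \<open>\<xi>\<close> and \<open>\<kappa>\<close> then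
  become families of nonzero scalars \<open>a x y z\<close> and \<open>b x y\<close>. In the two sides of the pentagon all braidings
  with \<open>X, Y, Z, W\<close> cancel, and what remains is an equation between scalars in which the braiding of
  \<open>L z w\<close> with \<open>L x y\<close> appears because these two invertible objects have to be interchanged. The second
  hexagon gives an equation without further factors. In the first one \<open>L y z\<close> is moved past \<open>X\<close> and
  back, which contributes the double braiding \<open>[C\<^sub>x, L y z]\<close>; it is a scalar on all of \<open>C\<^sub>x\<close> since the
  double braiding with an object of the symmetric centre is trivial on \<open>M \<odot> N\<close> for \<open>M\<close> of degree \<open>x\<close> and
  \<open>N\<close> of degree \<open>x\<^sup>-\<^sup>1\<close>. Evaluating on nonzero objects of every degree shows that the
  scalar equations are necessary. They say that the coboundary of \<open>(a, b)\<close> is the Pontryagin--Whitehead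
  cocycle with the arguments of its first component interchanged, and bimultiplicativity and symmetry of
  the braiding on invertible objects show that this interchange is itself a coboundary.
\<close>

section \<open>Linear and monoidal categories\<close>

text \<open>Two obstacles shape the proof. The constraints of \<open>C\<close> are explicit, so one
  side of the pentagon is already a long composite of associators on products of seven objects;
  rather than replacing \<open>C\<close> by a strict category, all comparisons are made after
  products have been split into lists, where associators leave no trace. And a scalar can be read
  off only from a nonzero morphism, so tensor products of nonzero morphisms must be shown to be
  nonzero; this is where duals and the simple unit enter. Objects of a component need not be simple,
  so Schur's lemma cannot show that a double braiding is a scalar there; algebraic closedness enters
  through an eigenvalue instead.

  The cochain \<open>sigma\<close> that exchanges the arguments is the cup-1 product of
  \<open>L\<close> with itself under the braiding, whose coboundary measures the failure of the cup
  product to be symmetric; symmetry of \<open>L\<close> removes the other two components of that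
  coboundary. The condition with the pentagon and the hexagons does not mention the skeletal model,
  so triviality of the class cannot depend on the model.\<close>

context linear_category
begin

text \<open>Every axiom is guarded by object membership. Bundling the guards with membership in the
  hom-set lets composites be typed by plain \<open>OF\<close> chains.\<close>

definition arr :: "'o \<Rightarrow> 'o \<Rightarrow> 'm \<Rightarrow> bool"
  where "arr X Y f \<longleftrightarrow> X \<in> Obj C \<and> Y \<in> Obj C \<and> f \<in> Hom C X Y"

lemma arr_Hom: "arr X Y f \<Longrightarrow> f \<in> Hom C X Y"
  and arr_dom: "arr X Y f \<Longrightarrow> X \<in> Obj C"
  and arr_cod: "arr X Y f \<Longrightarrow> Y \<in> Obj C"
  by (simp_all add: arr_def)

lemma arr_Idt [intro]: "X \<in> Obj C \<Longrightarrow> arr X X (Idt C X)"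
  by (simp add: arr_def Idt_in)

lemma arr_Cmp [intro]: "\<lbrakk>arr Y Z g; arr X Y f\<rbrakk> \<Longrightarrow> arr X Z (g \<cdot> f)"
  by (auto simp: arr_def intro: Cmp_in)

lemma arr_Scl [intro]: "arr X Y f \<Longrightarrow> arr X Y (Scl C a f)"
  by (simp add: arr_def Scl_in)

lemma arr_assoc: "\<lbrakk>arr W X f; arr X Y g; arr Y Z h\<rbrakk> \<Longrightarrow> (h \<cdot> g) \<cdot> f = h \<cdot> (g \<cdot> f)"
  unfolding arr_def by (rule Cmp_assoc[of W X Y Z, symmetric]) auto

lemma arr_Cmp_Idt: "arr X Y f \<Longrightarrow> f \<cdot> Idt C X = f"
  and arr_Idt_Cmp: "arr X Y f \<Longrightarrow> Idt C Y \<cdot> f = f"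
  by (auto simp: arr_def Cmp_Idt Idt_Cmp)

lemma arr_Scl_left: "\<lbrakk>arr X Y f; arr Y Z g\<rbrakk> \<Longrightarrow> Scl C a g \<cdot> f = Scl C a (g \<cdot> f)"
  and arr_Scl_right: "\<lbrakk>arr X Y f; arr Y Z g\<rbrakk> \<Longrightarrow> g \<cdot> Scl C a f = Scl C a (g \<cdot> f)"
  by (auto simp: arr_def intro: Cmp_Scl_left Cmp_Scl_right)

lemma arr_Scl_Scl: "arr X Y f \<Longrightarrow> Scl C a (Scl C b f) = Scl C (a * b) f"
  and arr_Scl_one: "arr X Y f \<Longrightarrow> Scl C 1 f = f"
  by (auto simp: arr_def intro: Scl_Scl Scl_one)

lemma hom_group_simps [simp]:
  "carrier (hom_group C X Y) = Hom C X Y"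
  "monoid.mult (hom_group C X Y) = Add C"
  "one (hom_group C X Y) = Zero C X Y"
  by (simp_all add: hom_group_def)

lemma arr_Add [intro]: "\<lbrakk>arr X Y f; arr X Y g\<rbrakk> \<Longrightarrow> arr X Y (Add C f g)"
proof -
  assume a: "arr X Y f" "arr X Y g"
  then interpret G: comm_group "hom_group C X Y" by (intro Hom_group) (auto simp: arr_def)
  show ?thesis using G.m_closed[of f g] a by (simp add: arr_def)
qed

lemma arr_Zero [intro]: "\<lbrakk>X \<in> Obj C; Y \<in> Obj C\<rbrakk> \<Longrightarrow> arr X Y (Zero C X Y)"
proof -
  assume a: "X \<in> Obj C" "Y \<in> Obj C"
  then interpret G: comm_group "hom_group C X Y" by (intro Hom_group)
  show ?thesis using G.one_closed a by (simp add: arr_def)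
qed

lemma Add_idem_Zero: "\<lbrakk>arr X Y f; Add C f f = f\<rbrakk> \<Longrightarrow> f = Zero C X Y"
proof -
  assume a: "arr X Y f" and e: "Add C f f = f"
  then interpret G: comm_group "hom_group C X Y" by (intro Hom_group) (auto simp: arr_def)
  show ?thesis using G.l_cancel_one'[of f f] a e by (simp add: arr_def)
qed

text \<open>Since 0 + 0 = 0, the morphism \<open>Scl C 0 f\<close> is idempotent for addition, and
  in a group only the neutral element is. Describing zero morphisms as multiples by 0 makes their
  behaviour under composition and tensor product a case of linearity in scalars.\<close>

lemma Scl_zero: "arr X Y f \<Longrightarrow> Scl C 0 f = Zero C X Y"
  by (rule Add_idem_Zero) (auto simp: arr_def Scl_plus[symmetric] Scl_in)

lemma Scl_Zero: "\<lbrakk>X \<in> Obj C; Y \<in> Obj C\<rbrakk> \<Longrightarrow> Scl C a (Zero C X Y) = Zero C X Y"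
proof -
  assume o: "X \<in> Obj C" "Y \<in> Obj C"
  have "Scl C a (Scl C 0 (Zero C X Y)) = Scl C 0 (Zero C X Y)"
    using arr_Scl_Scl[OF arr_Zero[OF o]] by simp
  then show ?thesis using Scl_zero[OF arr_Zero[OF o]] by simp
qed

lemma Cmp_Zero_right:
  assumes "X \<in> Obj C" "arr Y Z g" shows "g \<cdot> Zero C X Y = Zero C X Z"
proof -
  have z: "arr X Y (Zero C X Y)" using assms by (intro arr_Zero) (auto simp: arr_def)
  have "g \<cdot> Scl C 0 (Zero C X Y) = Scl C 0 (g \<cdot> Zero C X Y)" by (rule arr_Scl_right[OF z assms(2)])
  then show ?thesis by (simp only: Scl_zero[OF z] Scl_zero[OF arr_Cmp[OF assms(2) z]])
qed

lemma Cmp_Zero_left: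
  assumes "Z \<in> Obj C" "arr X Y f" shows "Zero C Y Z \<cdot> f = Zero C X Z"
proof -
  have z: "arr Y Z (Zero C Y Z)" using assms by (intro arr_Zero) (auto simp: arr_def)
  have "Scl C 0 (Zero C Y Z) \<cdot> f = Scl C 0 (Zero C Y Z \<cdot> f)" by (rule arr_Scl_left[OF assms(2) z])
  then show ?thesis by (simp only: Scl_zero[OF z] Scl_zero[OF arr_Cmp[OF z assms(2)]])
qed

lemma eq_if_diff_Zero:
  assumes "arr X Y f" "arr X Y g" "Add C f (Scl C (-1) g) = Zero C X Y"
  shows "f = g"
proof -
  interpret G: comm_group "hom_group C X Y" using assms by (intro Hom_group) (auto simp: arr_def)
  have z: "Add C g (Scl C (-1) g) = Zero C X Y"
    using Scl_plus[of X Y g 1 "-1"] assms Scl_zero[OF assms(2)] arr_Scl_one[OF assms(2)]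
    by (simp add: arr_def)
  show ?thesis
    using G.right_cancel[of "Scl C (-1) g" f g] z assms by (simp add: arr_def Scl_in)
qed

text \<open>Subtraction gives a zero multiple of \<open>f\<close> by \<open>a - b\<close>, and a
  nonzero \<open>a - b\<close> could be inverted. This is how equations of scalars are extracted
  from equations of morphisms.\<close>

lemma Scl_cancel:
  assumes f: "arr X Y f" "f \<noteq> Zero C X Y" and e: "Scl C a f = Scl C b f"
  shows "a = b"
proof (rule ccontr)
  assume "a \<noteq> b"
  have "Scl C (a - b) f = Zero C X Y"
  proof -
    have "Scl C (a + (- b)) f = Add C (Scl C a f) (Scl C (- b) f)"
      using f by (intro Scl_plus[of X Y]) (auto simp: arr_def)
    also have "\<dots> = Scl C (b + (- b)) f" using f Scl_plus[of X Y f b "- b"] e by (simp add: arr_def)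
    finally show ?thesis using Scl_zero[OF f(1)] by simp
  qed
  then have "Scl C (inverse (a - b)) (Scl C (a - b) f) = Zero C X Y"
    using Scl_Zero f by (simp add: arr_def)
  then show False using \<open>a \<noteq> b\<close> f arr_Scl_Scl arr_Scl_one by simp
qed

lemma Scl_eq_Zero: "\<lbrakk>arr X Y f; Scl C a f = Zero C X Y; a \<noteq> 0\<rbrakk> \<Longrightarrow> f = Zero C X Y"
  using Scl_cancel[of X Y f a 0] Scl_zero by auto

text \<open>Carrying the inverse as an argument makes isomorphisms closed under composition, tensor
  product and scaling by explicit formulas. The definite description in \<open>inv_mor\<close> is
  met only at the boundary with the given definitions.\<close>

definition ip :: "'o \<Rightarrow> 'o \<Rightarrow> 'm \<Rightarrow> 'm \<Rightarrow> bool"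
  where "ip X Y f g \<longleftrightarrow> arr X Y f \<and> arr Y X g \<and> g \<cdot> f = Idt C X \<and> f \<cdot> g = Idt C Y"

lemma ipD: assumes "ip X Y f g"
  shows "arr X Y f" "arr Y X g" "g \<cdot> f = Idt C X" "f \<cdot> g = Idt C Y" "X \<in> Obj C" "Y \<in> Obj C"
  using assms by (simp_all add: ip_def arr_def)

lemma ip_inverse_pair: "\<lbrakk>X \<in> Obj C; Y \<in> Obj C\<rbrakk> \<Longrightarrow> inverse_pair C X Y f g \<longleftrightarrow> ip X Y f g"
  by (auto simp: ip_def inverse_pair_def arr_def)

lemma inverse_pair_unique: assumes "ip X Y f g" "ip X Y f h" shows "g = h"
proof -
  note g = ipD[OF assms(1)] and h = ipD[OF assms(2)]
  have "h = (g \<cdot> f) \<cdot> h" using arr_Idt_Cmp[OF h(2)] g by simp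
  also have "\<dots> = g \<cdot> (f \<cdot> h)" by (rule arr_assoc[OF h(2) g(1) g(2)])
  also have "\<dots> = g" using arr_Cmp_Idt[OF g(2)] h by simp
  finally show ?thesis ..
qed

lemma inv_mor_eq: assumes "ip X Y f g" shows "inv_mor C X Y f = g"
  unfolding inv_mor_def ip_inverse_pair[OF ipD(5,6)[OF assms]]
  using assms inverse_pair_unique by (intro the_equality) auto

lemma iso_mor_ip: "\<lbrakk>X \<in> Obj C; Y \<in> Obj C\<rbrakk> \<Longrightarrow> iso_mor C X Y f \<longleftrightarrow> (\<exists>g. ip X Y f g)"
  by (simp add: iso_mor_def ip_inverse_pair)

lemma inv_mor_ip: "\<lbrakk>X \<in> Obj C; Y \<in> Obj C; iso_mor C X Y f\<rbrakk> \<Longrightarrow> ip X Y f (inv_mor C X Y f)"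
  using inv_mor_eq by (auto simp: iso_mor_ip)

lemma ip_sym: "ip X Y f g \<Longrightarrow> ip Y X g f"
  by (auto simp: ip_def)

lemma ip_Idt: "X \<in> Obj C \<Longrightarrow> ip X X (Idt C X) (Idt C X)"
  using arr_Idt arr_Idt_Cmp by (auto simp: ip_def)

lemma ip_Cmp:
  assumes "ip X Y f g" "ip Y Z f' g'"
  shows "ip X Z (f' \<cdot> f) (g \<cdot> g')"
proof -
  note a = ipD[OF assms(1)] and b = ipD[OF assms(2)]
  have "(g \<cdot> g') \<cdot> (f' \<cdot> f) = g \<cdot> g' \<cdot> f' \<cdot> f" by (rule arr_assoc[OF arr_Cmp[OF b(1) a(1)] b(2) a(2)])
  also have "g' \<cdot> f' \<cdot> f = f" using arr_assoc[OF a(1) b(1) b(2)] b(3) arr_Idt_Cmp[OF a(1)] by simp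
  finally have 1: "(g \<cdot> g') \<cdot> (f' \<cdot> f) = Idt C X" using a by simp
  have "(f' \<cdot> f) \<cdot> (g \<cdot> g') = f' \<cdot> f \<cdot> g \<cdot> g'" by (rule arr_assoc[OF arr_Cmp[OF a(2) b(2)] a(1) b(1)])
  also have "f \<cdot> g \<cdot> g' = g'" using arr_assoc[OF b(2) a(2) a(1)] a(4) arr_Idt_Cmp[OF b(2)] by simp
  finally have 2: "(f' \<cdot> f) \<cdot> (g \<cdot> g') = Idt C Z" using b by simp
  show ?thesis using 1 2 a b by (auto simp: ip_def)
qed

lemma ip_cancel_left:
  assumes "ip Y Z f g" "arr X Y h" "arr X Y h'" "f \<cdot> h = f \<cdot> h'"
  shows "h = h'"
proof -
  note a = ipD[OF assms(1)]
  have "g \<cdot> f \<cdot> h = h" if "arr X Y h" for h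
    using arr_assoc[OF that a(1) a(2)] a(3) arr_Idt_Cmp[OF that] by simp
  then show ?thesis using assms by metis
qed

lemma ip_cancel_right:
  assumes "ip X Y f g" "arr Y Z h" "arr Y Z h'" "h \<cdot> f = h' \<cdot> f"
  shows "h = h'"
proof -
  note a = ipD[OF assms(1)]
  have "(h \<cdot> f) \<cdot> g = h" if "arr Y Z h" for h
    using arr_assoc[OF a(2) a(1) that] a(4) arr_Cmp_Idt[OF that] by simp
  then show ?thesis using assms by metis
qed

lemma ip_Scl:
  assumes "ip X Y f g" "a \<noteq> 0"
  shows "ip X Y (Scl C a f) (Scl C (inverse a) g)"
proof -
  have b: "arr X Y f" "arr Y X g" "g \<cdot> f = Idt C X" "f \<cdot> g = Idt C Y"
    using assms(1) by (auto simp: ip_def)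
  have "Scl C (inverse a) g \<cdot> Scl C a f = Scl C (inverse a * a) (g \<cdot> f)"
    using arr_Scl_left[OF arr_Scl[OF b(1)] b(2)] arr_Scl_right[OF b(1) b(2)]
      arr_Scl_Scl[OF arr_Cmp[OF b(2,1)]] by simp
  moreover have "Scl C a f \<cdot> Scl C (inverse a) g = Scl C (a * inverse a) (f \<cdot> g)"
    using arr_Scl_left[OF arr_Scl[OF b(2)] b(1)] arr_Scl_right[OF b(2) b(1)]
      arr_Scl_Scl[OF arr_Cmp[OF b(1,2)]] by simp
  moreover have "Scl C 1 (Idt C X) = Idt C X" "Scl C 1 (Idt C Y) = Idt C Y"
    using b(1) arr_Scl_one arr_Idt by (auto simp: arr_def)
  ultimately show ?thesis using assms(2) b by (simp add: ip_def arr_Scl)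
qed

lemma isomorphic_ip: "\<lbrakk>X \<in> Obj C; Y \<in> Obj C\<rbrakk> \<Longrightarrow> isomorphic C X Y \<longleftrightarrow> (\<exists>f g. ip X Y f g)"
  by (simp add: isomorphic_def iso_mor_ip)

text \<open>If the isomorphism vanished, so would its composite with the inverse, which is the
  identity of \<open>X\<close>.\<close>

lemma ip_nonzero:
  assumes "ip X Y f g" "\<not> zero_object C X" shows "f \<noteq> Zero C X Y"
proof
  note a = ipD[OF assms(1)]
  assume "f = Zero C X Y"
  then have "g \<cdot> f = Zero C X X" using Cmp_Zero_right[OF a(5,2)] by simp
  then show False using a assms(2) by (simp add: zero_object_def)
qed

lemma zero_object_iso:
  assumes "ip X Y f g" "zero_object C X" shows "zero_object C Y"
proof -
  note a = ipD[OF assms(1)]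
  have z: "Idt C X = Zero C X X" using assms(2) by (simp add: zero_object_def)
  have "f = f \<cdot> Idt C X" using arr_Cmp_Idt[OF a(1)] by simp
  also have "\<dots> = Zero C X Y" unfolding z by (rule Cmp_Zero_right[OF a(5,1)])
  finally have "f \<cdot> g = Zero C Y Y" using Cmp_Zero_left[OF a(6,2)] by simp
  then show ?thesis using a by (simp add: zero_object_def)
qed

end

section \<open>Tensor products of morphisms\<close>

context monoidal_linear_category
begin

lemma arr_TMor [intro]: "\<lbrakk>arr X X' f; arr Y Y' g\<rbrakk> \<Longrightarrow> arr (X \<odot> Y) (X' \<odot> Y') (f \<star> g)"
  by (simp add: arr_def TMor_in TObj_in)

lemma arr_TMor_Cmp: "\<lbrakk>arr X X' f; arr X' X'' f'; arr Y Y' g; arr Y' Y'' g'\<rbrakk>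
    \<Longrightarrow> (f' \<star> g') \<cdot> (f \<star> g) = (f' \<cdot> f) \<star> (g' \<cdot> g)"
  unfolding arr_def by (rule TMor_Cmp[of X X' X'' Y Y' Y'', symmetric]) auto

lemma ip_TMor:
  assumes "ip X X' f f'" "ip Y Y' g g'" shows "ip (X \<odot> Y) (X' \<odot> Y') (f \<star> g) (f' \<star> g')"
proof -
  note a = ipD[OF assms(1)] and b = ipD[OF assms(2)]
  show ?thesis
    using arr_TMor[OF a(1) b(1)] arr_TMor[OF a(2) b(2)] arr_TMor_Cmp[OF a(1,2) b(1,2)] arr_TMor_Cmp[OF a(2,1) b(2,1)]
    a b by (simp add: ip_def TMor_Idt)
qed

lemma ip_Assoc: "\<lbrakk>X \<in> Obj C; Y \<in> Obj C; Z \<in> Obj C\<rbrakk>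
    \<Longrightarrow> ip ((X \<odot> Y) \<odot> Z) (X \<odot> (Y \<odot> Z)) (Assoc C X Y Z) (InvAssoc C X Y Z)"
  unfolding InvAssoc_def by (rule inv_mor_ip) (auto intro: TObj_in Assoc_iso)

lemma arr_Assoc: "\<lbrakk>X \<in> Obj C; Y \<in> Obj C; Z \<in> Obj C\<rbrakk>
    \<Longrightarrow> arr ((X \<odot> Y) \<odot> Z) (X \<odot> (Y \<odot> Z)) (Assoc C X Y Z)"
  and arr_InvAssoc: "\<lbrakk>X \<in> Obj C; Y \<in> Obj C; Z \<in> Obj C\<rbrakk>
    \<Longrightarrow> arr (X \<odot> (Y \<odot> Z)) ((X \<odot> Y) \<odot> Z) (InvAssoc C X Y Z)"
  using ip_Assoc by (auto simp: ip_def)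

text \<open>Naturality of \<open>RUnit\<close> conjugates \<open>f \<star> Idt C (Unit C)\<close>
  into \<open>f\<close>. Taking the unit as the tail of a state therefore loses nothing.\<close>

lemma faithful_Unit:
  assumes "arr X Y f" "arr X Y g" "f \<star> Idt C (Unit C) = g \<star> Idt C (Unit C)"
  shows "f = g"
proof -
  have o: "X \<in> Obj C" "Y \<in> Obj C" using assms by (auto simp: arr_def)
  have r: "ip (X \<odot> Unit C) X (RUnit C X) (inv_mor C (X \<odot> Unit C) X (RUnit C X))"
    using o by (intro inv_mor_ip) (auto intro: TObj_in Unit_in RUnit_iso)
  have "f \<cdot> RUnit C X = g \<cdot> RUnit C X"
    using RUnit_natural[OF o arr_Hom[OF assms(1)]] RUnit_natural[OF o arr_Hom[OF assms(2)]] assms(3) by simp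
  then show ?thesis using ip_cancel_right[OF r] assms by auto
qed

text \<open>A zero morphism is a multiple by 0, and scalars can be taken out of a tensor
  product.\<close>

lemma TMor_Zero_left:
  assumes "X \<in> Obj C" "Y \<in> Obj C" "arr Z W f" shows "Zero C X Y \<star> f = Zero C (X \<odot> Z) (Y \<odot> W)"
proof -
  have z: "arr X Y (Zero C X Y)" using assms by auto
  have "Scl C 0 (Zero C X Y) \<star> f = Scl C 0 (Zero C X Y \<star> f)"
    using z assms(3) unfolding arr_def by (intro TMor_Scl_left[of X Y Z W]) auto
  then show ?thesis by (simp only: Scl_zero[OF z] Scl_zero[OF arr_TMor[OF z assms(3)]])
qed

lemma TMor_Zero_right:
  assumes "X \<in> Obj C" "Y \<in> Obj C" "arr Z W f" shows "f \<star> Zero C X Y = Zero C (Z \<odot> X) (W \<odot> Y)"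
proof -
  have z: "arr X Y (Zero C X Y)" using assms by auto
  have "f \<star> Scl C 0 (Zero C X Y) = Scl C 0 (f \<star> Zero C X Y)"
    using z assms(3) unfolding arr_def by (intro TMor_Scl_right[of Z W X Y]) auto
  then show ?thesis by (simp only: Scl_zero[OF z] Scl_zero[OF arr_TMor[OF assms(3) z]])
qed

end

section \<open>A strict calculus for morphisms\<close>

text \<open>
  A box is a family of morphisms \<open>X\<^sub>1 \<odot> (\<dots> \<odot> (X\<^sub>m \<odot> V)) \<rightarrow> Y\<^sub>1 \<odot> (\<dots> \<odot> (Y\<^sub>n \<odot> V))\<close> natural in \<open>V\<close>, and
  a state \<open>(S, V, xs, k)\<close> is a morphism \<open>k\<close> from \<open>S\<close> to such an iterated product. Boxes act on a state at a
  position of \<open>xs\<close>. Since everything is bracketed to the right, boxes at disjoint positions commute without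
  associators, which occur only inside the boxes \<open>mm\<close> and \<open>mi\<close> that split and merge tensor products.
\<close>

type_synonym ('o, 'm) box = "'o list \<times> ('o \<Rightarrow> 'm) \<times> 'o list"
type_synonym ('o, 'm) state = "'o \<times> 'o \<times> 'o list \<times> 'm"

definition bdom :: "('o, 'm) box \<Rightarrow> 'o list" where "bdom b = fst b"
definition bfun :: "('o, 'm) box \<Rightarrow> 'o \<Rightarrow> 'm" where "bfun b = fst (snd b)"
definition bcod :: "('o, 'm) box \<Rightarrow> 'o list" where "bcod b = snd (snd b)"
definition cur :: "('o, 'm) state \<Rightarrow> 'o list" where "cur s = fst (snd (snd s))"
definition mor :: "('o, 'm) state \<Rightarrow> 'm" where "mor s = snd (snd (snd s))"

lemma box_simps [simp]: "bdom (xs, F, ys) = xs" "bfun (xs, F, ys) = F" "bcod (xs, F, ys) = ys"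
  by (simp_all add: bdom_def bfun_def bcod_def)

lemma state_simps [simp]: "cur (S, V, xs, k) = xs" "mor (S, V, xs, k) = k"
  by (simp_all add: cur_def mor_def)

context monoidal_linear_category
begin

primrec TO :: "'o list \<Rightarrow> 'o \<Rightarrow> 'o" where
  "TO [] V = V"
| "TO (X # xs) V = X \<odot> TO xs V"

primrec TM :: "'o list \<Rightarrow> 'm \<Rightarrow> 'm" where
  "TM [] f = f"
| "TM (X # xs) f = Idt C X \<star> TM xs f"

lemma TO_in: "\<lbrakk>set xs \<subseteq> Obj C; V \<in> Obj C\<rbrakk> \<Longrightarrow> TO xs V \<in> Obj C"
  by (induction xs) (auto intro: TObj_in)

lemma TO_append: "TO (xs @ ys) V = TO xs (TO ys V)"
  by (induction xs) auto

lemma TM_append: "TM (xs @ ys) f = TM xs (TM ys f)"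
  by (induction xs) auto

lemma TM_arr: "\<lbrakk>set xs \<subseteq> Obj C; arr V W f\<rbrakk> \<Longrightarrow> arr (TO xs V) (TO xs W) (TM xs f)"
  by (induction xs) auto

lemma TM_Cmp: "\<lbrakk>set xs \<subseteq> Obj C; arr U V f; arr V W g\<rbrakk> \<Longrightarrow> TM xs (g \<cdot> f) = TM xs g \<cdot> TM xs f"
proof (induction xs)
  case (Cons X xs)
  then have X: "X \<in> Obj C" "set xs \<subseteq> Obj C" by auto
  have "(Idt C X \<star> TM xs g) \<cdot> (Idt C X \<star> TM xs f) = (Idt C X \<cdot> Idt C X) \<star> (TM xs g \<cdot> TM xs f)"
    by (rule arr_TMor_Cmp[OF arr_Idt[OF X(1)] arr_Idt[OF X(1)] TM_arr[OF X(2) Cons.prems(2)] TM_arr[OF X(2) Cons.prems(3)]])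
  then show ?case using Cons X arr_Idt_Cmp[OF arr_Idt[OF X(1)]] by simp
qed simp

lemma TM_Idt: "\<lbrakk>set xs \<subseteq> Obj C; V \<in> Obj C\<rbrakk> \<Longrightarrow> TM xs (Idt C V) = Idt C (TO xs V)"
  by (induction xs) (auto simp: TMor_Idt TO_in)

lemma TM_Scl: "\<lbrakk>set xs \<subseteq> Obj C; arr V W f\<rbrakk> \<Longrightarrow> TM xs (Scl C a f) = Scl C a (TM xs f)"
proof (induction xs)
  case (Cons X xs)
  then show ?case
    using TM_arr[of xs V W f] arr_Idt[of X] TMor_Scl_right[of X X "TO xs V" "TO xs W" "Idt C X" "TM xs f" a]
    by (simp add: arr_def)
qed simp

definition box_ok :: "('o, 'm) box \<Rightarrow> bool"
  where "box_ok b \<longleftrightarrow> set (bdom b) \<subseteq> Obj C \<and> set (bcod b) \<subseteq> Obj C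
    \<and> (\<forall>V\<in>Obj C. arr (TO (bdom b) V) (TO (bcod b) V) (bfun b V))
    \<and> (\<forall>V W f. arr V W f \<longrightarrow> bfun b W \<cdot> TM (bdom b) f = TM (bcod b) f \<cdot> bfun b V)"

lemma box_ok_arr: "\<lbrakk>box_ok b; V \<in> Obj C\<rbrakk> \<Longrightarrow> arr (TO (bdom b) V) (TO (bcod b) V) (bfun b V)"
  and box_ok_nat: "\<lbrakk>box_ok b; arr V W f\<rbrakk> \<Longrightarrow> bfun b W \<cdot> TM (bdom b) f = TM (bcod b) f \<cdot> bfun b V"
  and box_ok_dom: "box_ok b \<Longrightarrow> set (bdom b) \<subseteq> Obj C"
  and box_ok_cod: "box_ok b \<Longrightarrow> set (bcod b) \<subseteq> Obj C"
  by (auto simp: box_ok_def)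

definition good :: "('o, 'm) state \<Rightarrow> bool"
  where "good = (\<lambda>(S, V, xs, k). V \<in> Obj C \<and> set xs \<subseteq> Obj C \<and> arr S (TO xs V) k)"

definition act :: "nat \<Rightarrow> ('o, 'm) box \<Rightarrow> ('o, 'm) state \<Rightarrow> ('o, 'm) state"
  where "act n b = (\<lambda>(S, V, xs, k). (S, V,
    take n xs @ bcod b @ drop (n + length (bdom b)) xs,
    TM (take n xs) (bfun b (TO (drop (n + length (bdom b)) xs) V)) \<cdot> k))"

text \<open>The bound on the length keeps the position inside the list also for a box with empty
  domain, where the last equation says nothing.\<close>

definition win :: "nat \<Rightarrow> 'o list \<Rightarrow> ('o, 'm) state \<Rightarrow> bool"
  where "win n ys s \<longleftrightarrow> good s \<and> n + length ys \<le> length (cur s) \<and> take (length ys) (drop n (cur s)) = ys"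

definition sscl :: "'k \<Rightarrow> ('o, 'm) state \<Rightarrow> ('o, 'm) state"
  where "sscl a = (\<lambda>(S, V, xs, k). (S, V, xs, Scl C a k))"

definition idst :: "'o list \<Rightarrow> 'o \<Rightarrow> ('o, 'm) state"
  where "idst xs V = (TO xs V, V, xs, Idt C (TO xs V))"

lemma good_idst: "\<lbrakk>set xs \<subseteq> Obj C; V \<in> Obj C\<rbrakk> \<Longrightarrow> good (idst xs V)"
  by (auto simp: good_def idst_def TO_in)

lemma cur_idst [simp]: "cur (idst xs V) = xs"
  by (simp add: idst_def)

lemma cur_act [simp]: "cur (act n b s) = take n (cur s) @ bcod b @ drop (n + length (bdom b)) (cur s)"
  by (cases s) (simp add: act_def)

lemma cur_sscl [simp]: "cur (sscl a s) = cur s"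
  by (cases s) (simp add: sscl_def)

lemma win_good: "win n ys s \<Longrightarrow> good s"
  by (simp add: win_def)

text \<open>Exposes the list as prefix, window and suffix, the form in which \<open>act\<close>
  computes by \<open>act_eq\<close>.\<close>

lemma win_cases:
  assumes "win n ys s"
  obtains S V us vs k where "s = (S, V, us @ ys @ vs, k)" "length us = n" "V \<in> Obj C"
    "set us \<subseteq> Obj C" "set ys \<subseteq> Obj C" "set vs \<subseteq> Obj C" "arr S (TO us (TO ys (TO vs V))) k"
proof -
  obtain S V xs k where s: "s = (S, V, xs, k)" by (cases s)
  have t: "take (length ys) (drop n xs) = ys" "n + length ys \<le> length xs" "good s"
    using assms s by (simp_all add: win_def)
  have "xs = take n xs @ take (length ys) (drop n xs) @ drop (length ys) (drop n xs)"
    by (simp only: append_take_drop_id)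
  then have x: "xs = take n xs @ ys @ drop (length ys) (drop n xs)" by (simp only: t)
  define us vs where "us = take n xs" and "vs = drop (length ys) (drop n xs)"
  have x: "xs = us @ ys @ vs" using x by (simp only: us_def vs_def)
  have l: "length us = n" using t by (simp add: us_def)
  show thesis using that[of S V us vs k] t(3) l unfolding s x good_def by (auto simp: TO_append)
qed

lemma act_eq: "length us = n \<Longrightarrow> act n b (S, V, us @ bdom b @ vs, k)
    = (S, V, us @ bcod b @ vs, TM us (bfun b (TO vs V)) \<cdot> k)"
  by (simp add: act_def)

lemma good_act:
  assumes "box_ok b" "win n (bdom b) s" shows "good (act n b s)"
  using assms(2)
proof (cases rule: win_cases)
  case (1 S V us vs k)
  have W: "TO vs V \<in> Obj C" using 1 by (intro TO_in)
  have "arr (TO us (TO (bdom b) (TO vs V))) (TO us (TO (bcod b) (TO vs V))) (TM us (bfun b (TO vs V)))"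
    by (intro TM_arr box_ok_arr 1 assms(1) W)
  then show ?thesis using 1 box_ok_cod[OF assms(1)]
    by (auto simp: act_eq good_def TO_append)
qed

lemma good_sscl [simp]: "good s \<Longrightarrow> good (sscl a s)"
  by (cases s) (auto simp: good_def sscl_def)

lemma win_sscl [simp]: "win n ys s \<Longrightarrow> win n ys (sscl a s)"
  by (simp add: win_def)

lemma sscl_sscl: "good s \<Longrightarrow> sscl a (sscl b s) = sscl (a * b) s"
  by (cases s) (auto simp: sscl_def good_def arr_Scl_Scl)

lemma sscl_one: "good s \<Longrightarrow> sscl 1 s = s"
  by (cases s) (auto simp: sscl_def good_def arr_Scl_one)

lemma act_sscl:
  assumes "box_ok b" "win n (bdom b) s" shows "act n b (sscl a s) = sscl a (act n b s)"
  using assms(2)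
proof (cases rule: win_cases)
  case (1 S V us vs k)
  have W: "TO vs V \<in> Obj C" using 1 by (intro TO_in)
  have "arr (TO us (TO (bdom b) (TO vs V))) (TO us (TO (bcod b) (TO vs V))) (TM us (bfun b (TO vs V)))"
    by (intro TM_arr box_ok_arr 1 assms(1) W)
  then show ?thesis using 1 arr_Scl_right by (simp add: act_eq sscl_def)
qed

text \<open>The box \<open>G\<close> lies to the right of \<open>F\<close>, hence within the tail of
  \<open>F\<close>, so the interchange law is naturality of \<open>F\<close> in its tail. The
  position of \<open>G\<close> shifts by the change in length that \<open>F\<close> causes; adding
  before subtracting avoids truncation.\<close>

lemma exchange:
  assumes F: "box_ok F" and G: "box_ok G" and w: "win n (bdom F) s" "win m (bdom G) s"
    and le: "n + length (bdom F) \<le> m"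
  shows "act (m + length (bcod F) - length (bdom F)) G (act n F s) = act n F (act m G s)"
  using w(1)
proof (cases rule: win_cases)
  case (1 S V us vs k)
  \<comment> \<open>The objects strictly between the two windows; \<open>ws\<close> below holds
    those behind both.\<close>
  define mid where "mid = take (m - n - length (bdom F)) vs"
  define ws where "ws = drop (length (bdom G)) (drop (m - n - length (bdom F)) vs)"
  have len: "length (us @ bdom F @ mid) = m" "m + length (bdom G) \<le> length (us @ bdom F @ vs)"
    using 1 le w(2) by (auto simp: mid_def win_def)
  have g: "take (length (bdom G)) (drop m (us @ bdom F @ vs)) = bdom G"
    using w(2) 1(1) by (simp add: win_def)
  have "drop m (us @ bdom F @ vs) = drop (m - n - length (bdom F)) vs"
    using 1(2) le by (simp add: add.commute)
  then have g: "take (length (bdom G)) (drop (m - n - length (bdom F)) vs) = bdom G" using g by simp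
  have "vs = mid @ take (length (bdom G)) (drop (m - n - length (bdom F)) vs)
      @ drop (length (bdom G)) (drop (m - n - length (bdom F)) vs)"
    by (simp only: mid_def append_take_drop_id)
  then have vs: "vs = mid @ bdom G @ ws"
    by (simp only: g ws_def)
  then have s: "s = (S, V, us @ bdom F @ mid @ bdom G @ ws, k)" using 1 by simp
  have o: "set mid \<subseteq> Obj C" "set ws \<subseteq> Obj C" "set us \<subseteq> Obj C" using 1 vs by auto
  have k: "arr S (TO us (TO (bdom F) (TO mid (TO (bdom G) (TO ws V))))) k"
    using 1 vs by (simp add: TO_append)
  have W: "TO ws V \<in> Obj C" using o 1 by (intro TO_in)
  \<comment> \<open>The action of \<open>G\<close>, seen as a morphism between tails of
    \<open>F\<close>.\<close>
  define g' where "g' = TM mid (bfun G (TO ws V))"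
  have g': "arr (TO mid (TO (bdom G) (TO ws V))) (TO mid (TO (bcod G) (TO ws V))) g'"
    unfolding g'_def by (intro TM_arr box_ok_arr G W o)
  define A where "A = TO mid (TO (bdom G) (TO ws V))"
  define B where "B = TO mid (TO (bcod G) (TO ws V))"
  have AB: "arr A B g'" using g' by (simp add: A_def B_def)
  have fA: "arr (TO (bdom F) A) (TO (bcod F) A) (bfun F A)" and fB: "arr (TO (bdom F) B) (TO (bcod F) B) (bfun F B)"
    using box_ok_arr[OF F] arr_dom[OF AB] arr_cod[OF AB] by auto
  have tF: "arr (TO (bdom F) A) (TO (bdom F) B) (TM (bdom F) g')"
    "arr (TO (bcod F) A) (TO (bcod F) B) (TM (bcod F) g')"
    using TM_arr[OF box_ok_dom[OF F] AB] TM_arr[OF box_ok_cod[OF F] AB] .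
  have k': "arr S (TO us (TO (bdom F) A)) k" using k by (simp add: A_def)
  have *: "TM us (TM (bcod F) g') \<cdot> (TM us (bfun F A) \<cdot> k) = TM us (bfun F B) \<cdot> (TM us (TM (bdom F) g') \<cdot> k)"
  proof -
    have "TM us (TM (bcod F) g') \<cdot> (TM us (bfun F A) \<cdot> k) = (TM us (TM (bcod F) g') \<cdot> TM us (bfun F A)) \<cdot> k"
      by (rule arr_assoc[symmetric]) (rule k' TM_arr o fA tF)+
    also have "TM us (TM (bcod F) g') \<cdot> TM us (bfun F A) = TM us (TM (bcod F) g' \<cdot> bfun F A)"
      by (rule TM_Cmp[symmetric]) (rule o fA tF)+
    also have "TM (bcod F) g' \<cdot> bfun F A = bfun F B \<cdot> TM (bdom F) g'"
      using box_ok_nat[OF F AB] by simp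
    also have "TM us (bfun F B \<cdot> TM (bdom F) g') = TM us (bfun F B) \<cdot> TM us (TM (bdom F) g')"
      by (rule TM_Cmp) (rule o fB tF)+
    also have "(TM us (bfun F B) \<cdot> TM us (TM (bdom F) g')) \<cdot> k = TM us (bfun F B) \<cdot> (TM us (TM (bdom F) g') \<cdot> k)"
      by (rule arr_assoc) (rule k' TM_arr o fB tF)+
    finally show ?thesis .
  qed
  have f1: "act n F s = (S, V, (us @ bcod F @ mid) @ bdom G @ ws, TM us (bfun F A) \<cdot> k)"
    using act_eq[of us n F S V "mid @ bdom G @ ws" k] 1(2) s by (simp add: A_def TO_append)
  have "length (us @ bcod F @ mid) = m + length (bcod F) - length (bdom F)" using len(1) by auto
  then have L: "act (m + length (bcod F) - length (bdom F)) G (act n F s) =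
      (S, V, (us @ bcod F @ mid) @ bcod G @ ws, TM us (TM (bcod F) g') \<cdot> (TM us (bfun F A) \<cdot> k))"
    unfolding f1 by (subst act_eq) (auto simp: g'_def TM_append)
  have f2: "act m G s = (S, V, us @ bdom F @ (mid @ bcod G @ ws), TM us (TM (bdom F) g') \<cdot> k)"
    using act_eq[of "us @ bdom F @ mid" m G S V "ws" k] len(1) s by (simp add: g'_def TM_append)
  have R: "act n F (act m G s) =
      (S, V, us @ bcod F @ (mid @ bcod G @ ws), TM us (bfun F B) \<cdot> (TM us (TM (bdom F) g') \<cdot> k))"
    unfolding f2 using 1(2) by (subst act_eq) (auto simp: B_def TO_append)
  show ?thesis using L R * by simp
qed

text \<open>Idle objects on both sides enlarge the window of a box, so that boxes acting at
  different positions can be composed into a single one.\<close>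

definition whisk :: "'o list \<Rightarrow> ('o, 'm) box \<Rightarrow> 'o list \<Rightarrow> ('o, 'm) box"
  where "whisk us b vs = (us @ bdom b @ vs, \<lambda>V. TM us (bfun b (TO vs V)), us @ bcod b @ vs)"

definition bcomp :: "('o, 'm) box \<Rightarrow> ('o, 'm) box \<Rightarrow> ('o, 'm) box"
  where "bcomp b' b = (bdom b, \<lambda>V. bfun b' V \<cdot> bfun b V, bcod b')"

lemma whisk_simps [simp]: "bdom (whisk us b vs) = us @ bdom b @ vs" "bcod (whisk us b vs) = us @ bcod b @ vs"
    "bfun (whisk us b vs) = (\<lambda>V. TM us (bfun b (TO vs V)))"
  and bcomp_simps [simp]: "bdom (bcomp b' b) = bdom b" "bcod (bcomp b' b) = bcod b'"
    "bfun (bcomp b' b) = (\<lambda>V. bfun b' V \<cdot> bfun b V)"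
  by (simp_all add: whisk_def bcomp_def)

text \<open>On the left whiskering is only a shift of position, on the right it is absorbed by the
  tail.\<close>

lemma act_whisk:
  assumes "win n (us @ bdom b @ vs) s" shows "act n (whisk us b vs) s = act (n + length us) b s"
  using assms
proof (cases rule: win_cases)
  case (1 S V us' vs' k)
  then show ?thesis
    using act_eq[of us' n "whisk us b vs" S V vs' k] act_eq[of "us' @ us" "n + length us" b S V "vs @ vs'" k]
    by (simp add: TO_append TM_append)
qed

lemma act_bcomp:
  assumes "box_ok b" "box_ok b'" "bdom b' = bcod b" "win n (bdom b) s"
  shows "act n (bcomp b' b) s = act n b' (act n b s)"
  using assms(4)
proof (cases rule: win_cases)
  case (1 S V us vs k)
  have W: "TO vs V \<in> Obj C" using 1 by (intro TO_in)
  have a: "arr (TO (bdom b) (TO vs V)) (TO (bcod b) (TO vs V)) (bfun b (TO vs V))"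
    "arr (TO (bcod b) (TO vs V)) (TO (bcod b') (TO vs V)) (bfun b' (TO vs V))"
    using box_ok_arr[OF assms(1) W] box_ok_arr[OF assms(2) W] assms(3) by auto
  have "TM us (bfun b' (TO vs V) \<cdot> bfun b (TO vs V)) \<cdot> k = TM us (bfun b' (TO vs V)) \<cdot> (TM us (bfun b (TO vs V)) \<cdot> k)"
    using TM_Cmp[OF 1(4) a] arr_assoc[OF 1(7) TM_arr[OF 1(4) a(1)] TM_arr[OF 1(4) a(2)]] by simp
  then show ?thesis
    using act_eq[of us n "bcomp b' b" S V vs k] act_eq[of us n b S V vs k] act_eq[of us n b' S V vs] 1 assms(3)
    by simp
qed

lemma box_ok_bcomp:
  assumes "box_ok b" "box_ok b'" "bdom b' = bcod b" shows "box_ok (bcomp b' b)"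
  unfolding box_ok_def
proof (intro conjI ballI allI impI)
  show "set (bdom (bcomp b' b)) \<subseteq> Obj C" "set (bcod (bcomp b' b)) \<subseteq> Obj C"
    using box_ok_dom[OF assms(1)] box_ok_cod[OF assms(2)] by auto
  fix V assume V: "V \<in> Obj C"
  show "arr (TO (bdom (bcomp b' b)) V) (TO (bcod (bcomp b' b)) V) (bfun (bcomp b' b) V)"
    using box_ok_arr[OF assms(1) V] box_ok_arr[OF assms(2) V] assms(3) by auto
next
  fix V W f assume f: "arr V W f"
  note o = arr_dom[OF f] arr_cod[OF f]
  note a = box_ok_arr[OF assms(1) o(1)] box_ok_arr[OF assms(1) o(2)]
    box_ok_arr[OF assms(2) o(1), unfolded assms(3)] box_ok_arr[OF assms(2) o(2), unfolded assms(3)]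
  note t = TM_arr[OF box_ok_dom[OF assms(1)] f] TM_arr[OF box_ok_cod[OF assms(1)] f] TM_arr[OF box_ok_cod[OF assms(2)] f]
  show "bfun (bcomp b' b) W \<cdot> TM (bdom (bcomp b' b)) f = TM (bcod (bcomp b' b)) f \<cdot> bfun (bcomp b' b) V"
    using arr_assoc[OF t(1) a(2) a(4)] arr_assoc[OF a(1) t(2) a(4)] arr_assoc[OF a(1) a(3) t(3)]
      box_ok_nat[OF assms(1) f] box_ok_nat[OF assms(2) f] assms(3) by simp
qed

lemma box_ok_whisk:
  assumes "box_ok b" "set us \<subseteq> Obj C" "set vs \<subseteq> Obj C" shows "box_ok (whisk us b vs)"
  unfolding box_ok_def
proof (intro conjI ballI allI impI)
  show "set (bdom (whisk us b vs)) \<subseteq> Obj C" "set (bcod (whisk us b vs)) \<subseteq> Obj C"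
    using assms(2,3) box_ok_dom[OF assms(1)] box_ok_cod[OF assms(1)] by auto
  fix V assume V: "V \<in> Obj C"
  show "arr (TO (bdom (whisk us b vs)) V) (TO (bcod (whisk us b vs)) V) (bfun (whisk us b vs) V)"
    unfolding whisk_simps TO_append by (intro TM_arr box_ok_arr TO_in assms V)
next
  fix V W f assume f: "arr V W f"
  define V' W' f' where "V' = TO vs V" and "W' = TO vs W" and "f' = TM vs f"
  have f': "arr V' W' f'" using TM_arr[OF assms(3) f] by (simp add: V'_def W'_def f'_def)
  note o = arr_dom[OF f'] arr_cod[OF f']
  have "TM us (bfun b W') \<cdot> TM us (TM (bdom b) f') = TM us (bfun b W' \<cdot> TM (bdom b) f')"
    by (rule TM_Cmp[OF assms(2) TM_arr[OF box_ok_dom[OF assms(1)] f'] box_ok_arr[OF assms(1) o(2)], symmetric])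
  also have "bfun b W' \<cdot> TM (bdom b) f' = TM (bcod b) f' \<cdot> bfun b V'" by (rule box_ok_nat[OF assms(1) f'])
  also have "TM us \<dots> = TM us (TM (bcod b) f') \<cdot> TM us (bfun b V')"
    by (rule TM_Cmp[OF assms(2) box_ok_arr[OF assms(1) o(1)] TM_arr[OF box_ok_cod[OF assms(1)] f']])
  finally show "bfun (whisk us b vs) W \<cdot> TM (bdom (whisk us b vs)) f = TM (bcod (whisk us b vs)) f \<cdot> bfun (whisk us b vs) V"
    by (simp add: V'_def W'_def f'_def TM_append)
qed

text \<open>Transfers an identity between natural families to all positions of all lists; the axioms
  of \<open>C\<close> enter the calculus in this way.\<close>

lemma act_cong:
  assumes "bdom b = bdom b'" "bcod b = bcod b'" "\<And>V. V \<in> Obj C \<Longrightarrow> bfun b V = bfun b' V" "win n (bdom b') s"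
  shows "act n b s = act n b' s"
  using assms(4)
proof (cases rule: win_cases)
  case (1 S V us vs k)
  have "bfun b (TO vs V) = bfun b' (TO vs V)" by (intro assms(3) TO_in 1)
  then show ?thesis
    using act_eq[of us n b S V vs k] act_eq[of us n b' S V vs k] 1 assms(1,2) by simp
qed

lemma act_cong_Scl:
  assumes "bdom b = bdom b'" "bcod b = bcod b'" "\<And>V. V \<in> Obj C \<Longrightarrow> bfun b V = Scl C t (bfun b' V)"
    "box_ok b'" "win n (bdom b') s"
  shows "act n b s = sscl t (act n b' s)"
  using assms(5)
proof (cases rule: win_cases)
  case (1 S V us vs k)
  have W: "TO vs V \<in> Obj C" using 1 by (intro TO_in)
  note a = box_ok_arr[OF assms(4) W]
  have "TM us (bfun b (TO vs V)) \<cdot> k = Scl C t (TM us (bfun b' (TO vs V)) \<cdot> k)"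
    using assms(3)[OF W] TM_Scl[OF 1(4) a] arr_Scl_left[OF 1(7) TM_arr[OF 1(4) a]] by simp
  then show ?thesis
    using act_eq[of us n b S V vs k] act_eq[of us n b' S V vs k] 1 assms(1,2) by (simp add: sscl_def)
qed

lemma act_id:
  assumes "bdom b = bcod b" "\<And>V. V \<in> Obj C \<Longrightarrow> bfun b V = Idt C (TO (bdom b) V)" "win n (bdom b) s"
  shows "act n b s = s"
  using assms(3)
proof (cases rule: win_cases)
  case (1 S V us vs k)
  have "bfun b (TO vs V) = Idt C (TO (bdom b) (TO vs V))" by (intro assms(2) TO_in 1)
  moreover have "TM us (Idt C (TO (bdom b) (TO vs V))) = Idt C (TO us (TO (bdom b) (TO vs V)))"
    by (intro TM_Idt TO_in 1)
  ultimately show ?thesis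
    using act_eq[of us n b S V vs k] 1 assms(1) arr_Idt_Cmp[OF 1(7)] by simp
qed

lemma win_iff: "good s \<Longrightarrow> win n ys s \<longleftrightarrow> n + length ys \<le> length (cur s) \<and> take (length ys) (drop n (cur s)) = ys"
  by (simp add: win_def)

lemma win_shape: "win n ys s \<Longrightarrow> \<exists>us vs. cur s = us @ ys @ vs \<and> length us = n"
  by (erule win_cases) (metis state_simps(1))

lemma win_act_same:
  assumes "box_ok b" "win n (bdom b) s" shows "win n (bcod b) (act n b s)"
  using good_act[OF assms] win_shape[OF assms(2)] by (auto simp: win_iff)

section \<open>Boxes from morphisms and associators\<close>

definition bx :: "'o \<Rightarrow> 'o \<Rightarrow> 'm \<Rightarrow> ('o, 'm) box"
  where "bx X Y f = ([X], \<lambda>V. f \<star> Idt C V, [Y])"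

definition mm :: "'o \<Rightarrow> 'o \<Rightarrow> ('o, 'm) box"
  where "mm X Y = ([X \<odot> Y], \<lambda>V. Assoc C X Y V, [X, Y])"

definition mi :: "'o \<Rightarrow> 'o \<Rightarrow> ('o, 'm) box"
  where "mi X Y = ([X, Y], \<lambda>V. InvAssoc C X Y V, [X \<odot> Y])"

text \<open>A morphism between twofold products can act only after the two neighbours have been
  merged; its result is split again.\<close>

definition bx2 :: "'o \<Rightarrow> 'o \<Rightarrow> 'o \<Rightarrow> 'o \<Rightarrow> 'm \<Rightarrow> ('o, 'm) box"
  where "bx2 X Y X' Y' f = bcomp (mm X' Y') (bcomp (bx (X \<odot> Y) (X' \<odot> Y') f) (mi X Y))"

lemma bx_simps [simp]: "bdom (bx X Y f) = [X]" "bcod (bx X Y f) = [Y]"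
  by (simp_all add: bx_def)

lemma mm_simps [simp]: "bdom (mm X Y) = [X \<odot> Y]" "bcod (mm X Y) = [X, Y]"
  by (simp_all add: mm_def)

lemma mi_simps [simp]: "bdom (mi X Y) = [X, Y]" "bcod (mi X Y) = [X \<odot> Y]"
  by (simp_all add: mi_def)

lemma bx2_simps [simp]: "bdom (bx2 X Y X' Y' f) = [X, Y]" "bcod (bx2 X Y X' Y' f) = [X', Y']"
  by (simp_all add: bx2_def)

lemma box_ok_bx: assumes "arr X Y f" shows "box_ok (bx X Y f)"
  unfolding box_ok_def
proof (intro conjI ballI allI impI)
  show "set (bdom (bx X Y f)) \<subseteq> Obj C" "set (bcod (bx X Y f)) \<subseteq> Obj C"
    using assms by (auto simp: arr_def)
  fix V assume "V \<in> Obj C"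
  then show "arr (TO (bdom (bx X Y f)) V) (TO (bcod (bx X Y f)) V) (bfun (bx X Y f) V)"
    using assms by (auto simp: bx_def)
next
  fix V W g assume g: "arr V W g"
  note o = arr_Idt[OF arr_dom[OF assms]] arr_Idt[OF arr_cod[OF assms]] arr_Idt[OF arr_dom[OF g]] arr_Idt[OF arr_cod[OF g]]
  show "bfun (bx X Y f) W \<cdot> TM (bdom (bx X Y f)) g = TM (bcod (bx X Y f)) g \<cdot> bfun (bx X Y f) V"
    using arr_TMor_Cmp[OF o(1) assms g o(4)] arr_TMor_Cmp[OF assms o(2) o(3) g]
      arr_Cmp_Idt[OF assms] arr_Cmp_Idt[OF g] arr_Idt_Cmp[OF assms] arr_Idt_Cmp[OF g]
    by (simp add: bx_def)
qed

lemma arr_Assoc_natural: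
  assumes "arr X X' f" "arr Y Y' g" "arr Z Z' h"
  shows "Assoc C X' Y' Z' \<cdot> ((f \<star> g) \<star> h) = (f \<star> (g \<star> h)) \<cdot> Assoc C X Y Z"
  using assms unfolding arr_def by (intro Assoc_natural) auto

lemma box_ok_mm [simp]: assumes "X \<in> Obj C" "Y \<in> Obj C" shows "box_ok (mm X Y)"
  unfolding box_ok_def
proof (intro conjI ballI allI impI)
  show "set (bdom (mm X Y)) \<subseteq> Obj C" "set (bcod (mm X Y)) \<subseteq> Obj C"
    using assms by (auto intro: TObj_in)
  fix V assume "V \<in> Obj C"
  then show "arr (TO (bdom (mm X Y)) V) (TO (bcod (mm X Y)) V) (bfun (mm X Y) V)"
    using assms arr_Assoc by (simp add: mm_def)
next
  fix V W g assume g: "arr V W g"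
  show "bfun (mm X Y) W \<cdot> TM (bdom (mm X Y)) g = TM (bcod (mm X Y)) g \<cdot> bfun (mm X Y) V"
    using arr_Assoc_natural[OF arr_Idt[OF assms(1)] arr_Idt[OF assms(2)] g]
    by (simp add: mm_def TMor_Idt assms)
qed

lemma arr_InvAssoc_natural:
  assumes "arr X X' f" "arr Y Y' g" "arr Z Z' h"
  shows "InvAssoc C X' Y' Z' \<cdot> (f \<star> (g \<star> h)) = ((f \<star> g) \<star> h) \<cdot> InvAssoc C X Y Z"
proof -
  note o = arr_dom[OF assms(1)] arr_dom[OF assms(2)] arr_dom[OF assms(3)]
  note o' = arr_cod[OF assms(1)] arr_cod[OF assms(2)] arr_cod[OF assms(3)]
  note a = ipD[OF ip_Assoc[OF o]] and a' = ipD[OF ip_Assoc[OF o']]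
  let ?F = "(f \<star> g) \<star> h" and ?F' = "f \<star> (g \<star> h)"
  have F: "arr ((X \<odot> Y) \<odot> Z) ((X' \<odot> Y') \<odot> Z') ?F" "arr (X \<odot> (Y \<odot> Z)) (X' \<odot> (Y' \<odot> Z')) ?F'"
    by (intro arr_TMor assms)+
  have "InvAssoc C X' Y' Z' \<cdot> ?F' = InvAssoc C X' Y' Z' \<cdot> ?F' \<cdot> Assoc C X Y Z \<cdot> InvAssoc C X Y Z"
    using a(4) arr_Cmp_Idt[OF F(2)] by simp
  also have "?F' \<cdot> Assoc C X Y Z \<cdot> InvAssoc C X Y Z = (?F' \<cdot> Assoc C X Y Z) \<cdot> InvAssoc C X Y Z"
    by (rule arr_assoc[OF a(2) a(1) F(2), symmetric])
  also have "?F' \<cdot> Assoc C X Y Z = Assoc C X' Y' Z' \<cdot> ?F" by (rule arr_Assoc_natural[OF assms, symmetric])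
  also have "(Assoc C X' Y' Z' \<cdot> ?F) \<cdot> InvAssoc C X Y Z = Assoc C X' Y' Z' \<cdot> ?F \<cdot> InvAssoc C X Y Z"
    by (rule arr_assoc[OF a(2) F(1) a'(1)])
  also have "InvAssoc C X' Y' Z' \<cdot> \<dots> = (InvAssoc C X' Y' Z' \<cdot> Assoc C X' Y' Z') \<cdot> ?F \<cdot> InvAssoc C X Y Z"
    by (rule arr_assoc[OF arr_Cmp[OF F(1) a(2)] a'(1) a'(2), symmetric])
  also have "\<dots> = ?F \<cdot> InvAssoc C X Y Z" using a' arr_Idt_Cmp[OF arr_Cmp[OF F(1) a(2)]] by simp
  finally show ?thesis .
qed

lemma box_ok_mi [simp]: assumes "X \<in> Obj C" "Y \<in> Obj C" shows "box_ok (mi X Y)"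
  unfolding box_ok_def
proof (intro conjI ballI allI impI)
  show "set (bdom (mi X Y)) \<subseteq> Obj C" "set (bcod (mi X Y)) \<subseteq> Obj C"
    using assms by (auto intro: TObj_in)
  fix V assume "V \<in> Obj C"
  then show "arr (TO (bdom (mi X Y)) V) (TO (bcod (mi X Y)) V) (bfun (mi X Y) V)"
    using assms arr_InvAssoc by (simp add: mi_def)
next
  fix V W g assume g: "arr V W g"
  show "bfun (mi X Y) W \<cdot> TM (bdom (mi X Y)) g = TM (bcod (mi X Y)) g \<cdot> bfun (mi X Y) V"
    using arr_InvAssoc_natural[OF arr_Idt[OF assms(1)] arr_Idt[OF assms(2)] g]
    by (simp add: mi_def TMor_Idt assms)
qed

lemma box_ok_bx2: assumes "X \<in> Obj C" "Y \<in> Obj C" "X' \<in> Obj C" "Y' \<in> Obj C" "arr (X \<odot> Y) (X' \<odot> Y') f"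
  shows "box_ok (bx2 X Y X' Y' f)"
  unfolding bx2_def using assms by (intro box_ok_bcomp box_ok_mm box_ok_mi box_ok_bx) simp_all

lemma act_mi_mm: assumes "X \<in> Obj C" "Y \<in> Obj C" "win n [X \<odot> Y] s"
  shows "act n (mi X Y) (act n (mm X Y) s) = s"
proof -
  have "act n (mi X Y) (act n (mm X Y) s) = act n (bcomp (mi X Y) (mm X Y)) s"
    using assms by (intro act_bcomp[symmetric]) auto
  also have "\<dots> = s"
  proof (rule act_id)
    show "bfun (bcomp (mi X Y) (mm X Y)) V = Idt C (TO (bdom (bcomp (mi X Y) (mm X Y))) V)" if "V \<in> Obj C" for V
      using ipD(3)[OF ip_Assoc[OF assms(1,2) that]] by (simp add: mi_def mm_def)
  qed (use assms in simp_all)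
  finally show ?thesis .
qed

lemma act_mm_mi: assumes "X \<in> Obj C" "Y \<in> Obj C" "win n [X, Y] s"
  shows "act n (mm X Y) (act n (mi X Y) s) = s"
proof -
  have "act n (mm X Y) (act n (mi X Y) s) = act n (bcomp (mm X Y) (mi X Y)) s"
    using assms by (intro act_bcomp[symmetric]) auto
  also have "\<dots> = s"
  proof (rule act_id)
    show "bfun (bcomp (mm X Y) (mi X Y)) V = Idt C (TO (bdom (bcomp (mm X Y) (mi X Y))) V)" if "V \<in> Obj C" for V
      using ipD(4)[OF ip_Assoc[OF assms(1,2) that]] by (simp add: mi_def mm_def)
  qed (use assms in simp_all)
  finally show ?thesis .
qed

lemma act_bx_Cmp: assumes "arr X Y f" "arr Y Z g" "win n [X] s"
  shows "act n (bx X Z (g \<cdot> f)) s = act n (bx Y Z g) (act n (bx X Y f) s)"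
proof -
  have "act n (bx Y Z g) (act n (bx X Y f) s) = act n (bcomp (bx Y Z g) (bx X Y f)) s"
    using assms by (intro act_bcomp[symmetric] box_ok_bx) auto
  also have "\<dots> = act n (bx X Z (g \<cdot> f)) s"
  proof (rule act_cong)
    show "bfun (bcomp (bx Y Z g) (bx X Y f)) V = bfun (bx X Z (g \<cdot> f)) V" if "V \<in> Obj C" for V
      using arr_TMor_Cmp[OF assms(1,2) arr_Idt[OF that] arr_Idt[OF that]] arr_Idt_Cmp[OF arr_Idt[OF that]]
      by (simp add: bx_def)
  qed (use assms in simp_all)
  finally show ?thesis ..
qed

lemma act_bx_Idt: assumes "win n [X] s" shows "act n (bx X X (Idt C X)) s = s"
proof (rule act_id)
  have "X \<in> Obj C" using assms by (auto elim: win_cases)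
  then show "bfun (bx X X (Idt C X)) V = Idt C (TO (bdom (bx X X (Idt C X))) V)" if "V \<in> Obj C" for V
    using that by (simp add: bx_def TMor_Idt)
qed (use assms in simp_all)

lemma act_bx_Scl: assumes "arr X Y f" "win n [X] s"
  shows "act n (bx X Y (Scl C t f)) s = sscl t (act n (bx X Y f) s)"
proof (rule act_cong_Scl)
  show "bfun (bx X Y (Scl C t f)) V = Scl C t (bfun (bx X Y f) V)" if "V \<in> Obj C" for V
    using TMor_Scl_left[of X Y V V f "Idt C V" t] assms that by (simp add: bx_def arr_def Idt_in)
qed (use assms in \<open>simp_all add: box_ok_bx\<close>)

lemma act_bx_inverse: assumes "ip X Y f g" "win n [X] s" shows "act n (bx Y X g) (act n (bx X Y f) s) = s"
  using act_bx_Cmp[OF ipD(1,2)[OF assms(1)] assms(2)] ipD(3)[OF assms(1)] act_bx_Idt[OF assms(2)] by simp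

text \<open>Naturality of the associator in its first two variables, together with the interchange
  law for \<open>f\<close> and \<open>g\<close>.\<close>

lemma act_mm_bx:
  assumes "arr X X' f" "arr Y Y' g" "win n [X \<odot> Y] s"
  shows "act n (mm X' Y') (act n (bx (X \<odot> Y) (X' \<odot> Y') (f \<star> g)) s)
    = act n (bx X X' f) (act (Suc n) (bx Y Y' g) (act n (mm X Y) s))"
proof -
  note o = arr_dom[OF assms(1)] arr_dom[OF assms(2)] arr_cod[OF assms(1)] arr_cod[OF assms(2)]
  note ok = assms(1-2)[THEN box_ok_bx] box_ok_bx[OF arr_TMor[OF assms(1,2)]]
    box_ok_mm[OF o(1,2)] box_ok_mm[OF o(3,4)]
  have w: "win n [X, Y] (act n (mm X Y) s)" "good s"
    using win_act_same[OF ok(4)] assms(3) win_good by auto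
  have "act (Suc n) (bx Y Y' g) (act n (mm X Y) s) = act n (whisk [X] (bx Y Y' g) []) (act n (mm X Y) s)"
    using w by (subst act_whisk) simp_all
  also have "\<dots> = act n (bcomp (whisk [X] (bx Y Y' g) []) (mm X Y)) s"
    using assms(3) ok o by (intro act_bcomp[symmetric] box_ok_whisk) simp_all
  finally have e: "act (Suc n) (bx Y Y' g) (act n (mm X Y) s) = act n (bcomp (whisk [X] (bx Y Y' g) []) (mm X Y)) s" .
  have ok1: "box_ok (bcomp (whisk [X] (bx Y Y' g) []) (mm X Y))" "box_ok (whisk [] (bx X X' f) [Y'])"
    using ok o by (auto intro!: box_ok_bcomp box_ok_whisk)
  have w2: "win n [X, Y'] (act n (bcomp (whisk [X] (bx Y Y' g) []) (mm X Y)) s)"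
    using w assms(3) good_act[OF ok1(1)] by (auto simp: win_iff elim!: win_cases)
  have "act n (bx X X' f) (act (Suc n) (bx Y Y' g) (act n (mm X Y) s))
    = act n (bcomp (whisk [] (bx X X' f) [Y']) (bcomp (whisk [X] (bx Y Y' g) []) (mm X Y))) s"
    unfolding e using w2 ok1 assms(3) by (simp add: act_bcomp act_whisk)
  also have "\<dots> = act n (bcomp (mm X' Y') (bx (X \<odot> Y) (X' \<odot> Y') (f \<star> g))) s"
  proof (rule act_cong)
    fix V assume V: "V \<in> Obj C"
    note i = arr_Idt[OF V] arr_Idt[OF o(1)] arr_Idt[OF o(4)]
    have "(f \<star> Idt C (Y' \<odot> V)) \<cdot> (Idt C X \<star> (g \<star> Idt C V)) = f \<star> (g \<star> Idt C V)"
      using arr_TMor_Cmp[OF i(2) assms(1) arr_TMor[OF assms(2) i(1)] arr_Idt[OF TObj_in[OF o(4) V]]]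
       arr_Cmp_Idt[OF assms(1)] arr_Idt_Cmp[OF arr_TMor[OF assms(2) i(1)]] by simp
    then show "bfun (bcomp (whisk [] (bx X X' f) [Y']) (bcomp (whisk [X] (bx Y Y' g) []) (mm X Y))) V
      = bfun (bcomp (mm X' Y') (bx (X \<odot> Y) (X' \<odot> Y') (f \<star> g))) V"
      using arr_assoc[OF arr_Assoc[OF o(1,2) V] arr_TMor[OF i(2) arr_TMor[OF assms(2) i(1)]]
         arr_TMor[OF assms(1) arr_Idt[OF TObj_in[OF o(4) V]]]]
        arr_Assoc_natural[OF assms(1,2) i(1)]
      by (simp add: bx_def mm_def)
  qed (use assms in simp_all)
  also have "\<dots> = act n (mm X' Y') (act n (bx (X \<odot> Y) (X' \<odot> Y') (f \<star> g)) s)"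
    using ok assms(3) by (intro act_bcomp) simp_all
  finally show ?thesis ..
qed

text \<open>This is the pentagon axiom with the tail as fourth object. It is the reason why
  associators disappear once all products are split.\<close>

lemma act_mm_Assoc:
  assumes o: "X \<in> Obj C" "Y \<in> Obj C" "Z \<in> Obj C" and w: "win n [(X \<odot> Y) \<odot> Z] s"
  shows "act (Suc n) (mm Y Z) (act n (mm X (Y \<odot> Z)) (act n (bx ((X \<odot> Y) \<odot> Z) (X \<odot> (Y \<odot> Z)) (Assoc C X Y Z)) s))
    = act n (mm X Y) (act n (mm (X \<odot> Y) Z) s)"
proof -
  note oo = TObj_in[OF o(1,2)] TObj_in[OF o(2,3)]
  have ok: "box_ok (mm Y Z)" "box_ok (mm X (Y \<odot> Z))" "box_ok (mm X Y)" "box_ok (mm (X \<odot> Y) Z)"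
    "box_ok (bx ((X \<odot> Y) \<odot> Z) (X \<odot> (Y \<odot> Z)) (Assoc C X Y Z))"
    using o oo by (auto intro: box_ok_bx arr_Assoc)
  let ?b = "bcomp (mm X (Y \<odot> Z)) (bx ((X \<odot> Y) \<odot> Z) (X \<odot> (Y \<odot> Z)) (Assoc C X Y Z))"
  have ok1: "box_ok ?b" using ok by (intro box_ok_bcomp) auto
  have "act n (mm X (Y \<odot> Z)) (act n (bx ((X \<odot> Y) \<odot> Z) (X \<odot> (Y \<odot> Z)) (Assoc C X Y Z)) s) = act n ?b s"
    using w ok by (intro act_bcomp[symmetric]) auto
  moreover have w2: "win n [X, Y \<odot> Z] (act n ?b s)"
    using w good_act[OF ok1] by (auto simp: win_iff elim!: win_cases)
  moreover have "act (Suc n) (mm Y Z) (act n ?b s) = act n (whisk [X] (mm Y Z) []) (act n ?b s)"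
    using w2 by (subst act_whisk) simp_all
  moreover have "\<dots> = act n (bcomp (whisk [X] (mm Y Z) []) ?b) s"
    using w ok ok1 o by (intro act_bcomp[symmetric] box_ok_whisk) simp_all
  moreover have "\<dots> = act n (bcomp (whisk [] (mm X Y) [Z]) (mm (X \<odot> Y) Z)) s"
  proof (rule act_cong)
    fix V assume V: "V \<in> Obj C"
    show "bfun (bcomp (whisk [X] (mm Y Z) []) ?b) V = bfun (bcomp (whisk [] (mm X Y) [Z]) (mm (X \<odot> Y) Z)) V"
      using pentagon[OF o V] by (simp add: bx_def mm_def)
  qed (use w in simp_all)
  moreover have "\<dots> = act n (whisk [] (mm X Y) [Z]) (act n (mm (X \<odot> Y) Z) s)"
    using w ok o by (intro act_bcomp box_ok_whisk) simp_all
  moreover have "win n [X \<odot> Y, Z] (act n (mm (X \<odot> Y) Z) s)"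
    using w good_act[OF ok(4)] by (auto simp: win_iff elim!: win_cases)
  then have "act n (whisk [] (mm X Y) [Z]) (act n (mm (X \<odot> Y) Z) s) = act n (mm X Y) (act n (mm (X \<odot> Y) Z) s)"
    by (subst act_whisk) simp_all
  ultimately show ?thesis by simp
qed

lemma act_mm_InvAssoc:
  assumes o: "X \<in> Obj C" "Y \<in> Obj C" "Z \<in> Obj C" and w: "win n [X \<odot> (Y \<odot> Z)] s"
  shows "act n (mm X Y) (act n (mm (X \<odot> Y) Z) (act n (bx (X \<odot> (Y \<odot> Z)) ((X \<odot> Y) \<odot> Z) (InvAssoc C X Y Z)) s))
   = act (Suc n) (mm Y Z) (act n (mm X (Y \<odot> Z)) s)"
proof -
  let ?s = "act n (bx (X \<odot> (Y \<odot> Z)) ((X \<odot> Y) \<odot> Z) (InvAssoc C X Y Z)) s"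
  note i = ip_Assoc[OF o]
  have ok: "box_ok (bx (X \<odot> (Y \<odot> Z)) ((X \<odot> Y) \<odot> Z) (InvAssoc C X Y Z))" by (rule box_ok_bx[OF ipD(2)[OF i]])
  have "win n [(X \<odot> Y) \<odot> Z] ?s"
    using w good_act[OF ok] by (auto simp: win_iff elim!: win_cases)
  then show ?thesis using act_mm_Assoc[OF o, of n ?s] act_bx_inverse[OF ip_sym[OF i] w] by simp
qed

lemma act_bx2_mm:
  assumes o: "X \<in> Obj C" "Y \<in> Obj C" "X' \<in> Obj C" "Y' \<in> Obj C" "arr (X \<odot> Y) (X' \<odot> Y') f"
    and w: "win n [X \<odot> Y] s"
  shows "act n (bx2 X Y X' Y' f) (act n (mm X Y) s) = act n (mm X' Y') (act n (bx (X \<odot> Y) (X' \<odot> Y') f) s)"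
proof -
  have w2: "win n [X, Y] (act n (mm X Y) s)"
    using w good_act[OF box_ok_mm[OF o(1,2)]] by (auto simp: win_iff elim!: win_cases)
  have "act n (bx2 X Y X' Y' f) (act n (mm X Y) s)
    = act n (mm X' Y') (act n (bx (X \<odot> Y) (X' \<odot> Y') f) (act n (mi X Y) (act n (mm X Y) s)))"
    unfolding bx2_def using o w2 by (simp add: act_bcomp box_ok_bcomp box_ok_bx)
  then show ?thesis using act_mi_mm[OF o(1,2) w] by simp
qed

lemma act_bx2_eq:
  assumes o: "X \<in> Obj C" "Y \<in> Obj C" "X' \<in> Obj C" "Y' \<in> Obj C" "arr (X \<odot> Y) (X' \<odot> Y') f"
    and w: "win n [X, Y] s"
  shows "act n (bx2 X Y X' Y' f) s = act n (mm X' Y') (act n (bx (X \<odot> Y) (X' \<odot> Y') f) (act n (mi X Y) s))"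
  unfolding bx2_def using o w by (simp add: act_bcomp box_ok_bcomp box_ok_bx)

lemma act_bx2_inverse:
  assumes o: "X \<in> Obj C" "Y \<in> Obj C" "X' \<in> Obj C" "Y' \<in> Obj C" and i: "ip (X \<odot> Y) (X' \<odot> Y') f g"
    and w: "win n [X, Y] s"
  shows "act n (bx2 X' Y' X Y g) (act n (bx2 X Y X' Y' f) s) = s"
proof -
  define s1 where "s1 = act n (mi X Y) s"
  have w1: "win n [X \<odot> Y] s1" using win_act_same[OF box_ok_mi[OF o(1,2)]] w by (simp add: s1_def)
  have s: "s = act n (mm X Y) s1" using act_mm_mi[OF o(1,2) w] by (simp add: s1_def)
  have w2: "win n [X' \<odot> Y'] (act n (bx (X \<odot> Y) (X' \<odot> Y') f) s1)"
    using win_act_same[OF box_ok_bx[OF ipD(1)[OF i]]] w1 by simp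
  show ?thesis unfolding s act_bx2_mm[OF o ipD(1)[OF i] w1] act_bx2_mm[OF o(3,4,1,2) ipD(2)[OF i] w2]
    act_bx_inverse[OF i w1] ..
qed

lemma act_bx2_Scl:
  assumes o: "X \<in> Obj C" "Y \<in> Obj C" "X' \<in> Obj C" "Y' \<in> Obj C" "arr (X \<odot> Y) (X' \<odot> Y') f"
   and w: "win n [X, Y] s"
  shows "act n (bx2 X Y X' Y' (Scl C t f)) s = sscl t (act n (bx2 X Y X' Y' f) s)"
proof -
  have w1: "win n [X \<odot> Y] (act n (mi X Y) s)" using win_act_same[OF box_ok_mi[OF o(1,2)]] w by simp
  have w2: "win n [X' \<odot> Y'] (act n (bx (X \<odot> Y) (X' \<odot> Y') f) (act n (mi X Y) s))"
    using win_act_same[OF box_ok_bx[OF o(5)]] w1 by simp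
  show ?thesis
    unfolding act_bx2_eq[OF o w] act_bx2_eq[OF o(1-4) arr_Scl[OF o(5)] w] act_bx_Scl[OF o(5) w1]
    using act_sscl[OF box_ok_mm[OF o(3,4)]] w2 by simp
qed

lemma act_bx2_Idt:
  assumes o: "X \<in> Obj C" "Y \<in> Obj C" and w: "win n [X, Y] s"
  shows "act n (bx2 X Y X Y (Idt C (X \<odot> Y))) s = s"
proof -
  have w1: "win n [X \<odot> Y] (act n (mi X Y) s)" using win_act_same[OF box_ok_mi[OF o(1,2)]] w by simp
  show ?thesis
    unfolding act_bx2_eq[OF o o arr_Idt[OF TObj_in[OF o]] w] act_bx_Idt[OF w1]
    by (rule act_mm_mi[OF o w])
qed

lemma act_bx2_Cmp:
  assumes o: "X \<in> Obj C" "Y \<in> Obj C" "X' \<in> Obj C" "Y' \<in> Obj C" "X'' \<in> Obj C" "Y'' \<in> Obj C"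
   and f: "arr (X \<odot> Y) (X' \<odot> Y') f" and g: "arr (X' \<odot> Y') (X'' \<odot> Y'') g"
   and w: "win n [X, Y] s"
  shows "act n (bx2 X' Y' X'' Y'' g) (act n (bx2 X Y X' Y' f) s) = act n (bx2 X Y X'' Y'' (g \<cdot> f)) s"
proof -
  have w1: "win n [X \<odot> Y] (act n (mi X Y) s)" using win_act_same[OF box_ok_mi[OF o(1,2)]] w by simp
  have w2: "win n [X' \<odot> Y'] (act n (bx (X \<odot> Y) (X' \<odot> Y') f) (act n (mi X Y) s))"
    using win_act_same[OF box_ok_bx[OF f]] w1 by simp
  show ?thesis
    unfolding act_bx2_eq[OF o(1-4) f w] act_bx2_eq[OF o(1,2,5,6) arr_Cmp[OF g f] w]
     act_bx2_mm[OF o(3-6) g w2] act_bx_Cmp[OF f g w1] ..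
qed

lemma act_bx_idst: "arr X Y f \<Longrightarrow> act 0 (bx X Y f) (idst [X] (Unit C)) = (X \<odot> Unit C, Unit C, [Y], f \<star> Idt C (Unit C))"
  using arr_Cmp_Idt[OF arr_TMor[OF _ arr_Idt[OF Unit_in]]] by (simp add: act_def idst_def bx_def)

text \<open>The way back from states to morphisms: on a list with one entry and tail
  \<open>Unit C\<close> a box acts as \<open>f \<star> Idt C (Unit C)\<close>, from which
  \<open>f\<close> is recovered. The scalar is carried along because the comparisons to come hold up
  to a factor.\<close>

lemma act_bx_faithful:
  assumes "arr X Y f" "arr X Y g"
    and "act 0 (bx X Y f) (idst [X] (Unit C)) = sscl t (act 0 (bx X Y g) (idst [X] (Unit C)))"
  shows "f = Scl C t g"
proof (rule faithful_Unit[OF assms(1) arr_Scl[OF assms(2)]])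
  have "Scl C t g \<star> Idt C (Unit C) = Scl C t (g \<star> Idt C (Unit C))"
    using assms(2) Unit_in Idt_in by (intro TMor_Scl_left[of X Y "Unit C" "Unit C"]) (auto simp: arr_def)
  then show "f \<star> Idt C (Unit C) = Scl C t g \<star> Idt C (Unit C)"
    using assms by (simp add: act_bx_idst sscl_def)
qed

end

section \<open>Units, duals and nonzero tensor products\<close>

context monoidal_linear_category
begin

text \<open>Turns window conditions into computations with lists, so that the typing of states is
  settled by simplification.\<close>

lemmas st_simps = win_iff good_act box_ok_bx box_ok_bx2

text \<open>Inverting a natural family objectwise preserves naturality; this supplies the box that
  inserts a unit.\<close>

lemma box_ok_inverse:
  assumes ok: "box_ok b" and i: "\<And>V. V \<in> Obj C \<Longrightarrow> ip (TO (bdom b) V) (TO (bcod b) V) (bfun b V) (F V)"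
  shows "box_ok (bcod b, F, bdom b)"
  unfolding box_ok_def
proof (intro conjI ballI allI impI)
  show "set (bdom (bcod b, F, bdom b)) \<subseteq> Obj C" "set (bcod (bcod b, F, bdom b)) \<subseteq> Obj C"
    using box_ok_dom[OF ok] box_ok_cod[OF ok] by auto
  show "arr (TO (bdom (bcod b, F, bdom b)) V) (TO (bcod (bcod b, F, bdom b)) V) (bfun (bcod b, F, bdom b) V)"
    if "V \<in> Obj C" for V using ipD(2)[OF i[OF that]] by simp
next
  fix V W f assume f: "arr V W f"
  note v = ipD[OF i[OF arr_dom[OF f]]] and w = ipD[OF i[OF arr_cod[OF f]]]
  note d = TM_arr[OF box_ok_dom[OF ok] f] and c = TM_arr[OF box_ok_cod[OF ok] f]
  have "TM (bdom b) f \<cdot> F V = F W \<cdot> bfun b W \<cdot> TM (bdom b) f \<cdot> F V"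
    using arr_assoc[OF arr_Cmp[OF d v(2)] w(1) w(2)] w(3) arr_Idt_Cmp[OF arr_Cmp[OF d v(2)]] by simp
  also have "bfun b W \<cdot> TM (bdom b) f \<cdot> F V = (TM (bcod b) f \<cdot> bfun b V) \<cdot> F V"
    using arr_assoc[OF v(2) d w(1)] box_ok_nat[OF ok f] by simp
  also have "\<dots> = TM (bcod b) f" using arr_assoc[OF v(2) v(1) c] v(4) arr_Cmp_Idt[OF c] by simp
  finally show "bfun (bcod b, F, bdom b) W \<cdot> TM (bdom (bcod b, F, bdom b)) f
    = TM (bcod (bcod b, F, bdom b)) f \<cdot> bfun (bcod b, F, bdom b) V" by simp
qed

lemma ip_LUnit: "X \<in> Obj C \<Longrightarrow> ip (Unit C \<odot> X) X (LUnit C X) (inv_mor C (Unit C \<odot> X) X (LUnit C X))"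
  and ip_RUnit: "X \<in> Obj C \<Longrightarrow> ip (X \<odot> Unit C) X (RUnit C X) (inv_mor C (X \<odot> Unit C) X (RUnit C X))"
  by (auto intro!: inv_mor_ip LUnit_iso RUnit_iso TObj_in Unit_in)

text \<open>Kelly's argument: the functor \<open>Unit C \<odot> -\<close> is faithful.\<close>

lemma LUnit_Assoc:
  assumes X: "X \<in> Obj C" and V: "V \<in> Obj C"
  shows "LUnit C (X \<odot> V) \<cdot> Assoc C (Unit C) X V = LUnit C X \<star> Idt C V"
proof -
  let ?I = "Unit C" and ?A = "LUnit C (X \<odot> V) \<cdot> Assoc C (Unit C) X V" and ?B = "LUnit C X \<star> Idt C V"
  note I = Unit_in and XV = TObj_in[OF X V] and IX = TObj_in[OF Unit_in X] and II = TObj_in[OF Unit_in Unit_in]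
  note lX = ipD(1)[OF ip_LUnit[OF X]] and lXV = ipD(1)[OF ip_LUnit[OF XV]]
  note aA = arr_Cmp[OF lXV arr_Assoc[OF I X V]] and aB = arr_TMor[OF lX arr_Idt[OF V]]
  note iI = arr_Idt[OF I] and iV = arr_Idt[OF V] and iX = arr_Idt[OF X]
  let ?p = "Assoc C ?I (?I \<odot> X) V" and ?q = "Assoc C ?I ?I X \<star> Idt C V"
  note p = ip_Assoc[OF I IX V] and q = ip_TMor[OF ip_Assoc[OF I I X] ip_Idt[OF V]]
  note ap = ipD(1)[OF p] and aq = ipD(1)[OF q]
  note rI = ipD(1)[OF ip_RUnit[OF I]]
  \<comment> \<open>Both candidates are compared after tensoring with the unit from the left and
    precomposing with the isomorphisms \<open>?p\<close> and \<open>?q\<close>, where triangle and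
    pentagon apply.\<close>
  have "((Idt C ?I \<star> ?B) \<cdot> ?p) \<cdot> ?q = (Assoc C ?I X V \<cdot> ((Idt C ?I \<star> LUnit C X) \<star> Idt C V)) \<cdot> ?q"
    using arr_Assoc_natural[OF iI lX iV] by simp
  also have "\<dots> = Assoc C ?I X V \<cdot> ((Idt C ?I \<star> LUnit C X) \<star> Idt C V) \<cdot> ?q"
    by (rule arr_assoc[OF aq arr_TMor[OF arr_TMor[OF iI lX] iV] arr_Assoc[OF I X V]])
  also have "((Idt C ?I \<star> LUnit C X) \<star> Idt C V) \<cdot> ?q = (RUnit C ?I \<star> Idt C X) \<star> Idt C V"
    using arr_TMor_Cmp[OF arr_Assoc[OF I I X] arr_TMor[OF iI lX] iV iV] triangle[OF I X] arr_Idt_Cmp[OF iV] by simp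
  also have "Assoc C ?I X V \<cdot> \<dots> = (RUnit C ?I \<star> Idt C (X \<odot> V)) \<cdot> Assoc C (?I \<odot> ?I) X V"
    using arr_Assoc_natural[OF rI iX iV] TMor_Idt[OF X V] by simp
  also have "\<dots> = ((Idt C ?I \<star> LUnit C (X \<odot> V)) \<cdot> Assoc C ?I ?I (X \<odot> V)) \<cdot> Assoc C (?I \<odot> ?I) X V"
    using triangle[OF I XV] by simp
  also have "\<dots> = (Idt C ?I \<star> LUnit C (X \<odot> V)) \<cdot> Assoc C ?I ?I (X \<odot> V) \<cdot> Assoc C (?I \<odot> ?I) X V"
    by (rule arr_assoc[OF arr_Assoc[OF II X V] arr_Assoc[OF I I XV] arr_TMor[OF iI lXV]])
  also have "\<dots> = (Idt C ?I \<star> LUnit C (X \<odot> V)) \<cdot> (Idt C ?I \<star> Assoc C ?I X V) \<cdot> ?p \<cdot> ?q"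
    using pentagon[OF I I X V] by simp
  also have "\<dots> = ((Idt C ?I \<star> LUnit C (X \<odot> V)) \<cdot> (Idt C ?I \<star> Assoc C ?I X V)) \<cdot> ?p \<cdot> ?q"
    by (rule arr_assoc[OF arr_Cmp[OF ap aq] arr_TMor[OF iI arr_Assoc[OF I X V]] arr_TMor[OF iI lXV], symmetric])
  also have "\<dots> = (Idt C ?I \<star> ?A) \<cdot> ?p \<cdot> ?q"
    using arr_TMor_Cmp[OF iI iI arr_Assoc[OF I X V] lXV] arr_Idt_Cmp[OF iI] by simp
  also have "\<dots> = ((Idt C ?I \<star> ?A) \<cdot> ?p) \<cdot> ?q"
    by (rule arr_assoc[OF aq ap arr_TMor[OF iI aA], symmetric])
  finally have "(Idt C ?I \<star> ?B) \<cdot> ?p = (Idt C ?I \<star> ?A) \<cdot> ?p"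
    using ip_cancel_right[OF q arr_Cmp[OF arr_TMor[OF iI aB] ap] arr_Cmp[OF arr_TMor[OF iI aA] ap]] by blast
  then have "Idt C ?I \<star> ?B = Idt C ?I \<star> ?A"
    using ip_cancel_right[OF p arr_TMor[OF iI aB] arr_TMor[OF iI aA]] by blast
  \<comment> \<open>Naturality of \<open>LUnit\<close> removes the extra unit factor.\<close>
  then have "?A \<cdot> LUnit C ((?I \<odot> X) \<odot> V) = ?B \<cdot> LUnit C ((?I \<odot> X) \<odot> V)"
    using LUnit_natural[OF _ _ arr_Hom[OF aA]] LUnit_natural[OF _ _ arr_Hom[OF aB]] aA by (simp add: arr_def)
  then show ?thesis
    using ip_cancel_right[OF ip_LUnit[OF TObj_in[OF IX V]] aA aB] by blast
qed

text \<open>Read as a family in the tail, the left unit constraint is a box that erases a unit from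
  the list; \<open>eui\<close> inserts one.\<close>

definition eu :: "('o, 'm) box" where "eu = ([Unit C], LUnit C, [])"
definition eui :: "('o, 'm) box" where "eui = ([], \<lambda>V. inv_mor C (Unit C \<odot> V) V (LUnit C V), [Unit C])"

lemma eu_simps [simp]: "bdom eu = [Unit C]" "bcod eu = []" "bdom eui = []" "bcod eui = [Unit C]"
  by (simp_all add: eu_def eui_def)

lemma box_ok_eu [simp]: "box_ok eu"
  using ipD(1)[OF ip_LUnit] LUnit_natural
  by (auto simp: box_ok_def eu_def Unit_in arr_def)

lemma box_ok_eui [simp]: "box_ok eui"
  using box_ok_inverse[OF box_ok_eu, of "\<lambda>V. inv_mor C (Unit C \<odot> V) V (LUnit C V)"] ip_LUnit
  by (simp add: eui_def eu_def)

lemma act_eui_eu: assumes "win n [Unit C] s" shows "act n eui (act n eu s) = s"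
proof -
  have "act n eui (act n eu s) = act n (bcomp eui eu) s"
    using assms by (intro act_bcomp[symmetric]) auto
  also have "\<dots> = s"
    using ipD(3)[OF ip_LUnit] assms by (intro act_id) (auto simp: eu_def eui_def)
  finally show ?thesis .
qed

lemma act_LUnit:
  assumes X: "X \<in> Obj C" and w: "win n [Unit C \<odot> X] s"
  shows "act n (bx (Unit C \<odot> X) X (LUnit C X)) s = act n eu (act n (mm (Unit C) X) s)"
proof -
  have w1: "win n [Unit C, X] (act n (mm (Unit C) X) s)"
    using win_act_same[OF box_ok_mm[OF Unit_in X]] w by simp
  have "act n eu (act n (mm (Unit C) X) s) = act n (whisk [] eu [X]) (act n (mm (Unit C) X) s)"
    using w1 by (subst act_whisk) simp_all
  also have "\<dots> = act n (bcomp (whisk [] eu [X]) (mm (Unit C) X)) s"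
    using w X Unit_in by (intro act_bcomp[symmetric] box_ok_whisk) simp_all
  also have "\<dots> = act n (bx (Unit C \<odot> X) X (LUnit C X)) s"
    using LUnit_Assoc[OF X] w by (intro act_cong) (auto simp: bx_def eu_def mm_def)
  finally show ?thesis ..
qed

text \<open>This is the triangle axiom with the tail as right object, whereas
  \<open>act_LUnit\<close> rests on Kelly's argument.\<close>

lemma act_RUnit:
  assumes X: "X \<in> Obj C" and w: "win n [X \<odot> Unit C] s"
  shows "act n (bx (X \<odot> Unit C) X (RUnit C X)) s = act (Suc n) eu (act n (mm X (Unit C)) s)"
proof -
  have w1: "win n [X, Unit C] (act n (mm X (Unit C)) s)"
    using win_act_same[OF box_ok_mm[OF X Unit_in]] w by simp
  have "act (Suc n) eu (act n (mm X (Unit C)) s) = act n (whisk [X] eu []) (act n (mm X (Unit C)) s)"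
    using w1 by (subst act_whisk) simp_all
  also have "\<dots> = act n (bcomp (whisk [X] eu []) (mm X (Unit C))) s"
    using w X Unit_in by (intro act_bcomp[symmetric] box_ok_whisk) simp_all
  also have "\<dots> = act n (bx (X \<odot> Unit C) X (RUnit C X)) s"
    using triangle[OF X] w by (intro act_cong) (auto simp: bx_def eu_def mm_def)
  finally show ?thesis ..
qed

text \<open>The evaluation as a box that erases an adjacent dual pair; \<open>cvb\<close> is the
  coevaluation as a box that creates one.\<close>

definition evb :: "'o \<Rightarrow> 'o \<Rightarrow> 'm \<Rightarrow> ('o, 'm) box"
  where "evb D X e = bcomp eu (bcomp (bx (D \<odot> X) (Unit C) e) (mi D X))"

definition cvb :: "'o \<Rightarrow> 'o \<Rightarrow> 'm \<Rightarrow> ('o, 'm) box"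
  where "cvb X D c = bcomp (mm X D) (bcomp (bx (Unit C) (X \<odot> D) c) eui)"

lemma evb_simps [simp]: "bdom (evb D X e) = [D, X]" "bcod (evb D X e) = []"
    "bdom (cvb X D e) = []" "bcod (cvb X D e) = [X, D]"
  by (simp_all add: evb_def cvb_def)

lemma box_ok_evb: "\<lbrakk>D \<in> Obj C; X \<in> Obj C; arr (D \<odot> X) (Unit C) e\<rbrakk> \<Longrightarrow> box_ok (evb D X e)"
  unfolding evb_def by (intro box_ok_bcomp box_ok_bx box_ok_eu box_ok_mi) simp_all

lemma box_ok_cvb: "\<lbrakk>D \<in> Obj C; X \<in> Obj C; arr (Unit C) (X \<odot> D) c\<rbrakk> \<Longrightarrow> box_ok (cvb X D c)"
  unfolding cvb_def by (intro box_ok_bcomp box_ok_bx box_ok_eui box_ok_mm) simp_all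

lemma act_evb: "\<lbrakk>D \<in> Obj C; X \<in> Obj C; arr (D \<odot> X) (Unit C) e; win n [D, X] s\<rbrakk>
    \<Longrightarrow> act n (evb D X e) s = act n eu (act n (bx (D \<odot> X) (Unit C) e) (act n (mi D X) s))"
  unfolding evb_def by (simp add: act_bcomp box_ok_bcomp box_ok_bx)

lemma act_cvb: "\<lbrakk>D \<in> Obj C; X \<in> Obj C; arr (Unit C) (X \<odot> D) c; win n [] s\<rbrakk>
    \<Longrightarrow> act n (cvb X D c) s = act n (mm X D) (act n (bx (Unit C) (X \<odot> D) c) (act n eui s))"
  unfolding cvb_def by (simp add: act_bcomp box_ok_bcomp box_ok_bx)

text \<open>The second equation of \<open>dual_pair\<close>, taken factor by factor: its unit
  constraints become \<open>eu\<close> and \<open>eui\<close>, its associator is absorbed by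
  \<open>act_mm_InvAssoc\<close>, and the boxes of evaluation and coevaluation remain.\<close>

lemma zigzag:
  assumes o: "X \<in> Obj C" "D \<in> Obj C" and dp: "dual_pair C X D ev coev" and w: "win n [D] s"
  shows "act n (evb D X ev) (act (Suc n) (cvb X D coev) s) = s"
proof -
  note I = Unit_in
  have e: "arr (D \<odot> X) (Unit C) ev" and c: "arr (Unit C) (X \<odot> D) coev"
    using dp o I by (auto simp: dual_pair_def arr_def TObj_in)
  note oo = TObj_in[OF o] TObj_in[OF o(2,1)] TObj_in[OF o(2) I] TObj_in[OF I o(2)]
  note l = ip_LUnit[OF o(2)] and r = ip_RUnit[OF o(2)]
  let ?r = "inv_mor C (D \<odot> Unit C) D (RUnit C D)"
  have z: "LUnit C D \<cdot> (ev \<star> Idt C D) \<cdot> InvAssoc C D X D \<cdot> (Idt C D \<star> coev) \<cdot> ?r = Idt C D"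
    using dp by (simp add: dual_pair_def)
  note a1 = ipD(2)[OF r] and a2 = arr_TMor[OF arr_Idt[OF o(2)] c] and a3 = arr_InvAssoc[OF o(2,1,2)]
    and a4 = arr_TMor[OF e arr_Idt[OF o(2)]] and a5 = ipD(1)[OF l]
  note b2 = arr_Cmp[OF a2 a1] note b3 = arr_Cmp[OF a3 b2] note b4 = arr_Cmp[OF a4 b3]
  obtain us vs where sh: "cur s = us @ [D] @ vs" "length us = n" using win_shape[OF w] by blast
  have g: "good s" using w by (rule win_good)
  define s1 where "s1 = act n (bx D (D \<odot> Unit C) ?r) s"
  have s1: "good s1" "cur s1 = us @ [D \<odot> Unit C] @ vs"
    using g sh o by (simp_all add: s1_def st_simps a1)
  define s2 where "s2 = act n (bx (D \<odot> Unit C) (D \<odot> (X \<odot> D)) (Idt C D \<star> coev)) s1"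
  have s2: "good s2" "cur s2 = us @ [D \<odot> (X \<odot> D)] @ vs"
    using s1 sh o by (simp_all add: s2_def st_simps a2)
  define s3 where "s3 = act n (bx (D \<odot> (X \<odot> D)) ((D \<odot> X) \<odot> D) (InvAssoc C D X D)) s2"
  have s3: "good s3" "cur s3 = us @ [(D \<odot> X) \<odot> D] @ vs"
    using s2 sh o by (simp_all add: s3_def st_simps a3)
  define s4 where "s4 = act n (bx ((D \<odot> X) \<odot> D) (Unit C \<odot> D) (ev \<star> Idt C D)) s3"
  have s4: "good s4" "cur s4 = us @ [Unit C \<odot> D] @ vs"
    using s3 sh o by (simp_all add: s4_def st_simps a4)
  have "act n (bx D D (LUnit C D \<cdot> (ev \<star> Idt C D) \<cdot> InvAssoc C D X D \<cdot> (Idt C D \<star> coev) \<cdot> ?r)) s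
      = act n (bx (Unit C \<odot> D) D (LUnit C D)) s4"
    by (simp only: act_bx_Cmp[OF b4 a5 w] act_bx_Cmp[OF b3 a4 w] act_bx_Cmp[OF b2 a3 w] act_bx_Cmp[OF a1 a2 w]
      s1_def s2_def s3_def s4_def)
  \<comment> \<open>The identity of \<open>D\<close> has been replaced by the composite in the snake
    equation, whose first four factors produced the states \<open>s1\<close> to
    \<open>s4\<close>.\<close>
  then have "s = act n (bx (Unit C \<odot> D) D (LUnit C D)) s4"
    unfolding z using act_bx_Idt[OF w] by simp
  also have "\<dots> = act n eu (act n (mm (Unit C) D) s4)"
    using s4 sh by (intro act_LUnit o) (simp add: win_iff)
  also have "act n (mm (Unit C) D) s4
    = act n (bx (D \<odot> X) (Unit C) ev) (act (Suc n) (bx D D (Idt C D)) (act n (mm (D \<odot> X) D) s3))"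
    unfolding s4_def using s3 sh by (intro act_mm_bx e arr_Idt o) (simp add: win_iff)
  also have "act (Suc n) (bx D D (Idt C D)) (act n (mm (D \<odot> X) D) s3) = act n (mm (D \<odot> X) D) s3"
    using s3 sh oo o by (intro act_bx_Idt) (simp add: st_simps)
  also have "\<dots> = act n (mi D X) (act n (mm D X) (act n (mm (D \<odot> X) D) s3))"
    using s3 sh oo o by (intro act_mi_mm[symmetric]) (simp_all add: st_simps)
  also have "act n (mm D X) (act n (mm (D \<odot> X) D) s3) = act (Suc n) (mm X D) (act n (mm D (X \<odot> D)) s2)"
    unfolding s3_def using s2 sh by (intro act_mm_InvAssoc o) (simp add: win_iff)
  also have "act n (mm D (X \<odot> D)) s2 = act n (bx D D (Idt C D)) (act (Suc n) (bx (Unit C) (X \<odot> D) coev) (act n (mm D (Unit C)) s1))"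
    unfolding s2_def using s1 sh by (intro act_mm_bx c arr_Idt o) (simp add: win_iff)
  also have "\<dots> = act (Suc n) (bx (Unit C) (X \<odot> D) coev) (act n (mm D (Unit C)) s1)"
    using s1 sh oo o I by (intro act_bx_Idt) (simp add: st_simps c)
  \<comment> \<open>Erasing the unit and inserting it again makes the right unit constraint visible,
    which then cancels against its inverse in \<open>s1\<close>.\<close>
  also have "act n (mm D (Unit C)) s1 = act (Suc n) eui (act (Suc n) eu (act n (mm D (Unit C)) s1))"
    using s1 sh oo o I by (intro act_eui_eu[symmetric]) (simp add: st_simps)
  also have "act (Suc n) eu (act n (mm D (Unit C)) s1) = act n (bx (D \<odot> Unit C) D (RUnit C D)) s1"
    using s1 sh by (intro act_RUnit[symmetric] o) (simp add: win_iff)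
  also have "\<dots> = s" unfolding s1_def by (rule act_bx_inverse[OF ip_sym[OF r] w])
  also have "act (Suc n) (mm X D) (act (Suc n) (bx (Unit C) (X \<odot> D) coev) (act (Suc n) eui s)) = act (Suc n) (cvb X D coev) s"
    using sh g by (intro act_cvb[symmetric] o c) (simp add: win_iff)
  also have "act n eu (act n (bx (D \<odot> X) (Unit C) ev) (act n (mi D X) (act (Suc n) (cvb X D coev) s)))
     = act n (evb D X ev) (act (Suc n) (cvb X D coev) s)"
    using sh g o box_ok_cvb[OF o(2,1) c] by (intro act_evb[symmetric] o e) (simp add: st_simps)
  finally show ?thesis ..
qed

end

context linear_category
begin

lemma Add_neg: "arr X Y g \<Longrightarrow> Add C g (Scl C (-1) g) = Zero C X Y"
  using Scl_plus[of X Y g 1 "-1"] Scl_zero[of X Y g] arr_Scl_one[of X Y g] by (simp add: arr_def)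

end

section \<open>Tensor products of nonzero morphisms\<close>

context tensor_category
begin

text \<open>A kernel of \<open>i\<close> is a subobject of the simple unit, hence zero or
  everything, and in the second case \<open>i\<close> itself would vanish.\<close>

lemma Unit_mono:
  assumes i: "arr (Unit C) Y i" "i \<noteq> Zero C (Unit C) Y" and h: "arr W (Unit C) h" and z: "i \<cdot> h = Zero C W Y"
  shows "h = Zero C W (Unit C)"
proof -
  obtain K j where k: "is_kernel C (Unit C) Y i K j"
    using has_kernels[of "Unit C" Y i] i(1) by (auto simp: arr_def)
  then have K: "arr K (Unit C) j" "i \<cdot> j = Zero C K Y"
    using Unit_in by (auto simp: is_kernel_def arr_def)
  have univ: "\<exists>!u. u \<in> Hom C V K \<and> j \<cdot> u = g" if "arr V (Unit C) g" "i \<cdot> g = Zero C V Y" for V g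
    using k that by (auto simp: is_kernel_def arr_def)
  \<comment> \<open>Kernels are monic by the uniqueness part of their universal property.\<close>
  have "mono_mor C K (Unit C) j"
    unfolding mono_mor_def
  proof (intro conjI ballI impI)
    show "j \<in> Hom C K (Unit C)" using K by (simp add: arr_def)
    fix V u v assume V: "V \<in> Obj C" and uv: "u \<in> Hom C V K" "v \<in> Hom C V K" "j \<cdot> u = j \<cdot> v"
    have a: "arr V K u" using V uv K by (simp add: arr_def)
    have "i \<cdot> (j \<cdot> u) = Zero C V Y"
      using arr_assoc[OF a K(1) i(1)] K(2) Cmp_Zero_left[OF arr_cod[OF i(1)] a] by simp
    then show "u = v" using univ[OF arr_Cmp[OF K(1) a]] uv by metis
  qed
  then consider "zero_object C K" | "iso_mor C K (Unit C) j"
    using Unit_simple K(1) by (auto simp: simple_object_def arr_def)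
  then show ?thesis
  proof cases
    case 1
    obtain u where u: "arr W K u" "j \<cdot> u = h"
      using univ[OF h z] h K(1) by (auto simp: arr_def)
    have "u = Zero C W K"
      using arr_Idt_Cmp[OF u(1)] 1 Cmp_Zero_left[OF arr_dom[OF K(1)] u(1)] by (simp add: zero_object_def)
    then show ?thesis using u(2) Cmp_Zero_right[OF arr_dom[OF h] K(1)] by simp
  next
    case 2
    then obtain j' where j: "ip K (Unit C) j j'" using iso_mor_ip K(1) by (auto simp: arr_def)
    have "i = (i \<cdot> j) \<cdot> j'"
      using arr_assoc[OF ipD(2)[OF j] K(1) i(1)] ipD(4)[OF j] arr_Cmp_Idt[OF i(1)] by simp
    then show ?thesis using i(2) K(2) Cmp_Zero_left[OF arr_cod[OF i(1)] ipD(2)[OF j]] by simp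
  qed
qed

text \<open>A right dual of \<open>X\<close> has \<open>X\<close> as its left dual, so
  \<open>zigzag\<close> with the roles exchanged restores \<open>X\<close>.\<close>

lemma right_dual:
  assumes "X \<in> Obj C"
  obtains D ev cv where "D \<in> Obj C" "arr (X \<odot> D) (Unit C) ev" "arr (Unit C) (D \<odot> X) cv"
    "\<And>n s. win n [X] s \<Longrightarrow> act n (evb X D ev) (act (Suc n) (cvb D X cv) s) = s"
proof -
  obtain D ev cv where d: "D \<in> Obj C" "dual_pair C D X ev cv" using has_right_duals[OF assms] by blast
  show thesis
    using that[of D ev cv] d zigzag[OF d(1) assms d(2)] assms
    by (auto simp: dual_pair_def arr_def TObj_in Unit_in)
qed

lemma act_bx_bx:
  assumes e: "arr M M' e" and g: "arr N N' g" and w: "win n [M, N] s"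
  shows "act n (bx M M' e) (act (Suc n) (bx N N' g) s) = act n (mm M' N') (act n (bx (M \<odot> N) (M' \<odot> N') (e \<star> g)) (act n (mi M N) s))"
proof -
  have w': "win n [M \<odot> N] (act n (mi M N) s)"
    using win_act_same[OF box_ok_mi[OF arr_dom[OF e] arr_dom[OF g]]] w by simp
  show ?thesis
    unfolding act_mm_bx[OF e g w'] act_mm_mi[OF arr_dom[OF e] arr_dom[OF g] w] ..
qed

text \<open>Vanishing of a state is written as invariance under \<open>sscl 0\<close>, a form that
  \<open>act_sscl\<close> carries through every box.\<close>

lemma act_TMor_zero:
  assumes e: "arr M M' e" and g: "arr N N' g" and z: "e \<star> g = Zero C (M \<odot> N) (M' \<odot> N')" and w: "win n [M, N] s"
  shows "act n (bx M M' e) (act (Suc n) (bx N N' g) s) = sscl 0 (act n (bx M M' e) (act (Suc n) (bx N N' g) s))"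
proof -
  note eg = arr_TMor[OF e g]
  have zz: "Scl C 0 (e \<star> g) = e \<star> g" using Scl_zero[OF eg] z by simp
  have w': "win n [M \<odot> N] (act n (mi M N) s)"
    using win_act_same[OF box_ok_mi[OF arr_dom[OF e] arr_dom[OF g]]] w by simp
  have w2: "win n [M' \<odot> N'] (act n (bx (M \<odot> N) (M' \<odot> N') (e \<star> g)) (act n (mi M N) s))"
    using win_act_same[OF box_ok_bx[OF eg]] w' by simp
  show ?thesis
    unfolding act_bx_bx[OF e g w]
    using act_bx_Scl[OF eg w', of 0, unfolded zz] act_sscl[OF box_ok_mm[OF arr_cod[OF e] arr_cod[OF g]], unfolded mm_simps, OF w2, of 0]
    by metis
qed

text \<open>
  With a dual of its source, \<open>e\<close> is turned into a nonzero morphism out of the unit object, which is monic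
  because the unit object is simple.
\<close>

lemma nonzero_TMor:
  assumes e: "arr M M' e" and g: "arr N N' g" and z: "e \<star> g = Zero C (M \<odot> N) (M' \<odot> N')"
    and nz: "e \<noteq> Zero C M M'"
  shows "g = Zero C N N'"
proof -
  note oM = arr_dom[OF e] and oM' = arr_cod[OF e] and oN = arr_dom[OF g] and oN' = arr_cod[OF g] and I = Unit_in
  obtain D ev cv where d: "D \<in> Obj C" "arr (M \<odot> D) (Unit C) ev" "arr (Unit C) (D \<odot> M) cv"
    "\<And>n s. win n [M] s \<Longrightarrow> act n (evb M D ev) (act (Suc n) (cvb D M cv) s) = s" using right_dual[OF oM] by blast
  obtain D2 ev2 cv2 where d2: "D2 \<in> Obj C" "arr (N' \<odot> D2) (Unit C) ev2" "arr (Unit C) (D2 \<odot> N') cv2"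
    "\<And>n s. win n [N'] s \<Longrightarrow> act n (evb N' D2 ev2) (act (Suc n) (cvb D2 N' cv2) s) = s" using right_dual[OF oN'] by blast
  note ok = box_ok_evb[OF oM d(1,2)] box_ok_cvb[OF oM d(1,3)] box_ok_evb[OF oN' d2(1,2)] box_ok_cvb[OF oN' d2(1,3)]
    box_ok_bx[OF e] box_ok_bx[OF g]
  \<comment> \<open>The mate of \<open>e\<close>: the coevaluation of the dual of \<open>M\<close>,
    followed by \<open>e\<close> on its second factor.\<close>
  define Eb where "Eb = bcomp (whisk [D] (bx M M' e) []) (cvb D M cv)"
  have okE: "box_ok Eb" unfolding Eb_def using ok d by (intro box_ok_bcomp box_ok_whisk) simp_all
  have dE [simp]: "bdom Eb = []" "bcod Eb = [D, M']" by (simp_all add: Eb_def)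
  have actE: "act n Eb s = act (Suc n) (bx M M' e) (act n (cvb D M cv) s)" if w: "win n [] s" for n s
  proof -
    have "win n [D, M] (act n (cvb D M cv) s)" using win_act_same[OF ok(2)] w by simp
    then show ?thesis
      unfolding Eb_def using ok d w by (subst act_bcomp) (simp_all add: box_ok_whisk act_whisk)
  qed
  have E1: "arr (Unit C) (D \<odot> M' \<odot> Unit C) (bfun Eb (Unit C))"
    using box_ok_arr[OF okE I] by simp
  have nzE: "bfun Eb (Unit C) \<noteq> Zero C (Unit C) (D \<odot> M' \<odot> Unit C)"
  proof
    assume z: "bfun Eb (Unit C) = Zero C (Unit C) (D \<odot> M' \<odot> Unit C)"
    define s where "s = idst [M] (Unit C)"
    have s: "good s" "cur s = [M]" using oM I by (simp_all add: s_def good_idst)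
    have wz: "win 1 [] s" using s by (simp add: win_iff)
    have zs: "act 1 Eb s = sscl 0 (act 1 Eb s)"
      using z Scl_Zero[OF TObj_in[OF oM I] TObj_in[OF oM TObj_in[OF d(1) TObj_in[OF oM' I]]], of 0]
        TMor_Zero_right[OF I TObj_in[OF d(1) TObj_in[OF oM' I]] arr_Idt[OF oM]]
        arr_Cmp_Idt[OF arr_Zero[OF TObj_in[OF oM I] TObj_in[OF oM TObj_in[OF d(1) TObj_in[OF oM' I]]]]]
      by (simp add: s_def idst_def act_def sscl_def)
    \<comment> \<open>The snake identity recovers \<open>e\<close> from its mate, so a vanishing
      mate would make \<open>e\<close> vanish.\<close>
    have "act 0 (bx M M' e) s = act 0 (bx M M' e) (act 0 (evb M D ev) (act 1 (cvb D M cv) s))"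
      using d(4)[of 0 s] s by (simp add: win_iff)
    also have "\<dots> = act 0 (evb M D ev) (act 2 (bx M M' e) (act 1 (cvb D M cv) s))"
      using exchange[OF ok(1) ok(5), of 0 "act 1 (cvb D M cv) s" 2] s ok by (simp add: st_simps)
    also have "act 2 (bx M M' e) (act 1 (cvb D M cv) s) = act 1 Eb s"
      using actE[OF wz] by (simp add: numeral_2_eq_2)
    also have "act 0 (evb M D ev) (act 1 Eb s) = act 0 (evb M D ev) (sscl 0 (act 1 Eb s))" using zs by simp
    also have "\<dots> = sscl 0 (act 0 (evb M D ev) (act 1 Eb s))"
      using ok okE s by (intro act_sscl) (simp_all add: st_simps)
    also have "act 0 (evb M D ev) (act 1 Eb s) = act 0 (bx M M' e) s"
    proof -
      have "act 0 (bx M M' e) s = act 0 (bx M M' e) (act 0 (evb M D ev) (act 1 (cvb D M cv) s))"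
        using d(4)[of 0 s] s by (simp add: win_iff)
      also have "\<dots> = act 0 (evb M D ev) (act 2 (bx M M' e) (act 1 (cvb D M cv) s))"
        using exchange[OF ok(1) ok(5), of 0 "act 1 (cvb D M cv) s" 2] s ok by (simp add: st_simps)
      finally show ?thesis using actE[OF wz] by (simp add: numeral_2_eq_2)
    qed
    finally have "e = Scl C 0 e" unfolding s_def by (rule act_bx_faithful[OF e e])
    then show False using nz Scl_zero[OF e] by simp
  qed
  \<comment> \<open>The mate of \<open>g\<close>, obtained by bending its target round with the dual
    of \<open>N'\<close>.\<close>
  define h where "h = ev2 \<cdot> (g \<star> Idt C D2)"
  have gi: "arr (N \<odot> D2) (N' \<odot> D2) (g \<star> Idt C D2)" using g d2 by auto
  have ah: "arr (N \<odot> D2) (Unit C) h" unfolding h_def by (rule arr_Cmp[OF d2(2) gi])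
  have acth: "act n (evb N' D2 ev2) (act n (bx N N' g) (act n (mm N D2) s)) = act n eu (act n (bx (N \<odot> D2) (Unit C) h) s)"
    if w: "win n [N \<odot> D2] s" for n s
  proof -
    have w0: "win n [N, D2] (act n (mm N D2) s)" using win_act_same[OF box_ok_mm[OF oN d2(1)]] w by simp
    obtain us vs where sh: "cur s = us @ [N \<odot> D2] @ vs" "length us = n" using win_shape[OF w] by blast
    have gs: "good s" by (rule win_good[OF w])
    have w1: "win n [N' \<odot> D2] (act n (bx (N \<odot> D2) (N' \<odot> D2) (g \<star> Idt C D2)) s)"
      using win_act_same[OF box_ok_bx[OF gi]] w by simp
    have e1: "act n (bx N N' g) (act n (mm N D2) s) = act n (mm N' D2) (act n (bx (N \<odot> D2) (N' \<odot> D2) (g \<star> Idt C D2)) s)"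
      unfolding act_mm_bx[OF g arr_Idt[OF d2(1)] w]
      by (subst act_bx_Idt) (use w gs sh d2 oN in \<open>simp_all add: st_simps\<close>)
    show ?thesis unfolding e1 h_def act_bx_Cmp[OF gi d2(2) w]
      by (subst act_evb[OF oN' d2(1,2)])
        (use win_act_same[OF box_ok_mm[OF oN' d2(1)]] w1 in \<open>simp_all add: act_mi_mm[OF oN' d2(1) w1]\<close>)
  qed
  have hz: "h = Scl C 0 h"
  proof -
    define i where "i = idst [N \<odot> D2] (Unit C)"
    have i: "good i" "cur i = [N \<odot> D2]" using TObj_in[OF oN d2(1)] I by (simp_all add: i_def good_idst)
    define s0 where "s0 = act 0 (mm N D2) i"
    have s0: "good s0" "cur s0 = [N, D2]" using i oN d2 by (simp_all add: s0_def st_simps)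
    \<comment> \<open>A state with empty list, where \<open>Eb\<close> may act before or after
      \<open>g\<close>; acting before, it puts \<open>e\<close> next to \<open>g\<close>.\<close>
    define t where "t = act 0 (evb N' D2 ev2) (act 0 (bx N N' g) s0)"
    have t: "good t" "cur t = []" using s0 ok by (simp_all add: t_def st_simps)
    have "act 0 Eb t = act 2 (evb N' D2 ev2) (act 0 Eb (act 0 (bx N N' g) s0))"
      unfolding t_def using exchange[OF okE ok(3), of 0 "act 0 (bx N N' g) s0" 0] s0 ok by (simp add: st_simps numeral_2_eq_2)
    also have "act 0 Eb (act 0 (bx N N' g) s0) = act 2 (bx N N' g) (act 0 Eb s0)"
      using exchange[OF okE ok(6), of 0 s0 0] s0 by (simp add: st_simps numeral_2_eq_2)
    also have "act 0 Eb s0 = act 1 (bx M M' e) (act 0 (cvb D M cv) s0)"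
      using actE[of 0 s0] s0 by (simp add: win_iff)
    also have "act 2 (bx N N' g) (act 1 (bx M M' e) (act 0 (cvb D M cv) s0))
      = act 1 (bx M M' e) (act 2 (bx N N' g) (act 0 (cvb D M cv) s0))"
      using exchange[OF ok(5) ok(6), of 1 "act 0 (cvb D M cv) s0" 2] s0 ok by (simp add: st_simps)
    \<comment> \<open>Now \<open>e\<close> and \<open>g\<close> are adjacent, and the vanishing of
      \<open>e \<star> g\<close> enters.\<close>
    also have "\<dots> = sscl 0 (act 1 (bx M M' e) (act 2 (bx N N' g) (act 0 (cvb D M cv) s0)))"
      using act_TMor_zero[OF e g z, of 1 "act 0 (cvb D M cv) s0"] s0 ok by (simp add: st_simps numeral_2_eq_2)
    also have "act 2 (evb N' D2 ev2) \<dots> = sscl 0 (act 2 (evb N' D2 ev2) (act 1 (bx M M' e) (act 2 (bx N N' g) (act 0 (cvb D M cv) s0))))"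
      using s0 ok by (intro act_sscl) (simp_all add: st_simps)
    finally obtain u where u: "act 0 Eb t = sscl 0 u" "good u"
      using s0 ok by (auto simp: st_simps)
    have Vt: "fst (snd t) = Unit C" by (simp add: t_def s0_def i_def idst_def act_def)
    obtain S k where tk: "t = (S, Unit C, [], k)" using Vt t(2) by (cases t) auto
    have k: "arr S (Unit C) k" using t tk by (simp add: good_def)
    obtain S' V' xs' k' where u': "u = (S', V', xs', k')" by (cases u)
    have "bfun Eb (Unit C) \<cdot> k = Scl C 0 k'" "S' = S" "V' = Unit C" "xs' = [D, M']"
      using u(1) tk u' by (auto simp: act_def sscl_def)
    then have "bfun Eb (Unit C) \<cdot> k = Zero C S (D \<odot> M' \<odot> Unit C)"
      using u(2) u' Scl_zero by (auto simp: good_def)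
    then have "k = Zero C S (Unit C)" by (rule Unit_mono[OF E1 nzE k])
    then have "t = sscl 0 t" using tk Scl_zero[OF k] by (simp add: sscl_def)
    moreover have "t = act 0 eu (act 0 (bx (N \<odot> D2) (Unit C) h) i)"
      unfolding t_def s0_def using acth[of 0 i] i by (simp add: win_iff)
    ultimately have "act 0 eu (act 0 (bx (N \<odot> D2) (Unit C) h) i) = sscl 0 (act 0 eu (act 0 (bx (N \<odot> D2) (Unit C) h) i))"
      by simp
    then have "act 0 eui (act 0 eu (act 0 (bx (N \<odot> D2) (Unit C) h) i)) = act 0 eui (sscl 0 (act 0 eu (act 0 (bx (N \<odot> D2) (Unit C) h) i)))"
      by simp
    also have "\<dots> = sscl 0 (act 0 eui (act 0 eu (act 0 (bx (N \<odot> D2) (Unit C) h) i)))"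
      using i ah I by (intro act_sscl) (simp_all add: st_simps)
    finally have "act 0 (bx (N \<odot> D2) (Unit C) h) i = sscl 0 (act 0 (bx (N \<odot> D2) (Unit C) h) i)"
      using act_eui_eu[of 0 "act 0 (bx (N \<odot> D2) (Unit C) h) i"] i ah by (simp add: st_simps)
    then show ?thesis unfolding i_def by (rule act_bx_faithful[OF ah ah])
  qed
  define s where "s = idst [N] (Unit C)"
  have s: "good s" "cur s = [N]" using oN I by (simp_all add: s_def good_idst)
  \<comment> \<open>Creating \<open>D2\<close> and \<open>N'\<close> behind \<open>N\<close>
    prepares the snake identity that turns \<open>h\<close> back into \<open>g\<close>.\<close>
  define v where "v = act 0 (mi N D2) (act 1 (cvb D2 N' cv2) s)"
  have v: "good v" "cur v = [N \<odot> D2, N']" using s ok oN d2 by (simp_all add: v_def st_simps)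
  have *: "act 0 (bx N N' g) s = act 0 eu (act 0 (bx (N \<odot> D2) (Unit C) h) v)"
  proof -
    have "act 0 (bx N N' g) s = act 0 (evb N' D2 ev2) (act 1 (cvb D2 N' cv2) (act 0 (bx N N' g) s))"
      using d2(4)[of 0 "act 0 (bx N N' g) s"] s ok by (simp add: st_simps)
    also have "act 1 (cvb D2 N' cv2) (act 0 (bx N N' g) s) = act 0 (bx N N' g) (act 1 (cvb D2 N' cv2) s)"
      using exchange[OF ok(6) ok(4), of 0 s 1] s by (simp add: st_simps)
    also have "act 1 (cvb D2 N' cv2) s = act 0 (mm N D2) v"
      unfolding v_def using s ok oN d2 by (intro act_mm_mi[symmetric]) (simp_all add: st_simps)
    also have "act 0 (evb N' D2 ev2) (act 0 (bx N N' g) (act 0 (mm N D2) v)) = act 0 eu (act 0 (bx (N \<odot> D2) (Unit C) h) v)"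
      using acth[of 0 v] v by (simp add: win_iff)
    finally show ?thesis .
  qed
  have "act 0 (bx (N \<odot> D2) (Unit C) h) v = sscl 0 (act 0 (bx (N \<odot> D2) (Unit C) h) v)"
    using act_bx_Scl[OF ah, of 0 v 0] v hz by (simp add: win_iff)
  then have "act 0 eu (act 0 (bx (N \<odot> D2) (Unit C) h) v) = sscl 0 (act 0 eu (act 0 (bx (N \<odot> D2) (Unit C) h) v))"
    using act_sscl[OF box_ok_eu, of 0 "act 0 (bx (N \<odot> D2) (Unit C) h) v" 0] v ah by (simp add: st_simps)
  then have "act 0 (bx N N' g) s = sscl 0 (act 0 (bx N N' g) s)" unfolding * .
  then have "g = Scl C 0 g" unfolding s_def by (rule act_bx_faithful[OF g g])
  then show ?thesis using Scl_zero[OF g] by simp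
qed

text \<open>Bilinearity reduces this to \<open>nonzero_TMor\<close> for the difference of
  \<open>g\<close> and \<open>g'\<close>.\<close>

lemma TMor_cancel_left:
  assumes e: "arr M M' e" "e \<noteq> Zero C M M'" and g: "arr N N' g" "arr N N' g'" and eq: "e \<star> g = e \<star> g'"
  shows "g = g'"
proof (rule eq_if_diff_Zero[OF g])
  note eg = arr_TMor[OF e(1) g(2)]
  have "e \<star> Add C g (Scl C (-1) g') = Add C (e \<star> g) (Scl C (-1) (e \<star> g'))"
    using TMor_Add_right[of M M' N N' e g "Scl C (-1) g'"] TMor_Scl_right[of M M' N N' e g' "-1"] e g Scl_in[of N N' g' "-1"]
    by (simp add: arr_def)
  then have "e \<star> Add C g (Scl C (-1) g') = Zero C (M \<odot> N) (M' \<odot> N')"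
    using eq Add_neg[OF eg] by simp
  then show "Add C g (Scl C (-1) g') = Zero C N N'"
    using nonzero_TMor[OF e(1) arr_Add[OF g(1) arr_Scl[OF g(2)]] _ e(2)] by simp
qed

text \<open>The roles in \<open>nonzero_TMor\<close> are exchanged: a nonzero difference of
  \<open>g\<close> and \<open>g'\<close> as left factor would force \<open>e\<close> to
  vanish.\<close>

lemma TMor_cancel_right:
  assumes e: "arr M M' e" "e \<noteq> Zero C M M'" and g: "arr N N' g" "arr N N' g'" and eq: "g \<star> e = g' \<star> e"
  shows "g = g'"
proof (rule ccontr)
  assume ne: "g \<noteq> g'"
  let ?d = "Add C g (Scl C (-1) g')"
  have d: "arr N N' ?d" using arr_Add[OF g(1) arr_Scl[OF g(2)]] .
  have nz: "?d \<noteq> Zero C N N'" using ne eq_if_diff_Zero[OF g] by blast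
  note eg = arr_TMor[OF g(2) e(1)]
  have "?d \<star> e = Add C (g \<star> e) (Scl C (-1) (g' \<star> e))"
    using TMor_Add_left[of N N' M M' g "Scl C (-1) g'" e] TMor_Scl_left[of N N' M M' g' e "-1"] e g Scl_in[of N N' g' "-1"]
    by (simp add: arr_def)
  then have "?d \<star> e = Zero C (N \<odot> M) (N' \<odot> M')"
    using eq Add_neg[OF eg] by simp
  then have "e = Zero C M M'"
    using nonzero_TMor[OF d e(1) _ nz] by simp
  then show False using e by simp
qed

lemma nonzero_TObj:
  assumes "X \<in> Obj C" "Y \<in> Obj C" "\<not> zero_object C X" "\<not> zero_object C Y"
  shows "\<not> zero_object C (X \<odot> Y)"
proof
  assume "zero_object C (X \<odot> Y)"
  then have "Idt C X \<star> Idt C Y = Zero C (X \<odot> Y) (X \<odot> Y)"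
    using assms by (simp add: zero_object_def TMor_Idt)
  then have "Idt C Y = Zero C Y Y"
    using nonzero_TMor[OF arr_Idt[OF assms(1)] arr_Idt[OF assms(2)]] assms by (auto simp: zero_object_def)
  then show False using assms by (simp add: zero_object_def)
qed

end

text \<open>Gaussian elimination by induction on the equations: a nonzero coefficient in equation
  \<open>j\<close> allows it to be solved for the unknown \<open>p\<close>, and substitution leaves
  one equation and one unknown less.\<close>

lemma homogeneous_system:
  fixes a :: "'i \<Rightarrow> 'j \<Rightarrow> 'k::field"
  assumes "finite J" "finite I" "card J < card I"
  shows "\<exists>c. (\<exists>i\<in>I. c i \<noteq> 0) \<and> (\<forall>j\<in>J. (\<Sum>i\<in>I. c i * a i j) = 0)"
  using assms
proof (induction J arbitrary: I a rule: finite_induct)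
  case empty
  then have "I \<noteq> {}" by auto
  then show ?case by (intro exI[of _ "\<lambda>_. 1"]) auto
next
  case (insert j J)
  show ?case
  proof (cases "\<forall>i\<in>I. a i j = 0")
    case True
    obtain c where "\<exists>i\<in>I. c i \<noteq> 0" "\<forall>j\<in>J. (\<Sum>i\<in>I. c i * a i j) = 0"
      using insert.IH[of I a] insert.prems insert.hyps by (auto dest: Suc_lessD)
    then show ?thesis using True by (intro exI[of _ c]) auto
  next
    case False
    then obtain p where p: "p \<in> I" "a p j \<noteq> 0" by auto
    let ?I = "I - {p}"
    have "card J < card ?I" using insert p by simp
    then obtain c where c: "\<exists>i\<in>?I. c i \<noteq> 0"
      "\<forall>j'\<in>J. (\<Sum>i\<in>?I. c i * (a i j' - a i j / a p j * a p j')) = 0"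
      using insert.IH[of ?I "\<lambda>i j'. a i j' - a i j / a p j * a p j'"] insert.prems by auto
    \<comment> \<open>The value at \<open>p\<close> is the one that equation \<open>j\<close>
      dictates.\<close>
    define c' where "c' = c(p := - (\<Sum>i\<in>?I. c i * a i j / a p j))"
    have s: "(\<Sum>i\<in>I. c' i * a i j') = (\<Sum>i\<in>?I. c i * (a i j' - a i j / a p j * a p j'))" for j'
    proof -
      have "(\<Sum>i\<in>I. c' i * a i j') = c' p * a p j' + (\<Sum>i\<in>?I. c' i * a i j')"
        using p insert.prems by (intro sum.remove) auto
      also have "(\<Sum>i\<in>?I. c' i * a i j') = (\<Sum>i\<in>?I. c i * a i j')"
        by (intro sum.cong) (auto simp: c'_def)
      finally show ?thesis
        by (simp add: c'_def sum_distrib_right sum_subtractf right_diff_distrib mult.assoc)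
    qed
    have "(\<Sum>i\<in>I. c' i * a i j) = 0" unfolding s using p by simp
    moreover have "\<exists>i\<in>I. c' i \<noteq> 0" using c(1) by (auto simp: c'_def)
    ultimately show ?thesis using s c(2) by (intro exI[of _ c']) auto
  qed
qed

section \<open>Eigenvectors\<close>

context linear_category
begin

lemma finprod_arr:
  assumes o: "X \<in> Obj C" "Y \<in> Obj C" and b: "\<And>j. j \<in> J \<Longrightarrow> arr X Y (b j)"
  shows "arr X Y (finprod (hom_group C X Y) b J)"
proof -
  interpret G: comm_group "hom_group C X Y" by (rule Hom_group[OF o])
  show ?thesis using G.finprod_closed[of b J] b o by (auto simp: arr_def)
qed

lemma finprod_Scl_zero:
  assumes o: "X \<in> Obj C" "Y \<in> Obj C" and J: "finite J" and b: "\<And>j. j \<in> J \<Longrightarrow> arr X Y (b j)"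
    and u: "\<And>j. j \<in> J \<Longrightarrow> u j = 0"
  shows "finprod (hom_group C X Y) (\<lambda>j. Scl C (u j) (b j)) J = Zero C X Y"
proof -
  interpret G: comm_group "hom_group C X Y" by (rule Hom_group[OF o])
  have "finprod (hom_group C X Y) (\<lambda>j. Scl C (u j) (b j)) J = finprod (hom_group C X Y) (\<lambda>j. Zero C X Y) J"
    using b u Scl_zero[OF b] arr_Hom[OF arr_Zero[OF o]] by (intro G.finprod_cong) (auto simp: simp_implies_def)
  then show ?thesis using G.finprod_one_eqI[of J "\<lambda>j. Zero C X Y"] by simp
qed

lemma Scl_finprod:
  assumes o: "X \<in> Obj C" "Y \<in> Obj C" and J: "finite J" and b: "\<And>j. j \<in> J \<Longrightarrow> arr X Y (b j)"
  shows "Scl C a (finprod (hom_group C X Y) b J) = finprod (hom_group C X Y) (\<lambda>j. Scl C a (b j)) J"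
proof -
  interpret G: comm_group "hom_group C X Y" by (rule Hom_group[OF o])
  from J b show ?thesis
  proof (induction J rule: finite_induct)
    case empty
    then show ?case using Scl_Zero[OF o] by simp
  next
    case (insert j J)
    then have "arr X Y (finprod (hom_group C X Y) b J)" by (intro finprod_arr[OF o]) auto
    then show ?case using insert o by (simp add: Scl_Add arr_def Scl_in Pi_def)
  qed
qed

text \<open>Interchanges the two sums and collects the coefficient of each
  \<open>b j\<close>.\<close>

lemma finprod_linear_combination:
  assumes o: "X \<in> Obj C" "Y \<in> Obj C" and I: "finite I" and J: "finite J" and b: "\<And>j. j \<in> J \<Longrightarrow> arr X Y (b j)"
  shows "finprod (hom_group C X Y) (\<lambda>i. Scl C (c i) (finprod (hom_group C X Y) (\<lambda>j. Scl C (a i j) (b j)) J)) I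
    = finprod (hom_group C X Y) (\<lambda>j. Scl C (\<Sum>i\<in>I. c i * a i j) (b j)) J"
proof -
  interpret G: comm_group "hom_group C X Y" by (rule Hom_group[OF o])
  from I show ?thesis
  proof (induction I rule: finite_induct)
    case empty
    then show ?case using finprod_Scl_zero[OF o J b] by simp
  next
    case (insert i I)
    have "Scl C (c i) (finprod (hom_group C X Y) (\<lambda>j. Scl C (a i j) (b j)) J)
      = finprod (hom_group C X Y) (\<lambda>j. Scl C (c i) (Scl C (a i j) (b j))) J"
      using b by (intro Scl_finprod o J) auto
    also have "\<dots> = finprod (hom_group C X Y) (\<lambda>j. Scl C (c i * a i j) (b j)) J"
      using b by (intro G.finprod_cong) (auto simp: simp_implies_def arr_Scl_Scl[OF b] arr_Hom[OF arr_Scl[OF b]])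
    finally have e: "Scl C (c i) (finprod (hom_group C X Y) (\<lambda>j. Scl C (a i j) (b j)) J) = \<dots>" .
    have "finprod (hom_group C X Y) (\<lambda>i. Scl C (c i) (finprod (hom_group C X Y) (\<lambda>j. Scl C (a i j) (b j)) J)) (insert i I)
      = Add C (Scl C (c i) (finprod (hom_group C X Y) (\<lambda>j. Scl C (a i j) (b j)) J))
        (finprod (hom_group C X Y) (\<lambda>i. Scl C (c i) (finprod (hom_group C X Y) (\<lambda>j. Scl C (a i j) (b j)) J)) I)"
    proof (subst G.finprod_insert)
      have *: "Scl C (c i) (finprod (hom_group C X Y) (\<lambda>j. Scl C (a i j) (b j)) J) \<in> Hom C X Y" for i
        by (intro arr_Hom[OF arr_Scl[OF finprod_arr[OF o]]] arr_Scl b)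
      then show "(\<lambda>i. Scl C (c i) (finprod (hom_group C X Y) (\<lambda>j. Scl C (a i j) (b j)) J)) \<in> I \<rightarrow> carrier (hom_group C X Y)"
        "Scl C (c i) (finprod (hom_group C X Y) (\<lambda>j. Scl C (a i j) (b j)) J) \<in> carrier (hom_group C X Y)"
        by auto
    qed (use insert in auto)
    also have "\<dots> = Add C (finprod (hom_group C X Y) (\<lambda>j. Scl C (c i * a i j) (b j)) J)
       (finprod (hom_group C X Y) (\<lambda>j. Scl C (\<Sum>i\<in>I. c i * a i j) (b j)) J)"
      unfolding e insert.IH ..
    also have "\<dots> = finprod (hom_group C X Y) (\<lambda>j. Add C (Scl C (c i * a i j) (b j)) (Scl C (\<Sum>i\<in>I. c i * a i j) (b j))) J"
      using G.finprod_multf[of "\<lambda>j. Scl C (c i * a i j) (b j)" J "\<lambda>j. Scl C (\<Sum>i\<in>I. c i * a i j) (b j)"] b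
      by (auto simp: Pi_def arr_def Scl_in)
    also have "\<dots> = finprod (hom_group C X Y) (\<lambda>j. Scl C (\<Sum>i\<in>insert i I. c i * a i j) (b j)) J"
      using b insert arr_Hom[OF arr_Add[OF arr_Scl[OF b] arr_Scl[OF b]]]
      by (intro G.finprod_cong) (auto simp: simp_implies_def arr_def Scl_plus[of X Y])
    finally show ?case .
  qed
qed

text \<open>Horner's scheme for the value of \<open>p\<close> at \<open>f\<close>, with composition
  as product; the endomorphism algebra is carried by a hom-set, not by a type.\<close>

definition ev_poly :: "'o \<Rightarrow> 'm \<Rightarrow> 'k poly \<Rightarrow> 'm"
  where "ev_poly M f p = fold_coeffs (\<lambda>a g. Add C (Scl C a (Idt C M)) (f \<cdot> g)) p (Zero C M M)"

lemma arr_Add_assoc: "\<lbrakk>arr X Y f; arr X Y g; arr X Y h\<rbrakk> \<Longrightarrow> Add C (Add C f g) h = Add C f (Add C g h)"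
  and arr_Add_commute: "\<lbrakk>arr X Y f; arr X Y g\<rbrakk> \<Longrightarrow> Add C f g = Add C g f"
  and arr_Add_Zero: "arr X Y f \<Longrightarrow> Add C (Zero C X Y) f = f" "arr X Y f \<Longrightarrow> Add C f (Zero C X Y) = f"
proof -
  have G: "comm_group (hom_group C X Y)" if "arr X Y f" for f using that Hom_group by (auto simp: arr_def)
  { assume a: "arr X Y f" "arr X Y g" "arr X Y h"
    interpret G: comm_group "hom_group C X Y" by (rule G[OF a(1)])
    show "Add C (Add C f g) h = Add C f (Add C g h)" using G.m_assoc[of f g h] a by (simp add: arr_def) }
  { assume a: "arr X Y f" "arr X Y g"
    interpret G: comm_group "hom_group C X Y" by (rule G[OF a(1)])
    show "Add C f g = Add C g f" using G.m_comm[of f g] a by (simp add: arr_def) }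
  { assume a: "arr X Y f"
    interpret G: comm_group "hom_group C X Y" by (rule G[OF a(1)])
    show "Add C (Zero C X Y) f = f" "Add C f (Zero C X Y) = f" using G.l_one[of f] G.r_one[of f] a by (simp_all add: arr_def) }
qed

lemma ev_poly_0 [simp]: "ev_poly M f 0 = Zero C M M"
  by (simp add: ev_poly_def)

lemma ev_poly_pCons:
  assumes f: "arr M M f"
  shows "ev_poly M f (pCons a p) = Add C (Scl C a (Idt C M)) (f \<cdot> ev_poly M f p)"
proof (cases "p = 0 \<and> a = 0")
  case True
  note z = arr_Zero[OF arr_dom[OF f] arr_dom[OF f]]
  show ?thesis using True Scl_zero[OF arr_Idt[OF arr_dom[OF f]]] Cmp_Zero_right[OF arr_dom[OF f] f] arr_Add_Zero(1)[OF z]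
    by simp
next
  case False
  then show ?thesis by (auto simp: ev_poly_def)
qed

lemma ev_poly_arr: "arr M M f \<Longrightarrow> arr M M (ev_poly M f p)"
  by (induction p) (auto simp: ev_poly_pCons arr_dom arr_Idt intro!: arr_Zero arr_Add arr_Cmp arr_Scl)

lemma arr_Cmp_Add: "\<lbrakk>arr X Y f; arr X Y g; arr Y Z h\<rbrakk> \<Longrightarrow> h \<cdot> Add C f g = Add C (h \<cdot> f) (h \<cdot> g)"
  unfolding arr_def by (intro Cmp_Add_right[of X Y Z]) auto

lemma ev_poly_add:
  assumes f: "arr M M f"
  shows "ev_poly M f (p + q) = Add C (ev_poly M f p) (ev_poly M f q)"
proof (induction p q rule: poly_induct2)
  case 0
  then show ?case using arr_Add_Zero[OF arr_Zero[OF arr_dom[OF f] arr_dom[OF f]]] by simp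
next
  case (pCons a p b q)
  note i = arr_Idt[OF arr_dom[OF f]]
  let ?P = "f \<cdot> ev_poly M f p" and ?Q = "f \<cdot> ev_poly M f q" and ?A = "Scl C a (Idt C M)" and ?B = "Scl C b (Idt C M)"
  have P: "arr M M ?P" "arr M M ?Q" "arr M M ?A" "arr M M ?B" using f ev_poly_arr[OF f] i by auto
  have "ev_poly M f (pCons a p + pCons b q) = Add C (Add C ?A ?B) (Add C ?P ?Q)"
    using pCons ev_poly_pCons[OF f] arr_Cmp_Add[OF ev_poly_arr[OF f] ev_poly_arr[OF f] f]
      Scl_plus[of M M "Idt C M" a b] i by (simp add: arr_def)
  also have "\<dots> = Add C ?A (Add C ?B (Add C ?P ?Q))" by (rule arr_Add_assoc[OF P(3,4) arr_Add[OF P(1,2)]])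
  also have "Add C ?B (Add C ?P ?Q) = Add C (Add C ?P ?B) ?Q"
    using arr_Add_assoc[OF P(4,1,2)] arr_Add_commute[OF P(4,1)] by simp
  also have "\<dots> = Add C ?P (Add C ?B ?Q)" by (rule arr_Add_assoc[OF P(1,4,2)])
  also have "Add C ?A \<dots> = Add C (Add C ?A ?P) (Add C ?B ?Q)" by (rule arr_Add_assoc[OF P(3,1) arr_Add[OF P(4,2)], symmetric])
  finally show ?case using ev_poly_pCons[OF f] by simp
qed

lemma ev_poly_smult:
  assumes f: "arr M M f"
  shows "ev_poly M f (smult c p) = Scl C c (ev_poly M f p)"
proof (induction p)
  case 0
  then show ?case using Scl_Zero[OF arr_dom[OF f] arr_dom[OF f]] by simp
next
  case (pCons a p)
  note i = arr_Idt[OF arr_dom[OF f]] and P = arr_Cmp[OF f ev_poly_arr[OF f, of p]]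
  show ?case
    using pCons ev_poly_pCons[OF f] Scl_Add[of M M "Scl C a (Idt C M)" "f \<cdot> ev_poly M f p" c] P arr_Scl[OF i, of a]
      arr_Scl_Scl[OF i] arr_Scl_right[OF ev_poly_arr[OF f, of p] f] by (simp add: arr_def)
qed

end

context finite_abelian_category
begin

text \<open>The powers of \<open>f\<close> up to exponent \<open>n\<close> are \<open>n + 1\<close>
  elements of a space spanned by \<open>n\<close> elements; the coefficients of a linear relation
  between them form the polynomial.\<close>

lemma ev_poly_exists:
  assumes f: "arr M M f"
  shows "\<exists>p. p \<noteq> 0 \<and> ev_poly M f p = Zero C M M"
proof -
  note M = arr_dom[OF f]
  interpret G: comm_group "hom_group C M M" by (rule Hom_group[OF M M])
  obtain b n where bn: "\<forall>j<n. b j \<in> Hom C M M"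
    and sp: "\<forall>f\<in>Hom C M M. \<exists>a. f = finprod (hom_group C M M) (\<lambda>j. Scl C (a j) (b j)) {..<n::nat}"
    using finite_dim[OF M M] unfolding finite_dim_hom_def by (elim exE conjE) (rule that)
  have b': "\<And>j. j \<in> {..<n} \<Longrightarrow> arr M M (b j)" using bn M by (simp add: arr_def)
  have "\<forall>i. \<exists>a. ev_poly M f (monom 1 i) = finprod (hom_group C M M) (\<lambda>j. Scl C (a j) (b j)) {..<n}"
    using sp ev_poly_arr[OF f] by (auto simp: arr_def)
  then obtain a where a: "\<And>i. ev_poly M f (monom 1 i) = finprod (hom_group C M M) (\<lambda>j. Scl C (a i j) (b j)) {..<n}"
    by metis
  obtain c where c: "\<exists>i\<in>{..n}. c i \<noteq> 0" "\<forall>j\<in>{..<n}. (\<Sum>i\<in>{..n}. c i * a i j) = 0"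
    using homogeneous_system[of "{..<n}" "{..n}" a] by auto
  define p where "p = (\<Sum>i\<le>n. monom (c i) i)"
  have "ev_poly M f (\<Sum>i\<in>I. monom (c i) i) = finprod (hom_group C M M) (\<lambda>i. Scl C (c i) (ev_poly M f (monom 1 i))) I"
    if "finite I" for I using that
  proof (induction I rule: finite_induct)
    case (insert i I)
    have "ev_poly M f (monom (c i) i) = Scl C (c i) (ev_poly M f (monom 1 i))"
      using ev_poly_smult[OF f, of "c i" "monom 1 i"] by (simp add: smult_monom)
    moreover have "Scl C (c i) (ev_poly M f (monom 1 i)) \<in> Hom C M M" for i
      using arr_Scl[OF ev_poly_arr[OF f]] by (simp add: arr_def)
    ultimately show ?case using insert ev_poly_add[OF f] by (simp add: Pi_def)
  qed simp
  then have "ev_poly M f p = finprod (hom_group C M M) (\<lambda>i. Scl C (c i) (finprod (hom_group C M M) (\<lambda>j. Scl C (a i j) (b j)) {..<n})) {..n}"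
    by (simp add: p_def a)
  also have "\<dots> = finprod (hom_group C M M) (\<lambda>j. Scl C (\<Sum>i\<le>n. c i * a i j) (b j)) {..<n}"
    by (rule finprod_linear_combination[OF M M _ _ b']) auto
  also have "\<dots> = Zero C M M"
    using c(2) by (intro finprod_Scl_zero[OF M M _ b']) auto
  finally have z: "ev_poly M f p = Zero C M M" .
  obtain i where "i \<le> n" "c i \<noteq> 0" using c(1) by auto
  then have "coeff p i \<noteq> 0" by (simp add: p_def coeff_sum sum.delta if_distrib cong: if_cong)
  then show ?thesis using z by (intro exI[of _ p]) auto
qed

end

text \<open>A nonzero annihilating polynomial of least degree has a root \<open>t\<close>. The
  cofactor \<open>q\<close> of the linear factor has smaller degree, so its value at
  \<open>f\<close> is nonzero and serves as eigenvector, which is thus itself an endomorphism of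
  \<open>M\<close>.\<close>

lemma (in tensor_category) eigenvector:
  assumes f: "arr M M f" and nz: "\<not> zero_object C M"
  shows "\<exists>t e. arr M M e \<and> e \<noteq> Zero C M M \<and> f \<cdot> e = Scl C t e"
proof -
  note M = arr_dom[OF f]
  obtain p where p: "p \<noteq> 0" "ev_poly M f p = Zero C M M"
    and min: "\<And>q. q \<noteq> 0 \<Longrightarrow> ev_poly M f q = Zero C M M \<Longrightarrow> degree p \<le> degree q"
    using ex_has_least_nat[of "\<lambda>p. p \<noteq> 0 \<and> ev_poly M f p = Zero C M M" _ degree] ev_poly_exists[OF f] by blast
  \<comment> \<open>A nonzero constant would annihilate the identity of \<open>M\<close>.\<close>
  have "degree p > 0"
  proof (rule ccontr)
    assume "\<not> degree p > 0"
    then obtain c where c: "p = [:c:]" "c \<noteq> 0" using p by (auto elim: degree_eq_zeroE)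
    then have "Scl C c (Idt C M) = Zero C M M"
      using p(2) ev_poly_pCons[OF f, of c 0] Cmp_Zero_right[OF M f] arr_Add_Zero(2)[OF arr_Scl[OF arr_Idt[OF M]]] by simp
    then show False using Scl_eq_Zero[OF arr_Idt[OF M] _ c(2)] nz M by (simp add: zero_object_def)
  qed
  then obtain t where "poly p t = 0" using alg_closed_imp_poly_has_root by blast
  then obtain q where q: "p = [:- t, 1:] * q" by (auto simp: poly_eq_0_iff_dvd elim: dvdE)
  then have "q \<noteq> 0" using p by auto
  then have "degree p = Suc (degree q)" unfolding q by (subst degree_mult_eq) auto
  then have nq: "ev_poly M f q \<noteq> Zero C M M" using min[OF \<open>q \<noteq> 0\<close>] by auto
  note e = ev_poly_arr[OF f, of q]
  \<comment> \<open>In this form evaluation only has to respect \<open>pCons\<close>, sums and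
    scalars, not products of polynomials.\<close>
  have "p = pCons 0 q + smult (- t) q" using q by simp
  then have "Add C (f \<cdot> ev_poly M f q) (Scl C (- t) (ev_poly M f q)) = Zero C M M"
    using p(2) by (simp only: ev_poly_add[OF f] ev_poly_smult[OF f] ev_poly_pCons[OF f] Scl_zero[OF arr_Idt[OF M]]
      arr_Add_Zero(1)[OF arr_Cmp[OF f e]])
  then have "f \<cdot> ev_poly M f q = Scl C t (ev_poly M f q)"
    using arr_Scl_Scl[OF e, of "-1" t] by (intro eq_if_diff_Zero[OF arr_Cmp[OF f e] arr_Scl[OF e]]) simp
  then show ?thesis using e nq by blast
qed

section \<open>Braidings and invertible objects\<close>

context braided_tensor_category
begin

definition brd :: "'o \<Rightarrow> 'o \<Rightarrow> ('o, 'm) box"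
  where "brd X Y = bx2 X Y Y X (Braid C X Y)"

definition brdi :: "'o \<Rightarrow> 'o \<Rightarrow> ('o, 'm) box"
  where "brdi X Y = bx2 Y X X Y (inv_mor C (X \<odot> Y) (Y \<odot> X) (Braid C X Y))"

lemma brd_simps [simp]: "bdom (brd X Y) = [X, Y]" "bcod (brd X Y) = [Y, X]"
    "bdom (brdi X Y) = [Y, X]" "bcod (brdi X Y) = [X, Y]"
  by (simp_all add: brd_def brdi_def)

lemma ip_Braid: "\<lbrakk>X \<in> Obj C; Y \<in> Obj C\<rbrakk>
    \<Longrightarrow> ip (X \<odot> Y) (Y \<odot> X) (Braid C X Y) (inv_mor C (X \<odot> Y) (Y \<odot> X) (Braid C X Y))"
  by (intro inv_mor_ip TObj_in Braid_iso)

lemma arr_Braid: "\<lbrakk>X \<in> Obj C; Y \<in> Obj C\<rbrakk> \<Longrightarrow> arr (X \<odot> Y) (Y \<odot> X) (Braid C X Y)"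
  using ipD(1)[OF ip_Braid] .

lemma box_ok_brd [simp]: "\<lbrakk>X \<in> Obj C; Y \<in> Obj C\<rbrakk> \<Longrightarrow> box_ok (brd X Y)"
  unfolding brd_def by (intro box_ok_bx2 arr_Braid)

lemma box_ok_brdi [simp]: "\<lbrakk>X \<in> Obj C; Y \<in> Obj C\<rbrakk> \<Longrightarrow> box_ok (brdi X Y)"
  unfolding brdi_def by (intro box_ok_bx2 ipD(2)[OF ip_Braid])

lemma act_brdi_brd: "\<lbrakk>X \<in> Obj C; Y \<in> Obj C; win n [X, Y] s\<rbrakk> \<Longrightarrow> act n (brdi X Y) (act n (brd X Y) s) = s"
  unfolding brd_def brdi_def by (rule act_bx2_inverse[OF _ _ _ _ ip_Braid])

lemma act_brd_brdi: "\<lbrakk>X \<in> Obj C; Y \<in> Obj C; win n [Y, X] s\<rbrakk> \<Longrightarrow> act n (brd X Y) (act n (brdi X Y) s) = s"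
  unfolding brd_def brdi_def by (rule act_bx2_inverse[OF _ _ _ _ ip_sym[OF ip_Braid]])

lemma act_brd_mm: "\<lbrakk>X \<in> Obj C; Y \<in> Obj C; win n [X \<odot> Y] s\<rbrakk>
    \<Longrightarrow> act n (brd X Y) (act n (mm X Y) s) = act n (mm Y X) (act n (bx (X \<odot> Y) (Y \<odot> X) (Braid C X Y)) s)"
  unfolding brd_def by (rule act_bx2_mm[OF _ _ _ _ arr_Braid])

lemma brd_bx_bx:
  assumes f: "arr X X' f" and g: "arr Y Y' g" and w: "win n [X, Y] s"
  shows "act n (brd X' Y') (act n (bx X X' f) (act (Suc n) (bx Y Y' g) s))
    = act n (bx Y Y' g) (act (Suc n) (bx X X' f) (act n (brd X Y) s))"
proof -
  note o = arr_dom[OF f] arr_dom[OF g] arr_cod[OF f] arr_cod[OF g]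
  have w': "win n [X \<odot> Y] (act n (mi X Y) s)" using win_act_same[OF box_ok_mi[OF o(1,2)]] w by simp
  have w1: "win n [X' \<odot> Y'] (act n (bx (X \<odot> Y) (X' \<odot> Y') (f \<star> g)) (act n (mi X Y) s))"
    using win_act_same[OF box_ok_bx[OF arr_TMor[OF f g]]] w' by simp
  have w2: "win n [Y \<odot> X] (act n (bx (X \<odot> Y) (Y \<odot> X) (Braid C X Y)) (act n (mi X Y) s))"
    using win_act_same[OF box_ok_bx[OF arr_Braid[OF o(1,2)]]] w' by simp
  have nat: "Braid C X' Y' \<cdot> (f \<star> g) = (g \<star> f) \<cdot> Braid C X Y"
    using f g by (intro Braid_natural[of X X' Y Y']) (auto simp: arr_def)
  have s: "act n (brd X Y) s = act n (mm Y X) (act n (bx (X \<odot> Y) (Y \<odot> X) (Braid C X Y)) (act n (mi X Y) s))"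
    using act_brd_mm[OF o(1,2) w'] act_mm_mi[OF o(1,2) w] by simp
  show ?thesis
    unfolding act_bx_bx[OF f g w] act_brd_mm[OF o(3,4) w1] s act_mm_bx[OF g f w2, symmetric]
      act_bx_Cmp[OF arr_TMor[OF f g] arr_Braid[OF o(3,4)] w', symmetric]
      act_bx_Cmp[OF arr_Braid[OF o(1,2)] arr_TMor[OF g f] w', symmetric] nat ..
qed

lemma brd_bx1:
  assumes f: "arr X X' f" and Y: "Y \<in> Obj C" and w: "win n [X, Y] s"
  shows "act n (brd X' Y) (act n (bx X X' f) s) = act (Suc n) (bx X X' f) (act n (brd X Y) s)"
proof -
  obtain us vs where sh: "cur s = us @ [X, Y] @ vs" "length us = n" using win_shape[OF w] by blast
  have g: "good s" by (rule win_good[OF w])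
  have "act (Suc n) (bx Y Y (Idt C Y)) s = s" using sh g by (intro act_bx_Idt) (simp add: win_iff)
  moreover have "act n (bx Y Y (Idt C Y)) (act (Suc n) (bx X X' f) (act n (brd X Y) s)) = act (Suc n) (bx X X' f) (act n (brd X Y) s)"
    using sh g f Y by (intro act_bx_Idt) (simp add: st_simps arr_dom)
  ultimately show ?thesis using brd_bx_bx[OF f arr_Idt[OF Y] w] by simp
qed

text \<open>The first hexagon in strict form: its three associators are absorbed by
  \<open>act_mm_Assoc\<close>, and only the braidings remain.\<close>

lemma brd_hex1:
  assumes o: "X \<in> Obj C" "Y \<in> Obj C" "Z \<in> Obj C" and w: "win n [X, Y \<odot> Z] s"
  shows "act n (mm Y Z) (act n (brd X (Y \<odot> Z)) s) = act (Suc n) (brd X Z) (act n (brd X Y) (act (Suc n) (mm Y Z) s))"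
proof -
  note oo = TObj_in[OF o(1,2)] TObj_in[OF o(2,3)] TObj_in[OF o(3,1)] TObj_in[OF o(1,3)] TObj_in[OF o(2,1)]
  obtain us vs where sh: "cur s = us @ [X, Y \<odot> Z] @ vs" "length us = n" using win_shape[OF w] by blast
  note i = ip_Assoc[OF o]
  \<comment> \<open>Merging everything first provides a state to which the axiom, an equation
    between morphisms of bracketed products, can be applied.\<close>
  define s' where "s' = act n (mi X (Y \<odot> Z)) s"
  define s'' where "s'' = act n (bx (X \<odot> (Y \<odot> Z)) ((X \<odot> Y) \<odot> Z) (InvAssoc C X Y Z)) s'"
  have g: "good s" by (rule win_good[OF w])
  have s': "good s'" "cur s' = us @ [X \<odot> (Y \<odot> Z)] @ vs" using g sh o oo by (simp_all add: s'_def st_simps)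
  have s'': "good s''" "cur s'' = us @ [(X \<odot> Y) \<odot> Z] @ vs"
    using s' sh o oo ipD(2)[OF i] by (simp_all add: s''_def st_simps)
  have w'': "win n [(X \<odot> Y) \<odot> Z] s''" using s'' sh by (simp add: win_iff)
  have w': "win n [X \<odot> (Y \<odot> Z)] s'" using s' sh by (simp add: win_iff)
  have e': "s' = act n (bx ((X \<odot> Y) \<odot> Z) (X \<odot> (Y \<odot> Z)) (Assoc C X Y Z)) s''"
    using act_bx_inverse[OF ip_sym[OF i] w'] by (simp add: s''_def)
  have e: "s = act n (mm X (Y \<odot> Z)) s'" using act_mm_mi[OF o(1) oo(2) w] by (simp add: s'_def)
  note a1 = arr_Assoc[OF o] and a2 = arr_Braid[OF o(1) oo(2)] and a3 = arr_Assoc[OF o(2,3,1)]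
  note b1 = arr_TMor[OF arr_Braid[OF o(1,2)] arr_Idt[OF o(3)]] and b2 = arr_Assoc[OF o(2,1,3)]
    and b3 = arr_TMor[OF arr_Idt[OF o(2)] arr_Braid[OF o(1,3)]]
  define t1 where "t1 = act n (bx (X \<odot> (Y \<odot> Z)) ((Y \<odot> Z) \<odot> X) (Braid C X (Y \<odot> Z))) s'"
  have t1: "good t1" "cur t1 = us @ [(Y \<odot> Z) \<odot> X] @ vs"
    using s' sh o oo a2 by (simp_all add: t1_def st_simps)
  define u where "u = act n (bx ((X \<odot> Y) \<odot> Z) ((Y \<odot> X) \<odot> Z) (Braid C X Y \<star> Idt C Z)) s''"
  have u: "good u" "cur u = us @ [(Y \<odot> X) \<odot> Z] @ vs"
    using s'' sh o oo b1 by (simp_all add: u_def st_simps)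
  define v where "v = act n (bx ((Y \<odot> X) \<odot> Z) (Y \<odot> (X \<odot> Z)) (Assoc C Y X Z)) u"
  have v: "good v" "cur v = us @ [Y \<odot> (X \<odot> Z)] @ vs"
    using u sh o oo b2 by (simp_all add: v_def st_simps)
  \<comment> \<open>By \<open>act_bx_Cmp\<close> a sequence of boxes is the box of a composite, so
    the axiom applies as it stands.\<close>
  have key: "act n (bx ((Y \<odot> Z) \<odot> X) (Y \<odot> (Z \<odot> X)) (Assoc C Y Z X)) t1 = act n (bx (Y \<odot> (X \<odot> Z)) (Y \<odot> (Z \<odot> X)) (Idt C Y \<star> Braid C X Z)) v"
    unfolding t1_def v_def u_def e'
    by (simp only: act_bx_Cmp[OF a1 a2 w'', symmetric] act_bx_Cmp[OF arr_Cmp[OF a2 a1] a3 w'', symmetric]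
      act_bx_Cmp[OF b1 b2 w'', symmetric] act_bx_Cmp[OF arr_Cmp[OF b2 b1] b3 w'', symmetric] hexagon1[OF o])
  have "act n (mm Y Z) (act n (brd X (Y \<odot> Z)) s) = act n (mm Y Z) (act n (mm (Y \<odot> Z) X) t1)"
    unfolding e act_brd_mm[OF o(1) oo(2) w'] t1_def ..
  also have "\<dots> = act (Suc n) (mm Z X) (act n (mm Y (Z \<odot> X)) (act n (bx ((Y \<odot> Z) \<odot> X) (Y \<odot> (Z \<odot> X)) (Assoc C Y Z X)) t1))"
    using t1 sh o by (intro act_mm_Assoc[symmetric]) (simp_all add: win_iff)
  also have "\<dots> = act (Suc n) (mm Z X) (act n (bx Y Y (Idt C Y)) (act (Suc n) (bx (X \<odot> Z) (Z \<odot> X) (Braid C X Z)) (act n (mm Y (X \<odot> Z)) v)))"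
    unfolding key using v sh o arr_Braid by (subst act_mm_bx) (auto simp add: win_iff)
  also have "act n (bx Y Y (Idt C Y)) (act (Suc n) (bx (X \<odot> Z) (Z \<odot> X) (Braid C X Z)) (act n (mm Y (X \<odot> Z)) v))
     = act (Suc n) (bx (X \<odot> Z) (Z \<odot> X) (Braid C X Z)) (act n (mm Y (X \<odot> Z)) v)"
    using v sh o oo arr_Braid by (intro act_bx_Idt) (simp add: st_simps)
  also have "act (Suc n) (mm Z X) \<dots> = act (Suc n) (brd X Z) (act (Suc n) (mm X Z) (act n (mm Y (X \<odot> Z)) v))"
    using v sh o oo by (intro act_brd_mm[symmetric]) (simp_all add: st_simps)
  also have "act (Suc n) (mm X Z) (act n (mm Y (X \<odot> Z)) v) = act n (mm Y X) (act n (mm (Y \<odot> X) Z) u)"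
    unfolding v_def using u sh o by (intro act_mm_Assoc) (simp_all add: win_iff)
  also have "act n (mm (Y \<odot> X) Z) u = act n (bx (X \<odot> Y) (Y \<odot> X) (Braid C X Y)) (act (Suc n) (bx Z Z (Idt C Z)) (act n (mm (X \<odot> Y) Z) s''))"
    unfolding u_def by (rule act_mm_bx[OF arr_Braid[OF o(1,2)] arr_Idt[OF o(3)] w''])
  also have "act (Suc n) (bx Z Z (Idt C Z)) (act n (mm (X \<odot> Y) Z) s'') = act n (mm (X \<odot> Y) Z) s''"
    using s'' sh o oo by (intro act_bx_Idt) (simp add: st_simps)
  also have "act n (mm Y X) (act n (bx (X \<odot> Y) (Y \<odot> X) (Braid C X Y)) (act n (mm (X \<odot> Y) Z) s''))
    = act n (brd X Y) (act n (mm X Y) (act n (mm (X \<odot> Y) Z) s''))"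
    using s'' sh o oo by (intro act_brd_mm[symmetric]) (simp_all add: st_simps)
  also have "act n (mm X Y) (act n (mm (X \<odot> Y) Z) s'') = act (Suc n) (mm Y Z) s"
    unfolding e e' using act_mm_Assoc[OF o w''] by simp
  finally show ?thesis .
qed

text \<open>The second hexagon in strict form; its inverse associators are absorbed by
  \<open>act_mm_InvAssoc\<close>.\<close>

lemma brd_hex2:
  assumes o: "X \<in> Obj C" "Y \<in> Obj C" "Z \<in> Obj C" and w: "win n [X \<odot> Y, Z] s"
  shows "act (Suc n) (mm X Y) (act n (brd (X \<odot> Y) Z) s) = act n (brd X Z) (act (Suc n) (brd Y Z) (act n (mm X Y) s))"
proof -
  note oo = TObj_in[OF o(1,2)] TObj_in[OF o(2,3)] TObj_in[OF o(3,1)] TObj_in[OF o(1,3)] TObj_in[OF o(2,1)] TObj_in[OF o(3,2)]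
  obtain us vs where sh: "cur s = us @ [X \<odot> Y, Z] @ vs" "length us = n" using win_shape[OF w] by blast
  note i = ip_Assoc[OF o]
  define s' where "s' = act n (mi (X \<odot> Y) Z) s"
  define s'' where "s'' = act n (bx ((X \<odot> Y) \<odot> Z) (X \<odot> (Y \<odot> Z)) (Assoc C X Y Z)) s'"
  have g: "good s" by (rule win_good[OF w])
  have s': "good s'" "cur s' = us @ [(X \<odot> Y) \<odot> Z] @ vs" using g sh o oo by (simp_all add: s'_def st_simps)
  have s'': "good s''" "cur s'' = us @ [X \<odot> (Y \<odot> Z)] @ vs"
    using s' sh o oo ipD(1)[OF i] by (simp_all add: s''_def st_simps)
  have w'': "win n [X \<odot> (Y \<odot> Z)] s''" using s'' sh by (simp add: win_iff)
  have w': "win n [(X \<odot> Y) \<odot> Z] s'" using s' sh by (simp add: win_iff)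
  have e': "s' = act n (bx (X \<odot> (Y \<odot> Z)) ((X \<odot> Y) \<odot> Z) (InvAssoc C X Y Z)) s''"
    using act_bx_inverse[OF i w'] by (simp add: s''_def)
  have e: "s = act n (mm (X \<odot> Y) Z) s'" using act_mm_mi[OF oo(1) o(3) w] by (simp add: s'_def)
  note a1 = arr_InvAssoc[OF o] and a2 = arr_Braid[OF oo(1) o(3)] and a3 = arr_InvAssoc[OF o(3,1,2)]
  note b1 = arr_TMor[OF arr_Idt[OF o(1)] arr_Braid[OF o(2,3)]] and b2 = arr_InvAssoc[OF o(1,3,2)]
    and b3 = arr_TMor[OF arr_Braid[OF o(1,3)] arr_Idt[OF o(2)]]
  define t1 where "t1 = act n (bx ((X \<odot> Y) \<odot> Z) (Z \<odot> (X \<odot> Y)) (Braid C (X \<odot> Y) Z)) s'"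
  have t1: "good t1" "cur t1 = us @ [Z \<odot> (X \<odot> Y)] @ vs"
    using s' sh o oo a2 by (simp_all add: t1_def st_simps)
  define u where "u = act n (bx (X \<odot> (Y \<odot> Z)) (X \<odot> (Z \<odot> Y)) (Idt C X \<star> Braid C Y Z)) s''"
  have u: "good u" "cur u = us @ [X \<odot> (Z \<odot> Y)] @ vs"
    using s'' sh o oo b1 by (simp_all add: u_def st_simps)
  define v where "v = act n (bx (X \<odot> (Z \<odot> Y)) ((X \<odot> Z) \<odot> Y) (InvAssoc C X Z Y)) u"
  have v: "good v" "cur v = us @ [(X \<odot> Z) \<odot> Y] @ vs"
    using u sh o oo b2 by (simp_all add: v_def st_simps)
  have key: "act n (bx (Z \<odot> (X \<odot> Y)) ((Z \<odot> X) \<odot> Y) (InvAssoc C Z X Y)) t1 = act n (bx ((X \<odot> Z) \<odot> Y) ((Z \<odot> X) \<odot> Y) (Braid C X Z \<star> Idt C Y)) v"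
    unfolding t1_def v_def u_def e'
    by (simp only: act_bx_Cmp[OF a1 a2 w'', symmetric] act_bx_Cmp[OF arr_Cmp[OF a2 a1] a3 w'', symmetric]
      act_bx_Cmp[OF b1 b2 w'', symmetric] act_bx_Cmp[OF arr_Cmp[OF b2 b1] b3 w'', symmetric] hexagon2[OF o])
  have "act (Suc n) (mm X Y) (act n (brd (X \<odot> Y) Z) s) = act (Suc n) (mm X Y) (act n (mm Z (X \<odot> Y)) t1)"
    unfolding e act_brd_mm[OF oo(1) o(3) w'] t1_def ..
  also have "\<dots> = act n (mm Z X) (act n (mm (Z \<odot> X) Y) (act n (bx (Z \<odot> (X \<odot> Y)) ((Z \<odot> X) \<odot> Y) (InvAssoc C Z X Y)) t1))"
    using t1 sh o by (intro act_mm_InvAssoc[symmetric]) (simp_all add: win_iff)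
  also have "\<dots> = act n (mm Z X) (act n (bx (X \<odot> Z) (Z \<odot> X) (Braid C X Z)) (act (Suc n) (bx Y Y (Idt C Y)) (act n (mm (X \<odot> Z) Y) v)))"
    unfolding key using v sh o arr_Braid by (subst act_mm_bx) (auto simp add: win_iff)
  also have "act (Suc n) (bx Y Y (Idt C Y)) (act n (mm (X \<odot> Z) Y) v) = act n (mm (X \<odot> Z) Y) v"
    using v sh o oo arr_Braid by (intro act_bx_Idt) (simp add: st_simps)
  also have "act n (mm Z X) (act n (bx (X \<odot> Z) (Z \<odot> X) (Braid C X Z)) \<dots>) = act n (brd X Z) (act n (mm X Z) (act n (mm (X \<odot> Z) Y) v))"
    using v sh o oo by (intro act_brd_mm[symmetric]) (simp_all add: st_simps)
  also have "act n (mm X Z) (act n (mm (X \<odot> Z) Y) v) = act (Suc n) (mm Z Y) (act n (mm X (Z \<odot> Y)) u)"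
    unfolding v_def using u sh o by (intro act_mm_InvAssoc) (simp_all add: win_iff)
  also have "act n (mm X (Z \<odot> Y)) u = act n (bx X X (Idt C X)) (act (Suc n) (bx (Y \<odot> Z) (Z \<odot> Y) (Braid C Y Z)) (act n (mm X (Y \<odot> Z)) s''))"
    unfolding u_def by (rule act_mm_bx[OF arr_Idt[OF o(1)] arr_Braid[OF o(2,3)] w''])
  also have "\<dots> = act (Suc n) (bx (Y \<odot> Z) (Z \<odot> Y) (Braid C Y Z)) (act n (mm X (Y \<odot> Z)) s'')"
    using s'' sh o oo arr_Braid by (intro act_bx_Idt) (simp add: st_simps)
  also have "act (Suc n) (mm Z Y) \<dots>
    = act (Suc n) (brd Y Z) (act (Suc n) (mm Y Z) (act n (mm X (Y \<odot> Z)) s''))"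
    using s'' sh o oo by (intro act_brd_mm[symmetric]) (simp_all add: st_simps)
  also have "act (Suc n) (mm Y Z) (act n (mm X (Y \<odot> Z)) s'') = act n (mm X Y) s"
    unfolding e e' using act_mm_InvAssoc[OF o w''] by simp
  finally show ?thesis .
qed

end

section \<open>Invertible objects\<close>

context tensor_category
begin

lemma Unit_nonzero: "\<not> zero_object C (Unit C)"
  using Unit_simple by (simp add: simple_object_def)

lemma nonzero_factors:
  assumes "X \<in> Obj C" "Y \<in> Obj C" "\<not> zero_object C (X \<odot> Y)"
  shows "\<not> zero_object C X" "\<not> zero_object C Y"
proof -
  have "Idt C (X \<odot> Y) = Idt C X \<star> Idt C Y" using assms TMor_Idt by simp
  then show "\<not> zero_object C X" "\<not> zero_object C Y"
    using TMor_Zero_left[OF assms(1,1) arr_Idt[OF assms(2)]] TMor_Zero_right[OF assms(2,2) arr_Idt[OF assms(1)]] assms TObj_in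
    by (auto simp: zero_object_def)
qed

lemma TMor_Scl:
  assumes f: "arr X X' f" and g: "arr Y Y' g"
  shows "Scl C a f \<star> g = Scl C a (f \<star> g)" "f \<star> Scl C a g = Scl C a (f \<star> g)"
  using assms TMor_Scl_left[of X X' Y Y' f g a] TMor_Scl_right[of X X' Y Y' f g a] by (simp_all add: arr_def)

definition inverse_objects :: "'o \<Rightarrow> 'o \<Rightarrow> bool"
  where "inverse_objects Z W \<longleftrightarrow> Z \<in> Obj C \<and> W \<in> Obj C \<and> isomorphic C (Z \<odot> W) (Unit C) \<and> isomorphic C (W \<odot> Z) (Unit C)"

lemma inverse_objects_ip:
  assumes "inverse_objects Z W"
  obtains j j' i i' where "ip (Z \<odot> W) (Unit C) j j'" "ip (W \<odot> Z) (Unit C) i i'"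
  using assms Unit_in TObj_in isomorphic_ip unfolding inverse_objects_def by metis

text \<open>A zero factor would make the product zero, and with it the unit.\<close>

lemma inverse_objects_nonzero:
  assumes "inverse_objects Z W" shows "\<not> zero_object C Z" "\<not> zero_object C W"
proof -
  obtain j j' where "ip (Z \<odot> W) (Unit C) j j'" using inverse_objects_ip[OF assms] by metis
  then have "\<not> zero_object C (Z \<odot> W)" using zero_object_iso Unit_nonzero by blast
  then show "\<not> zero_object C Z" "\<not> zero_object C W"
    using nonzero_factors assms by (auto simp: inverse_objects_def)
qed

lemma Idt_nonzero: "\<lbrakk>X \<in> Obj C; \<not> zero_object C X\<rbrakk> \<Longrightarrow> Idt C X \<noteq> Zero C X X"
  by (simp add: zero_object_def)

text \<open>Tensoring with \<open>W\<close> and conjugating by an isomorphism of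
  \<open>Z \<odot> W\<close> with the unit carries \<open>f\<close> to an endomorphism of the unit,
  which is a scalar. Tensoring with the nonzero object \<open>W\<close> is faithful, so
  \<open>f\<close> is that scalar already.\<close>

lemma End_invertible:
  assumes i: "inverse_objects Z W" and f: "arr Z Z f"
  shows "\<exists>t. f = Scl C t (Idt C Z)"
proof -
  have o: "Z \<in> Obj C" "W \<in> Obj C" using i by (auto simp: inverse_objects_def)
  obtain j j' where j: "ip (Z \<odot> W) (Unit C) j j'" using inverse_objects_ip[OF i] by metis
  note jj = ipD[OF j] and fW = arr_TMor[OF f arr_Idt[OF o(2)]]
  have "arr (Unit C) (Unit C) (j \<cdot> (f \<star> Idt C W) \<cdot> j')" by (rule arr_Cmp[OF jj(1) arr_Cmp[OF fW jj(2)]])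
  then obtain t where t: "j \<cdot> (f \<star> Idt C W) \<cdot> j' = Scl C t (Idt C (Unit C))"
    using End_Unit by (auto simp: arr_def)
  have tj: "Scl C t (Idt C Z) \<star> Idt C W = Scl C t (Idt C (Z \<odot> W))"
    using TMor_Scl(1)[OF arr_Idt[OF o(1)] arr_Idt[OF o(2)]] TMor_Idt[OF o] by simp
  have "j \<cdot> Scl C t (Idt C (Z \<odot> W)) \<cdot> j' = Scl C t (Idt C (Unit C))"
    using arr_Scl_left[OF jj(2) arr_Idt[OF jj(5)]] arr_Idt_Cmp[OF jj(2)] arr_Scl_right[OF jj(2,1)] jj(4) by simp
  then have "(f \<star> Idt C W) \<cdot> j' = (Scl C t (Idt C Z) \<star> Idt C W) \<cdot> j'"
    using t tj ip_cancel_left[OF j arr_Cmp[OF fW jj(2)] arr_Cmp[OF arr_Scl[OF arr_Idt[OF jj(5)]] jj(2)]] by simp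
  then have "f \<star> Idt C W = Scl C t (Idt C Z) \<star> Idt C W"
    using ip_cancel_right[OF ip_sym[OF j] fW arr_Scl[OF arr_Idt[OF jj(5)]]] tj by simp
  then have "f = Scl C t (Idt C Z)"
    using TMor_cancel_right[OF arr_Idt[OF o(2)] Idt_nonzero[OF o(2) inverse_objects_nonzero(2)[OF i]] f arr_Scl[OF arr_Idt[OF o(1)]]]
    by blast
  then show ?thesis ..
qed

lemma Hom_invertible:
  assumes i: "inverse_objects Z W" and u: "ip Z Z' u u'" and f: "arr Z Z' f"
  shows "\<exists>t. f = Scl C t u"
proof -
  note uu = ipD[OF u]
  obtain t where t: "u' \<cdot> f = Scl C t (Idt C Z)" using End_invertible[OF i arr_Cmp[OF uu(2) f]] by blast
  have "u' \<cdot> Scl C t u = Scl C t (Idt C Z)" using arr_Scl_right[OF uu(1,2)] uu(3) by simp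
  then have "f = Scl C t u" using ip_cancel_left[OF ip_sym[OF u] f arr_Scl[OF uu(1)]] t by simp
  then show ?thesis ..
qed

lemma iso_invertible_scalar:
  assumes i: "inverse_objects Z W" and u: "ip Z Z' u u'" and f: "ip Z Z' f f'"
  shows "\<exists>t. t \<noteq> 0 \<and> f = Scl C t u"
proof -
  obtain t where t: "f = Scl C t u" using Hom_invertible[OF i u ipD(1)[OF f]] by blast
  moreover have "t \<noteq> 0"
    using t ip_nonzero[OF f inverse_objects_nonzero(1)[OF i]] Scl_zero[OF ipD(1)[OF u]] by auto
  ultimately show ?thesis by blast
qed

text \<open>Here \<open>g\<close> is \<open>Idt C W \<star> h\<close> conjugated by an isomorphism
  \<open>p\<close> from \<open>W \<odot> (Z \<odot> N)\<close> to \<open>N\<close>. Naturality of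
  \<open>p\<close> in \<open>N\<close> shows that \<open>h\<close> and
  \<open>Idt C Z \<star> g\<close> agree after tensoring with \<open>W\<close>, which can be
  cancelled.\<close>

lemma full_invertible:
  assumes i: "inverse_objects Z W" and N: "N \<in> Obj C" and h: "arr (Z \<odot> N) (Z \<odot> N) h"
  shows "\<exists>g. arr N N g \<and> h = Idt C Z \<star> g"
proof -
  have o: "Z \<in> Obj C" "W \<in> Obj C" using i by (auto simp: inverse_objects_def)
  obtain j j' where j: "ip (W \<odot> Z) (Unit C) j j'" using inverse_objects_ip[OF i] by metis
  note l = ip_LUnit[OF N] and a = ip_sym[OF ip_Assoc[OF o(2,1) N]] and jN = ip_TMor[OF j ip_Idt[OF N]]
  let ?l = "LUnit C N" and ?a = "InvAssoc C W Z N"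
  define p where "p = ?l \<cdot> (j \<star> Idt C N) \<cdot> ?a"
  obtain p' where p: "ip (W \<odot> (Z \<odot> N)) N p p'" unfolding p_def using ip_Cmp[OF ip_Cmp[OF a jN] l] by blast
  note pp = ipD[OF p] and iW = arr_Idt[OF o(2)] and iZ = arr_Idt[OF o(1)] and iN = arr_Idt[OF N]
  note Wh = arr_TMor[OF iW h]
  define g where "g = p \<cdot> (Idt C W \<star> h) \<cdot> p'"
  have g: "arr N N g" unfolding g_def by (rule arr_Cmp[OF pp(1) arr_Cmp[OF Wh pp(2)]])
  note WZg = arr_TMor[OF iW arr_TMor[OF iZ g]] and Ig = arr_TMor[OF arr_Idt[OF Unit_in] g]
  have "p \<cdot> (Idt C W \<star> (Idt C Z \<star> g)) = (?l \<cdot> (j \<star> Idt C N)) \<cdot> ?a \<cdot> (Idt C W \<star> (Idt C Z \<star> g))"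
    unfolding p_def using arr_assoc[OF ipD(1)[OF a] ipD(1)[OF jN] ipD(1)[OF l]]
     arr_assoc[OF WZg ipD(1)[OF a] arr_Cmp[OF ipD(1)[OF l] ipD(1)[OF jN]]] by simp
  also have "?a \<cdot> (Idt C W \<star> (Idt C Z \<star> g)) = (Idt C (W \<odot> Z) \<star> g) \<cdot> ?a"
    using arr_InvAssoc_natural[OF iW iZ g] TMor_Idt[OF o(2,1)] by simp
  also have "(?l \<cdot> (j \<star> Idt C N)) \<cdot> (Idt C (W \<odot> Z) \<star> g) \<cdot> ?a = ?l \<cdot> ((j \<star> Idt C N) \<cdot> (Idt C (W \<odot> Z) \<star> g)) \<cdot> ?a"
    using arr_assoc[OF arr_Cmp[OF arr_TMor[OF arr_Idt[OF TObj_in[OF o(2,1)]] g] ipD(1)[OF a]] ipD(1)[OF jN] ipD(1)[OF l]]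
      arr_assoc[OF ipD(1)[OF a] arr_TMor[OF arr_Idt[OF TObj_in[OF o(2,1)]] g] ipD(1)[OF jN]] by simp
  also have "(j \<star> Idt C N) \<cdot> (Idt C (W \<odot> Z) \<star> g) = (Idt C (Unit C) \<star> g) \<cdot> (j \<star> Idt C N)"
    using arr_TMor_Cmp[OF arr_Idt[OF TObj_in[OF o(2,1)]] ipD(1)[OF j] g iN]
      arr_TMor_Cmp[OF ipD(1)[OF j] arr_Idt[OF Unit_in] iN g]
      arr_Cmp_Idt[OF ipD(1)[OF j]] arr_Idt_Cmp[OF ipD(1)[OF j]] arr_Cmp_Idt[OF g] arr_Idt_Cmp[OF g] by simp
  also have "?l \<cdot> ((Idt C (Unit C) \<star> g) \<cdot> (j \<star> Idt C N)) \<cdot> ?a = (?l \<cdot> (Idt C (Unit C) \<star> g)) \<cdot> (j \<star> Idt C N) \<cdot> ?a"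
    using arr_assoc[OF ipD(1)[OF a] ipD(1)[OF jN] Ig] arr_assoc[OF arr_Cmp[OF ipD(1)[OF jN] ipD(1)[OF a]] Ig ipD(1)[OF l]] by simp
  also have "?l \<cdot> (Idt C (Unit C) \<star> g) = g \<cdot> ?l" by (rule LUnit_natural[OF N N arr_Hom[OF g]])
  also have "(g \<cdot> ?l) \<cdot> (j \<star> Idt C N) \<cdot> ?a = g \<cdot> p"
    unfolding p_def by (rule arr_assoc[OF arr_Cmp[OF ipD(1)[OF jN] ipD(1)[OF a]] ipD(1)[OF l] g])
  also have "\<dots> = p \<cdot> ((Idt C W \<star> h) \<cdot> p') \<cdot> p"
    unfolding g_def by (rule arr_assoc[OF pp(1) arr_Cmp[OF Wh pp(2)] pp(1)])
  also have "((Idt C W \<star> h) \<cdot> p') \<cdot> p = Idt C W \<star> h"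
    using arr_assoc[OF pp(1,2) Wh] pp(3) arr_Cmp_Idt[OF Wh] by simp
  finally have "Idt C W \<star> (Idt C Z \<star> g) = Idt C W \<star> h" by (rule ip_cancel_left[OF p WZg Wh])
  then have "Idt C Z \<star> g = h"
    by (rule TMor_cancel_left[OF iW Idt_nonzero[OF o(2) inverse_objects_nonzero(2)[OF i]] arr_TMor[OF iZ g] h])
  then show ?thesis using g by blast
qed

end

section \<open>Double braidings with an invertible object\<close>

context braided_tensor_category
begin

definition dbl :: "'o \<Rightarrow> 'o \<Rightarrow> 'm" where "dbl Z M = Braid C M Z \<cdot> Braid C Z M"

lemma arr_dbl: "\<lbrakk>Z \<in> Obj C; M \<in> Obj C\<rbrakk> \<Longrightarrow> arr (Z \<odot> M) (Z \<odot> M) (dbl Z M)"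
  unfolding dbl_def by (rule arr_Cmp[OF arr_Braid arr_Braid])

lemma act_dbl: "\<lbrakk>Z \<in> Obj C; M \<in> Obj C; win n [Z, M] s\<rbrakk>
  \<Longrightarrow> act n (brd M Z) (act n (brd Z M) s) = act n (bx2 Z M Z M (dbl Z M)) s"
  unfolding brd_def dbl_def by (rule act_bx2_Cmp) (auto intro: arr_Braid)

lemma dbl_scalar: "\<lbrakk>Z \<in> Obj C; M \<in> Obj C; dbl Z M = Scl C t (Idt C (Z \<odot> M)); win n [Z, M] s\<rbrakk>
  \<Longrightarrow> act n (brd M Z) (act n (brd Z M) s) = sscl t s"
  using act_dbl act_bx2_Scl[OF _ _ _ _ arr_Idt[OF TObj_in]] act_bx2_Idt by simp

lemma dbl_one: "\<lbrakk>Z \<in> Obj C; M \<in> Obj C; dbl Z M = Idt C (Z \<odot> M); win n [Z, M] s\<rbrakk>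
  \<Longrightarrow> act n (brd M Z) (act n (brd Z M) s) = s"
  using act_dbl act_bx2_Idt by simp

text \<open>The hexagons decompose the two braidings of \<open>Z\<close> with
  \<open>M \<odot> N\<close>; the double braiding with \<open>N\<close> ends up between the two
  braidings with \<open>M\<close>.\<close>

lemma act_dbl_TObj:
  assumes o: "Z \<in> Obj C" "M \<in> Obj C" "N \<in> Obj C" and w: "win n [Z, M, N] s"
    and d: "dbl Z (M \<odot> N) = Idt C (Z \<odot> (M \<odot> N))"
  shows "act n (brd M Z) (act (Suc n) (brd N Z) (act (Suc n) (brd Z N) (act n (brd Z M) s))) = s"
proof -
  note MN = TObj_in[OF o(2,3)]
  obtain us vs where sh: "cur s = us @ [Z, M, N] @ vs" "length us = n" using win_shape[OF w] by blast
  have g: "good s" by (rule win_good[OF w])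
  define s' where "s' = act (Suc n) (mi M N) s"
  have s': "good s'" "cur s' = us @ [Z, M \<odot> N] @ vs" using g sh o by (simp_all add: s'_def st_simps)
  have e: "s = act (Suc n) (mm M N) s'" using g sh o by (simp add: s'_def act_mm_mi st_simps)
  define t where "t = act n (brd Z (M \<odot> N)) s'"
  have t: "good t" "cur t = us @ [M \<odot> N, Z] @ vs" using s' sh o MN by (simp_all add: t_def st_simps)
  have "act (Suc n) (brd Z N) (act n (brd Z M) s) = act n (mm M N) t"
    unfolding e t_def using s' sh by (intro brd_hex1[symmetric] o) (simp add: win_iff)
  moreover have "act n (brd M Z) (act (Suc n) (brd N Z) (act n (mm M N) t)) = act (Suc n) (mm M N) (act n (brd (M \<odot> N) Z) t)"
    using t sh by (intro brd_hex2[symmetric] o) (simp add: win_iff)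
  moreover have "act n (brd (M \<odot> N) Z) t = s'"
    unfolding t_def using s' sh by (intro dbl_one o MN d) (simp add: win_iff)
  ultimately show ?thesis using e by simp
qed

lemma act_bx2_Idt_TMor:
  assumes o: "Z \<in> Obj C" and g: "arr N N' g" and w: "win n [Z, N] s"
  shows "act n (bx2 Z N Z N' (Idt C Z \<star> g)) s = act (Suc n) (bx N N' g) s"
proof -
  note oN = arr_dom[OF g] arr_cod[OF g]
  obtain us vs where sh: "cur s = us @ [Z, N] @ vs" "length us = n" using win_shape[OF w] by blast
  have gs: "good s" by (rule win_good[OF w])
  have "act n (bx2 Z N Z N' (Idt C Z \<star> g)) s = act n (bx Z Z (Idt C Z)) (act (Suc n) (bx N N' g) s)"
    unfolding act_bx_bx[OF arr_Idt[OF o] g w] by (rule act_bx2_eq[OF o oN(1) o oN(2) arr_TMor[OF arr_Idt[OF o] g] w])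
  also have "\<dots> = act (Suc n) (bx N N' g) s" using sh gs g by (intro act_bx_Idt) (simp add: st_simps)
  finally show ?thesis .
qed

text \<open>In the form \<open>Idt C Z \<star> g\<close> the double braiding with \<open>N\<close>
  touches only \<open>N\<close> and slides out from between the braidings with \<open>M\<close>,
  which then meet in \<open>dbl Z M\<close>.\<close>

lemma dbl_TMor:
  assumes o: "Z \<in> Obj C" "M \<in> Obj C" "N \<in> Obj C" and d: "dbl Z (M \<odot> N) = Idt C (Z \<odot> (M \<odot> N))"
    and g: "arr N N g" "dbl Z N = Idt C Z \<star> g"
  shows "dbl Z M \<star> g = Idt C ((Z \<odot> M) \<odot> N)"
proof -
  note ZM = TObj_in[OF o(1,2)] note ZMN = TObj_in[OF ZM o(3)] note dM = arr_dbl[OF o(1,2)]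
  note dg = arr_TMor[OF dM g(1)]
  define i where "i = idst [(Z \<odot> M) \<odot> N] (Unit C)"
  have i: "good i" "cur i = [(Z \<odot> M) \<odot> N]" using ZMN Unit_in by (simp_all add: i_def good_idst)
  define i' where "i' = act 0 (mm (Z \<odot> M) N) i"
  have i': "good i'" "cur i' = [Z \<odot> M, N]" using i ZM o by (simp_all add: i'_def st_simps)
  define s where "s = act 0 (mm Z M) i'"
  have s: "good s" "cur s = [Z, M, N]" using i' o by (simp_all add: s_def st_simps)
  have t: "good (act 0 (brd Z M) s)" "cur (act 0 (brd Z M) s) = [M, Z, N]" using s o by (simp_all add: st_simps)
  have "s = act 0 (brd M Z) (act 1 (brd N Z) (act 1 (brd Z N) (act 0 (brd Z M) s)))"
    using act_dbl_TObj[OF o _ d, of 0 s] s by (simp add: win_iff)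
  also have "act 1 (brd N Z) (act 1 (brd Z N) (act 0 (brd Z M) s)) = act 1 (bx2 Z N Z N (dbl Z N)) (act 0 (brd Z M) s)"
    using t by (intro act_dbl o) (simp add: win_iff)
  also have "\<dots> = act 2 (bx N N g) (act 0 (brd Z M) s)"
    unfolding g(2) using t by (subst act_bx2_Idt_TMor[OF o(1) g(1)]) (simp_all add: win_iff numeral_2_eq_2)
  also have "act 0 (brd M Z) \<dots> = act 2 (bx N N g) (act 0 (brd M Z) (act 0 (brd Z M) s))"
    using exchange[OF box_ok_brd[OF o(2,1)] box_ok_bx[OF g(1)], of 0 "act 0 (brd Z M) s" 2] s o by (simp add: st_simps numeral_2_eq_2)
  also have "act 0 (brd M Z) (act 0 (brd Z M) s) = act 0 (bx2 Z M Z M (dbl Z M)) s"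
    using s by (intro act_dbl o) (simp add: win_iff)
  also have "\<dots> = act 0 (mm Z M) (act 0 (bx (Z \<odot> M) (Z \<odot> M) (dbl Z M)) i')"
    unfolding s_def using i' by (intro act_bx2_mm o dM) (simp add: win_iff)
  also have "act 2 (bx N N g) \<dots> = act 0 (mm Z M) (act 1 (bx N N g) (act 0 (bx (Z \<odot> M) (Z \<odot> M) (dbl Z M)) i'))"
    using exchange[OF box_ok_mm[OF o(1,2)] box_ok_bx[OF g(1)], of 0 "act 0 (bx (Z \<odot> M) (Z \<odot> M) (dbl Z M)) i'" 1] i' o dM by (simp add: st_simps numeral_2_eq_2)
  also have "act 1 (bx N N g) (act 0 (bx (Z \<odot> M) (Z \<odot> M) (dbl Z M)) i') = act 0 (bx (Z \<odot> M) (Z \<odot> M) (dbl Z M)) (act 1 (bx N N g) i')"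
    using exchange[OF box_ok_bx[OF dM] box_ok_bx[OF g(1)], of 0 i' 1] i' by (simp add: st_simps)
  also have "\<dots> = act 0 (mm (Z \<odot> M) N) (act 0 (bx ((Z \<odot> M) \<odot> N) ((Z \<odot> M) \<odot> N) (dbl Z M \<star> g)) i)"
    unfolding i'_def using act_mm_bx[OF dM g(1), of 0 i] i by (simp add: win_iff)
  finally have "act 0 (mi (Z \<odot> M) N) (act 0 (mi Z M) (act 0 (mm Z M) (act 0 (mm (Z \<odot> M) N) i)))
      = act 0 (mi (Z \<odot> M) N) (act 0 (mi Z M) (act 0 (mm Z M) (act 0 (mm (Z \<odot> M) N) (act 0 (bx ((Z \<odot> M) \<odot> N) ((Z \<odot> M) \<odot> N) (dbl Z M \<star> g)) i))))"
    by (simp add: s_def i'_def)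
  then have "i = act 0 (bx ((Z \<odot> M) \<odot> N) ((Z \<odot> M) \<odot> N) (dbl Z M \<star> g)) i"
    using i o ZM dg by (simp add: act_mi_mm st_simps)
  then have "act 0 (bx ((Z \<odot> M) \<odot> N) ((Z \<odot> M) \<odot> N) (dbl Z M \<star> g)) i
    = sscl 1 (act 0 (bx ((Z \<odot> M) \<odot> N) ((Z \<odot> M) \<odot> N) (Idt C ((Z \<odot> M) \<odot> N))) i)"
    using act_bx_Idt[of 0 "(Z \<odot> M) \<odot> N" i] i sscl_one by (simp add: win_iff)
  then have "dbl Z M \<star> g = Scl C 1 (Idt C ((Z \<odot> M) \<odot> N))"
    unfolding i_def by (rule act_bx_faithful[OF dg arr_Idt[OF ZMN]])
  then show ?thesis using arr_Scl_one[OF arr_Idt[OF ZMN]] by simp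
qed

text \<open>
  By the hexagons \<open>dbl Z (M \<odot> N)\<close> is composed of \<open>dbl Z M\<close> and \<open>dbl Z N\<close>, and the latter is \<open>Idt \<star> g\<close> as
  \<open>Z\<close> is invertible, so triviality on \<open>M \<odot> N\<close> says \<open>dbl Z M \<star> g = Idt\<close>. An eigenvector \<open>e\<close> of \<open>dbl Z M0\<close>
  shows that \<open>g\<close> is a scalar.
\<close>

lemma pairing_scalar:
  assumes i: "inverse_objects Z W" and S: "Sx \<subseteq> Obj C" "Sy \<subseteq> Obj C"
    and nz: "M0 \<in> Sx" "\<not> zero_object C M0" "N0 \<in> Sy" "\<not> zero_object C N0"
    and tr: "\<And>M N. \<lbrakk>M \<in> Sx; N \<in> Sy\<rbrakk> \<Longrightarrow> dbl Z (M \<odot> N) = Idt C (Z \<odot> (M \<odot> N))"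
  shows "\<exists>t. t \<noteq> 0 \<and> (\<forall>M\<in>Sx. dbl Z M = Scl C t (Idt C (Z \<odot> M)))"
proof -
  have o: "Z \<in> Obj C" "M0 \<in> Obj C" "N0 \<in> Obj C" using i S nz by (auto simp: inverse_objects_def)
  note ZM = TObj_in[OF o(1,2)] note iN = arr_Idt[OF o(3)]
  note nN = Idt_nonzero[OF o(3) nz(4)]
  obtain g where g: "arr N0 N0 g" "dbl Z N0 = Idt C Z \<star> g"
    using full_invertible[OF i o(3) arr_dbl[OF o(1,3)]] by blast
  have d: "dbl Z M \<star> g = Idt C ((Z \<odot> M) \<odot> N0)" if "M \<in> Sx" for M
    using dbl_TMor[OF o(1) _ o(3) tr[OF that nz(3)] g] that S by auto
  note dM = arr_dbl[OF o(1,2)]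
  obtain t e where e: "arr (Z \<odot> M0) (Z \<odot> M0) e" "e \<noteq> Zero C (Z \<odot> M0) (Z \<odot> M0)" "dbl Z M0 \<cdot> e = Scl C t e"
    using eigenvector[OF dM nonzero_TObj[OF o(1,2) inverse_objects_nonzero(1)[OF i] nz(2)]] by blast
  have "e \<star> Idt C N0 = (dbl Z M0 \<star> g) \<cdot> (e \<star> Idt C N0)"
    unfolding d[OF nz(1)] by (rule arr_Idt_Cmp[OF arr_TMor[OF e(1) iN], symmetric])
  also have "\<dots> = Scl C t e \<star> g" using arr_TMor_Cmp[OF e(1) dM iN g(1)] e(3) arr_Cmp_Idt[OF g(1)] by simp
  also have "\<dots> = e \<star> Scl C t g" using TMor_Scl[OF e(1) g(1)] by simp
  finally have tg: "Idt C N0 = Scl C t g" by (rule TMor_cancel_left[OF e(1,2) iN arr_Scl[OF g(1)]])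
  have t: "t \<noteq> 0" using tg nN Scl_zero[OF g(1)] by auto
  \<comment> \<open>Since \<open>g\<close> depends on \<open>N0\<close> alone, the scalar found with
    \<open>M0\<close> serves every \<open>M\<close> of the component.\<close>
  have "dbl Z M = Scl C t (Idt C (Z \<odot> M))" if M: "M \<in> Sx" for M
  proof -
    have oM: "M \<in> Obj C" using M S by auto
    note iZM = arr_Idt[OF TObj_in[OF o(1) oM]]
    have "dbl Z M \<star> Idt C N0 = Scl C t (dbl Z M \<star> g)"
      unfolding tg by (rule TMor_Scl(2)[OF arr_dbl[OF o(1) oM] g(1)])
    also have "\<dots> = Scl C t (Idt C (Z \<odot> M) \<star> Idt C N0)"
      unfolding d[OF M] using TMor_Idt[OF TObj_in[OF o(1) oM] o(3)] by simp
    also have "\<dots> = Scl C t (Idt C (Z \<odot> M)) \<star> Idt C N0"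
      by (rule TMor_Scl(1)[OF iZM iN, symmetric])
    finally show ?thesis by (rule TMor_cancel_right[OF iN nN arr_dbl[OF o(1) oM] arr_Scl[OF iZM]])
  qed
  then show ?thesis using t by blast
qed

end

context monoidal_linear_category
begin

text \<open>The new position is a variable bound by an equation, so the rule applies with literal
  positions.\<close>

lemma exch:
  "\<lbrakk>box_ok F; box_ok G; win n (bdom F) s; win m (bdom G) s; n + length (bdom F) \<le> m;
    m' = m + length (bcod F) - length (bdom F)\<rbrakk> \<Longrightarrow> act m' G (act n F s) = act n F (act m G s)"
  using exchange by blast

lemma mm_bx_right:
  assumes X: "X \<in> Obj C" and g: "arr Y Y' g" and w: "win n [X \<odot> Y] s"
  shows "act n (mm X Y') (act n (bx (X \<odot> Y) (X \<odot> Y') (Idt C X \<star> g)) s) = act (Suc n) (bx Y Y' g) (act n (mm X Y) s)"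
proof -
  obtain us vs where sh: "cur s = us @ [X \<odot> Y] @ vs" "length us = n" using win_shape[OF w] by blast
  show ?thesis unfolding act_mm_bx[OF arr_Idt[OF X] g w]
    using sh win_good[OF w] X g by (intro act_bx_Idt) (simp add: st_simps arr_dom)
qed

lemma mm_bx_left:
  assumes Y: "Y \<in> Obj C" and f: "arr X X' f" and w: "win n [X \<odot> Y] s"
  shows "act n (mm X' Y) (act n (bx (X \<odot> Y) (X' \<odot> Y) (f \<star> Idt C Y)) s) = act n (bx X X' f) (act n (mm X Y) s)"
proof -
  obtain us vs where sh: "cur s = us @ [X \<odot> Y] @ vs" "length us = n" using win_shape[OF w] by blast
  have "act (Suc n) (bx Y Y (Idt C Y)) (act n (mm X Y) s) = act n (mm X Y) s"
    using sh win_good[OF w] Y f by (intro act_bx_Idt) (simp add: st_simps arr_dom)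
  then show ?thesis using act_mm_bx[OF f arr_Idt[OF Y] w] by simp
qed

lemma act_bx_ok: "\<lbrakk>arr X Y f; win n [X] s\<rbrakk> \<Longrightarrow> win n [Y] (act n (bx X Y f) s)"
  using win_act_same[OF box_ok_bx] by simp

end

section \<open>The twisted constraints\<close>

context braided_tensor_category
begin

text \<open>The degrees are dropped and the four cocycle objects become independent parameters, so
  that identities between products in \<open>A\<close> do not enter until the scalar equations are
  assembled.\<close>

definition tassoc :: "'o \<Rightarrow> 'o \<Rightarrow> 'o \<Rightarrow> 'o \<Rightarrow> 'm \<Rightarrow> 'o \<Rightarrow> 'o \<Rightarrow> 'o \<Rightarrow> 'm"
  where "tassoc P Q S T k X Y Z =
      (Idt C S \<star> Assoc C X T (Y \<odot> Z))
      \<cdot> (Idt C S \<star> (Braid C T X \<star> Idt C (Y \<odot> Z)))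
      \<cdot> (Idt C S \<star> InvAssoc C T X (Y \<odot> Z))
      \<cdot> Assoc C S T (X \<odot> (Y \<odot> Z))
      \<cdot> (k \<star> Idt C (X \<odot> (Y \<odot> Z)))
      \<cdot> InvAssoc C P Q (X \<odot> (Y \<odot> Z))
      \<cdot> (Idt C P \<star> (Idt C Q \<star> Assoc C X Y Z))
      \<cdot> (Idt C P \<star> Assoc C Q (X \<odot> Y) Z)"

definition tbraid :: "'o \<Rightarrow> 'o \<Rightarrow> 'm \<Rightarrow> 'o \<Rightarrow> 'o \<Rightarrow> 'm"
  where "tbraid R R' k X Y = (Idt C R' \<star> Braid C X Y) \<cdot> (k \<star> Idt C (X \<odot> Y))"

lemma ip_tassoc:
  assumes o: "P \<in> Obj C" "Q \<in> Obj C" "S \<in> Obj C" "T \<in> Obj C" "X \<in> Obj C" "Y \<in> Obj C" "Z \<in> Obj C"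
    and k: "ip (P \<odot> Q) (S \<odot> T) k k'"
  shows "\<exists>g. ip (P \<odot> ((Q \<odot> (X \<odot> Y)) \<odot> Z)) (S \<odot> (X \<odot> (T \<odot> (Y \<odot> Z)))) (tassoc P Q S T k X Y Z) g"
proof -
  note XY = TObj_in[OF o(5,6)] and YZ = TObj_in[OF o(6,7)] note XYZ = TObj_in[OF o(5) YZ]
  note iP = ip_Idt[OF o(1)] and iQ = ip_Idt[OF o(2)] and iS = ip_Idt[OF o(3)]
  note 1 = ip_TMor[OF iP ip_Assoc[OF o(2) XY o(7)]]
  note 2 = ip_TMor[OF iP ip_TMor[OF iQ ip_Assoc[OF o(5-7)]]]
  note 3 = ip_sym[OF ip_Assoc[OF o(1,2) XYZ]]
  note 4 = ip_TMor[OF k ip_Idt[OF XYZ]]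
  note 5 = ip_Assoc[OF o(3,4) XYZ]
  note 6 = ip_TMor[OF iS ip_sym[OF ip_Assoc[OF o(4,5) YZ]]]
  note 7 = ip_TMor[OF iS ip_TMor[OF ip_Braid[OF o(4,5)] ip_Idt[OF YZ]]]
  note 8 = ip_TMor[OF iS ip_Assoc[OF o(5,4) YZ]]
  show ?thesis unfolding tassoc_def
    using ip_Cmp[OF ip_Cmp[OF ip_Cmp[OF ip_Cmp[OF ip_Cmp[OF ip_Cmp[OF ip_Cmp[OF 1 2] 3] 4] 5] 6] 7] 8] by blast
qed

text \<open>After splitting source and target, the eight factors of the constraint reduce to
  \<open>k\<close> on the two leading objects and one braiding of \<open>T\<close> with
  \<open>X\<close>. Later computations with the twisted associator use this form.\<close>

lemma act_tassoc:
  assumes o: "P \<in> Obj C" "Q \<in> Obj C" "S \<in> Obj C" "T \<in> Obj C" "X \<in> Obj C" "Y \<in> Obj C" "Z \<in> Obj C"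
    and k: "arr (P \<odot> Q) (S \<odot> T) k" and w: "win n [P \<odot> ((Q \<odot> (X \<odot> Y)) \<odot> Z)] s"
  shows "act (n + 3) (mm Y Z) (act (n + 2) (mm T (Y \<odot> Z)) (act (n + 1) (mm X (T \<odot> (Y \<odot> Z)))
      (act n (mm S (X \<odot> (T \<odot> (Y \<odot> Z))))
        (act n (bx (P \<odot> ((Q \<odot> (X \<odot> Y)) \<odot> Z)) (S \<odot> (X \<odot> (T \<odot> (Y \<odot> Z)))) (tassoc P Q S T k X Y Z)) s))))
    = act (n + 1) (brd T X) (act n (bx2 P Q S T k) (act (n + 2) (mm X Y) (act (n + 1) (mm Q (X \<odot> Y))
      (act (n + 1) (mm (Q \<odot> (X \<odot> Y)) Z) (act n (mm P ((Q \<odot> (X \<odot> Y)) \<odot> Z)) s)))))"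
proof -
  note XY = TObj_in[OF o(5,6)] and YZ = TObj_in[OF o(6,7)] note XYZ = TObj_in[OF o(5) YZ] TObj_in[OF XY o(7)]
  note QXY = TObj_in[OF o(2) XY] note QXY_Z = TObj_in[OF QXY o(7)] and Q_XYZ = TObj_in[OF o(2) XYZ(1)]
  note QXYZ' = TObj_in[OF o(2) XYZ(2)]
  note TX = TObj_in[OF o(4,5)] TObj_in[OF o(5,4)] note TYZ = TObj_in[OF o(4) YZ]
  note ST = TObj_in[OF o(3,4)] and PQ = TObj_in[OF o(1,2)]
  note obs = o XY YZ XYZ QXY QXY_Z Q_XYZ QXYZ' TX TYZ ST PQ TObj_in[OF o(4) XYZ(1)] TObj_in[OF TX(1) YZ] TObj_in[OF TX(2) YZ]
    TObj_in[OF o(5) TYZ]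
  \<comment> \<open>The objects \<open>O0\<close> to \<open>O8\<close> are the stations of the
    composite and \<open>a1\<close> to \<open>a8\<close> its factors, in the order of
    application.\<close>
  define O0 where "O0 = P \<odot> ((Q \<odot> (X \<odot> Y)) \<odot> Z)"
  define O1 where "O1 = P \<odot> (Q \<odot> ((X \<odot> Y) \<odot> Z))"
  define O2 where "O2 = P \<odot> (Q \<odot> (X \<odot> (Y \<odot> Z)))"
  define O3 where "O3 = (P \<odot> Q) \<odot> (X \<odot> (Y \<odot> Z))"
  define O4 where "O4 = (S \<odot> T) \<odot> (X \<odot> (Y \<odot> Z))"
  define O5 where "O5 = S \<odot> (T \<odot> (X \<odot> (Y \<odot> Z)))"
  define O6 where "O6 = S \<odot> ((T \<odot> X) \<odot> (Y \<odot> Z))"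
  define O7 where "O7 = S \<odot> ((X \<odot> T) \<odot> (Y \<odot> Z))"
  define O8 where "O8 = S \<odot> (X \<odot> (T \<odot> (Y \<odot> Z)))"
  note Os = O0_def O1_def O2_def O3_def O4_def O5_def O6_def O7_def O8_def
  define a1 where "a1 = Idt C P \<star> Assoc C Q (X \<odot> Y) Z"
  define a2 where "a2 = Idt C P \<star> (Idt C Q \<star> Assoc C X Y Z)"
  define a3 where "a3 = InvAssoc C P Q (X \<odot> (Y \<odot> Z))"
  define a4 where "a4 = k \<star> Idt C (X \<odot> (Y \<odot> Z))"
  define a5 where "a5 = Assoc C S T (X \<odot> (Y \<odot> Z))"
  define a6 where "a6 = Idt C S \<star> InvAssoc C T X (Y \<odot> Z)"
  define a7 where "a7 = Idt C S \<star> (Braid C T X \<star> Idt C (Y \<odot> Z))"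
  define a8 where "a8 = Idt C S \<star> Assoc C X T (Y \<odot> Z)"
  note as = a1_def a2_def a3_def a4_def a5_def a6_def a7_def a8_def
  have a: "arr O0 O1 a1" "arr O1 O2 a2" "arr O2 O3 a3" "arr O3 O4 a4" "arr O4 O5 a5" "arr O5 O6 a6" "arr O6 O7 a7" "arr O7 O8 a8"
    unfolding Os as by (intro arr_TMor arr_Idt arr_Assoc arr_InvAssoc arr_Braid k obs)+
  note c2 = arr_Cmp[OF a(2,1)] note c3 = arr_Cmp[OF a(3) c2] note c4 = arr_Cmp[OF a(4) c3] note c5 = arr_Cmp[OF a(5) c4]
  note c6 = arr_Cmp[OF a(6) c5] note c7 = arr_Cmp[OF a(7) c6]
  define s1 where "s1 = act n (bx O0 O1 a1) s"
  define s2 where "s2 = act n (bx O1 O2 a2) s1"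
  define s3 where "s3 = act n (bx O2 O3 a3) s2"
  define s4 where "s4 = act n (bx O3 O4 a4) s3"
  define s5 where "s5 = act n (bx O4 O5 a5) s4"
  define s6 where "s6 = act n (bx O5 O6 a6) s5"
  define s7 where "s7 = act n (bx O6 O7 a7) s6"
  define s8 where "s8 = act n (bx O7 O8 a8) s7"
  have w0: "win n [O0] s" using w by (simp add: O0_def)
  have w1: "win n [O1] s1" unfolding s1_def by (rule act_bx_ok[OF a(1) w0])
  have w2: "win n [O2] s2" unfolding s2_def by (rule act_bx_ok[OF a(2) w1])
  have w3: "win n [O3] s3" unfolding s3_def by (rule act_bx_ok[OF a(3) w2])
  have w4: "win n [O4] s4" unfolding s4_def by (rule act_bx_ok[OF a(4) w3])
  have w5: "win n [O5] s5" unfolding s5_def by (rule act_bx_ok[OF a(5) w4])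
  have w6: "win n [O6] s6" unfolding s6_def by (rule act_bx_ok[OF a(6) w5])
  have w7: "win n [O7] s7" unfolding s7_def by (rule act_bx_ok[OF a(7) w6])
  have tot: "act n (bx (P \<odot> ((Q \<odot> (X \<odot> Y)) \<odot> Z)) (S \<odot> (X \<odot> (T \<odot> (Y \<odot> Z)))) (tassoc P Q S T k X Y Z)) s = s8"
    unfolding tassoc_def as[symmetric] O0_def[symmetric] O8_def[symmetric]
    unfolding act_bx_Cmp[OF c7 a(8) w0] act_bx_Cmp[OF c6 a(7) w0] act_bx_Cmp[OF c5 a(6) w0] act_bx_Cmp[OF c4 a(5) w0]
      act_bx_Cmp[OF c3 a(4) w0] act_bx_Cmp[OF c2 a(3) w0] act_bx_Cmp[OF a(1,2) w0]
      s1_def[symmetric] s2_def[symmetric] s3_def[symmetric] s4_def[symmetric] s5_def[symmetric] s6_def[symmetric] s7_def[symmetric] s8_def[symmetric] ..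
  define m7 where "m7 = act n (mm S ((X \<odot> T) \<odot> (Y \<odot> Z))) s7"
  define m6 where "m6 = act n (mm S ((T \<odot> X) \<odot> (Y \<odot> Z))) s6"
  define m5 where "m5 = act n (mm S (T \<odot> (X \<odot> (Y \<odot> Z)))) s5"
  obtain us vs where sh: "cur s = us @ [O0] @ vs" "length us = n" using win_shape[OF w0] by blast
  have shs: "good s5" "cur s5 = us @ [O5] @ vs" "good s6" "cur s6 = us @ [O6] @ vs" "good s7" "cur s7 = us @ [O7] @ vs"
    "good s4" "cur s4 = us @ [O4] @ vs" "good s3" "cur s3 = us @ [O3] @ vs"
    using w5 w6 w7 w4 w3 sh by (auto simp: win_good s7_def s6_def s5_def s4_def s3_def s2_def s1_def)
  have g: "good s" by (rule win_good[OF w])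
  have 8: "act n (mm S (X \<odot> (T \<odot> (Y \<odot> Z)))) s8 = act (Suc n) (bx ((X \<odot> T) \<odot> (Y \<odot> Z)) (X \<odot> (T \<odot> (Y \<odot> Z))) (Assoc C X T (Y \<odot> Z))) m7"
    unfolding s8_def m7_def a8_def O7_def O8_def using w7 unfolding O7_def by (intro mm_bx_right obs arr_Assoc)
  have 7: "m7 = act (Suc n) (bx ((T \<odot> X) \<odot> (Y \<odot> Z)) ((X \<odot> T) \<odot> (Y \<odot> Z)) (Braid C T X \<star> Idt C (Y \<odot> Z))) m6"
    unfolding s7_def m7_def m6_def a7_def O6_def O7_def using w6 unfolding O6_def by (intro mm_bx_right obs arr_TMor arr_Braid arr_Idt)
  have 6: "m6 = act (Suc n) (bx (T \<odot> (X \<odot> (Y \<odot> Z))) ((T \<odot> X) \<odot> (Y \<odot> Z)) (InvAssoc C T X (Y \<odot> Z))) m5"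
    unfolding s6_def m6_def m5_def a6_def O5_def O6_def using w5 unfolding O5_def by (intro mm_bx_right obs arr_InvAssoc)
  have m7: "win (Suc n) [(X \<odot> T) \<odot> (Y \<odot> Z)] m7" unfolding m7_def using shs sh obs by (simp add: st_simps O7_def)
  have m6: "win (Suc n) [(T \<odot> X) \<odot> (Y \<odot> Z)] m6" unfolding m6_def using shs sh obs by (simp add: st_simps O6_def)
  have m5: "win (Suc n) [T \<odot> (X \<odot> (Y \<odot> Z))] m5" unfolding m5_def using shs sh obs by (simp add: st_simps O5_def)
  define q where "q = act (Suc n) (mm (T \<odot> X) (Y \<odot> Z)) m6"
  have q: "win (Suc n) [T \<odot> X] q" unfolding q_def m6_def using shs sh obs by (simp add: st_simps O6_def)
  \<comment> \<open>The last three factors: two associators around the braiding of \<open>T\<close>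
    with \<open>X\<close>.\<close>
  have A: "act (Suc (Suc n)) (mm T (Y \<odot> Z)) (act (Suc n) (mm X (T \<odot> (Y \<odot> Z))) (act n (mm S (X \<odot> (T \<odot> (Y \<odot> Z)))) s8))
    = act (Suc n) (brd T X) (act (Suc (Suc n)) (mm X (Y \<odot> Z)) (act (Suc n) (mm T (X \<odot> (Y \<odot> Z))) m5))"
  proof -
    have "act (Suc (Suc n)) (mm T (Y \<odot> Z)) (act (Suc n) (mm X (T \<odot> (Y \<odot> Z))) (act n (mm S (X \<odot> (T \<odot> (Y \<odot> Z)))) s8))
      = act (Suc n) (mm X T) (act (Suc n) (mm (X \<odot> T) (Y \<odot> Z)) m7)"
      unfolding 8 by (rule act_mm_Assoc[OF o(5,4) YZ m7])
    also have "act (Suc n) (mm (X \<odot> T) (Y \<odot> Z)) m7 = act (Suc n) (bx (T \<odot> X) (X \<odot> T) (Braid C T X)) q"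
      unfolding 7 q_def by (rule mm_bx_left[OF YZ arr_Braid[OF o(4,5)] m6])
    also have "act (Suc n) (mm X T) \<dots> = act (Suc n) (brd T X) (act (Suc n) (mm T X) q)"
      by (rule act_brd_mm[OF o(4,5) q, symmetric])
    also have "act (Suc n) (mm T X) q = act (Suc (Suc n)) (mm X (Y \<odot> Z)) (act (Suc n) (mm T (X \<odot> (Y \<odot> Z))) m5)"
      unfolding q_def 6 by (rule act_mm_InvAssoc[OF o(4,5) YZ m5])
    finally show ?thesis .
  qed
  define V where "V = act n (mm P ((Q \<odot> (X \<odot> Y)) \<odot> Z)) s"
  define U where "U = act (Suc n) (mm Q ((X \<odot> Y) \<odot> Z)) (act (Suc n) (bx ((Q \<odot> (X \<odot> Y)) \<odot> Z) (Q \<odot> ((X \<odot> Y) \<odot> Z)) (Assoc C Q (X \<odot> Y) Z)) V)"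
  have V: "good V" "cur V = us @ [P, (Q \<odot> (X \<odot> Y)) \<odot> Z] @ vs" unfolding V_def using g sh obs by (simp_all add: st_simps O0_def)
  have U: "good U" "cur U = us @ [P, Q, (X \<odot> Y) \<odot> Z] @ vs" unfolding U_def using V sh obs arr_Assoc[OF o(2) XY o(7)] by (simp_all add: st_simps)
  \<comment> \<open>The factors up to \<open>a5\<close>, with \<open>k\<close> among them;
    \<open>a1\<close> is contained in \<open>U\<close>, and \<open>a2\<close> survives as an
    associator on \<open>X\<close>, \<open>Y\<close>, \<open>Z\<close>.\<close>
  have B: "act (Suc n) (mm T (X \<odot> (Y \<odot> Z))) m5 = act n (bx2 P Q S T k) (act (Suc (Suc n)) (bx ((X \<odot> Y) \<odot> Z) (X \<odot> (Y \<odot> Z)) (Assoc C X Y Z)) U)"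
  proof -
    have "act (Suc n) (mm T (X \<odot> (Y \<odot> Z))) m5 = act n (mm S T) (act n (mm (S \<odot> T) (X \<odot> (Y \<odot> Z))) s4)"
      unfolding m5_def s5_def a5_def O4_def O5_def using w4 unfolding O4_def by (intro act_mm_Assoc obs)
    also have "act n (mm (S \<odot> T) (X \<odot> (Y \<odot> Z))) s4 = act n (bx (P \<odot> Q) (S \<odot> T) k) (act n (mm (P \<odot> Q) (X \<odot> (Y \<odot> Z))) s3)"
      unfolding s4_def a4_def O3_def O4_def using w3 unfolding O3_def by (intro mm_bx_left k obs)
    also have "act n (mm S T) \<dots> = act n (bx2 P Q S T k) (act n (mm P Q) (act n (mm (P \<odot> Q) (X \<odot> (Y \<odot> Z))) s3))"
      using shs sh obs by (intro act_bx2_mm[symmetric] obs k) (simp_all add: st_simps O3_def)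
    also have "act n (mm P Q) (act n (mm (P \<odot> Q) (X \<odot> (Y \<odot> Z))) s3) = act (Suc n) (mm Q (X \<odot> (Y \<odot> Z))) (act n (mm P (Q \<odot> (X \<odot> (Y \<odot> Z)))) s2)"
      unfolding s3_def a3_def O2_def O3_def using w2 unfolding O2_def by (intro act_mm_InvAssoc obs)
    also have "act n (mm P (Q \<odot> (X \<odot> (Y \<odot> Z)))) s2 = act (Suc n) (bx (Q \<odot> ((X \<odot> Y) \<odot> Z)) (Q \<odot> (X \<odot> (Y \<odot> Z))) (Idt C Q \<star> Assoc C X Y Z)) (act n (mm P (Q \<odot> ((X \<odot> Y) \<odot> Z))) s1)"
      unfolding s2_def a2_def O1_def O2_def using w1 unfolding O1_def by (intro mm_bx_right obs arr_TMor arr_Idt arr_Assoc)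
    also have "act n (mm P (Q \<odot> ((X \<odot> Y) \<odot> Z))) s1 = act (Suc n) (bx ((Q \<odot> (X \<odot> Y)) \<odot> Z) (Q \<odot> ((X \<odot> Y) \<odot> Z)) (Assoc C Q (X \<odot> Y) Z)) V"
      unfolding s1_def a1_def V_def O0_def O1_def using w0 unfolding O0_def by (intro mm_bx_right obs arr_Assoc)
    also have "act (Suc n) (mm Q (X \<odot> (Y \<odot> Z))) (act (Suc n) (bx (Q \<odot> ((X \<odot> Y) \<odot> Z)) (Q \<odot> (X \<odot> (Y \<odot> Z))) (Idt C Q \<star> Assoc C X Y Z))
       (act (Suc n) (bx ((Q \<odot> (X \<odot> Y)) \<odot> Z) (Q \<odot> ((X \<odot> Y) \<odot> Z)) (Assoc C Q (X \<odot> Y) Z)) V))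
      = act (Suc (Suc n)) (bx ((X \<odot> Y) \<odot> Z) (X \<odot> (Y \<odot> Z)) (Assoc C X Y Z)) U"
      unfolding U_def using V sh obs arr_Assoc[OF o(2) XY o(7)] by (intro mm_bx_right obs arr_Assoc) (simp_all add: st_simps)
    finally show ?thesis .
  qed
  note kk = box_ok_bx2[OF o(1-4) k] and asx = arr_Assoc[OF o(5-7)]
  define U1 where "U1 = act (Suc (Suc n)) (bx ((X \<odot> Y) \<odot> Z) (X \<odot> (Y \<odot> Z)) (Assoc C X Y Z)) U"
  have U1: "good U1" "cur U1 = us @ [P, Q, X \<odot> (Y \<odot> Z)] @ vs" unfolding U1_def using U sh obs asx by (simp_all add: st_simps)
  define U2 where "U2 = act (Suc (Suc n)) (mm X (Y \<odot> Z)) U1"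
  have U2: "good U2" "cur U2 = us @ [P, Q, X, Y \<odot> Z] @ vs" unfolding U2_def using U1 sh obs asx by (simp_all add: st_simps)
  \<comment> \<open>Splitting \<open>Y \<odot> Z\<close> touches neither \<open>k\<close> nor the
    braiding, so it can be done first, where it absorbs the remaining associator.\<close>
  have "act (n + 3) (mm Y Z) (act (Suc n) (brd T X) (act (Suc (Suc n)) (mm X (Y \<odot> Z)) (act n (bx2 P Q S T k) U1)))
    = act (n + 3) (mm Y Z) (act (Suc n) (brd T X) (act n (bx2 P Q S T k) U2))"
    unfolding U2_def using U1 sh obs kk by (subst exch[of "bx2 P Q S T k" "mm X (Y \<odot> Z)" n U1 "Suc (Suc n)"]) (simp_all add: st_simps)
  also have "\<dots> = act (Suc n) (brd T X) (act (n + 3) (mm Y Z) (act n (bx2 P Q S T k) U2))"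
    using U2 sh obs kk by (intro exch) (simp_all add: st_simps)
  also have "act (n + 3) (mm Y Z) (act n (bx2 P Q S T k) U2) = act n (bx2 P Q S T k) (act (n + 3) (mm Y Z) U2)"
    using U2 sh obs kk by (intro exch) (simp_all add: st_simps)
  also have "act (n + 3) (mm Y Z) U2 = act (Suc (Suc n)) (mm X Y) (act (Suc (Suc n)) (mm (X \<odot> Y) Z) U)"
    unfolding U2_def U1_def using act_mm_Assoc[OF o(5-7), of "Suc (Suc n)" U] U sh by (simp add: win_iff numeral_3_eq_3)
  also have "act (Suc (Suc n)) (mm (X \<odot> Y) Z) U = act (Suc n) (mm Q (X \<odot> Y)) (act (Suc n) (mm (Q \<odot> (X \<odot> Y)) Z) V)"
    unfolding U_def using V sh by (intro act_mm_Assoc obs) (simp add: win_iff)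
  finally show ?thesis unfolding tot using A B by (simp add: U1_def V_def)
qed

lemma ip_tbraid:
  assumes o: "R \<in> Obj C" "R' \<in> Obj C" "X \<in> Obj C" "Y \<in> Obj C" and k: "ip R R' k k'"
  shows "\<exists>g. ip (R \<odot> (X \<odot> Y)) (R' \<odot> (Y \<odot> X)) (tbraid R R' k X Y) g"
  unfolding tbraid_def
  using ip_Cmp[OF ip_TMor[OF k ip_Idt[OF TObj_in[OF o(3,4)]]] ip_TMor[OF ip_Idt[OF o(2)] ip_Braid[OF o(3,4)]]] by blast

text \<open>The counterpart of \<open>act_tassoc\<close>: splitting separates the part of the
  constraint on the cocycle object from the braiding of the arguments.\<close>

lemma act_tbraid:
  assumes o: "R \<in> Obj C" "R' \<in> Obj C" "X \<in> Obj C" "Y \<in> Obj C" and k: "arr R R' k"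
    and w: "win n [R \<odot> (X \<odot> Y)] s"
  shows "act (n + 1) (mm Y X) (act n (mm R' (Y \<odot> X)) (act n (bx (R \<odot> (X \<odot> Y)) (R' \<odot> (Y \<odot> X)) (tbraid R R' k X Y)) s))
    = act (n + 1) (brd X Y) (act n (bx R R' k) (act (n + 1) (mm X Y) (act n (mm R (X \<odot> Y)) s)))"
proof -
  note XY = TObj_in[OF o(3,4)] and YX = TObj_in[OF o(4,3)]
  note b = arr_Braid[OF o(3,4)]
  note a1 = arr_TMor[OF k arr_Idt[OF XY]] and a2 = arr_TMor[OF arr_Idt[OF o(2)] b]
  obtain us vs where sh: "cur s = us @ [R \<odot> (X \<odot> Y)] @ vs" "length us = n" using win_shape[OF w] by blast
  note g = win_good[OF w] and w1 = act_bx_ok[OF a1 w]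
  define s1 where "s1 = act n (mm R (X \<odot> Y)) s"
  have s1: "good s1" "cur s1 = us @ [R, X \<odot> Y] @ vs" unfolding s1_def using g sh o XY by (simp_all add: st_simps)
  have "act n (mm R' (Y \<odot> X)) (act n (bx (R \<odot> (X \<odot> Y)) (R' \<odot> (Y \<odot> X)) (tbraid R R' k X Y)) s)
    = act (Suc n) (bx (X \<odot> Y) (Y \<odot> X) (Braid C X Y)) (act n (bx R R' k) s1)"
    unfolding tbraid_def act_bx_Cmp[OF a1 a2 w] mm_bx_right[OF o(2) b w1] mm_bx_left[OF XY k w] s1_def ..
  also have "act (n + 1) (mm Y X) \<dots> = act (n + 1) (brd X Y) (act (n + 1) (mm X Y) (act n (bx R R' k) s1))"
    using act_brd_mm[OF o(3,4), of "Suc n" "act n (bx R R' k) s1"] s1 sh k by (simp add: st_simps)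
  also have "act (n + 1) (mm X Y) (act n (bx R R' k) s1) = act n (bx R R' k) (act (n + 1) (mm X Y) s1)"
    using s1 sh k o by (intro exch) (simp_all add: st_simps)
  finally show ?thesis by (simp add: s1_def)
qed

end

context monoidal_linear_category
begin

text \<open>Splitting is invertible, so an equation up to a scalar may be checked on completely
  split targets.\<close>

lemma mm_cancel:
  assumes o: "X \<in> Obj C" "Y \<in> Obj C" and w: "win n [X \<odot> Y] s" "win n [X \<odot> Y] s'"
    and e: "act n (mm X Y) s = sscl t (act n (mm X Y) s')"
  shows "s = sscl t s'"
proof -
  have "act n (mm X Y) s = act n (mm X Y) (sscl t s')"
    using e act_sscl[OF box_ok_mm[OF o]] w(2) by simp
  then have "act n (mi X Y) (act n (mm X Y) s) = act n (mi X Y) (act n (mm X Y) (sscl t s'))" by simp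
  then show ?thesis using act_mi_mm[OF o w(1)] act_mi_mm[OF o win_sscl[OF w(2)]] by simp
qed

end

section \<open>Pentagon and hexagons for the twisted constraints\<close>

context braided_tensor_category
begin

text \<open>By the second hexagon \<open>U \<odot> V\<close> passes \<open>X\<close> as one object,
  and naturality of the braiding lets \<open>f\<close> act before or after.\<close>

lemma brd_bx2_slide:
  assumes o: "U \<in> Obj C" "V \<in> Obj C" "U' \<in> Obj C" "V' \<in> Obj C" "X \<in> Obj C"
    and f: "arr (U \<odot> V) (U' \<odot> V') f" and w: "win n [U, V, X] s"
  shows "act (Suc n) (bx2 U V U' V' f) (act n (brd U X) (act (Suc n) (brd V X) s))
    = act n (brd U' X) (act (Suc n) (brd V' X) (act n (bx2 U V U' V' f) s))"
proof -
  note UV = TObj_in[OF o(1,2)] and UV' = TObj_in[OF o(3,4)]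
  obtain us vs where sh: "cur s = us @ [U, V, X] @ vs" "length us = n" using win_shape[OF w] by blast
  note g = win_good[OF w]
  define s' where "s' = act n (mi U V) s"
  have s': "good s'" "cur s' = us @ [U \<odot> V, X] @ vs" unfolding s'_def using g sh o by (simp_all add: st_simps)
  have e: "s = act n (mm U V) s'" using g sh o by (simp add: s'_def act_mm_mi st_simps)
  have ws: "win n [U \<odot> V] s'" "win n [U \<odot> V, X] s'" using s' sh by (simp_all add: win_iff)
  have "act (Suc n) (bx2 U V U' V' f) (act n (brd U X) (act (Suc n) (brd V X) s))
    = act (Suc n) (bx2 U V U' V' f) (act (Suc n) (mm U V) (act n (brd (U \<odot> V) X) s'))"
    unfolding e brd_hex2[OF o(1,2,5) ws(2)] ..
  also have "\<dots> = act (Suc n) (mm U' V') (act (Suc n) (bx (U \<odot> V) (U' \<odot> V') f) (act n (brd (U \<odot> V) X) s'))"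
    using s' sh o UV by (intro act_bx2_mm o f) (simp add: st_simps)
  also have "act (Suc n) (bx (U \<odot> V) (U' \<odot> V') f) (act n (brd (U \<odot> V) X) s') = act n (brd (U' \<odot> V') X) (act n (bx (U \<odot> V) (U' \<odot> V') f) s')"
    by (rule brd_bx1[OF f o(5) ws(2), symmetric])
  also have "act (Suc n) (mm U' V') \<dots> = act n (brd U' X) (act (Suc n) (brd V' X) (act n (mm U' V') (act n (bx (U \<odot> V) (U' \<odot> V') f) s')))"
    using s' sh f by (intro brd_hex2 o) (simp add: st_simps)
  also have "act n (mm U' V') (act n (bx (U \<odot> V) (U' \<odot> V') f) s') = act n (bx2 U V U' V' f) s"
    unfolding e by (rule act_bx2_mm[OF o(1-4) f ws(1), symmetric])
  finally show ?thesis .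
qed

lemma brdi_bx:
  assumes f: "arr T T' f" and X: "X \<in> Obj C" and w: "win n [X, T] s"
  shows "act n (brdi T' X) (act (Suc n) (bx T T' f) s) = act n (bx T T' f) (act n (brdi T X) s)"
proof -
  note o = arr_dom[OF f] arr_cod[OF f]
  obtain us vs where sh: "cur s = us @ [X, T] @ vs" "length us = n" using win_shape[OF w] by blast
  note g = win_good[OF w]
  define r where "r = act n (brdi T X) s"
  have r: "good r" "cur r = us @ [T, X] @ vs" unfolding r_def using g sh o X by (simp_all add: st_simps)
  have s: "s = act n (brd T X) r" unfolding r_def by (rule act_brd_brdi[OF o(1) X w, symmetric])
  have "act (Suc n) (bx T T' f) s = act n (brd T' X) (act n (bx T T' f) r)"
    unfolding s using r sh by (intro brd_bx1[OF f X, symmetric]) (simp add: win_iff)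
  moreover have "act n (brdi T' X) (act n (brd T' X) (act n (bx T T' f) r)) = act n (bx T T' f) r"
    using r sh f o X by (intro act_brdi_brd o X) (simp add: st_simps)
  ultimately show ?thesis by (simp add: r_def)
qed

text \<open>This is \<open>act_tassoc\<close> read backwards: the braiding and \<open>k\<close> are
  undone in the opposite order. The inverse \<open>g\<close> is a variable, to be instantiated with
  the definite description in \<open>tw_inv_assoc\<close>.\<close>

lemma act_tassoc_inv:
  assumes o: "P \<in> Obj C" "Q \<in> Obj C" "S \<in> Obj C" "T \<in> Obj C" "X \<in> Obj C" "Y \<in> Obj C" "Z \<in> Obj C"
    and k: "ip (P \<odot> Q) (S \<odot> T) k k'"
    and A: "ip (P \<odot> ((Q \<odot> (X \<odot> Y)) \<odot> Z)) (S \<odot> (X \<odot> (T \<odot> (Y \<odot> Z)))) (tassoc P Q S T k X Y Z) g"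
    and w: "win n [S \<odot> (X \<odot> (T \<odot> (Y \<odot> Z)))] s"
  shows "act (n + 2) (mm X Y) (act (n + 1) (mm Q (X \<odot> Y))
      (act (n + 1) (mm (Q \<odot> (X \<odot> Y)) Z) (act n (mm P ((Q \<odot> (X \<odot> Y)) \<odot> Z)) (act n (bx (S \<odot> (X \<odot> (T \<odot> (Y \<odot> Z)))) (P \<odot> ((Q \<odot> (X \<odot> Y)) \<odot> Z)) g) s))))
    = act n (bx2 S T P Q k') (act (n + 1) (brdi T X) (act (n + 3) (mm Y Z) (act (n + 2) (mm T (Y \<odot> Z)) (act (n + 1) (mm X (T \<odot> (Y \<odot> Z)))
      (act n (mm S (X \<odot> (T \<odot> (Y \<odot> Z)))) s)))))"
proof -
  note XY = TObj_in[OF o(5,6)] and YZ = TObj_in[OF o(6,7)]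
  note QXY = TObj_in[OF o(2) XY] note QXY_Z = TObj_in[OF QXY o(7)]
  obtain us vs where sh: "cur s = us @ [S \<odot> (X \<odot> (T \<odot> (Y \<odot> Z)))] @ vs" "length us = n" using win_shape[OF w] by blast
  note gs = win_good[OF w]
  define r where "r = act n (bx (S \<odot> (X \<odot> (T \<odot> (Y \<odot> Z)))) (P \<odot> ((Q \<odot> (X \<odot> Y)) \<odot> Z)) g) s"
  have wr: "win n [P \<odot> ((Q \<odot> (X \<odot> Y)) \<odot> Z)] r" unfolding r_def by (rule act_bx_ok[OF ipD(2)[OF A] w])
  have r: "good r" "cur r = us @ [P \<odot> ((Q \<odot> (X \<odot> Y)) \<odot> Z)] @ vs" using win_good[OF wr] sh by (simp_all add: r_def)
  have s: "s = act n (bx (P \<odot> ((Q \<odot> (X \<odot> Y)) \<odot> Z)) (S \<odot> (X \<odot> (T \<odot> (Y \<odot> Z)))) (tassoc P Q S T k X Y Z)) r"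
    unfolding r_def by (rule act_bx_inverse[OF ip_sym[OF A] w, symmetric])
  define D where "D = act (n + 2) (mm X Y) (act (n + 1) (mm Q (X \<odot> Y))
      (act (n + 1) (mm (Q \<odot> (X \<odot> Y)) Z) (act n (mm P ((Q \<odot> (X \<odot> Y)) \<odot> Z)) r)))"
  have D: "good D" "cur D = us @ [P, Q, X, Y, Z] @ vs"
    unfolding D_def using r sh o XY QXY QXY_Z by (simp_all add: st_simps)
  have "act (n + 3) (mm Y Z) (act (n + 2) (mm T (Y \<odot> Z)) (act (n + 1) (mm X (T \<odot> (Y \<odot> Z)))
      (act n (mm S (X \<odot> (T \<odot> (Y \<odot> Z)))) s))) = act (n + 1) (brd T X) (act n (bx2 P Q S T k) D)"
    using act_tassoc[OF o ipD(1)[OF k] wr] unfolding s[symmetric] D_def .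
  moreover have "act (n + 1) (brdi T X) (act (n + 1) (brd T X) (act n (bx2 P Q S T k) D)) = act n (bx2 P Q S T k) D"
    using D sh o ipD(1)[OF k] by (intro act_brdi_brd o) (simp add: st_simps)
  moreover have "act n (bx2 S T P Q k') (act n (bx2 P Q S T k) D) = D"
    using D sh by (intro act_bx2_inverse o k) (simp add: win_iff)
  ultimately show ?thesis by (simp only: r_def[symmetric] D_def[symmetric])
qed

text \<open>After splitting, both sides end with the braidings of \<open>T1\<close> and
  \<open>T2\<close> with \<open>X\<close> and of \<open>T1\<close> with \<open>Y\<close>. On the
  left \<open>T1\<close> has moreover been moved across \<open>N\<close>, because the first
  associator treats \<open>N \<odot> (X \<odot> Y)\<close> as one argument. This braiding stays in
  the hypothesis \<open>eq\<close>, which involves the cocycle objects alone; in the application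
  \<open>N\<close> is \<open>R x y\<close> and \<open>T1\<close> is \<open>R z w\<close>.\<close>

lemma twisted_pentagon:
  assumes o: "P \<in> Obj C" "Q \<in> Obj C" "N \<in> Obj C" "S1 \<in> Obj C" "T1 \<in> Obj C" "S2 \<in> Obj C" "T2 \<in> Obj C"
      "S' \<in> Obj C" "T' \<in> Obj C" "U \<in> Obj C" "X \<in> Obj C" "Y \<in> Obj C" "Z \<in> Obj C" "W \<in> Obj C"
    and k: "ip (P \<odot> Q) (S1 \<odot> T1) k1 k1'" "ip (S1 \<odot> N) (S2 \<odot> T2) k2 k2'" "ip (Q \<odot> N) (S' \<odot> T') k3 k3'"
      "ip (P \<odot> S') (S2 \<odot> U) k4 k4'" "ip (U \<odot> T') (T2 \<odot> T1) k5 k5'"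
    and eq: "\<And>n s. win n [P, Q, N] s \<Longrightarrow>
      act n (bx2 S1 N S2 T2 k2) (act (Suc n) (brd T1 N) (act n (bx2 P Q S1 T1 k1) s))
      = sscl t (act (Suc n) (bx2 U T' T2 T1 k5) (act n (bx2 P S' S2 U k4) (act (Suc n) (bx2 Q N S' T' k3) s)))"
  shows "tassoc S1 N S2 T2 k2 X Y (T1 \<odot> (Z \<odot> W)) \<cdot> tassoc P Q S1 T1 k1 (N \<odot> (X \<odot> Y)) Z W
    = Scl C t ((Idt C S2 \<star> (Idt C X \<star> tassoc U T' T2 T1 k5 Y Z W)) \<cdot> tassoc P S' S2 U k4 X (T' \<odot> (Y \<odot> Z)) W
      \<cdot> (Idt C P \<star> (tassoc Q N S' T' k3 X Y Z \<star> Idt C W)))"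
proof -
  note XY = TObj_in[OF o(11,12)] and YZ = TObj_in[OF o(12,13)] and ZW = TObj_in[OF o(13,14)]
  note NXY = TObj_in[OF o(3) XY] and TYZ = TObj_in[OF o(9) YZ] and TZW = TObj_in[OF o(5) ZW]
  note obs = o XY YZ ZW NXY TYZ TZW
  note kk = k(1-5)[THEN ipD(1)]
  define A1 where "A1 = tassoc P Q S1 T1 k1 (N \<odot> (X \<odot> Y)) Z W"
  define A2 where "A2 = tassoc S1 N S2 T2 k2 X Y (T1 \<odot> (Z \<odot> W))"
  define A3 where "A3 = tassoc Q N S' T' k3 X Y Z"
  define A4 where "A4 = tassoc P S' S2 U k4 X (T' \<odot> (Y \<odot> Z)) W"
  define A5 where "A5 = tassoc U T' T2 T1 k5 Y Z W"
  define O0 where "O0 = P \<odot> ((Q \<odot> ((N \<odot> (X \<odot> Y)) \<odot> Z)) \<odot> W)"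
  define O1 where "O1 = S1 \<odot> ((N \<odot> (X \<odot> Y)) \<odot> (T1 \<odot> (Z \<odot> W)))"
  define O2 where "O2 = S2 \<odot> (X \<odot> (T2 \<odot> (Y \<odot> (T1 \<odot> (Z \<odot> W)))))"
  define O3 where "O3 = P \<odot> ((S' \<odot> (X \<odot> (T' \<odot> (Y \<odot> Z)))) \<odot> W)"
  define O4 where "O4 = S2 \<odot> (X \<odot> (U \<odot> ((T' \<odot> (Y \<odot> Z)) \<odot> W)))"
  have A1: "arr O0 O1 A1" unfolding O0_def O1_def A1_def using ip_tassoc[OF o(1,2,4,5) NXY o(13,14) k(1)] ipD(1) by blast
  have A2: "arr O1 O2 A2" unfolding O1_def O2_def A2_def using ip_tassoc[OF o(4,3,6,7,11,12) TZW k(2)] ipD(1) by blast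
  have A3: "arr (Q \<odot> ((N \<odot> (X \<odot> Y)) \<odot> Z)) (S' \<odot> (X \<odot> (T' \<odot> (Y \<odot> Z)))) A3"
    unfolding A3_def using ip_tassoc[OF o(2,3,8,9,11-13) k(3)] ipD(1) by blast
  have A4: "arr O3 O4 A4" unfolding O3_def O4_def A4_def using ip_tassoc[OF o(1,8,6,10,11) TYZ o(14) k(4)] ipD(1) by blast
  have A5: "arr (U \<odot> ((T' \<odot> (Y \<odot> Z)) \<odot> W)) (T2 \<odot> (Y \<odot> (T1 \<odot> (Z \<odot> W)))) A5"
    unfolding A5_def using ip_tassoc[OF o(10,9,7,5,12-14) k(5)] ipD(1) by blast
  note A3W = arr_TMor[OF A3 arr_Idt[OF o(14)]] note PA3 = arr_TMor[OF arr_Idt[OF o(1)] A3W, folded O0_def O3_def]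
  note XA5 = arr_TMor[OF arr_Idt[OF o(11)] A5] note SA5 = arr_TMor[OF arr_Idt[OF o(6)] XA5, folded O4_def O2_def]
  define i where "i = idst [O0] (Unit C)"
  have i: "good i" "cur i = [O0]" using arr_dom[OF A1] Unit_in by (simp_all add: i_def good_idst)
  have i': "cur i = [P \<odot> ((Q \<odot> ((N \<odot> (X \<odot> Y)) \<odot> Z)) \<odot> W)]" using i by (simp add: O0_def)
  define p where "p = act 1 (mm (Q \<odot> ((N \<odot> (X \<odot> Y)) \<odot> Z)) W) (act 0 (mm P ((Q \<odot> ((N \<odot> (X \<odot> Y)) \<odot> Z)) \<odot> W)) i)"
  have p: "good p" "cur p = [P, Q \<odot> ((N \<odot> (X \<odot> Y)) \<odot> Z), W]"
    unfolding p_def using i i' o NXY by (simp_all add: st_simps TObj_in)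
  define v where "v = act 2 (mm (N \<odot> (X \<odot> Y)) Z) (act 1 (mm Q ((N \<odot> (X \<odot> Y)) \<odot> Z)) p)"
  have v: "good v" "cur v = [P, Q, N \<odot> (X \<odot> Y), Z, W]"
    unfolding v_def using p o NXY by (simp_all add: st_simps TObj_in)
  define s where "s = act 3 (mm X Y) (act 2 (mm N (X \<odot> Y)) v)"
  have s: "good s" "cur s = [P, Q, N, X, Y, Z, W]"
    unfolding s_def using v obs by (simp_all add: st_simps)
  note bk = box_ok_bx2[OF o(1,2,4,5) kk(1)] box_ok_bx2[OF o(4,3,6,7) kk(2)] box_ok_bx2[OF o(2,3,8,9) kk(3)]
    box_ok_bx2[OF o(1,8,6,10) kk(4)] box_ok_bx2[OF o(10,9,7,5) kk(5)]
  \<comment> \<open>Splits the common target completely; \<open>cancel\<close> undoes it at the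
    end.\<close>
  define D where "D = (\<lambda>q. act 5 (mm Z W) (act 4 (mm T1 (Z \<odot> W)) (act 3 (mm Y (T1 \<odot> (Z \<odot> W))) (act 2 (mm T2 (Y \<odot> (T1 \<odot> (Z \<odot> W))))
    (act 1 (mm X (T2 \<odot> (Y \<odot> (T1 \<odot> (Z \<odot> W))))) (act 0 (mm S2 (X \<odot> (T2 \<odot> (Y \<odot> (T1 \<odot> (Z \<odot> W)))))) q))))))"
  define s1 where "s1 = act 0 (bx O0 O1 A1) i"
  have s1: "good s1" "cur s1 = [O1]" unfolding s1_def using i A1 by (simp_all add: st_simps)
  define l where "l = act 0 (bx2 P Q S1 T1 k1) s"
  have l: "good l" "cur l = [S1, T1, N, X, Y, Z, W]" unfolding l_def using s bk by (simp_all add: st_simps)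

  have L1: "act 3 (mm Z W) (act 2 (mm T1 (Z \<odot> W)) (act 1 (mm (N \<odot> (X \<odot> Y)) (T1 \<odot> (Z \<odot> W))) (act 0 (mm S1 ((N \<odot> (X \<odot> Y)) \<odot> (T1 \<odot> (Z \<odot> W)))) s1)))
    = act 1 (brd T1 (N \<odot> (X \<odot> Y))) (act 0 (bx2 P Q S1 T1 k1) v)"
    unfolding s1_def A1_def O0_def O1_def v_def p_def
    using act_tassoc[OF o(1,2,4,5) NXY o(13,14) kk(1), of 0 i] i i' by (simp add: win_iff numeral_2_eq_2 numeral_3_eq_3)
  define q1 where "q1 = act 1 (mm (N \<odot> (X \<odot> Y)) (T1 \<odot> (Z \<odot> W))) (act 0 (mm S1 ((N \<odot> (X \<odot> Y)) \<odot> (T1 \<odot> (Z \<odot> W)))) s1)"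
  have q1: "good q1" "cur q1 = [S1, N \<odot> (X \<odot> Y), T1 \<odot> (Z \<odot> W)]" unfolding q1_def using s1 obs by (simp_all add: st_simps O1_def TObj_in)
  have L2: "act 3 (mm Y (T1 \<odot> (Z \<odot> W))) (act 2 (mm T2 (Y \<odot> (T1 \<odot> (Z \<odot> W)))) (act 1 (mm X (T2 \<odot> (Y \<odot> (T1 \<odot> (Z \<odot> W)))))
      (act 0 (mm S2 (X \<odot> (T2 \<odot> (Y \<odot> (T1 \<odot> (Z \<odot> W)))))) (act 0 (bx O1 O2 A2) s1))))
    = act 1 (brd T2 X) (act 0 (bx2 S1 N S2 T2 k2) (act 2 (mm X Y) (act 1 (mm N (X \<odot> Y)) q1)))"
    unfolding A2_def O1_def O2_def q1_def
    using act_tassoc[OF o(4,3,6,7,11,12) TZW kk(2), of 0 s1] s1 by (simp add: win_iff numeral_2_eq_2 numeral_3_eq_3 O1_def)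
  have L3: "act 5 (mm Z W) (act 4 (mm T1 (Z \<odot> W)) (act 1 (brd T2 X) (act 0 (bx2 S1 N S2 T2 k2) (act 2 (mm X Y) (act 1 (mm N (X \<odot> Y)) q1)))))
    = act 1 (brd T2 X) (act 0 (bx2 S1 N S2 T2 k2) (act 2 (mm X Y) (act 1 (mm N (X \<odot> Y)) (act 3 (mm Z W) (act 2 (mm T1 (Z \<odot> W)) q1)))))"
  proof -
    \<comment> \<open>A box behind \<open>S1\<close> and \<open>N \<odot> (X \<odot> Y)\<close>
      commutes with everything done to these two. The two splittings add two entries to the list,
      which moves \<open>G\<close> from \<open>Suc m\<close> to
      \<open>Suc (Suc (Suc m))\<close>.\<close>
    have *: "act (Suc (Suc (Suc m))) G (act 1 (brd T2 X) (act 0 (bx2 S1 N S2 T2 k2) (act 2 (mm X Y) (act 1 (mm N (X \<odot> Y)) q))))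
      = act 1 (brd T2 X) (act 0 (bx2 S1 N S2 T2 k2) (act 2 (mm X Y) (act 1 (mm N (X \<odot> Y)) (act (Suc m) G q))))"
      if h: "good q" "cur q = S1 # (N \<odot> (X \<odot> Y)) # rest" "win (Suc m) (bdom G) q" "box_ok G" "1 \<le> m" for q G rest m
    proof -
      define b where "b = act 1 (mm N (X \<odot> Y)) q"
      have b: "good b" "cur b = S1 # N # (X \<odot> Y) # rest" unfolding b_def using h obs by (simp_all add: st_simps)
      define c where "c = act 2 (mm X Y) b"
      have c: "good c" "cur c = S1 # N # X # Y # rest" unfolding c_def using b obs by (simp_all add: st_simps)
      define d where "d = act 0 (bx2 S1 N S2 T2 k2) c"
      have d: "good d" "cur d = S2 # T2 # X # Y # rest" unfolding d_def using c bk by (simp_all add: st_simps)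
      have wG: "m + length (bdom G) \<le> Suc (length rest)" "take (length (bdom G)) (drop m ((N \<odot> (X \<odot> Y)) # rest)) = bdom G"
        using h by (simp_all add: win_iff)
      obtain j where m: "m = Suc j" using h(5) by (cases m) auto
      have wG': "j + length (bdom G) \<le> length rest" "take (length (bdom G)) (drop j rest) = bdom G"
        using wG by (simp_all add: m)
      have "act (Suc (Suc (Suc m))) G (act 1 (brd T2 X) d) = act 1 (brd T2 X) (act (Suc (Suc (Suc m))) G d)"
        using d obs h(4) wG' by (intro exch) (simp_all add: win_iff m)
      also have "act (Suc (Suc (Suc m))) G d = act 0 (bx2 S1 N S2 T2 k2) (act (Suc (Suc (Suc m))) G c)"
        unfolding d_def using c obs bk h(4) wG' by (intro exch) (simp_all add: win_iff m)
      also have "act (Suc (Suc (Suc m))) G c = act 2 (mm X Y) (act (Suc (Suc m)) G b)"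
        unfolding c_def using b obs h(4) wG' by (intro exch) (simp_all add: win_iff m)
      also have "act (Suc (Suc m)) G b = act 1 (mm N (X \<odot> Y)) (act (Suc m) G q)"
        unfolding b_def using h wG' obs by (intro exch) (simp_all add: win_iff m)
      finally show ?thesis by (simp add: b_def c_def d_def)
    qed
    have e4: "act 4 (mm T1 (Z \<odot> W)) (act 1 (brd T2 X) (act 0 (bx2 S1 N S2 T2 k2) (act 2 (mm X Y) (act 1 (mm N (X \<odot> Y)) q1))))
     = act 1 (brd T2 X) (act 0 (bx2 S1 N S2 T2 k2) (act 2 (mm X Y) (act 1 (mm N (X \<odot> Y)) (act 2 (mm T1 (Z \<odot> W)) q1))))"
      using *[of q1 _ 1 "mm T1 (Z \<odot> W)"] q1 obs by (simp add: win_iff eval_nat_numeral)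
    have q2: "good (act 2 (mm T1 (Z \<odot> W)) q1)" "cur (act 2 (mm T1 (Z \<odot> W)) q1) = [S1, N \<odot> (X \<odot> Y), T1, Z \<odot> W]"
      using q1 obs by (simp_all add: st_simps)
    show ?thesis unfolding e4
      using *[of "act 2 (mm T1 (Z \<odot> W)) q1" _ 2 "mm Z W"] q2 obs by (simp add: win_iff eval_nat_numeral)
  qed
  define b where "b = act 0 (bx2 P Q S1 T1 k1) v"
  have b: "good b" "cur b = [S1, T1, N \<odot> (X \<odot> Y), Z, W]" unfolding b_def using v bk by (simp_all add: st_simps)
  \<comment> \<open>Two hexagons let \<open>T1\<close> pass \<open>N\<close>, \<open>X\<close> and
    \<open>Y\<close> one at a time.\<close>
  have L4: "act 2 (mm X Y) (act 1 (mm N (X \<odot> Y)) (act 1 (brd T1 (N \<odot> (X \<odot> Y))) b))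
    = act 3 (brd T1 Y) (act 2 (brd T1 X) (act 1 (brd T1 N) l))"
  proof -
    define b2 where "b2 = act 2 (mm N (X \<odot> Y)) b"
    have b2: "good b2" "cur b2 = [S1, T1, N, X \<odot> Y, Z, W]" unfolding b2_def using b obs by (simp_all add: st_simps)
    have "act 1 (mm N (X \<odot> Y)) (act 1 (brd T1 (N \<odot> (X \<odot> Y))) b) = act 2 (brd T1 (X \<odot> Y)) (act 1 (brd T1 N) b2)"
      unfolding b2_def using brd_hex1[OF o(5,3) XY, of 1 b] b by (simp add: win_iff eval_nat_numeral)
    also have "act 2 (mm X Y) \<dots> = act 3 (brd T1 Y) (act 2 (brd T1 X) (act 3 (mm X Y) (act 1 (brd T1 N) b2)))"
      using brd_hex1[OF o(5,11,12), of 2 "act 1 (brd T1 N) b2"] b2 obs by (simp add: st_simps eval_nat_numeral)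
    also have "act 3 (mm X Y) (act 1 (brd T1 N) b2) = act 1 (brd T1 N) (act 3 (mm X Y) b2)"
      using b2 obs by (intro exch) (simp_all add: st_simps)
    also have "b2 = act 0 (bx2 P Q S1 T1 k1) (act 2 (mm N (X \<odot> Y)) v)"
      unfolding b2_def b_def using v obs bk by (intro exch) (simp_all add: st_simps)
    also have "act 3 (mm X Y) \<dots> = l"
      unfolding l_def s_def using v obs bk by (intro exch) (simp_all add: st_simps)
    finally show ?thesis .
  qed
  define l3 where "l3 = act 1 (brd T1 N) l"
  have l3: "good l3" "cur l3 = [S1, N, T1, X, Y, Z, W]" unfolding l3_def using l obs by (simp_all add: st_simps)
  have LHS: "D (act 0 (bx O0 O2 (A2 \<cdot> A1)) i)
    = act 1 (brd T2 X) (act 3 (brd T1 Y) (act 2 (brd T1 X) (act 0 (bx2 S1 N S2 T2 k2) l3)))"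
  proof -
    have "act 0 (bx O0 O2 (A2 \<cdot> A1)) i = act 0 (bx O1 O2 A2) s1"
      unfolding s1_def using i by (intro act_bx_Cmp A1 A2) (simp add: win_iff)
    then have "D (act 0 (bx O0 O2 (A2 \<cdot> A1)) i) = act 1 (brd T2 X) (act 0 (bx2 S1 N S2 T2 k2) (act 2 (mm X Y) (act 1 (mm N (X \<odot> Y)) (act 3 (mm Z W) (act 2 (mm T1 (Z \<odot> W)) q1)))))"
      unfolding D_def using L2 L3 by simp
    also have "\<dots> = act 1 (brd T2 X) (act 0 (bx2 S1 N S2 T2 k2) (act 3 (brd T1 Y) (act 2 (brd T1 X) l3)))"
      using L1 L4 by (simp add: q1_def b_def l3_def)
    also have "act 0 (bx2 S1 N S2 T2 k2) (act 3 (brd T1 Y) (act 2 (brd T1 X) l3)) = act 3 (brd T1 Y) (act 0 (bx2 S1 N S2 T2 k2) (act 2 (brd T1 X) l3))"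
      using l3 obs bk by (intro exch[symmetric]) (simp_all add: st_simps)
    also have "act 0 (bx2 S1 N S2 T2 k2) (act 2 (brd T1 X) l3) = act 2 (brd T1 X) (act 0 (bx2 S1 N S2 T2 k2) l3)"
      using l3 obs bk by (intro exch[symmetric]) (simp_all add: st_simps)
    finally show ?thesis .
  qed

  define j where "j = act 0 (bx O0 O3 (Idt C P \<star> (A3 \<star> Idt C W))) i"
  have j: "good j" "cur j = [O3]" unfolding j_def using i PA3 by (simp_all add: st_simps)
  define j4 where "j4 = act 0 (bx O3 O4 A4) j"
  have j4: "good j4" "cur j4 = [O4]" unfolding j4_def using j A4 by (simp_all add: st_simps)
  define q4 where "q4 = act 1 (mm X (U \<odot> ((T' \<odot> (Y \<odot> Z)) \<odot> W))) (act 0 (mm S2 (X \<odot> (U \<odot> ((T' \<odot> (Y \<odot> Z)) \<odot> W)))) j4)"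
  have q4: "good q4" "cur q4 = [S2, X, U \<odot> ((T' \<odot> (Y \<odot> Z)) \<odot> W)]" unfolding q4_def using j4 obs by (simp_all add: st_simps O4_def TObj_in)
  define x3 where "x3 = act 1 (bx (Q \<odot> ((N \<odot> (X \<odot> Y)) \<odot> Z)) (S' \<odot> (X \<odot> (T' \<odot> (Y \<odot> Z)))) A3) p"
  have x3: "good x3" "cur x3 = [P, S' \<odot> (X \<odot> (T' \<odot> (Y \<odot> Z))), W]" unfolding x3_def using p A3 by (simp_all add: st_simps)
  have R0: "act 1 (mm (S' \<odot> (X \<odot> (T' \<odot> (Y \<odot> Z)))) W) (act 0 (mm P ((S' \<odot> (X \<odot> (T' \<odot> (Y \<odot> Z)))) \<odot> W)) j) = x3"
  proof -
    have "act 0 (mm P ((S' \<odot> (X \<odot> (T' \<odot> (Y \<odot> Z)))) \<odot> W)) j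
      = act 1 (bx ((Q \<odot> ((N \<odot> (X \<odot> Y)) \<odot> Z)) \<odot> W) ((S' \<odot> (X \<odot> (T' \<odot> (Y \<odot> Z)))) \<odot> W) (A3 \<star> Idt C W)) (act 0 (mm P ((Q \<odot> ((N \<odot> (X \<odot> Y)) \<odot> Z)) \<odot> W)) i)"
      unfolding j_def O0_def O3_def using mm_bx_right[OF o(1) A3W, of 0 i] i i' by (simp add: win_iff)
    also have "act 1 (mm (S' \<odot> (X \<odot> (T' \<odot> (Y \<odot> Z)))) W) \<dots> = x3"
      unfolding x3_def p_def using i i' A3 o by (intro mm_bx_left o A3) (simp add: st_simps arr_dom TObj_in)
    finally show ?thesis .
  qed
  define y where "y = act 2 (mm X (T' \<odot> (Y \<odot> Z))) (act 1 (mm S' (X \<odot> (T' \<odot> (Y \<odot> Z)))) x3)"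
  have y: "good y" "cur y = [P, S', X, T' \<odot> (Y \<odot> Z), W]" unfolding y_def using x3 obs by (simp_all add: st_simps TObj_in)
  have R1: "act 3 (mm (T' \<odot> (Y \<odot> Z)) W) (act 2 (mm U ((T' \<odot> (Y \<odot> Z)) \<odot> W)) q4) = act 1 (brd U X) (act 0 (bx2 P S' S2 U k4) y)"
    unfolding q4_def j4_def A4_def O3_def O4_def y_def R0[symmetric]
    using act_tassoc[OF o(1,8,6,10,11) TYZ o(14) kk(4), of 0 j] j by (simp add: win_iff numeral_2_eq_2 numeral_3_eq_3 O3_def)
  have R2: "act 4 (mm Y Z) (act 3 (mm T' (Y \<odot> Z)) y) = act 2 (brd T' X) (act 1 (bx2 Q N S' T' k3) s)"
    unfolding y_def x3_def A3_def s_def v_def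
    using act_tassoc[OF o(2,3,8,9,11-13) kk(3), of 1 p] p by (simp add: win_iff eval_nat_numeral)
  have R3: "act 5 (mm Z W) (act 4 (mm T1 (Z \<odot> W)) (act 3 (mm Y (T1 \<odot> (Z \<odot> W))) (act 2 (mm T2 (Y \<odot> (T1 \<odot> (Z \<odot> W))))
      (act 2 (bx (U \<odot> ((T' \<odot> (Y \<odot> Z)) \<odot> W)) (T2 \<odot> (Y \<odot> (T1 \<odot> (Z \<odot> W)))) A5) q4))))
    = act 3 (brd T1 Y) (act 2 (bx2 U T' T2 T1 k5) (act 4 (mm Y Z) (act 3 (mm T' (Y \<odot> Z)) (act 3 (mm (T' \<odot> (Y \<odot> Z)) W) (act 2 (mm U ((T' \<odot> (Y \<odot> Z)) \<odot> W)) q4)))))"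
    unfolding A5_def
    using act_tassoc[OF o(10,9,7,5,12-14) kk(5), of 2 q4] q4 by (simp add: win_iff eval_nat_numeral)
  define w where "w = act 1 (bx2 Q N S' T' k3) s"
  have w: "good w" "cur w = [P, S', T', X, Y, Z, W]" unfolding w_def using s bk by (simp_all add: st_simps)
  define w2 where "w2 = act 0 (bx2 P S' S2 U k4) w"
  have w2: "good w2" "cur w2 = [S2, U, T', X, Y, Z, W]" unfolding w2_def using w bk by (simp_all add: st_simps)
  define w5 where "w5 = act 1 (bx2 U T' T2 T1 k5) w2"
  have w5: "good w5" "cur w5 = [S2, T2, T1, X, Y, Z, W]" unfolding w5_def using w2 bk by (simp_all add: st_simps)
  have RHS: "D (act 0 (bx O0 O2 ((Idt C S2 \<star> (Idt C X \<star> A5)) \<cdot> A4 \<cdot> (Idt C P \<star> (A3 \<star> Idt C W)))) i)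
    = act 1 (brd T2 X) (act 3 (brd T1 Y) (act 2 (brd T1 X) w5))"
  proof -
    have "act 0 (bx O0 O2 ((Idt C S2 \<star> (Idt C X \<star> A5)) \<cdot> A4 \<cdot> (Idt C P \<star> (A3 \<star> Idt C W)))) i
      = act 0 (bx O4 O2 (Idt C S2 \<star> (Idt C X \<star> A5))) j4"
      unfolding j4_def j_def using i
      by (subst act_bx_Cmp[OF arr_Cmp[OF A4 PA3] SA5]) (simp_all add: win_iff act_bx_Cmp[OF PA3 A4])
    moreover have "act 0 (mm S2 (X \<odot> (T2 \<odot> (Y \<odot> (T1 \<odot> (Z \<odot> W)))))) (act 0 (bx O4 O2 (Idt C S2 \<star> (Idt C X \<star> A5))) j4)
      = act 1 (bx (X \<odot> (U \<odot> ((T' \<odot> (Y \<odot> Z)) \<odot> W))) (X \<odot> (T2 \<odot> (Y \<odot> (T1 \<odot> (Z \<odot> W))))) (Idt C X \<star> A5)) (act 0 (mm S2 (X \<odot> (U \<odot> ((T' \<odot> (Y \<odot> Z)) \<odot> W)))) j4)"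
      unfolding O4_def O2_def using mm_bx_right[OF o(6) XA5, of 0 j4] j4 by (simp add: win_iff O4_def)
    moreover have "act 1 (mm X (T2 \<odot> (Y \<odot> (T1 \<odot> (Z \<odot> W))))) \<dots>
      = act 2 (bx (U \<odot> ((T' \<odot> (Y \<odot> Z)) \<odot> W)) (T2 \<odot> (Y \<odot> (T1 \<odot> (Z \<odot> W)))) A5) q4"
      unfolding q4_def using mm_bx_right[OF o(11) A5, of 1 "act 0 (mm S2 (X \<odot> (U \<odot> ((T' \<odot> (Y \<odot> Z)) \<odot> W)))) j4"] j4 obs
      by (simp add: st_simps O4_def numeral_2_eq_2 TObj_in)
    ultimately have "D (act 0 (bx O0 O2 ((Idt C S2 \<star> (Idt C X \<star> A5)) \<cdot> A4 \<cdot> (Idt C P \<star> (A3 \<star> Idt C W)))) i)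
      = act 3 (brd T1 Y) (act 2 (bx2 U T' T2 T1 k5) (act 4 (mm Y Z) (act 3 (mm T' (Y \<odot> Z)) (act 1 (brd U X) (act 0 (bx2 P S' S2 U k4) y)))))"
      unfolding D_def using R3 R1 by simp
    also have "act 3 (mm T' (Y \<odot> Z)) (act 1 (brd U X) (act 0 (bx2 P S' S2 U k4) y)) = act 1 (brd U X) (act 3 (mm T' (Y \<odot> Z)) (act 0 (bx2 P S' S2 U k4) y))"
      using y obs bk by (intro exch) (simp_all add: st_simps)
    also have "act 3 (mm T' (Y \<odot> Z)) (act 0 (bx2 P S' S2 U k4) y) = act 0 (bx2 P S' S2 U k4) (act 3 (mm T' (Y \<odot> Z)) y)"
      using y obs bk by (intro exch) (simp_all add: st_simps)
    also have "act 4 (mm Y Z) (act 1 (brd U X) (act 0 (bx2 P S' S2 U k4) (act 3 (mm T' (Y \<odot> Z)) y)))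
      = act 1 (brd U X) (act 4 (mm Y Z) (act 0 (bx2 P S' S2 U k4) (act 3 (mm T' (Y \<odot> Z)) y)))"
      using y obs bk by (intro exch) (simp_all add: st_simps)
    also have "act 4 (mm Y Z) (act 0 (bx2 P S' S2 U k4) (act 3 (mm T' (Y \<odot> Z)) y)) = act 0 (bx2 P S' S2 U k4) (act 4 (mm Y Z) (act 3 (mm T' (Y \<odot> Z)) y))"
      using y obs bk by (intro exch) (simp_all add: st_simps)
    also have "act 4 (mm Y Z) (act 3 (mm T' (Y \<odot> Z)) y) = act 2 (brd T' X) w" using R2 by (simp add: w_def)
    also have "act 0 (bx2 P S' S2 U k4) (act 2 (brd T' X) w) = act 2 (brd T' X) w2"
      unfolding w2_def using w obs bk by (intro exch[symmetric]) (simp_all add: st_simps)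
    \<comment> \<open>The isomorphism \<open>k5\<close> slides through the braidings of
      \<open>U\<close> and \<open>T'\<close> with \<open>X\<close>, which thereby become those of
      \<open>T2\<close> and \<open>T1\<close>.\<close>
    also have "act 2 (bx2 U T' T2 T1 k5) (act 1 (brd U X) (act 2 (brd T' X) w2)) = act 1 (brd T2 X) (act 2 (brd T1 X) w5)"
      unfolding w5_def using brd_bx2_slide[OF o(10,9,7,5,11) kk(5), of 1 w2] w2 by (simp add: win_iff numeral_2_eq_2)
    also have "act 3 (brd T1 Y) \<dots> = act 1 (brd T2 X) (act 3 (brd T1 Y) (act 2 (brd T1 X) w5))"
      using w5 obs by (intro exch) (simp_all add: st_simps)
    finally show ?thesis .
  qed
  have "act 0 (bx2 S1 N S2 T2 k2) l3 = sscl t w5"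
    unfolding l3_def l_def w5_def w2_def w_def using eq[of 0 s] s by (simp add: win_iff)
  then have fin: "D (act 0 (bx O0 O2 (A2 \<cdot> A1)) i) = sscl t (D (act 0 (bx O0 O2 ((Idt C S2 \<star> (Idt C X \<star> A5)) \<cdot> A4 \<cdot> (Idt C P \<star> (A3 \<star> Idt C W)))) i))"
    unfolding LHS RHS using w5 obs by (simp add: act_sscl st_simps)
  note f1 = arr_Cmp[OF A2 A1] and f2 = arr_Cmp[OF SA5 arr_Cmp[OF A4 PA3]]
  \<comment> \<open>The splittings in \<open>D\<close> are cancelled in turn: the last premise of
    each use of \<open>mm_cancel\<close> is the equation one splitting further, until the assumption
    about \<open>D\<close> is reached.\<close>
  have cancel: "q = sscl t q'" if "D q = sscl t (D q')" "good q" "good q'" "cur q = [O2]" "cur q' = [O2]" for q q'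
  proof -
    have c: "cur q = [S2 \<odot> (X \<odot> (T2 \<odot> (Y \<odot> (T1 \<odot> (Z \<odot> W)))))]" "cur q' = [S2 \<odot> (X \<odot> (T2 \<odot> (Y \<odot> (T1 \<odot> (Z \<odot> W)))))]"
      using that by (simp_all add: O2_def)
    note ob2 = obs TObj_in[OF o(12) TZW] TObj_in[OF o(7) TObj_in[OF o(12) TZW]] TObj_in[OF o(11) TObj_in[OF o(7) TObj_in[OF o(12) TZW]]]
    note z = that(2,3) c ob2
    note m5 = mm_cancel[OF _ _ _ _ that(1)[unfolded D_def]]
    show ?thesis
      apply (rule mm_cancel[of S2 "X \<odot> (T2 \<odot> (Y \<odot> (T1 \<odot> (Z \<odot> W))))" 0])
          prefer 5
          apply (rule mm_cancel[of X "T2 \<odot> (Y \<odot> (T1 \<odot> (Z \<odot> W)))" 1])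
              prefer 5
              apply (rule mm_cancel[of T2 "Y \<odot> (T1 \<odot> (Z \<odot> W))" 2])
                  prefer 5
                  apply (rule mm_cancel[of Y "T1 \<odot> (Z \<odot> W)" 3])
                      prefer 5
                      apply (rule mm_cancel[of T1 "Z \<odot> W" 4])
                          prefer 5
                          apply (rule m5)
      using z by (simp_all add: st_simps)
  qed
  have "act 0 (bx O0 O2 (A2 \<cdot> A1)) i = sscl t (act 0 (bx O0 O2 ((Idt C S2 \<star> (Idt C X \<star> A5)) \<cdot> A4 \<cdot> (Idt C P \<star> (A3 \<star> Idt C W)))) i)"
    by (rule cancel[OF fin]) (use i in \<open>simp_all add: st_simps f1 f2\<close>)
  then have "A2 \<cdot> A1 = Scl C t ((Idt C S2 \<star> (Idt C X \<star> A5)) \<cdot> A4 \<cdot> (Idt C P \<star> (A3 \<star> Idt C W)))"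
    unfolding i_def by (rule act_bx_faithful[OF f1 f2])
  then show ?thesis by (simp add: A1_def A2_def A3_def A4_def A5_def)
qed

text \<open>Both sides end with the braidings of \<open>X\<close> with \<open>Y\<close> and
  \<open>Z\<close> and of \<open>T2\<close> with \<open>Y\<close>. On the left \<open>T\<close> also
  passes \<open>X\<close> in the first associator and comes back inside the braiding of
  \<open>X\<close> with \<open>T \<odot> (Y \<odot> Z)\<close>, which leaves the factor
  \<open>u\<close>.\<close>

lemma twisted_hexagon1:
  assumes o: "P \<in> Obj C" "Q \<in> Obj C" "S \<in> Obj C" "T \<in> Obj C" "S' \<in> Obj C" "S2 \<in> Obj C" "T2 \<in> Obj C"
      "Q' \<in> Obj C" "T3 \<in> Obj C" "X \<in> Obj C" "Y \<in> Obj C" "Z \<in> Obj C"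
    and k: "ip (P \<odot> Q) (S \<odot> T) k1 k1'" "ip (S' \<odot> T) (S2 \<odot> T2) k2 k2'" "ip (P \<odot> Q') (S2 \<odot> T3) k3 k3'"
    and h: "ip S S' h1 h1'" "ip Q Q' h2 h2'" "ip T3 T2 h3 h3'"
    and d: "dbl T X = Scl C u (Idt C (T \<odot> X))"
    and eq: "\<And>n s. win n [P, Q] s \<Longrightarrow>
      act n (bx2 S' T S2 T2 k2) (act n (bx S S' h1) (act n (bx2 P Q S T k1) s))
      = sscl t (act (Suc n) (bx T3 T2 h3) (act n (bx2 P Q' S2 T3 k3) (act (Suc n) (bx Q Q' h2) s)))"
  shows "tassoc S' T S2 T2 k2 Y Z X \<cdot> tbraid S S' h1 X (T \<odot> (Y \<odot> Z)) \<cdot> tassoc P Q S T k1 X Y Z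
    = Scl C (u * t) ((Idt C S2 \<star> (Idt C Y \<star> tbraid T3 T2 h3 X Z)) \<cdot> tassoc P Q' S2 T3 k3 Y X Z
      \<cdot> (Idt C P \<star> (tbraid Q Q' h2 X Y \<star> Idt C Z)))"
proof -
  note XY = TObj_in[OF o(10,11)] and YX = TObj_in[OF o(11,10)] and YZ = TObj_in[OF o(11,12)] and XZ = TObj_in[OF o(10,12)] and ZX = TObj_in[OF o(12,10)]
  note TYZ = TObj_in[OF o(4) YZ]
  note obs = o XY YX YZ XZ ZX TYZ
  note kk = k(1-3)[THEN ipD(1)]
  note hh = h(1-3)[THEN ipD(1)]
  define A1 where "A1 = tassoc P Q S T k1 X Y Z"
  define A2 where "A2 = tassoc S' T S2 T2 k2 Y Z X"
  define A3 where "A3 = tassoc P Q' S2 T3 k3 Y X Z"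
  define B1 where "B1 = tbraid S S' h1 X (T \<odot> (Y \<odot> Z))"
  define B2 where "B2 = tbraid Q Q' h2 X Y"
  define B3 where "B3 = tbraid T3 T2 h3 X Z"
  define O0 where "O0 = P \<odot> ((Q \<odot> (X \<odot> Y)) \<odot> Z)"
  define O1 where "O1 = S \<odot> (X \<odot> (T \<odot> (Y \<odot> Z)))"
  define O2 where "O2 = S' \<odot> ((T \<odot> (Y \<odot> Z)) \<odot> X)"
  define O3 where "O3 = S2 \<odot> (Y \<odot> (T2 \<odot> (Z \<odot> X)))"
  define O4 where "O4 = P \<odot> ((Q' \<odot> (Y \<odot> X)) \<odot> Z)"
  define O5 where "O5 = S2 \<odot> (Y \<odot> (T3 \<odot> (X \<odot> Z)))"
  have A1: "arr O0 O1 A1" unfolding O0_def O1_def A1_def using ip_tassoc[OF o(1-4,10-12) k(1)] ipD(1) by blast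
  have B1: "arr O1 O2 B1" unfolding O1_def O2_def B1_def using ip_tbraid[OF o(3,5,10) TYZ h(1)] ipD(1) by blast
  have A2: "arr O2 O3 A2" unfolding O2_def O3_def A2_def using ip_tassoc[OF o(5,4,6,7,11,12,10) k(2)] ipD(1) by blast
  have A3: "arr O4 O5 A3" unfolding O4_def O5_def A3_def using ip_tassoc[OF o(1,8,6,9,11,10,12) k(3)] ipD(1) by blast
  have B2: "arr (Q \<odot> (X \<odot> Y)) (Q' \<odot> (Y \<odot> X)) B2" unfolding B2_def using ip_tbraid[OF o(2,8,10,11) h(2)] ipD(1) by blast
  have B3: "arr (T3 \<odot> (X \<odot> Z)) (T2 \<odot> (Z \<odot> X)) B3" unfolding B3_def using ip_tbraid[OF o(9,7,10,12) h(3)] ipD(1) by blast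
  note B2Z = arr_TMor[OF B2 arr_Idt[OF o(12)]] note PB2 = arr_TMor[OF arr_Idt[OF o(1)] B2Z, folded O0_def O4_def]
  note YB3 = arr_TMor[OF arr_Idt[OF o(11)] B3] note SB3 = arr_TMor[OF arr_Idt[OF o(6)] YB3, folded O5_def O3_def]
  define i where "i = idst [O0] (Unit C)"
  have i: "good i" "cur i = [O0]" using arr_dom[OF A1] Unit_in by (simp_all add: i_def good_idst)
  have i': "cur i = [P \<odot> ((Q \<odot> (X \<odot> Y)) \<odot> Z)]" using i by (simp add: O0_def)
  define p where "p = act 1 (mm (Q \<odot> (X \<odot> Y)) Z) (act 0 (mm P ((Q \<odot> (X \<odot> Y)) \<odot> Z)) i)"
  have p: "good p" "cur p = [P, Q \<odot> (X \<odot> Y), Z]"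
    unfolding p_def using i i' o XY by (simp_all add: st_simps TObj_in)
  define s where "s = act 2 (mm X Y) (act 1 (mm Q (X \<odot> Y)) p)"
  have s: "good s" "cur s = [P, Q, X, Y, Z]" unfolding s_def using p obs by (simp_all add: st_simps)
  note bk = box_ok_bx2[OF o(1-4) kk(1)] box_ok_bx2[OF o(5,4,6,7) kk(2)] box_ok_bx2[OF o(1,8,6,9) kk(3)]
    hh(1-3)[THEN box_ok_bx]
  define D where "D = (\<lambda>q. act 3 (mm Z X) (act 2 (mm T2 (Z \<odot> X)) (act 1 (mm Y (T2 \<odot> (Z \<odot> X))) (act 0 (mm S2 (Y \<odot> (T2 \<odot> (Z \<odot> X)))) q))))"
  define s1 where "s1 = act 0 (bx O0 O1 A1) i"
  have s1: "good s1" "cur s1 = [O1]" unfolding s1_def using i A1 by (simp_all add: st_simps)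
  define s2 where "s2 = act 0 (bx O1 O2 B1) s1"
  have s2: "good s2" "cur s2 = [O2]" unfolding s2_def using s1 B1 by (simp_all add: st_simps)
  define q1 where "q1 = act 1 (mm X (T \<odot> (Y \<odot> Z))) (act 0 (mm S (X \<odot> (T \<odot> (Y \<odot> Z)))) s1)"
  have q1: "good q1" "cur q1 = [S, X, T \<odot> (Y \<odot> Z)]" unfolding q1_def using s1 obs by (simp_all add: st_simps O1_def TObj_in)
  define l where "l = act 0 (bx2 P Q S T k1) s"
  have l: "good l" "cur l = [S, T, X, Y, Z]" unfolding l_def using s bk by (simp_all add: st_simps)
  have L1: "act 3 (mm Y Z) (act 2 (mm T (Y \<odot> Z)) q1) = act 1 (brd T X) l"
    unfolding q1_def s1_def A1_def O0_def O1_def l_def s_def p_def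
    using act_tassoc[OF o(1-4,10-12) kk(1), of 0 i] i i' by (simp add: win_iff numeral_2_eq_2 numeral_3_eq_3)
  have L2: "act 1 (mm (T \<odot> (Y \<odot> Z)) X) (act 0 (mm S' ((T \<odot> (Y \<odot> Z)) \<odot> X)) s2) = act 1 (brd X (T \<odot> (Y \<odot> Z))) (act 0 (bx S S' h1) q1)"
    unfolding s2_def B1_def O1_def O2_def q1_def
    using act_tbraid[OF o(3,5,10) TYZ hh(1), of 0 s1] s1 by (simp add: win_iff O1_def)
  have L3: "D (act 0 (bx O2 O3 A2) s2) = act 1 (brd T2 Y) (act 0 (bx2 S' T S2 T2 k2) (act 2 (mm Y Z) (act 1 (mm T (Y \<odot> Z))
      (act 1 (brd X (T \<odot> (Y \<odot> Z))) (act 0 (bx S S' h1) q1)))))"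
    unfolding D_def A2_def O2_def O3_def L2[symmetric]
    using act_tassoc[OF o(5,4,6,7,11,12,10) kk(2), of 0 s2] s2 by (simp add: win_iff numeral_2_eq_2 numeral_3_eq_3 O2_def)
  define b where "b = act 0 (bx S S' h1) q1"
  have b: "good b" "cur b = [S', X, T \<odot> (Y \<odot> Z)]" unfolding b_def using q1 bk by (simp_all add: st_simps)
  define l1 where "l1 = act 0 (bx S S' h1) l"
  have l1: "good l1" "cur l1 = [S', T, X, Y, Z]" unfolding l1_def using l bk by (simp_all add: st_simps)
  have L4: "act 2 (mm Y Z) (act 1 (mm T (Y \<odot> Z)) (act 1 (brd X (T \<odot> (Y \<odot> Z))) b)) = sscl u (act 3 (brd X Z) (act 2 (brd X Y) l1))"
  proof -
    define b2 where "b2 = act 2 (mm T (Y \<odot> Z)) b"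
    have b2: "good b2" "cur b2 = [S', X, T, Y \<odot> Z]" unfolding b2_def using b obs by (simp_all add: st_simps)
    have "act 1 (mm T (Y \<odot> Z)) (act 1 (brd X (T \<odot> (Y \<odot> Z))) b) = act 2 (brd X (Y \<odot> Z)) (act 1 (brd X T) b2)"
      unfolding b2_def using brd_hex1[OF o(10,4) YZ, of 1 b] b by (simp add: win_iff eval_nat_numeral)
    also have "act 2 (mm Y Z) \<dots> = act 3 (brd X Z) (act 2 (brd X Y) (act 3 (mm Y Z) (act 1 (brd X T) b2)))"
      using brd_hex1[OF o(10,11,12), of 2 "act 1 (brd X T) b2"] b2 obs by (simp add: st_simps eval_nat_numeral)
    also have "act 3 (mm Y Z) (act 1 (brd X T) b2) = act 1 (brd X T) (act 3 (mm Y Z) b2)"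
      using b2 obs by (intro exch) (simp_all add: st_simps)
    also have "b2 = act 0 (bx S S' h1) (act 2 (mm T (Y \<odot> Z)) q1)"
      unfolding b2_def b_def using q1 obs bk by (intro exch) (simp_all add: st_simps)
    also have "act 3 (mm Y Z) \<dots> = act 0 (bx S S' h1) (act 3 (mm Y Z) (act 2 (mm T (Y \<odot> Z)) q1))"
      using q1 obs bk by (intro exch) (simp_all add: st_simps)
    also have "\<dots> = act 1 (brd T X) l1"
      unfolding L1 l1_def using l obs bk by (intro exch[symmetric]) (simp_all add: st_simps)
    \<comment> \<open>The two crossings of \<open>T\<close> and \<open>X\<close> meet here.\<close>
    also have "act 1 (brd X T) \<dots> = sscl u l1"
      using l1 by (intro dbl_scalar o d) (simp add: win_iff)
    finally show ?thesis using l1 obs by (simp add: act_sscl st_simps)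
  qed
  define l2 where "l2 = act 0 (bx2 S' T S2 T2 k2) l1"
  have l2: "good l2" "cur l2 = [S2, T2, X, Y, Z]" unfolding l2_def using l1 bk by (simp_all add: st_simps)
  have LHS: "D (act 0 (bx O0 O3 (A2 \<cdot> B1 \<cdot> A1)) i) = sscl u (act 1 (brd T2 Y) (act 3 (brd X Z) (act 2 (brd X Y) l2)))"
  proof -
    have "act 0 (bx O0 O3 (A2 \<cdot> B1 \<cdot> A1)) i = act 0 (bx O2 O3 A2) s2"
      unfolding s1_def s2_def using i
      by (subst act_bx_Cmp[OF arr_Cmp[OF B1 A1] A2]) (simp_all add: win_iff act_bx_Cmp[OF A1 B1])
    then have "D (act 0 (bx O0 O3 (A2 \<cdot> B1 \<cdot> A1)) i) = act 1 (brd T2 Y) (act 0 (bx2 S' T S2 T2 k2) (sscl u (act 3 (brd X Z) (act 2 (brd X Y) l1))))"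
      using L3 L4 by (simp add: b_def)
    also have "\<dots> = sscl u (act 1 (brd T2 Y) (act 0 (bx2 S' T S2 T2 k2) (act 3 (brd X Z) (act 2 (brd X Y) l1))))"
      using l1 obs bk by (simp add: act_sscl st_simps)
    also have "act 0 (bx2 S' T S2 T2 k2) (act 3 (brd X Z) (act 2 (brd X Y) l1)) = act 3 (brd X Z) (act 0 (bx2 S' T S2 T2 k2) (act 2 (brd X Y) l1))"
      using l1 obs bk by (intro exch[symmetric]) (simp_all add: st_simps)
    also have "act 0 (bx2 S' T S2 T2 k2) (act 2 (brd X Y) l1) = act 2 (brd X Y) l2"
      unfolding l2_def using l1 obs bk by (intro exch[symmetric]) (simp_all add: st_simps)
    finally show ?thesis .
  qed

  define j where "j = act 0 (bx O0 O4 (Idt C P \<star> (B2 \<star> Idt C Z))) i"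
  have j: "good j" "cur j = [O4]" unfolding j_def using i PB2 by (simp_all add: st_simps)
  define j4 where "j4 = act 0 (bx O4 O5 A3) j"
  have j4: "good j4" "cur j4 = [O5]" unfolding j4_def using j A3 by (simp_all add: st_simps)
  define q4 where "q4 = act 1 (mm Y (T3 \<odot> (X \<odot> Z))) (act 0 (mm S2 (Y \<odot> (T3 \<odot> (X \<odot> Z)))) j4)"
  have q4: "good q4" "cur q4 = [S2, Y, T3 \<odot> (X \<odot> Z)]" unfolding q4_def using j4 obs by (simp_all add: st_simps O5_def TObj_in)
  define x3 where "x3 = act 1 (bx (Q \<odot> (X \<odot> Y)) (Q' \<odot> (Y \<odot> X)) B2) p"
  have x3: "good x3" "cur x3 = [P, Q' \<odot> (Y \<odot> X), Z]" unfolding x3_def using p B2 by (simp_all add: st_simps)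
  have R0: "act 1 (mm (Q' \<odot> (Y \<odot> X)) Z) (act 0 (mm P ((Q' \<odot> (Y \<odot> X)) \<odot> Z)) j) = x3"
  proof -
    have "act 0 (mm P ((Q' \<odot> (Y \<odot> X)) \<odot> Z)) j
      = act 1 (bx ((Q \<odot> (X \<odot> Y)) \<odot> Z) ((Q' \<odot> (Y \<odot> X)) \<odot> Z) (B2 \<star> Idt C Z)) (act 0 (mm P ((Q \<odot> (X \<odot> Y)) \<odot> Z)) i)"
      unfolding j_def O0_def O4_def using mm_bx_right[OF o(1) B2Z, of 0 i] i i' by (simp add: win_iff)
    also have "act 1 (mm (Q' \<odot> (Y \<odot> X)) Z) \<dots> = x3"
      unfolding x3_def p_def using i i' B2 o by (intro mm_bx_left o B2) (simp add: st_simps arr_dom TObj_in)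
    finally show ?thesis .
  qed
  define s' where "s' = act 1 (bx Q Q' h2) s"
  have s': "good s'" "cur s' = [P, Q', X, Y, Z]" unfolding s'_def using s bk by (simp_all add: st_simps)
  have R1: "act 3 (mm X Z) (act 2 (mm T3 (X \<odot> Z)) q4) = act 1 (brd T3 Y) (act 0 (bx2 P Q' S2 T3 k3) (act 2 (mm Y X) (act 1 (mm Q' (Y \<odot> X)) x3)))"
    unfolding q4_def j4_def A3_def O4_def O5_def R0[symmetric]
    using act_tassoc[OF o(1,8,6,9,11,10,12) kk(3), of 0 j] j by (simp add: win_iff numeral_2_eq_2 numeral_3_eq_3 O4_def)
  have R2: "act 2 (mm Y X) (act 1 (mm Q' (Y \<odot> X)) x3) = act 2 (brd X Y) s'"
    unfolding x3_def B2_def s'_def s_def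
    using act_tbraid[OF o(2,8,10,11) hh(2), of 1 p] p by (simp add: win_iff eval_nat_numeral)
  have R3: "act 3 (mm Z X) (act 2 (mm T2 (Z \<odot> X)) (act 2 (bx (T3 \<odot> (X \<odot> Z)) (T2 \<odot> (Z \<odot> X)) B3) q4))
    = act 3 (brd X Z) (act 2 (bx T3 T2 h3) (act 3 (mm X Z) (act 2 (mm T3 (X \<odot> Z)) q4)))"
    unfolding B3_def using act_tbraid[OF o(9,7,10,12) hh(3), of 2 q4] q4 by (simp add: win_iff eval_nat_numeral)
  define w where "w = act 0 (bx2 P Q' S2 T3 k3) s'"
  have w: "good w" "cur w = [S2, T3, X, Y, Z]" unfolding w_def using s' bk by (simp_all add: st_simps)
  define w2 where "w2 = act 1 (bx T3 T2 h3) w"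
  have w2: "good w2" "cur w2 = [S2, T2, X, Y, Z]" unfolding w2_def using w bk by (simp_all add: st_simps)
  note c1 = arr_Cmp[OF A2 arr_Cmp[OF B1 A1]] and c2 = arr_Cmp[OF SB3 arr_Cmp[OF A3 PB2]]
  have RHS: "D (act 0 (bx O0 O3 ((Idt C S2 \<star> (Idt C Y \<star> B3)) \<cdot> A3 \<cdot> (Idt C P \<star> (B2 \<star> Idt C Z)))) i)
    = act 1 (brd T2 Y) (act 3 (brd X Z) (act 2 (brd X Y) w2))"
  proof -
    have "act 0 (bx O0 O3 ((Idt C S2 \<star> (Idt C Y \<star> B3)) \<cdot> A3 \<cdot> (Idt C P \<star> (B2 \<star> Idt C Z)))) i
      = act 0 (bx O5 O3 (Idt C S2 \<star> (Idt C Y \<star> B3))) j4"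
      unfolding j4_def j_def using i
      by (subst act_bx_Cmp[OF arr_Cmp[OF A3 PB2] SB3]) (simp_all add: win_iff act_bx_Cmp[OF PB2 A3])
    moreover have "act 0 (mm S2 (Y \<odot> (T2 \<odot> (Z \<odot> X)))) (act 0 (bx O5 O3 (Idt C S2 \<star> (Idt C Y \<star> B3))) j4)
      = act 1 (bx (Y \<odot> (T3 \<odot> (X \<odot> Z))) (Y \<odot> (T2 \<odot> (Z \<odot> X))) (Idt C Y \<star> B3)) (act 0 (mm S2 (Y \<odot> (T3 \<odot> (X \<odot> Z)))) j4)"
      unfolding O5_def O3_def using mm_bx_right[OF o(6) YB3, of 0 j4] j4 by (simp add: win_iff O5_def)
    moreover have "act 1 (mm Y (T2 \<odot> (Z \<odot> X))) \<dots> = act 2 (bx (T3 \<odot> (X \<odot> Z)) (T2 \<odot> (Z \<odot> X)) B3) q4"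
      unfolding q4_def using mm_bx_right[OF o(11) B3, of 1 "act 0 (mm S2 (Y \<odot> (T3 \<odot> (X \<odot> Z)))) j4"] j4 obs
      by (simp add: st_simps O5_def numeral_2_eq_2 TObj_in)
    ultimately have "D (act 0 (bx O0 O3 ((Idt C S2 \<star> (Idt C Y \<star> B3)) \<cdot> A3 \<cdot> (Idt C P \<star> (B2 \<star> Idt C Z)))) i)
      = act 3 (brd X Z) (act 2 (bx T3 T2 h3) (act 1 (brd T3 Y) (act 0 (bx2 P Q' S2 T3 k3) (act 2 (brd X Y) s'))))"
      unfolding D_def using R3 R1 R2 by simp
    also have "act 0 (bx2 P Q' S2 T3 k3) (act 2 (brd X Y) s') = act 2 (brd X Y) w"
      unfolding w_def using s' obs bk by (intro exch[symmetric]) (simp_all add: st_simps)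
    also have "act 2 (bx T3 T2 h3) (act 1 (brd T3 Y) (act 2 (brd X Y) w)) = act 1 (brd T2 Y) (act 1 (bx T3 T2 h3) (act 2 (brd X Y) w))"
      using brd_bx1[OF hh(3) o(11), of 1 "act 2 (brd X Y) w"] w obs by (simp add: st_simps numeral_2_eq_2)
    also have "act 1 (bx T3 T2 h3) (act 2 (brd X Y) w) = act 2 (brd X Y) w2"
      unfolding w2_def using w obs bk by (intro exch[symmetric]) (simp_all add: st_simps)
    also have "act 3 (brd X Z) (act 1 (brd T2 Y) (act 2 (brd X Y) w2)) = act 1 (brd T2 Y) (act 3 (brd X Z) (act 2 (brd X Y) w2))"
      using w2 obs by (intro exch) (simp_all add: st_simps)
    finally show ?thesis .
  qed
  have "l2 = sscl t w2"
    unfolding l2_def l1_def l_def w2_def w_def s'_def using eq[of 0 s] s by (simp add: win_iff)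
  then have fin: "D (act 0 (bx O0 O3 (A2 \<cdot> B1 \<cdot> A1)) i)
     = sscl (u * t) (D (act 0 (bx O0 O3 ((Idt C S2 \<star> (Idt C Y \<star> B3)) \<cdot> A3 \<cdot> (Idt C P \<star> (B2 \<star> Idt C Z)))) i))"
    unfolding LHS RHS using w2 obs by (simp add: act_sscl sscl_sscl st_simps)
  have cancel: "q = sscl v q'" if "D q = sscl v (D q')" "good q" "good q'" "cur q = [O3]" "cur q' = [O3]" for q q' v
  proof -
    have c: "cur q = [S2 \<odot> (Y \<odot> (T2 \<odot> (Z \<odot> X)))]" "cur q' = [S2 \<odot> (Y \<odot> (T2 \<odot> (Z \<odot> X)))]"
      using that by (simp_all add: O3_def)
    note z = that(2,3) c obs TObj_in[OF o(7) ZX] TObj_in[OF o(11) TObj_in[OF o(7) ZX]]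
    note m5 = mm_cancel[OF _ _ _ _ that(1)[unfolded D_def]]
    show ?thesis
      apply (rule mm_cancel[of S2 "Y \<odot> (T2 \<odot> (Z \<odot> X))" 0])
          prefer 5
          apply (rule mm_cancel[of Y "T2 \<odot> (Z \<odot> X)" 1])
              prefer 5
              apply (rule mm_cancel[of T2 "Z \<odot> X" 2])
                  prefer 5
                  apply (rule m5)
      using z by (simp_all add: st_simps)
  qed
  have "act 0 (bx O0 O3 (A2 \<cdot> B1 \<cdot> A1)) i = sscl (u * t) (act 0 (bx O0 O3 ((Idt C S2 \<star> (Idt C Y \<star> B3)) \<cdot> A3 \<cdot> (Idt C P \<star> (B2 \<star> Idt C Z)))) i)"
    by (rule cancel[OF fin]) (use i in \<open>simp_all add: st_simps c1 c2\<close>)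
  then have "A2 \<cdot> B1 \<cdot> A1 = Scl C (u * t) ((Idt C S2 \<star> (Idt C Y \<star> B3)) \<cdot> A3 \<cdot> (Idt C P \<star> (B2 \<star> Idt C Z)))"
    unfolding i_def by (rule act_bx_faithful[OF c1 c2])
  then show ?thesis by (simp add: A1_def A2_def A3_def B1_def B2_def B3_def)
qed

text \<open>With inverse associators, \<open>Q\<close> is carried across \<open>Z\<close> by the
  braiding and straight back by the inverse braiding in \<open>g2\<close>, so no further scalar
  arises. The inverse braiding of \<open>T\<close> with \<open>X\<close> occurs on both sides and is
  absorbed into the state \<open>r\<close>, to which \<open>eq\<close> is applied.\<close>

lemma twisted_hexagon2:
  assumes o: "P \<in> Obj C" "Q \<in> Obj C" "S \<in> Obj C" "T \<in> Obj C" "P' \<in> Obj C" "P2 \<in> Obj C" "Q2 \<in> Obj C"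
      "Q4 \<in> Obj C" "T4 \<in> Obj C" "X \<in> Obj C" "Y \<in> Obj C" "Z \<in> Obj C"
    and k: "ip (P \<odot> Q) (S \<odot> T) k1 k1'" "ip (P2 \<odot> Q2) (P' \<odot> Q) k2 k2'" "ip (P2 \<odot> Q4) (S \<odot> T4) k3 k3'"
    and h: "ip P P' h1 h1'" "ip T T4 h2 h2'" "ip Q4 Q2 h3 h3'"
    and g: "ip (P \<odot> ((Q \<odot> (X \<odot> Y)) \<odot> Z)) (S \<odot> (X \<odot> (T \<odot> (Y \<odot> Z)))) (tassoc P Q S T k1 X Y Z) g1"
      "ip (P2 \<odot> ((Q2 \<odot> (Z \<odot> X)) \<odot> Y)) (P' \<odot> (Z \<odot> (Q \<odot> (X \<odot> Y)))) (tassoc P2 Q2 P' Q k2 Z X Y) g2"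
      "ip (P2 \<odot> ((Q4 \<odot> (X \<odot> Z)) \<odot> Y)) (S \<odot> (X \<odot> (T4 \<odot> (Z \<odot> Y)))) (tassoc P2 Q4 S T4 k3 X Z Y) g3"
    and eq: "\<And>n s. win n [S, T] s \<Longrightarrow>
      act n (bx2 P' Q P2 Q2 k2') (act n (bx P P' h1) (act n (bx2 S T P Q k1') s))
      = sscl t (act (Suc n) (bx Q4 Q2 h3) (act n (bx2 S T4 P2 Q4 k3') (act (Suc n) (bx T T4 h2) s)))"
  shows "g2 \<cdot> tbraid P P' h1 (Q \<odot> (X \<odot> Y)) Z \<cdot> g1
    = Scl C t ((Idt C P2 \<star> (tbraid Q4 Q2 h3 X Z \<star> Idt C Y)) \<cdot> g3 \<cdot> (Idt C S \<star> (Idt C X \<star> tbraid T T4 h2 Y Z)))"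
proof -
  note XY = TObj_in[OF o(10,11)] and YZ = TObj_in[OF o(11,12)] and ZY = TObj_in[OF o(12,11)] and XZ = TObj_in[OF o(10,12)] and ZX = TObj_in[OF o(12,10)]
  note QXY = TObj_in[OF o(2) XY] and Q2ZX = TObj_in[OF o(7) ZX] and Q4XZ = TObj_in[OF o(8) XZ]
  note obs = o XY YZ ZY XZ ZX QXY Q2ZX Q4XZ
  note kk = k(1-3)[THEN ipD(2)]
  note hh = h(1-3)[THEN ipD(1)]
  define B1 where "B1 = tbraid P P' h1 (Q \<odot> (X \<odot> Y)) Z"
  define B2 where "B2 = tbraid T T4 h2 Y Z"
  define B3 where "B3 = tbraid Q4 Q2 h3 X Z"
  define O0 where "O0 = S \<odot> (X \<odot> (T \<odot> (Y \<odot> Z)))"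
  define O1 where "O1 = P \<odot> ((Q \<odot> (X \<odot> Y)) \<odot> Z)"
  define O2 where "O2 = P' \<odot> (Z \<odot> (Q \<odot> (X \<odot> Y)))"
  define O3 where "O3 = P2 \<odot> ((Q2 \<odot> (Z \<odot> X)) \<odot> Y)"
  define O4 where "O4 = S \<odot> (X \<odot> (T4 \<odot> (Z \<odot> Y)))"
  define O5 where "O5 = P2 \<odot> ((Q4 \<odot> (X \<odot> Z)) \<odot> Y)"
  have G1: "arr O0 O1 g1" and G2: "arr O2 O3 g2" and G3: "arr O4 O5 g3"
    unfolding O0_def O1_def O2_def O3_def O4_def O5_def using g(1-3)[THEN ipD(2)] .
  have B1: "arr O1 O2 B1" unfolding O1_def O2_def B1_def using ip_tbraid[OF o(1,5) QXY o(12) h(1)] ipD(1) by blast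
  have B2: "arr (T \<odot> (Y \<odot> Z)) (T4 \<odot> (Z \<odot> Y)) B2" unfolding B2_def using ip_tbraid[OF o(4,9,11,12) h(2)] ipD(1) by blast
  have B3: "arr (Q4 \<odot> (X \<odot> Z)) (Q2 \<odot> (Z \<odot> X)) B3" unfolding B3_def using ip_tbraid[OF o(8,7,10,12) h(3)] ipD(1) by blast
  note XB2 = arr_TMor[OF arr_Idt[OF o(10)] B2] note SB2 = arr_TMor[OF arr_Idt[OF o(3)] XB2, folded O0_def O4_def]
  note B3Y = arr_TMor[OF B3 arr_Idt[OF o(11)]] note PB3 = arr_TMor[OF arr_Idt[OF o(6)] B3Y, folded O5_def O3_def]
  define i where "i = idst [O0] (Unit C)"
  have i: "good i" "cur i = [O0]" using arr_dom[OF G1] Unit_in by (simp_all add: i_def good_idst)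
  have i': "cur i = [S \<odot> (X \<odot> (T \<odot> (Y \<odot> Z)))]" using i by (simp add: O0_def)
  define p where "p = act 1 (mm X (T \<odot> (Y \<odot> Z))) (act 0 (mm S (X \<odot> (T \<odot> (Y \<odot> Z)))) i)"
  have p: "good p" "cur p = [S, X, T \<odot> (Y \<odot> Z)]" unfolding p_def using i i' o YZ by (simp_all add: st_simps TObj_in)
  define s where "s = act 3 (mm Y Z) (act 2 (mm T (Y \<odot> Z)) p)"
  have s: "good s" "cur s = [S, X, T, Y, Z]" unfolding s_def using p obs by (simp_all add: st_simps)
  note bk = box_ok_bx2[OF o(3,4,1,2) kk(1)] box_ok_bx2[OF o(5,2,6,7) kk(2)] box_ok_bx2[OF o(3,9,6,8) kk(3)]
    hh(1-3)[THEN box_ok_bx]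
  define D where "D = (\<lambda>q. act 2 (mm Z X) (act 1 (mm Q2 (Z \<odot> X)) (act 1 (mm (Q2 \<odot> (Z \<odot> X)) Y) (act 0 (mm P2 ((Q2 \<odot> (Z \<odot> X)) \<odot> Y)) q))))"
  define r where "r = act 1 (brdi T X) s"
  have r: "good r" "cur r = [S, T, X, Y, Z]" unfolding r_def using s obs by (simp_all add: st_simps)
  define s1 where "s1 = act 0 (bx O0 O1 g1) i"
  have s1: "good s1" "cur s1 = [O1]" unfolding s1_def using i G1 by (simp_all add: st_simps)
  define s2 where "s2 = act 0 (bx O1 O2 B1) s1"
  have s2: "good s2" "cur s2 = [O2]" unfolding s2_def using s1 B1 by (simp_all add: st_simps)
  define q1 where "q1 = act 1 (mm (Q \<odot> (X \<odot> Y)) Z) (act 0 (mm P ((Q \<odot> (X \<odot> Y)) \<odot> Z)) s1)"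
  have q1: "good q1" "cur q1 = [P, Q \<odot> (X \<odot> Y), Z]" unfolding q1_def using s1 obs by (simp_all add: st_simps O1_def TObj_in)
  define l where "l = act 0 (bx2 S T P Q k1') r"
  have l: "good l" "cur l = [P, Q, X, Y, Z]" unfolding l_def using r bk by (simp_all add: st_simps)
  have L1: "act 2 (mm X Y) (act 1 (mm Q (X \<odot> Y)) q1) = l"
    unfolding q1_def s1_def O0_def O1_def l_def r_def s_def p_def
    using act_tassoc_inv[OF o(1-4,10-12) k(1) g(1), of 0 i] i i' by (simp add: win_iff numeral_2_eq_2 numeral_3_eq_3)
  have L2: "act 1 (mm Z (Q \<odot> (X \<odot> Y))) (act 0 (mm P' (Z \<odot> (Q \<odot> (X \<odot> Y)))) s2) = act 1 (brd (Q \<odot> (X \<odot> Y)) Z) (act 0 (bx P P' h1) q1)"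
    unfolding s2_def B1_def O1_def O2_def q1_def
    using act_tbraid[OF o(1,5) QXY o(12) hh(1), of 0 s1] s1 by (simp add: win_iff O1_def)
  have L3: "D (act 0 (bx O2 O3 g2) s2) = act 0 (bx2 P' Q P2 Q2 k2') (act 1 (brdi Q Z) (act 3 (mm X Y) (act 2 (mm Q (X \<odot> Y))
      (act 1 (brd (Q \<odot> (X \<odot> Y)) Z) (act 0 (bx P P' h1) q1)))))"
    unfolding D_def O2_def O3_def L2[symmetric]
    using act_tassoc_inv[OF o(6,7,5,2,12,10,11) k(2) g(2), of 0 s2] s2 by (simp add: win_iff numeral_2_eq_2 numeral_3_eq_3 O2_def)
  define b where "b = act 0 (bx P P' h1) q1"
  have b: "good b" "cur b = [P', Q \<odot> (X \<odot> Y), Z]" unfolding b_def using q1 bk by (simp_all add: st_simps)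
  define l1 where "l1 = act 0 (bx P P' h1) l"
  have l1: "good l1" "cur l1 = [P', Q, X, Y, Z]" unfolding l1_def using l bk by (simp_all add: st_simps)
  have L4: "act 1 (brdi Q Z) (act 3 (mm X Y) (act 2 (mm Q (X \<odot> Y)) (act 1 (brd (Q \<odot> (X \<odot> Y)) Z) b))) = act 2 (brd X Z) (act 3 (brd Y Z) l1)"
  proof -
    define b2 where "b2 = act 1 (mm Q (X \<odot> Y)) b"
    have b2: "good b2" "cur b2 = [P', Q, X \<odot> Y, Z]" unfolding b2_def using b obs by (simp_all add: st_simps)
    have "act 2 (mm Q (X \<odot> Y)) (act 1 (brd (Q \<odot> (X \<odot> Y)) Z) b) = act 1 (brd Q Z) (act 2 (brd (X \<odot> Y) Z) b2)"
      unfolding b2_def using brd_hex2[OF o(2) XY o(12), of 1 b] b by (simp add: win_iff eval_nat_numeral)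
    also have "act 3 (mm X Y) \<dots> = act 1 (brd Q Z) (act 3 (mm X Y) (act 2 (brd (X \<odot> Y) Z) b2))"
      using b2 obs by (intro exch) (simp_all add: st_simps)
    also have "act 3 (mm X Y) (act 2 (brd (X \<odot> Y) Z) b2) = act 2 (brd X Z) (act 3 (brd Y Z) (act 2 (mm X Y) b2))"
      using brd_hex2[OF o(10-12), of 2 b2] b2 obs by (simp add: st_simps eval_nat_numeral)
    also have "b2 = act 0 (bx P P' h1) (act 1 (mm Q (X \<odot> Y)) q1)"
      unfolding b2_def b_def using q1 obs bk by (intro exch) (simp_all add: st_simps)
    also have "act 2 (mm X Y) \<dots> = act 0 (bx P P' h1) (act 2 (mm X Y) (act 1 (mm Q (X \<odot> Y)) q1))"
      using q1 obs bk by (intro exch) (simp_all add: st_simps)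
    also have "\<dots> = l1" unfolding L1 l1_def ..
    also have "act 1 (brdi Q Z) (act 1 (brd Q Z) (act 2 (brd X Z) (act 3 (brd Y Z) l1))) = act 2 (brd X Z) (act 3 (brd Y Z) l1)"
      using l1 obs by (intro act_brdi_brd o) (simp add: st_simps)
    finally show ?thesis .
  qed
  define l2 where "l2 = act 0 (bx2 P' Q P2 Q2 k2') l1"
  have l2: "good l2" "cur l2 = [P2, Q2, X, Y, Z]" unfolding l2_def using l1 bk by (simp_all add: st_simps)
  have LHS: "D (act 0 (bx O0 O3 (g2 \<cdot> B1 \<cdot> g1)) i) = act 2 (brd X Z) (act 3 (brd Y Z) l2)"
  proof -
    have "act 0 (bx O0 O3 (g2 \<cdot> B1 \<cdot> g1)) i = act 0 (bx O2 O3 g2) s2"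
      unfolding s1_def s2_def using i
      by (subst act_bx_Cmp[OF arr_Cmp[OF B1 G1] G2]) (simp_all add: win_iff act_bx_Cmp[OF G1 B1])
    then have "D (act 0 (bx O0 O3 (g2 \<cdot> B1 \<cdot> g1)) i) = act 0 (bx2 P' Q P2 Q2 k2') (act 2 (brd X Z) (act 3 (brd Y Z) l1))"
      using L3 L4 by (simp add: b_def)
    also have "\<dots> = act 2 (brd X Z) (act 0 (bx2 P' Q P2 Q2 k2') (act 3 (brd Y Z) l1))"
      using l1 obs bk by (intro exch[symmetric]) (simp_all add: st_simps)
    also have "act 0 (bx2 P' Q P2 Q2 k2') (act 3 (brd Y Z) l1) = act 3 (brd Y Z) l2"
      unfolding l2_def using l1 obs bk by (intro exch[symmetric]) (simp_all add: st_simps)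
    finally show ?thesis .
  qed

  define j where "j = act 0 (bx O0 O4 (Idt C S \<star> (Idt C X \<star> B2))) i"
  have j: "good j" "cur j = [O4]" unfolding j_def using i SB2 by (simp_all add: st_simps)
  define j4 where "j4 = act 0 (bx O4 O5 g3) j"
  have j4: "good j4" "cur j4 = [O5]" unfolding j4_def using j G3 by (simp_all add: st_simps)
  define q4 where "q4 = act 1 (mm (Q4 \<odot> (X \<odot> Z)) Y) (act 0 (mm P2 ((Q4 \<odot> (X \<odot> Z)) \<odot> Y)) j4)"
  have q4: "good q4" "cur q4 = [P2, Q4 \<odot> (X \<odot> Z), Y]" unfolding q4_def using j4 obs by (simp_all add: st_simps O5_def TObj_in)
  have R0: "act 1 (mm X (T4 \<odot> (Z \<odot> Y))) (act 0 (mm S (X \<odot> (T4 \<odot> (Z \<odot> Y)))) j) = act 2 (bx (T \<odot> (Y \<odot> Z)) (T4 \<odot> (Z \<odot> Y)) B2) p"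
  proof -
    have e: "act 0 (mm S (X \<odot> (T4 \<odot> (Z \<odot> Y)))) j
      = act 1 (bx (X \<odot> (T \<odot> (Y \<odot> Z))) (X \<odot> (T4 \<odot> (Z \<odot> Y))) (Idt C X \<star> B2)) (act 0 (mm S (X \<odot> (T \<odot> (Y \<odot> Z)))) i)"
      unfolding j_def O0_def O4_def using mm_bx_right[OF o(3) XB2, of 0 i] i i' by (simp add: win_iff)
    show ?thesis
      unfolding e p_def using mm_bx_right[OF o(10) B2, of 1 "act 0 (mm S (X \<odot> (T \<odot> (Y \<odot> Z)))) i"] i i' obs
      by (simp add: st_simps numeral_2_eq_2 TObj_in)
  qed
  define s' where "s' = act 2 (bx T T4 h2) s"
  have s': "good s'" "cur s' = [S, X, T4, Y, Z]" unfolding s'_def using s bk by (simp_all add: st_simps)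
  have R1: "act 2 (mm X Z) (act 1 (mm Q4 (X \<odot> Z)) q4) = act 0 (bx2 S T4 P2 Q4 k3') (act 1 (brdi T4 X) (act 3 (mm Z Y) (act 2 (mm T4 (Z \<odot> Y)) (act 2 (bx (T \<odot> (Y \<odot> Z)) (T4 \<odot> (Z \<odot> Y)) B2) p))))"
    unfolding q4_def j4_def O4_def O5_def R0[symmetric]
    using act_tassoc_inv[OF o(6,8,3,9,10,12,11) k(3) g(3), of 0 j] j by (simp add: win_iff numeral_2_eq_2 numeral_3_eq_3 O4_def)
  have R2: "act 3 (mm Z Y) (act 2 (mm T4 (Z \<odot> Y)) (act 2 (bx (T \<odot> (Y \<odot> Z)) (T4 \<odot> (Z \<odot> Y)) B2) p)) = act 3 (brd Y Z) s'"
    unfolding B2_def s'_def s_def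
    using act_tbraid[OF o(4,9,11,12) hh(2), of 2 p] p by (simp add: win_iff eval_nat_numeral)
  have R3: "act 2 (mm Z X) (act 1 (mm Q2 (Z \<odot> X)) (act 1 (bx (Q4 \<odot> (X \<odot> Z)) (Q2 \<odot> (Z \<odot> X)) B3) q4))
    = act 2 (brd X Z) (act 1 (bx Q4 Q2 h3) (act 2 (mm X Z) (act 1 (mm Q4 (X \<odot> Z)) q4)))"
    unfolding B3_def using act_tbraid[OF o(8,7,10,12) hh(3), of 1 q4] q4 by (simp add: win_iff eval_nat_numeral)
  define r' where "r' = act 1 (bx T T4 h2) r"
  have r': "good r'" "cur r' = [S, T4, X, Y, Z]" unfolding r'_def using r bk by (simp_all add: st_simps)
  define w where "w = act 0 (bx2 S T4 P2 Q4 k3') r'"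
  have w: "good w" "cur w = [P2, Q4, X, Y, Z]" unfolding w_def using r' bk by (simp_all add: st_simps)
  define w2 where "w2 = act 1 (bx Q4 Q2 h3) w"
  have w2: "good w2" "cur w2 = [P2, Q2, X, Y, Z]" unfolding w2_def using w bk by (simp_all add: st_simps)
  note c1 = arr_Cmp[OF G2 arr_Cmp[OF B1 G1]] and c2 = arr_Cmp[OF PB3 arr_Cmp[OF G3 SB2]]
  have RHS: "D (act 0 (bx O0 O3 ((Idt C P2 \<star> (B3 \<star> Idt C Y)) \<cdot> g3 \<cdot> (Idt C S \<star> (Idt C X \<star> B2)))) i)
    = act 2 (brd X Z) (act 3 (brd Y Z) w2)"
  proof -
    have "act 0 (bx O0 O3 ((Idt C P2 \<star> (B3 \<star> Idt C Y)) \<cdot> g3 \<cdot> (Idt C S \<star> (Idt C X \<star> B2)))) i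
      = act 0 (bx O5 O3 (Idt C P2 \<star> (B3 \<star> Idt C Y))) j4"
      unfolding j4_def j_def using i
      by (subst act_bx_Cmp[OF arr_Cmp[OF G3 SB2] PB3]) (simp_all add: win_iff act_bx_Cmp[OF SB2 G3])
    moreover have "act 0 (mm P2 ((Q2 \<odot> (Z \<odot> X)) \<odot> Y)) (act 0 (bx O5 O3 (Idt C P2 \<star> (B3 \<star> Idt C Y))) j4)
      = act 1 (bx ((Q4 \<odot> (X \<odot> Z)) \<odot> Y) ((Q2 \<odot> (Z \<odot> X)) \<odot> Y) (B3 \<star> Idt C Y)) (act 0 (mm P2 ((Q4 \<odot> (X \<odot> Z)) \<odot> Y)) j4)"
      unfolding O5_def O3_def using mm_bx_right[OF o(6) B3Y, of 0 j4] j4 by (simp add: win_iff O5_def)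
    moreover have "act 1 (mm (Q2 \<odot> (Z \<odot> X)) Y) \<dots> = act 1 (bx (Q4 \<odot> (X \<odot> Z)) (Q2 \<odot> (Z \<odot> X)) B3) q4"
      unfolding q4_def using mm_bx_left[OF o(11) B3, of 1 "act 0 (mm P2 ((Q4 \<odot> (X \<odot> Z)) \<odot> Y)) j4"] j4 obs
      by (simp add: st_simps O5_def TObj_in)
    ultimately have "D (act 0 (bx O0 O3 ((Idt C P2 \<star> (B3 \<star> Idt C Y)) \<cdot> g3 \<cdot> (Idt C S \<star> (Idt C X \<star> B2)))) i)
      = act 2 (brd X Z) (act 1 (bx Q4 Q2 h3) (act 0 (bx2 S T4 P2 Q4 k3') (act 1 (brdi T4 X) (act 3 (brd Y Z) s'))))"
      unfolding D_def using R3 R1 R2 by simp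
    also have "act 1 (brdi T4 X) (act 3 (brd Y Z) s') = act 3 (brd Y Z) (act 1 (brdi T4 X) s')"
      using s' obs by (intro exch[symmetric]) (simp_all add: st_simps)
    also have "act 1 (brdi T4 X) s' = r'"
      unfolding s'_def r'_def r_def using brdi_bx[OF hh(2) o(10), of 1 s] s by (simp add: win_iff numeral_2_eq_2)
    also have "act 0 (bx2 S T4 P2 Q4 k3') (act 3 (brd Y Z) r') = act 3 (brd Y Z) w"
      unfolding w_def using r' obs bk by (intro exch[symmetric]) (simp_all add: st_simps)
    also have "act 1 (bx Q4 Q2 h3) (act 3 (brd Y Z) w) = act 3 (brd Y Z) w2"
      unfolding w2_def using w obs bk by (intro exch[symmetric]) (simp_all add: st_simps)
    finally show ?thesis .
  qed
  have "l2 = sscl t w2"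
    unfolding l2_def l1_def l_def w2_def w_def r'_def using eq[of 0 r] r by (simp add: win_iff)
  then have fin: "D (act 0 (bx O0 O3 (g2 \<cdot> B1 \<cdot> g1)) i)
     = sscl t (D (act 0 (bx O0 O3 ((Idt C P2 \<star> (B3 \<star> Idt C Y)) \<cdot> g3 \<cdot> (Idt C S \<star> (Idt C X \<star> B2)))) i))"
    unfolding LHS RHS using w2 obs by (simp add: act_sscl st_simps)
  have cancel: "q = sscl v q'" if "D q = sscl v (D q')" "good q" "good q'" "cur q = [O3]" "cur q' = [O3]" for q q' v
  proof -
    have c: "cur q = [P2 \<odot> ((Q2 \<odot> (Z \<odot> X)) \<odot> Y)]" "cur q' = [P2 \<odot> ((Q2 \<odot> (Z \<odot> X)) \<odot> Y)]"
      using that by (simp_all add: O3_def)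
    note z = that(2,3) c obs TObj_in[OF Q2ZX o(11)]
    note m5 = mm_cancel[OF _ _ _ _ that(1)[unfolded D_def]]
    show ?thesis
      apply (rule mm_cancel[of P2 "(Q2 \<odot> (Z \<odot> X)) \<odot> Y" 0])
          prefer 5
          apply (rule mm_cancel[of "Q2 \<odot> (Z \<odot> X)" Y 1])
              prefer 5
              apply (rule mm_cancel[of Q2 "Z \<odot> X" 1])
                  prefer 5
                  apply (rule m5)
      using z by (simp_all add: st_simps)
  qed
  have "act 0 (bx O0 O3 (g2 \<cdot> B1 \<cdot> g1)) i = sscl t (act 0 (bx O0 O3 ((Idt C P2 \<star> (B3 \<star> Idt C Y)) \<cdot> g3 \<cdot> (Idt C S \<star> (Idt C X \<star> B2)))) i)"
    by (rule cancel[OF fin]) (use i in \<open>simp_all add: st_simps c1 c2\<close>)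
  then have "g2 \<cdot> B1 \<cdot> g1 = Scl C t ((Idt C P2 \<star> (B3 \<star> Idt C Y)) \<cdot> g3 \<cdot> (Idt C S \<star> (Idt C X \<star> B2)))"
    unfolding i_def by (rule act_bx_faithful[OF c1 c2])
  then show ?thesis by (simp add: B1_def B2_def B3_def)
qed

end

section \<open>Skeletal models\<close>

context braided_tensor_category
begin

text \<open>The box of a multiplication: two neighbours are merged and the product is mapped
  on.\<close>

definition bm :: "'o \<Rightarrow> 'o \<Rightarrow> 'o \<Rightarrow> 'm \<Rightarrow> ('o, 'm) box"
  where "bm X Y Z f = bcomp (bx (X \<odot> Y) Z f) (mi X Y)"

lemma bm_simps [simp]: "bdom (bm X Y Z f) = [X, Y]" "bcod (bm X Y Z f) = [Z]"
  by (simp_all add: bm_def)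

lemma box_ok_bm: "\<lbrakk>X \<in> Obj C; Y \<in> Obj C; arr (X \<odot> Y) Z f\<rbrakk> \<Longrightarrow> box_ok (bm X Y Z f)"
  unfolding bm_def by (intro box_ok_bcomp box_ok_bx box_ok_mi) simp_all

lemma act_bm: "\<lbrakk>X \<in> Obj C; Y \<in> Obj C; arr (X \<odot> Y) Z f; win n [X, Y] s\<rbrakk>
    \<Longrightarrow> act n (bm X Y Z f) s = act n (bx (X \<odot> Y) Z f) (act n (mi X Y) s)"
  unfolding bm_def by (simp add: act_bcomp box_ok_bx)

lemma act_bm_mm:
  assumes o: "X \<in> Obj C" "Y \<in> Obj C" and f: "arr (X \<odot> Y) Z f" and w: "win n [X \<odot> Y] s"
  shows "act n (bm X Y Z f) (act n (mm X Y) s) = act n (bx (X \<odot> Y) Z f) s"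
proof -
  have "win n [X, Y] (act n (mm X Y) s)" using win_act_same[OF box_ok_mm[OF o]] w by simp
  then show ?thesis using act_bm[OF o f] act_mi_mm[OF o w] by simp
qed

lemma act_bm_Scl:
  assumes o: "X \<in> Obj C" "Y \<in> Obj C" and f: "arr (X \<odot> Y) Z f" and w: "win n [X, Y] s"
  shows "act n (bm X Y Z (Scl C t f)) s = sscl t (act n (bm X Y Z f) s)"
proof -
  have "win n [X \<odot> Y] (act n (mi X Y) s)" using win_act_same[OF box_ok_mi[OF o]] w by simp
  then show ?thesis unfolding act_bm[OF o f w] act_bm[OF o arr_Scl[OF f] w] by (rule act_bx_Scl[OF f])
qed

lemma act_bm_bx2:
  assumes o: "X \<in> Obj C" "Y \<in> Obj C" "X' \<in> Obj C" "Y' \<in> Obj C" and k: "arr (X \<odot> Y) (X' \<odot> Y') k"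
    and f: "arr (X' \<odot> Y') Z f" and w: "win n [X, Y] s"
  shows "act n (bm X' Y' Z f) (act n (bx2 X Y X' Y' k) s) = act n (bm X Y Z (f \<cdot> k)) s"
proof -
  have w1: "win n [X \<odot> Y] (act n (mi X Y) s)" using win_act_same[OF box_ok_mi[OF o(1,2)]] w by simp
  show ?thesis
    unfolding act_bx2_eq[OF o k w] act_bm[OF o(1,2) arr_Cmp[OF f k] w] act_bm_mm[OF o(3,4) f act_bx_ok[OF k w1]]
      act_bx_Cmp[OF k f w1] ..
qed

lemma act_bm_bx1:
  assumes o: "Y \<in> Obj C" and h: "arr X X' h" and f: "arr (X' \<odot> Y) Z f" and w: "win n [X, Y] s"
  shows "act n (bm X' Y Z f) (act n (bx X X' h) s) = act n (bm X Y Z (f \<cdot> (h \<star> Idt C Y))) s"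
proof -
  note oX = arr_dom[OF h] arr_cod[OF h] and hY = arr_TMor[OF h arr_Idt[OF o]]
  have w1: "win n [X \<odot> Y] (act n (mi X Y) s)" using win_act_same[OF box_ok_mi[OF oX(1) o]] w by simp
  have "act n (bx X X' h) s = act n (mm X' Y) (act n (bx (X \<odot> Y) (X' \<odot> Y) (h \<star> Idt C Y)) (act n (mi X Y) s))"
    using mm_bx_left[OF o h w1] act_mm_mi[OF oX(1) o w] by simp
  then show ?thesis
    unfolding act_bm[OF oX(1) o arr_Cmp[OF f hY] w] act_bx_Cmp[OF hY f w1] using act_bm_mm[OF oX(2) o f act_bx_ok[OF hY w1]] by simp
qed

lemma act_bm_bx2':
  assumes o: "X \<in> Obj C" and h: "arr Y Y' h" and f: "arr (X \<odot> Y') Z f" and w: "win n [X, Y] s"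
  shows "act n (bm X Y' Z f) (act (Suc n) (bx Y Y' h) s) = act n (bm X Y Z (f \<cdot> (Idt C X \<star> h))) s"
proof -
  note oY = arr_dom[OF h] arr_cod[OF h] and hY = arr_TMor[OF arr_Idt[OF o] h]
  have w1: "win n [X \<odot> Y] (act n (mi X Y) s)" using win_act_same[OF box_ok_mi[OF o oY(1)]] w by simp
  have "act (Suc n) (bx Y Y' h) s = act n (mm X Y') (act n (bx (X \<odot> Y) (X \<odot> Y') (Idt C X \<star> h)) (act n (mi X Y) s))"
    using mm_bx_right[OF o h w1] act_mm_mi[OF o oY(1) w] by simp
  then show ?thesis
    unfolding act_bm[OF o oY(1) arr_Cmp[OF f hY] w] act_bx_Cmp[OF hY f w1] using act_bm_mm[OF o oY(2) f act_bx_ok[OF hY w1]] by simp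
qed

text \<open>The hypothesis \<open>e\<close> is associativity with the associator of \<open>C\<close>
  written out; on lists the associator is no longer visible.\<close>

lemma bm_assoc:
  assumes o: "X \<in> Obj C" "Y \<in> Obj C" "Z \<in> Obj C" and f: "arr (X \<odot> Y) U f" "arr (U \<odot> Z) W g"
    and f': "arr (Y \<odot> Z) U' f'" "arr (X \<odot> U') W g'"
    and e: "g \<cdot> (f \<star> Idt C Z) = g' \<cdot> (Idt C X \<star> f') \<cdot> Assoc C X Y Z" and w: "win n [X, Y, Z] s"
  shows "act n (bm U Z W g) (act n (bm X Y U f) s) = act n (bm X U' W g') (act (Suc n) (bm Y Z U' f') s)"
proof -
  note XY = TObj_in[OF o(1,2)] and YZ = TObj_in[OF o(2,3)] and U = arr_cod[OF f(1)] arr_cod[OF f'(1)]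
  obtain us vs where sh: "cur s = us @ [X, Y, Z] @ vs" "length us = n" using win_shape[OF w] by blast
  note gs = win_good[OF w]
  define s1 where "s1 = act n (mi X Y) s"
  have s1: "good s1" "cur s1 = us @ [X \<odot> Y, Z] @ vs" unfolding s1_def using gs sh o by (simp_all add: st_simps)
  define s0 where "s0 = act n (mi (X \<odot> Y) Z) s1"
  have s0: "good s0" "cur s0 = us @ [(X \<odot> Y) \<odot> Z] @ vs" unfolding s0_def using s1 sh o XY by (simp_all add: st_simps)
  have w0: "win n [(X \<odot> Y) \<odot> Z] s0" using s0 sh by (simp add: win_iff)
  have e1: "s1 = act n (mm (X \<odot> Y) Z) s0" unfolding s0_def using s1 sh o XY by (intro act_mm_mi[symmetric]) (simp_all add: win_iff)
  have e0: "s = act n (mm X Y) s1" unfolding s1_def using gs sh o by (intro act_mm_mi[symmetric]) (simp_all add: win_iff)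
  note fZ = arr_TMor[OF f(1) arr_Idt[OF o(3)]] and Xf = arr_TMor[OF arr_Idt[OF o(1)] f'(1)] and a = arr_Assoc[OF o]
  have "act n (bm X Y U f) s = act n (bx (X \<odot> Y) U f) s1"
    unfolding e0 using s1 sh by (intro act_bm_mm o f) (simp add: win_iff)
  also have "\<dots> = act n (mm U Z) (act n (bx ((X \<odot> Y) \<odot> Z) (U \<odot> Z) (f \<star> Idt C Z)) s0)"
    unfolding e1 by (rule mm_bx_left[OF o(3) f(1) w0, symmetric])
  finally have "act n (bm U Z W g) (act n (bm X Y U f) s) = act n (bx ((X \<odot> Y) \<odot> Z) W (g \<cdot> (f \<star> Idt C Z))) s0"
    using act_bm_mm[OF U(1) o(3) f(2) act_bx_ok[OF fZ w0]] act_bx_Cmp[OF fZ f(2) w0] by simp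
  moreover define t where "t = act n (bx ((X \<odot> Y) \<odot> Z) (X \<odot> (Y \<odot> Z)) (Assoc C X Y Z)) s0"
  have t: "good t" "cur t = us @ [X \<odot> (Y \<odot> Z)] @ vs" unfolding t_def using s0 sh a by (simp_all add: st_simps)
  have wt: "win n [X \<odot> (Y \<odot> Z)] t" using t sh by (simp add: win_iff)
  have "s = act (Suc n) (mm Y Z) (act n (mm X (Y \<odot> Z)) t)"
    unfolding t_def using act_mm_Assoc[OF o w0] e0 e1 by simp
  then have "act (Suc n) (bm Y Z U' f') s = act (Suc n) (bx (Y \<odot> Z) U' f') (act n (mm X (Y \<odot> Z)) t)"
    using act_bm_mm[OF o(2,3) f'(1), of "Suc n" "act n (mm X (Y \<odot> Z)) t"] t sh o YZ by (simp add: st_simps)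
  then have "act (Suc n) (bm Y Z U' f') s = act n (mm X U') (act n (bx (X \<odot> (Y \<odot> Z)) (X \<odot> U') (Idt C X \<star> f')) t)"
    using mm_bx_right[OF o(1) f'(1) wt] by simp
  then have "act n (bm X U' W g') (act (Suc n) (bm Y Z U' f') s) = act n (bx (X \<odot> U') W g') (act n (bx (X \<odot> (Y \<odot> Z)) (X \<odot> U') (Idt C X \<star> f')) t)"
    using act_bm_mm[OF o(1) U(2) f'(2) act_bx_ok[OF Xf wt]] by simp
  then have "act n (bm X U' W g') (act (Suc n) (bm Y Z U' f') s) = act n (bx ((X \<odot> Y) \<odot> Z) W (g' \<cdot> (Idt C X \<star> f') \<cdot> Assoc C X Y Z)) s0"
    unfolding t_def using act_bx_Cmp[OF arr_Cmp[OF Xf a] f'(2) w0] act_bx_Cmp[OF a Xf w0] by simp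
  ultimately show ?thesis using e by simp
qed

lemma act_bm_inject:
  assumes o: "X \<in> Obj C" "Y \<in> Obj C" and f: "ip (X \<odot> Y) Z f f'" and w: "win n [X, Y] s" "win n [X, Y] s'"
    and e: "act n (bm X Y Z f) s = act n (bm X Y Z f) s'"
  shows "s = s'"
proof -
  have "act n (mm X Y) (act n (bx Z (X \<odot> Y) f') (act n (bm X Y Z f) s)) = s" if w: "win n [X, Y] s" for s
  proof -
    have w1: "win n [X \<odot> Y] (act n (mi X Y) s)" using win_act_same[OF box_ok_mi[OF o]] w by simp
    show ?thesis unfolding act_bm[OF o ipD(1)[OF f] w] act_bx_inverse[OF f w1] by (rule act_mm_mi[OF o w])
  qed
  then show ?thesis using e w by metis
qed

text \<open>Second hexagon and naturality: \<open>X\<close> crosses either the merged object or its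
  two factors.\<close>

lemma brd_bm:
  assumes o: "U \<in> Obj C" "V \<in> Obj C" "X \<in> Obj C" and f: "arr (U \<odot> V) Y f" and w: "win n [U, V, X] s"
  shows "act n (brd Y X) (act n (bm U V Y f) s) = act (Suc n) (bm U V Y f) (act n (brd U X) (act (Suc n) (brd V X) s))"
proof -
  note UV = TObj_in[OF o(1,2)]
  obtain us vs where sh: "cur s = us @ [U, V, X] @ vs" "length us = n" using win_shape[OF w] by blast
  note g = win_good[OF w]
  define s' where "s' = act n (mi U V) s"
  have s': "good s'" "cur s' = us @ [U \<odot> V, X] @ vs" unfolding s'_def using g sh o by (simp_all add: st_simps)
  have e: "s = act n (mm U V) s'" using g sh o by (simp add: s'_def act_mm_mi st_simps)
  have ws: "win n [U \<odot> V] s'" "win n [U \<odot> V, X] s'" using s' sh by (simp_all add: win_iff)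
  have "act (Suc n) (bm U V Y f) (act n (brd U X) (act (Suc n) (brd V X) s))
    = act (Suc n) (bm U V Y f) (act (Suc n) (mm U V) (act n (brd (U \<odot> V) X) s'))"
    unfolding e brd_hex2[OF o ws(2)] ..
  also have "\<dots> = act (Suc n) (bx (U \<odot> V) Y f) (act n (brd (U \<odot> V) X) s')"
    using s' sh o UV by (intro act_bm_mm o f) (simp add: st_simps)
  also have "\<dots> = act n (brd Y X) (act n (bx (U \<odot> V) Y f) s')"
    by (rule brd_bx1[OF f o(3) ws(2), symmetric])
  also have "act n (bx (U \<odot> V) Y f) s' = act n (bm U V Y f) s"
    unfolding e by (rule act_bm_mm[OF o(1,2) f ws(1), symmetric])
  finally show ?thesis ..
qed

end

text \<open>
  The group of isomorphism classes enters only as a commutative semigroup \<open>G\<close>.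
\<close>

locale skeletal_data = braided_tensor_category C
  for C :: "('o, 'm, 'k::alg_closed_field, 'z) braided_cat_scheme" (structure) +
  fixes G :: "('g, 'd) monoid_scheme" and r :: "'g \<Rightarrow> 'o" and \<phi> :: "'g \<Rightarrow> 'g \<Rightarrow> 'm"
  assumes G_closed [simp, intro]: "\<lbrakk>K \<in> carrier G; K' \<in> carrier G\<rbrakk> \<Longrightarrow> K \<otimes>\<^bsub>G\<^esub> K' \<in> carrier G"
    and G_assoc: "\<lbrakk>K \<in> carrier G; K' \<in> carrier G; K'' \<in> carrier G\<rbrakk>
      \<Longrightarrow> K \<otimes>\<^bsub>G\<^esub> K' \<otimes>\<^bsub>G\<^esub> K'' = K \<otimes>\<^bsub>G\<^esub> (K' \<otimes>\<^bsub>G\<^esub> K'')"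
    and G_comm: "\<lbrakk>K \<in> carrier G; K' \<in> carrier G\<rbrakk> \<Longrightarrow> K \<otimes>\<^bsub>G\<^esub> K' = K' \<otimes>\<^bsub>G\<^esub> K"
    and r_invertible: "K \<in> carrier G \<Longrightarrow> \<exists>W. inverse_objects (r K) W"
    and phi_iso: "\<lbrakk>K \<in> carrier G; K' \<in> carrier G\<rbrakk> \<Longrightarrow> \<exists>g. ip (r K \<odot> r K') (r (K \<otimes>\<^bsub>G\<^esub> K')) (\<phi> K K') g"
    and phi_assoc: "\<lbrakk>K \<in> carrier G; K' \<in> carrier G; K'' \<in> carrier G\<rbrakk>
      \<Longrightarrow> \<phi> (K \<otimes>\<^bsub>G\<^esub> K') K'' \<cdot> (\<phi> K K' \<star> Idt C (r K''))
        = \<phi> K (K' \<otimes>\<^bsub>G\<^esub> K'') \<cdot> (Idt C (r K) \<star> \<phi> K' K'') \<cdot> Assoc C (r K) (r K') (r K'')"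
    and r_sym: "\<lbrakk>K \<in> carrier G; K' \<in> carrier G\<rbrakk> \<Longrightarrow> dbl (r K) (r K') = Idt C (r K \<odot> r K')"
begin

lemma r_in: "K \<in> carrier G \<Longrightarrow> r K \<in> Obj C"
  using r_invertible by (auto simp: inverse_objects_def)

lemma arr_phi: "\<lbrakk>K \<in> carrier G; K' \<in> carrier G\<rbrakk> \<Longrightarrow> arr (r K \<odot> r K') (r (K \<otimes>\<^bsub>G\<^esub> K')) (\<phi> K K')"
  using phi_iso ipD(1) by blast

lemma inverse_objects_transfer:
  assumes u: "ip Z Z' u u'" and i: "inverse_objects Z' W" shows "inverse_objects Z W"
proof -
  have W: "W \<in> Obj C" using i by (simp add: inverse_objects_def)
  obtain j j' k k' where "ip (Z' \<odot> W) (Unit C) j j'" "ip (W \<odot> Z') (Unit C) k k'" using inverse_objects_ip[OF i] by metis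
  then have e: "\<exists>f g. ip (Z \<odot> W) (Unit C) f g" "\<exists>f g. ip (W \<odot> Z) (Unit C) f g"
    using ip_Cmp[OF ip_TMor[OF u ip_Idt[OF W]]] ip_Cmp[OF ip_TMor[OF ip_Idt[OF W] u]] by blast+
  note Z = ipD(5)[OF u]
  show ?thesis
    unfolding inverse_objects_def isomorphic_ip[OF TObj_in[OF Z W] Unit_in] isomorphic_ip[OF TObj_in[OF W Z] Unit_in]
    using W Z e by blast
qed

text \<open>\<open>u\<close> identifies the invertible object \<open>Z\<close> with the representative of the class \<open>K\<close>.\<close>

definition lab :: "'o \<Rightarrow> 'g \<Rightarrow> 'm \<Rightarrow> bool"
  where "lab Z K u \<longleftrightarrow> K \<in> carrier G \<and> (\<exists>u'. ip Z (r K) u u')"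

text \<open>The tensor structure \<open>\<phi>\<close> transported along two labels; by
  \<open>lab_mu\<close> it labels the product by the product class.\<close>

definition mu :: "'g \<Rightarrow> 'g \<Rightarrow> 'm \<Rightarrow> 'm \<Rightarrow> 'm"
  where "mu K K' u u' = \<phi> K K' \<cdot> (u \<star> u')"

lemma labD: "lab Z K u \<Longrightarrow> K \<in> carrier G" "lab Z K u \<Longrightarrow> Z \<in> Obj C" "lab Z K u \<Longrightarrow> arr Z (r K) u"
  by (auto simp: lab_def dest: ipD)

lemma lab_r: "K \<in> carrier G \<Longrightarrow> lab (r K) K (Idt C (r K))"
  using ip_Idt[OF r_in] by (auto simp: lab_def)

lemma lab_invertible: "lab Z K u \<Longrightarrow> \<exists>W. inverse_objects Z W"
  using r_invertible inverse_objects_transfer unfolding lab_def by blast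

lemma ip_mu:
  assumes "lab Z K u" "lab Z' K' u'" shows "\<exists>g. ip (Z \<odot> Z') (r (K \<otimes>\<^bsub>G\<^esub> K')) (mu K K' u u') g"
proof -
  obtain v v' where v: "ip Z (r K) u v" "ip Z' (r K') u' v'" using assms by (auto simp: lab_def)
  obtain g where g: "ip (r K \<odot> r K') (r (K \<otimes>\<^bsub>G\<^esub> K')) (\<phi> K K') g"
    using phi_iso assms by (auto simp: lab_def)
  show ?thesis unfolding mu_def using ip_Cmp[OF ip_TMor[OF v] g] by blast
qed

lemma lab_mu: "\<lbrakk>lab Z K u; lab Z' K' u'\<rbrakk> \<Longrightarrow> lab (Z \<odot> Z') (K \<otimes>\<^bsub>G\<^esub> K') (mu K K' u u')"
  using ip_mu by (auto simp: lab_def)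

lemma arr_mu: "\<lbrakk>lab Z K u; lab Z' K' u'\<rbrakk> \<Longrightarrow> arr (Z \<odot> Z') (r (K \<otimes>\<^bsub>G\<^esub> K')) (mu K K' u u')"
  using ip_mu ipD(1) by blast

lemma lab_scalar: "\<lbrakk>lab Z K u; lab Z K v\<rbrakk> \<Longrightarrow> \<exists>t. t \<noteq> 0 \<and> v = Scl C t u"
  using lab_invertible iso_invertible_scalar unfolding lab_def by blast

lemma lab_nonzero: assumes "lab Z K u" shows "u \<noteq> Zero C Z (r K)" "\<not> zero_object C Z"
proof -
  obtain W where "inverse_objects Z W" using lab_invertible[OF assms] by blast
  then show "\<not> zero_object C Z" by (rule inverse_objects_nonzero)
  then show "u \<noteq> Zero C Z (r K)" using ip_nonzero assms unfolding lab_def by blast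
qed

lemma lab_Scl_eq: "\<lbrakk>lab Z K u; Scl C a u = Scl C b u\<rbrakk> \<Longrightarrow> a = b"
  using Scl_cancel[OF labD(3)] lab_nonzero(1) by blast

lemma lab_Cmp: "\<lbrakk>lab Z K u; ip Y Z f f'\<rbrakk> \<Longrightarrow> lab Y K (u \<cdot> f)"
  using ip_Cmp unfolding lab_def by blast

text \<open>The scalar of \<open>skeletal_braiding\<close>, with composition and braiding taken in
  \<open>C\<close>.\<close>

definition beta :: "'g \<Rightarrow> 'g \<Rightarrow> 'k"
  where "beta K K' = (THE t. t \<noteq> 0 \<and> \<phi> K' K \<cdot> Braid C (r K) (r K') = Scl C t (\<phi> K K'))"

text \<open>As \<open>G\<close> is commutative, both morphisms label \<open>r K \<odot> r K'\<close>
  by the same class, so they differ by a unique nonzero scalar.\<close>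

lemma beta_unique:
  assumes K: "K \<in> carrier G" "K' \<in> carrier G"
  shows "\<exists>!t. t \<noteq> 0 \<and> \<phi> K' K \<cdot> Braid C (r K) (r K') = Scl C t (\<phi> K K')"
proof -
  have l: "lab (r K \<odot> r K') (K \<otimes>\<^bsub>G\<^esub> K') (\<phi> K K')" "lab (r K' \<odot> r K) (K' \<otimes>\<^bsub>G\<^esub> K) (\<phi> K' K)"
    using K phi_iso by (auto simp: lab_def)
  have "lab (r K \<odot> r K') (K \<otimes>\<^bsub>G\<^esub> K') (\<phi> K' K \<cdot> Braid C (r K) (r K'))"
    using lab_Cmp[OF l(2) ip_Braid[OF r_in[OF K(1)] r_in[OF K(2)]]] G_comm[OF K] by simp
  then show ?thesis using lab_scalar[OF l(1)] lab_Scl_eq[OF l(1)] by metis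
qed

lemma beta:
  assumes "K \<in> carrier G" "K' \<in> carrier G"
  shows "beta K K' \<noteq> 0" "\<phi> K' K \<cdot> Braid C (r K) (r K') = Scl C (beta K K') (\<phi> K K')"
  using theI'[OF beta_unique[OF assms]] unfolding beta_def by auto

text \<open>By naturality of the braiding, the scalar measured on the representatives is valid for
  arbitrary labelled objects.\<close>

lemma mu_Braid:
  assumes l: "lab Z K u" "lab Z' K' u'"
  shows "mu K' K u' u \<cdot> Braid C Z Z' = Scl C (beta K K') (mu K K' u u')"
proof -
  note K = l(1-2)[THEN labD(1)] and Z = l(1-2)[THEN labD(2)] and u = l(1-2)[THEN labD(3)]
  note rK = r_in[OF K(1)] r_in[OF K(2)]
  have "mu K' K u' u \<cdot> Braid C Z Z' = \<phi> K' K \<cdot> (u' \<star> u) \<cdot> Braid C Z Z'"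
    unfolding mu_def by (rule arr_assoc[OF arr_Braid[OF Z] arr_TMor[OF u(2,1)] arr_phi[OF K(2,1)]])
  also have "(u' \<star> u) \<cdot> Braid C Z Z' = Braid C (r K) (r K') \<cdot> (u \<star> u')"
    by (rule Braid_natural[OF Z(1) rK(1) Z(2) rK(2) arr_Hom[OF u(1)] arr_Hom[OF u(2)], symmetric])
  also have "\<phi> K' K \<cdot> Braid C (r K) (r K') \<cdot> (u \<star> u') = (\<phi> K' K \<cdot> Braid C (r K) (r K')) \<cdot> (u \<star> u')"
    by (rule arr_assoc[OF arr_TMor[OF u] arr_Braid[OF rK] arr_phi[OF K(2,1)], symmetric])
  also have "\<dots> = Scl C (beta K K') (mu K K' u u')"
    unfolding beta(2)[OF K] mu_def by (rule arr_Scl_left[OF arr_TMor[OF u] arr_phi[OF K]])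
  finally show ?thesis .
qed

text \<open>Naturality of the associator reduces this to \<open>phi_assoc\<close> on the
  representatives.\<close>

lemma mu_assoc:
  assumes l: "lab X K u" "lab Y L v" "lab Z M w"
  shows "mu (K \<otimes>\<^bsub>G\<^esub> L) M (Idt C (r (K \<otimes>\<^bsub>G\<^esub> L))) w \<cdot> (mu K L u v \<star> Idt C Z)
    = mu K (L \<otimes>\<^bsub>G\<^esub> M) u (Idt C (r (L \<otimes>\<^bsub>G\<^esub> M))) \<cdot> (Idt C X \<star> mu L M v w) \<cdot> Assoc C X Y Z"
proof -
  note K = l(1-3)[THEN labD(1)] and o = l(1-3)[THEN labD(2)]
    and a = l(1-3)[THEN labD(3)]
  note rK = r_in[OF K(1)] r_in[OF K(2)] r_in[OF K(3)]
  have KL: "K \<otimes>\<^bsub>G\<^esub> L \<in> carrier G" "L \<otimes>\<^bsub>G\<^esub> M \<in> carrier G" using K by auto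
  note rKL = r_in[OF KL(1)] r_in[OF KL(2)]
  note p = arr_phi[OF K(1,2)] arr_phi[OF K(2,3)] arr_phi[OF KL(1) K(3)] arr_phi[OF K(1) KL(2)]
  note m = arr_mu[OF l(1,2)] arr_mu[OF l(2,3)]
  have "mu (K \<otimes>\<^bsub>G\<^esub> L) M (Idt C (r (K \<otimes>\<^bsub>G\<^esub> L))) w \<cdot> (mu K L u v \<star> Idt C Z)
    = \<phi> (K \<otimes>\<^bsub>G\<^esub> L) M \<cdot> (Idt C (r (K \<otimes>\<^bsub>G\<^esub> L)) \<star> w) \<cdot> (mu K L u v \<star> Idt C Z)"
    unfolding mu_def[of "K \<otimes>\<^bsub>G\<^esub> L"] by (rule arr_assoc[OF arr_TMor[OF m(1) arr_Idt[OF o(3)]] arr_TMor[OF arr_Idt[OF rKL(1)] a(3)] p(3)])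
  also have "(Idt C (r (K \<otimes>\<^bsub>G\<^esub> L)) \<star> w) \<cdot> (mu K L u v \<star> Idt C Z) = mu K L u v \<star> w"
    using arr_TMor_Cmp[OF m(1) arr_Idt[OF rKL(1)] arr_Idt[OF o(3)] a(3)] arr_Idt_Cmp[OF m(1)] arr_Cmp_Idt[OF a(3)] by simp
  also have "\<dots> = (\<phi> K L \<star> Idt C (r M)) \<cdot> ((u \<star> v) \<star> w)"
    unfolding mu_def using arr_TMor_Cmp[OF arr_TMor[OF a(1,2)] p(1) a(3) arr_Idt[OF rK(3)]] arr_Idt_Cmp[OF a(3)] by simp
  also have "\<phi> (K \<otimes>\<^bsub>G\<^esub> L) M \<cdot> \<dots> = (\<phi> (K \<otimes>\<^bsub>G\<^esub> L) M \<cdot> (\<phi> K L \<star> Idt C (r M))) \<cdot> ((u \<star> v) \<star> w)"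
    by (rule arr_assoc[OF arr_TMor[OF arr_TMor[OF a(1,2)] a(3)] arr_TMor[OF p(1) arr_Idt[OF rK(3)]] p(3), symmetric])
  also have "\<phi> (K \<otimes>\<^bsub>G\<^esub> L) M \<cdot> (\<phi> K L \<star> Idt C (r M)) = \<phi> K (L \<otimes>\<^bsub>G\<^esub> M) \<cdot> (Idt C (r K) \<star> \<phi> L M) \<cdot> Assoc C (r K) (r L) (r M)"
    by (rule phi_assoc[OF K])
  also have "(\<phi> K (L \<otimes>\<^bsub>G\<^esub> M) \<cdot> (Idt C (r K) \<star> \<phi> L M) \<cdot> Assoc C (r K) (r L) (r M)) \<cdot> ((u \<star> v) \<star> w)
    = \<phi> K (L \<otimes>\<^bsub>G\<^esub> M) \<cdot> ((Idt C (r K) \<star> \<phi> L M) \<cdot> Assoc C (r K) (r L) (r M)) \<cdot> ((u \<star> v) \<star> w)"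
    by (rule arr_assoc[OF arr_TMor[OF arr_TMor[OF a(1,2)] a(3)] arr_Cmp[OF arr_TMor[OF arr_Idt[OF rK(1)] p(2)] arr_Assoc[OF rK]] p(4)])
  also have "((Idt C (r K) \<star> \<phi> L M) \<cdot> Assoc C (r K) (r L) (r M)) \<cdot> ((u \<star> v) \<star> w)
    = (Idt C (r K) \<star> \<phi> L M) \<cdot> Assoc C (r K) (r L) (r M) \<cdot> ((u \<star> v) \<star> w)"
    by (rule arr_assoc[OF arr_TMor[OF arr_TMor[OF a(1,2)] a(3)] arr_Assoc[OF rK] arr_TMor[OF arr_Idt[OF rK(1)] p(2)]])
  also have "Assoc C (r K) (r L) (r M) \<cdot> ((u \<star> v) \<star> w) = (u \<star> (v \<star> w)) \<cdot> Assoc C X Y Z"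
    by (rule arr_Assoc_natural[OF a])
  also have "(Idt C (r K) \<star> \<phi> L M) \<cdot> (u \<star> (v \<star> w)) \<cdot> Assoc C X Y Z = ((Idt C (r K) \<star> \<phi> L M) \<cdot> (u \<star> (v \<star> w))) \<cdot> Assoc C X Y Z"
    by (rule arr_assoc[OF arr_Assoc[OF o] arr_TMor[OF a(1) arr_TMor[OF a(2,3)]] arr_TMor[OF arr_Idt[OF rK(1)] p(2)], symmetric])
  also have "(Idt C (r K) \<star> \<phi> L M) \<cdot> (u \<star> (v \<star> w)) = u \<star> mu L M v w"
    unfolding mu_def using arr_TMor_Cmp[OF a(1) arr_Idt[OF rK(1)] arr_TMor[OF a(2,3)] p(2)] arr_Idt_Cmp[OF a(1)] by simp
  also have "\<dots> = (u \<star> Idt C (r (L \<otimes>\<^bsub>G\<^esub> M))) \<cdot> (Idt C X \<star> mu L M v w)"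
    using arr_TMor_Cmp[OF arr_Idt[OF o(1)] a(1) m(2) arr_Idt[OF rKL(2)]] arr_Idt_Cmp[OF m(2)] arr_Cmp_Idt[OF a(1)] by simp
  also have "((u \<star> Idt C (r (L \<otimes>\<^bsub>G\<^esub> M))) \<cdot> (Idt C X \<star> mu L M v w)) \<cdot> Assoc C X Y Z
    = (u \<star> Idt C (r (L \<otimes>\<^bsub>G\<^esub> M))) \<cdot> (Idt C X \<star> mu L M v w) \<cdot> Assoc C X Y Z"
    by (rule arr_assoc[OF arr_Assoc[OF o] arr_TMor[OF arr_Idt[OF o(1)] m(2)] arr_TMor[OF a(1) arr_Idt[OF rKL(2)]]])
  also have "\<phi> K (L \<otimes>\<^bsub>G\<^esub> M) \<cdot> \<dots> = mu K (L \<otimes>\<^bsub>G\<^esub> M) u (Idt C (r (L \<otimes>\<^bsub>G\<^esub> M))) \<cdot> (Idt C X \<star> mu L M v w) \<cdot> Assoc C X Y Z"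
    unfolding mu_def[of K "L \<otimes>\<^bsub>G\<^esub> M"]
    by (rule arr_assoc[OF arr_Cmp[OF arr_TMor[OF arr_Idt[OF o(1)] m(2)] arr_Assoc[OF o]] arr_TMor[OF a(1) arr_Idt[OF rKL(2)]] p(4), symmetric])
  finally show ?thesis .
qed

definition mub :: "'o \<Rightarrow> 'o \<Rightarrow> 'g \<Rightarrow> 'g \<Rightarrow> 'm \<Rightarrow> 'm \<Rightarrow> ('o, 'm) box"
  where "mub Z Z' K K' u u' = bm Z Z' (r (K \<otimes>\<^bsub>G\<^esub> K')) (mu K K' u u')"

lemma mub_simps [simp]: "bdom (mub Z Z' K K' u u') = [Z, Z']" "bcod (mub Z Z' K K' u u') = [r (K \<otimes>\<^bsub>G\<^esub> K')]"
  by (simp_all add: mub_def)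

lemma box_ok_mub: "\<lbrakk>lab Z K u; lab Z' K' u'\<rbrakk> \<Longrightarrow> box_ok (mub Z Z' K K' u u')"
  unfolding mub_def by (intro box_ok_bm labD arr_mu)

text \<open>
  All paths between threefold products are compared after evaluation in the representative of the product
  class; \<open>phi_assoc\<close> makes the two ways of bracketing agree.
\<close>

definition EL :: "nat \<Rightarrow> 'o \<Rightarrow> 'o \<Rightarrow> 'o \<Rightarrow> 'g \<Rightarrow> 'g \<Rightarrow> 'g \<Rightarrow> 'm \<Rightarrow> 'm \<Rightarrow> 'm \<Rightarrow> ('o, 'm) state \<Rightarrow> ('o, 'm) state"
  where "EL n X Y Z K L M u v w s = act n (mub (r (K \<otimes>\<^bsub>G\<^esub> L)) Z (K \<otimes>\<^bsub>G\<^esub> L) M (Idt C (r (K \<otimes>\<^bsub>G\<^esub> L))) w) (act n (mub X Y K L u v) s)"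

lemma EL_right:
  assumes l: "lab X K u" "lab Y L v" "lab Z M w" and w: "win n [X, Y, Z] s"
  shows "EL n X Y Z K L M u v w s = act n (mub X (r (L \<otimes>\<^bsub>G\<^esub> M)) K (L \<otimes>\<^bsub>G\<^esub> M) u (Idt C (r (L \<otimes>\<^bsub>G\<^esub> M)))) (act (Suc n) (mub Y Z L M v w) s)"
proof -
  note K = l(1-3)[THEN labD(1)]
  have KL: "K \<otimes>\<^bsub>G\<^esub> L \<in> carrier G" "L \<otimes>\<^bsub>G\<^esub> M \<in> carrier G" using K by auto
  note g1 = arr_mu[OF lab_r[OF KL(1)] l(3)] and g2 = arr_mu[OF l(1) lab_r[OF KL(2)]]
  have as: "K \<otimes>\<^bsub>G\<^esub> (L \<otimes>\<^bsub>G\<^esub> M) = K \<otimes>\<^bsub>G\<^esub> L \<otimes>\<^bsub>G\<^esub> M" using G_assoc[OF K] by simp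
  show ?thesis unfolding EL_def mub_def
    using bm_assoc[OF l(1-3)[THEN labD(2)] arr_mu[OF l(1,2)] g1 arr_mu[OF l(2,3)] g2[unfolded as] mu_assoc[OF l] w]
    unfolding as .
qed

lemma good_EL:
  assumes l: "lab X K u" "lab Y L v" "lab Z M w" and w: "win n [X, Y, Z] s"
  shows "good (EL n X Y Z K L M u v w s)"
proof -
  have KL: "K \<otimes>\<^bsub>G\<^esub> L \<in> carrier G" using l(1-2)[THEN labD(1)] by auto
  obtain us vs where sh: "cur s = us @ [X, Y, Z] @ vs" "length us = n" using win_shape[OF w] by blast
  show ?thesis unfolding EL_def using win_good[OF w] sh box_ok_mub[OF l(1,2)] box_ok_mub[OF lab_r[OF KL] l(3)] by (simp add: st_simps)
qed

text \<open>Evaluation consists of isomorphisms, so comparing scalars after evaluation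
  suffices.\<close>

lemma EL_inject:
  assumes l: "lab X K u" "lab Y L v" "lab Z M w" and w: "win n [X, Y, Z] s" "win n [X, Y, Z] s'"
    and e: "EL n X Y Z K L M u v w s = EL n X Y Z K L M u v w s'"
  shows "s = s'"
proof -
  have KL: "K \<otimes>\<^bsub>G\<^esub> L \<in> carrier G" using l(1-2)[THEN labD(1)] by auto
  note l' = lab_r[OF KL]
  obtain g g' where g: "ip (X \<odot> Y) (r (K \<otimes>\<^bsub>G\<^esub> L)) (mu K L u v) g"
    "ip (r (K \<otimes>\<^bsub>G\<^esub> L) \<odot> Z) (r (K \<otimes>\<^bsub>G\<^esub> L \<otimes>\<^bsub>G\<^esub> M)) (mu (K \<otimes>\<^bsub>G\<^esub> L) M (Idt C (r (K \<otimes>\<^bsub>G\<^esub> L))) w) g'"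
    using ip_mu[OF l(1,2)] ip_mu[OF l' l(3)] by blast
  have w': "win n [r (K \<otimes>\<^bsub>G\<^esub> L), Z] (act n (mub X Y K L u v) s) \<and> win n [X, Y] s" if w: "win n [X, Y, Z] s" for s
  proof -
    obtain us vs where sh: "cur s = us @ [X, Y, Z] @ vs" "length us = n" using win_shape[OF w] by blast
    show ?thesis using win_good[OF w] sh box_ok_mub[OF l(1,2)] by (simp add: st_simps)
  qed
  note ws = w'[OF w(1)] w'[OF w(2)]
  have "act n (mub X Y K L u v) s = act n (mub X Y K L u v) s'"
    by (rule act_bm_inject[OF labD(2)[OF l'] labD(2)[OF l(3)] g(2) ws(1)[THEN conjunct1] ws(2)[THEN conjunct1] e[unfolded EL_def mub_def[of "r (K \<otimes>\<^bsub>G\<^esub> L)"]]])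
  then show ?thesis
    unfolding mub_def by (rule act_bm_inject[OF l(1-2)[THEN labD(2)] g(1) ws(1)[THEN conjunct2] ws(2)[THEN conjunct2]])
qed

text \<open>After evaluation an isomorphism of twofold products counts only by its scalar
  \<open>a\<close> relative to the labels.\<close>

lemma EL_bx2_left:
  assumes l: "lab X K u" "lab Y L v" "lab Z M w" "lab X' K' u'" "lab Y' L' v'"
    and k: "arr (X \<odot> Y) (X' \<odot> Y') k" and KL: "K' \<otimes>\<^bsub>G\<^esub> L' = K \<otimes>\<^bsub>G\<^esub> L"
    and e: "mu K' L' u' v' \<cdot> k = Scl C a (mu K L u v)" and w: "win n [X, Y, Z] s"
  shows "EL n X' Y' Z K' L' M u' v' w (act n (bx2 X Y X' Y' k) s) = sscl a (EL n X Y Z K L M u v w s)"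
proof -
  have c: "K \<otimes>\<^bsub>G\<^esub> L \<in> carrier G" using l(1-2)[THEN labD(1)] by auto
  obtain us vs where sh: "cur s = us @ [X, Y, Z] @ vs" "length us = n" using win_shape[OF w] by blast
  have wXY: "win n [X, Y] s" using win_good[OF w] sh by (simp add: win_iff)
  have "act n (mub X' Y' K' L' u' v') (act n (bx2 X Y X' Y' k) s) = sscl a (act n (mub X Y K L u v) s)"
    unfolding mub_def act_bm_bx2[OF labD(2)[OF l(1)] labD(2)[OF l(2)] labD(2)[OF l(4)] labD(2)[OF l(5)] k arr_mu[OF l(4,5)] wXY] e
      unfolding KL using act_bm_Scl[OF l(1-2)[THEN labD(2)] arr_mu[OF l(1,2)] wXY] .
  then show ?thesis
    unfolding EL_def KL using win_good[OF w] sh box_ok_mub[OF l(1,2)] box_ok_mub[OF lab_r[OF c] l(3)]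
    by (simp add: act_sscl st_simps)
qed

text \<open>On the last two factors the evaluation is first rebracketed by
  \<open>EL_right\<close>.\<close>

lemma EL_bx2_right:
  assumes l: "lab X K u" "lab Y L v" "lab Z M w" "lab Y' L' v'" "lab Z' M' w'"
    and k: "arr (Y \<odot> Z) (Y' \<odot> Z') k" and LM: "L' \<otimes>\<^bsub>G\<^esub> M' = L \<otimes>\<^bsub>G\<^esub> M"
    and e: "mu L' M' v' w' \<cdot> k = Scl C a (mu L M v w)" and w: "win n [X, Y, Z] s"
  shows "EL n X Y' Z' K L' M' u v' w' (act (Suc n) (bx2 Y Z Y' Z' k) s) = sscl a (EL n X Y Z K L M u v w s)"
proof -
  have c: "L \<otimes>\<^bsub>G\<^esub> M \<in> carrier G" using labD(1)[OF l(2)] labD(1)[OF l(3)] by auto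
  obtain us vs where sh: "cur s = us @ [X, Y, Z] @ vs" "length us = n" using win_shape[OF w] by blast
  have wYZ: "win (Suc n) [Y, Z] s" using win_good[OF w] sh by (simp add: win_iff)
  have w2: "win n [X, Y', Z'] (act (Suc n) (bx2 Y Z Y' Z' k) s)"
    using win_good[OF w] sh box_ok_bx2[OF labD(2)[OF l(2)] labD(2)[OF l(3)] labD(2)[OF l(4)] labD(2)[OF l(5)] k] by (simp add: st_simps)
  have "act (Suc n) (mub Y' Z' L' M' v' w') (act (Suc n) (bx2 Y Z Y' Z' k) s) = sscl a (act (Suc n) (mub Y Z L M v w) s)"
    unfolding mub_def act_bm_bx2[OF labD(2)[OF l(2)] labD(2)[OF l(3)] labD(2)[OF l(4)] labD(2)[OF l(5)] k arr_mu[OF l(4,5)] wYZ] e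
      unfolding LM using act_bm_Scl[OF labD(2)[OF l(2)] labD(2)[OF l(3)] arr_mu[OF l(2,3)] wYZ] .
  then show ?thesis
    unfolding EL_right[OF l(1,4,5) w2] EL_right[OF l(1-3) w] LM
    using win_good[OF w] sh box_ok_mub[OF l(2,3)] box_ok_mub[OF l(1) lab_r[OF c]]
    by (simp add: act_sscl st_simps)
qed

lemma EL_brd_left:
  assumes l: "lab X K u" "lab Y L v" "lab Z M w" and w: "win n [X, Y, Z] s"
  shows "EL n Y X Z L K M v u w (act n (brd X Y) s) = sscl (beta K L) (EL n X Y Z K L M u v w s)"
  unfolding brd_def
  by (rule EL_bx2_left[OF l l(2,1) arr_Braid[OF l(1-2)[THEN labD(2)]] G_comm[OF labD(1)[OF l(2)] labD(1)[OF l(1)]] mu_Braid[OF l(1,2)] w])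

lemma EL_brd_right:
  assumes l: "lab X K u" "lab Y L v" "lab Z M w" and w: "win n [X, Y, Z] s"
  shows "EL n X Z Y K M L u w v (act (Suc n) (brd Y Z) s) = sscl (beta L M) (EL n X Y Z K L M u v w s)"
  unfolding brd_def
  by (rule EL_bx2_right[OF l l(3,2) arr_Braid[OF labD(2)[OF l(2)] labD(2)[OF l(3)]] G_comm[OF labD(1)[OF l(3)] labD(1)[OF l(2)]] mu_Braid[OF l(2,3)] w])

text \<open>Both braidings together multiply \<open>\<phi> K L\<close> by both scalars, while by
  \<open>r_sym\<close> they compose to the identity.\<close>

lemma beta_sym:
  assumes K: "K \<in> carrier G" "L \<in> carrier G"
  shows "beta K L * beta L K = 1"
proof -
  note rK = r_in[OF K(1)] r_in[OF K(2)] note B = arr_Braid[OF rK] arr_Braid[OF rK(2,1)]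
  have l: "lab (r K \<odot> r L) (K \<otimes>\<^bsub>G\<^esub> L) (\<phi> K L)" using K phi_iso by (auto simp: lab_def)
  have "\<phi> K L = \<phi> K L \<cdot> Braid C (r L) (r K) \<cdot> Braid C (r K) (r L)"
    using r_sym[OF K] arr_Cmp_Idt[OF arr_phi[OF K]] by (simp add: dbl_def)
  also have "\<dots> = Scl C (beta L K) (\<phi> L K) \<cdot> Braid C (r K) (r L)"
    using arr_assoc[OF B arr_phi[OF K]] beta(2)[OF K(2,1)] by simp
  also have "\<dots> = Scl C (beta L K) (Scl C (beta K L) (\<phi> K L))"
    using arr_Scl_left[OF B(1) arr_phi[OF K(2,1)]] beta(2)[OF K] by simp
  also have "\<dots> = Scl C (beta L K * beta K L) (\<phi> K L)" by (rule arr_Scl_Scl[OF arr_phi[OF K]])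
  finally have "Scl C 1 (\<phi> K L) = Scl C (beta L K * beta K L) (\<phi> K L)" using arr_Scl_one[OF arr_phi[OF K]] by simp
  then show ?thesis using lab_Scl_eq[OF l] by (simp add: mult.commute)
qed

text \<open>The identity state lives on a product of invertible objects and the unit, which is
  nonzero; this makes the scalar unique.\<close>

lemma sscl_eq_EL:
  assumes l: "lab X K u" "lab Y L v" "lab Z M w"
    and e: "sscl a (EL 0 X Y Z K L M u v w (idst [X, Y, Z] (Unit C))) = sscl b (EL 0 X Y Z K L M u v w (idst [X, Y, Z] (Unit C)))"
  shows "a = b"
proof -
  let ?s = "idst [X, Y, Z] (Unit C)"
  note o = l(1-3)[THEN labD(2)]
  have g: "good ?s" using o Unit_in by (simp add: good_idst)
  have w: "win 0 [X, Y, Z] ?s" using g by (simp add: win_iff)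
  have KL: "K \<otimes>\<^bsub>G\<^esub> L \<in> carrier G" using l(1-2)[THEN labD(1)] by auto
  have "EL 0 X Y Z K L M u v w (sscl a ?s) = EL 0 X Y Z K L M u v w (sscl b ?s)"
    using e g box_ok_mub[OF l(1,2)] box_ok_mub[OF lab_r[OF KL] l(3)] by (simp add: EL_def act_sscl st_simps)
  then have "sscl a ?s = sscl b ?s" by (rule EL_inject[OF l win_sscl[OF w] win_sscl[OF w]])
  then have "Scl C a (Idt C (X \<odot> Y \<odot> Z \<odot> Unit C)) = Scl C b (Idt C (X \<odot> Y \<odot> Z \<odot> Unit C))"
    by (simp add: sscl_def idst_def)
  moreover have ob: "X \<odot> Y \<odot> Z \<odot> Unit C \<in> Obj C" using o Unit_in TObj_in by auto
  moreover have "\<not> zero_object C (X \<odot> Y \<odot> Z \<odot> Unit C)"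
    using o Unit_in TObj_in lab_nonzero(2)[OF l(1)] lab_nonzero(2)[OF l(2)] lab_nonzero(2)[OF l(3)] Unit_nonzero nonzero_TObj by auto
  ultimately show ?thesis using Scl_cancel[OF arr_Idt[OF ob] Idt_nonzero[OF ob]] by blast
qed

text \<open>Either the representative of the product class is carried across \<open>Z\<close> as one
  object, or \<open>Y\<close> and \<open>X\<close> are carried across one after the other. Because
  \<open>\<phi>\<close> is compatible with the trivial associator, the two evaluations agree without
  a further scalar.\<close>

lemma beta_mult_left:
  assumes K: "K \<in> carrier G" "L \<in> carrier G" "M \<in> carrier G"
  shows "beta (K \<otimes>\<^bsub>G\<^esub> L) M = beta K M * beta L M"
proof -
  have KL: "K \<otimes>\<^bsub>G\<^esub> L \<in> carrier G" using K by auto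
  define X Y Z where "X = r K" and "Y = r L" and "Z = r M"
  define u v w where "u = Idt C X" and "v = Idt C Y" and "w = Idt C Z"
  have l: "lab X K u" "lab Y L v" "lab Z M w" unfolding X_def Y_def Z_def u_def v_def w_def by (intro lab_r K)+
  note o = l(1-3)[THEN labD(2)]
  note l' = lab_r[OF KL]
  define s where "s = idst [X, Y, Z] (Unit C)"
  have s: "good s" "cur s = [X, Y, Z]" unfolding s_def using o Unit_in by (simp_all add: good_idst)
  have ws: "win 0 [X, Y, Z] s" using s by (simp add: win_iff)
  have s1: "good (act 1 (brd Y Z) s)" "cur (act 1 (brd Y Z) s) = [X, Z, Y]" using s o by (simp_all add: st_simps)
  \<comment> \<open>Now \<open>Z\<close> has been moved to the front, past \<open>Y\<close> and then
    past \<open>X\<close>.\<close>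
  define s2 where "s2 = act 0 (brd X Z) (act 1 (brd Y Z) s)"
  have s2: "good s2" "cur s2 = [Z, X, Y]" unfolding s2_def using s o by (simp_all add: st_simps)
  define Q where "Q = mub Z (r (K \<otimes>\<^bsub>G\<^esub> L)) M (K \<otimes>\<^bsub>G\<^esub> L) w (Idt C (r (K \<otimes>\<^bsub>G\<^esub> L)))"
  have m: "good (act 0 (mub X Y K L u v) s)" "cur (act 0 (mub X Y K L u v) s) = [r (K \<otimes>\<^bsub>G\<^esub> L), Z]"
    using s box_ok_mub[OF l(1,2)] by (simp_all add: st_simps)
  have "sscl (beta (K \<otimes>\<^bsub>G\<^esub> L) M) (EL 0 X Y Z K L M u v w s) = act 0 Q (act 0 (brd (r (K \<otimes>\<^bsub>G\<^esub> L)) Z) (act 0 (mub X Y K L u v) s))"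
  proof -
    have wm: "win 0 [r (K \<otimes>\<^bsub>G\<^esub> L), Z] (act 0 (mub X Y K L u v) s)" using m by (simp add: win_iff)
    have "act 0 Q (act 0 (brd (r (K \<otimes>\<^bsub>G\<^esub> L)) Z) (act 0 (mub X Y K L u v) s))
      = act 0 (bm (r (K \<otimes>\<^bsub>G\<^esub> L)) Z (r (M \<otimes>\<^bsub>G\<^esub> (K \<otimes>\<^bsub>G\<^esub> L))) (mu M (K \<otimes>\<^bsub>G\<^esub> L) w (Idt C (r (K \<otimes>\<^bsub>G\<^esub> L))) \<cdot> Braid C (r (K \<otimes>\<^bsub>G\<^esub> L)) Z)) (act 0 (mub X Y K L u v) s)"
      unfolding Q_def mub_def[of Z] brd_def
      by (rule act_bm_bx2[OF labD(2)[OF l'] o(3) o(3) labD(2)[OF l'] arr_Braid[OF labD(2)[OF l'] o(3)] arr_mu[OF l(3) l'] wm])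
    also have "\<dots> = sscl (beta (K \<otimes>\<^bsub>G\<^esub> L) M) (EL 0 X Y Z K L M u v w s)"
      unfolding mu_Braid[OF l' l(3)] EL_def G_comm[OF K(3) KL] mub_def[of "r (K \<otimes>\<^bsub>G\<^esub> L)"]
      by (rule act_bm_Scl[OF labD(2)[OF l'] o(3) arr_mu[OF l' l(3)] wm])
    finally show ?thesis ..
  qed
  also have "act 0 (brd (r (K \<otimes>\<^bsub>G\<^esub> L)) Z) (act 0 (mub X Y K L u v) s) = act 1 (mub X Y K L u v) s2"
    unfolding mub_def s2_def using brd_bm[OF o arr_mu[OF l(1,2)] ws] by simp
  also have "act 0 Q (act 1 (mub X Y K L u v) s2) = EL 0 Z X Y M K L w u v s2"
    unfolding Q_def using EL_right[OF l(3,1,2), of 0 s2] s2 by (simp add: win_iff)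
  also have "\<dots> = sscl (beta K M) (EL 0 X Z Y K M L u w v (act 1 (brd Y Z) s))"
    unfolding s2_def using s1 by (intro EL_brd_left l) (simp add: win_iff)
  also have "EL 0 X Z Y K M L u w v (act 1 (brd Y Z) s) = sscl (beta L M) (EL 0 X Y Z K L M u v w s)"
    using EL_brd_right[OF l ws] by simp
  also have "sscl (beta K M) \<dots> = sscl (beta K M * beta L M) (EL 0 X Y Z K L M u v w s)"
    by (rule sscl_sscl[OF good_EL[OF l ws]])
  finally show ?thesis unfolding s_def by (rule sscl_eq_EL[OF l])
qed

text \<open>Follows from the left version, since by \<open>beta_sym\<close> exchanging the arguments
  inverts the scalar.\<close>

lemma beta_mult_right:
  assumes K: "K \<in> carrier G" "L \<in> carrier G" "M \<in> carrier G"
  shows "beta K (L \<otimes>\<^bsub>G\<^esub> M) = beta K L * beta K M"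
proof -
  have LM: "L \<otimes>\<^bsub>G\<^esub> M \<in> carrier G" using K by auto
  have "beta K (L \<otimes>\<^bsub>G\<^esub> M) * (beta L K * beta M K) = 1"
    using beta_sym[OF K(1) LM] beta_mult_left[OF K(2,3,1)] by simp
  moreover have "(beta K L * beta K M) * (beta L K * beta M K) = 1"
    using beta_sym[OF K(1,2)] beta_sym[OF K(1,3)] by (metis mult.assoc mult.left_commute mult_1)
  ultimately show ?thesis
    using beta(1)[OF K(2,1)] beta(1)[OF K(3,1)] by (metis mult_right_cancel mult_eq_0_iff)
qed

text \<open>Both paths are evaluated by \<open>EL\<close>. Each isomorphism contributes its scalar
  and the single interchange of \<open>T1\<close> with \<open>N\<close> contributes
  \<open>beta KT1 KN\<close>, whence the quotient.\<close>

lemma pentagon_L: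
  assumes l: "lab P KP uP" "lab Q KQ uQ" "lab N KN uN" "lab S1 KS1 uS1" "lab T1 KT1 uT1" "lab S2 KS2 uS2" "lab T2 KT2 uT2"
      "lab S' KS' uS'" "lab T' KT' uT'" "lab U KU uU"
    and k: "arr (P \<odot> Q) (S1 \<odot> T1) k1" "arr (S1 \<odot> N) (S2 \<odot> T2) k2" "arr (Q \<odot> N) (S' \<odot> T') k3"
      "arr (P \<odot> S') (S2 \<odot> U) k4" "arr (U \<odot> T') (T2 \<odot> T1) k5"
    and KK: "KS1 \<otimes>\<^bsub>G\<^esub> KT1 = KP \<otimes>\<^bsub>G\<^esub> KQ" "KS2 \<otimes>\<^bsub>G\<^esub> KT2 = KS1 \<otimes>\<^bsub>G\<^esub> KN" "KS' \<otimes>\<^bsub>G\<^esub> KT' = KQ \<otimes>\<^bsub>G\<^esub> KN"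
      "KS2 \<otimes>\<^bsub>G\<^esub> KU = KP \<otimes>\<^bsub>G\<^esub> KS'" "KT2 \<otimes>\<^bsub>G\<^esub> KT1 = KU \<otimes>\<^bsub>G\<^esub> KT'"
    and e: "mu KS1 KT1 uS1 uT1 \<cdot> k1 = Scl C a1 (mu KP KQ uP uQ)" "mu KS2 KT2 uS2 uT2 \<cdot> k2 = Scl C a2 (mu KS1 KN uS1 uN)"
      "mu KS' KT' uS' uT' \<cdot> k3 = Scl C a3 (mu KQ KN uQ uN)" "mu KS2 KU uS2 uU \<cdot> k4 = Scl C a4 (mu KP KS' uP uS')"
      "mu KT2 KT1 uT2 uT1 \<cdot> k5 = Scl C a5 (mu KU KT' uU uT')"
    and nz: "a3 \<noteq> 0" "a4 \<noteq> 0" "a5 \<noteq> 0" and w: "win n [P, Q, N] s"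
  shows "act n (bx2 S1 N S2 T2 k2) (act (Suc n) (brd T1 N) (act n (bx2 P Q S1 T1 k1) s))
      = sscl ((a2 * beta KT1 KN * a1) / (a5 * a4 * a3)) (act (Suc n) (bx2 U T' T2 T1 k5) (act n (bx2 P S' S2 U k4) (act (Suc n) (bx2 Q N S' T' k3) s)))"
proof -
  note o = l(1-10)[THEN labD(2)]
  note bk = box_ok_bx2[OF o(1,2,4,5) k(1)] box_ok_bx2[OF o(4,3,6,7) k(2)] box_ok_bx2[OF o(2,3,8,9) k(3)]
    box_ok_bx2[OF o(1,8,6,10) k(4)] box_ok_bx2[OF o(10,9,7,5) k(5)]
  obtain us vs where sh: "cur s = us @ [P, Q, N] @ vs" "length us = n" using win_shape[OF w] by blast
  note g = win_good[OF w]
  define s1 where "s1 = act n (bx2 P Q S1 T1 k1) s"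
  have s1: "win n [S1, T1, N] s1" unfolding s1_def using g sh bk by (simp add: st_simps)
  define s2 where "s2 = act (Suc n) (brd T1 N) s1"
  have s2: "win n [S1, N, T1] s2" unfolding s2_def s1_def using g sh bk o by (simp add: st_simps)
  define s3 where "s3 = act n (bx2 S1 N S2 T2 k2) s2"
  have s3: "win n [S2, T2, T1] s3" unfolding s3_def s2_def s1_def using g sh bk o by (simp add: st_simps)
  define w1 where "w1 = act (Suc n) (bx2 Q N S' T' k3) s"
  have w1: "win n [P, S', T'] w1" unfolding w1_def using g sh bk by (simp add: st_simps)
  define w2 where "w2 = act n (bx2 P S' S2 U k4) w1"
  have w2: "win n [S2, U, T'] w2" unfolding w2_def w1_def using g sh bk by (simp add: st_simps)
  define w3 where "w3 = act (Suc n) (bx2 U T' T2 T1 k5) w2"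
  have w3: "win n [S2, T2, T1] w3" unfolding w3_def w2_def w1_def using g sh bk by (simp add: st_simps)
  define E where "E = EL n P Q N KP KQ KN uP uQ uN s"
  have gE: "good E" unfolding E_def by (rule good_EL[OF l(1-3) w])
  have "EL n S2 T2 T1 KS2 KT2 KT1 uS2 uT2 uT1 s3 = sscl a2 (EL n S1 N T1 KS1 KN KT1 uS1 uN uT1 s2)"
    unfolding s3_def by (rule EL_bx2_left[OF l(4,3,5,6,7) k(2) KK(2) e(2) s2])
  also have "EL n S1 N T1 KS1 KN KT1 uS1 uN uT1 s2 = sscl (beta KT1 KN) (EL n S1 T1 N KS1 KT1 KN uS1 uT1 uN s1)"
    unfolding s2_def by (rule EL_brd_right[OF l(4,5,3) s1])
  also have "EL n S1 T1 N KS1 KT1 KN uS1 uT1 uN s1 = sscl a1 E"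
    unfolding s1_def E_def by (rule EL_bx2_left[OF l(1-5) k(1) KK(1) e(1) w])
  finally have L: "EL n S2 T2 T1 KS2 KT2 KT1 uS2 uT2 uT1 s3 = sscl (a2 * beta KT1 KN * a1) E"
    using gE by (simp add: sscl_sscl mult.assoc)
  have "EL n S2 T2 T1 KS2 KT2 KT1 uS2 uT2 uT1 w3 = sscl a5 (EL n S2 U T' KS2 KU KT' uS2 uU uT' w2)"
    unfolding w3_def by (rule EL_bx2_right[OF l(6,10,9,7,5) k(5) KK(5) e(5) w2])
  also have "EL n S2 U T' KS2 KU KT' uS2 uU uT' w2 = sscl a4 (EL n P S' T' KP KS' KT' uP uS' uT' w1)"
    unfolding w2_def by (rule EL_bx2_left[OF l(1,8,9,6,10) k(4) KK(4) e(4) w1])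
  also have "EL n P S' T' KP KS' KT' uP uS' uT' w1 = sscl a3 E"
    unfolding w1_def E_def by (rule EL_bx2_right[OF l(1,2,3,8,9) k(3) KK(3) e(3) w])
  finally have R: "EL n S2 T2 T1 KS2 KT2 KT1 uS2 uT2 uT1 w3 = sscl (a5 * a4 * a3) E"
    using gE by (simp add: sscl_sscl mult.assoc)
  let ?t = "(a2 * beta KT1 KN * a1) / (a5 * a4 * a3)"
  have KL: "KS2 \<otimes>\<^bsub>G\<^esub> KT2 \<in> carrier G" using labD(1)[OF l(6)] labD(1)[OF l(7)] by auto
  obtain us' vs' where sh': "cur w3 = us' @ [S2, T2, T1] @ vs'" "length us' = n" using win_shape[OF w3] by blast
  have "EL n S2 T2 T1 KS2 KT2 KT1 uS2 uT2 uT1 (sscl ?t w3) = sscl ?t (EL n S2 T2 T1 KS2 KT2 KT1 uS2 uT2 uT1 w3)"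
    using win_good[OF w3] sh' box_ok_mub[OF l(6,7)] box_ok_mub[OF lab_r[OF KL] l(5)] by (simp add: EL_def act_sscl st_simps)
  also have "\<dots> = EL n S2 T2 T1 KS2 KT2 KT1 uS2 uT2 uT1 s3"
    unfolding L R using gE nz by (simp add: sscl_sscl)
  finally have "s3 = sscl ?t w3" using EL_inject[OF l(6,7,5) s3 win_sscl[OF w3]] by simp
  then show ?thesis by (simp add: s3_def s2_def s1_def w3_def w2_def w1_def)
qed

text \<open>The twofold counterpart of \<open>EL_bx2_left\<close>, used for the hexagons.\<close>

lemma mub_bx2:
  assumes l: "lab X K u" "lab Y L v" "lab X' K' u'" "lab Y' L' v'"
    and k: "arr (X \<odot> Y) (X' \<odot> Y') k" and KL: "K' \<otimes>\<^bsub>G\<^esub> L' = K \<otimes>\<^bsub>G\<^esub> L"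
    and e: "mu K' L' u' v' \<cdot> k = Scl C a (mu K L u v)" and w: "win n [X, Y] s"
  shows "act n (mub X' Y' K' L' u' v') (act n (bx2 X Y X' Y' k) s) = sscl a (act n (mub X Y K L u v) s)"
  unfolding mub_def act_bm_bx2[OF l(1-4)[THEN labD(2)] k arr_mu[OF l(3,4)] w] e
  unfolding KL using act_bm_Scl[OF l(1-2)[THEN labD(2)] arr_mu[OF l(1,2)] w] .

lemma mub_bx_left:
  assumes l: "lab X K u" "lab Y L v" "lab X' K u'" and h: "arr X X' h"
    and e: "u' \<cdot> h = Scl C b u" and w: "win n [X, Y] s"
  shows "act n (mub X' Y K L u' v) (act n (bx X X' h) s) = sscl b (act n (mub X Y K L u v) s)"
proof -
  note K = l(1-2)[THEN labD(1)] and o = l(1-3)[THEN labD(2)]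
    and a = l(1-3)[THEN labD(3)]
  have "mu K L u' v \<cdot> (h \<star> Idt C Y) = \<phi> K L \<cdot> (u' \<star> v) \<cdot> (h \<star> Idt C Y)"
    unfolding mu_def by (rule arr_assoc[OF arr_TMor[OF h arr_Idt[OF o(2)]] arr_TMor[OF a(3,2)] arr_phi[OF K]])
  also have "(u' \<star> v) \<cdot> (h \<star> Idt C Y) = Scl C b u \<star> v"
    using arr_TMor_Cmp[OF h a(3) arr_Idt[OF o(2)] a(2)] e arr_Cmp_Idt[OF a(2)] by simp
  also have "\<dots> = Scl C b (u \<star> v)" by (rule TMor_Scl(1)[OF a(1,2)])
  also have "\<phi> K L \<cdot> \<dots> = Scl C b (mu K L u v)"
    unfolding mu_def by (rule arr_Scl_right[OF arr_TMor[OF a(1,2)] arr_phi[OF K]])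
  finally show ?thesis
    unfolding mub_def act_bm_bx1[OF o(2) h arr_mu[OF l(3,2)] w] by (simp add: act_bm_Scl[OF o(1,2) arr_mu[OF l(1,2)] w])
qed

lemma mub_bx_right:
  assumes l: "lab X K u" "lab Y L v" "lab Y' L v'" and h: "arr Y Y' h"
    and e: "v' \<cdot> h = Scl C b v" and w: "win n [X, Y] s"
  shows "act n (mub X Y' K L u v') (act (Suc n) (bx Y Y' h) s) = sscl b (act n (mub X Y K L u v) s)"
proof -
  note K = l(1-2)[THEN labD(1)] and o = l(1-3)[THEN labD(2)]
    and a = l(1-3)[THEN labD(3)]
  have "mu K L u v' \<cdot> (Idt C X \<star> h) = \<phi> K L \<cdot> (u \<star> v') \<cdot> (Idt C X \<star> h)"
    unfolding mu_def by (rule arr_assoc[OF arr_TMor[OF arr_Idt[OF o(1)] h] arr_TMor[OF a(1,3)] arr_phi[OF K]])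
  also have "(u \<star> v') \<cdot> (Idt C X \<star> h) = u \<star> Scl C b v"
    using arr_TMor_Cmp[OF arr_Idt[OF o(1)] a(1) h a(3)] e arr_Cmp_Idt[OF a(1)] by simp
  also have "\<dots> = Scl C b (u \<star> v)" by (rule TMor_Scl(2)[OF a(1,2)])
  also have "\<phi> K L \<cdot> \<dots> = Scl C b (mu K L u v)"
    unfolding mu_def by (rule arr_Scl_right[OF arr_TMor[OF a(1,2)] arr_phi[OF K]])
  finally show ?thesis
    unfolding mub_def act_bm_bx2'[OF o(1) h arr_mu[OF l(1,3)] w] by (simp add: act_bm_Scl[OF o(1,2) arr_mu[OF l(1,2)] w])
qed

lemma mub_inject:
  assumes l: "lab X K u" "lab Y L v" and w: "win n [X, Y] s" "win n [X, Y] s'"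
    and e: "act n (mub X Y K L u v) s = act n (mub X Y K L u v) s'"
  shows "s = s'"
proof -
  obtain g where g: "ip (X \<odot> Y) (r (K \<otimes>\<^bsub>G\<^esub> L)) (mu K L u v) g" using ip_mu[OF l] by blast
  show ?thesis by (rule act_bm_inject[OF l(1-2)[THEN labD(2)] g w e[unfolded mub_def]])
qed

text \<open>Both states evaluate to multiples of the same \<open>e0\<close>, and evaluation is
  injective.\<close>

lemma mub_compare:
  assumes l: "lab X K u" "lab Y L v" and w: "win n [X, Y] s" "win n [X, Y] s'"
    and e: "act n (mub X Y K L u v) s = sscl a e0" "act n (mub X Y K L u v) s' = sscl b e0" "good e0" and b: "b \<noteq> 0"
  shows "s = sscl (a / b) s'"
proof (rule mub_inject[OF l w(1) win_sscl[OF w(2)]])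
  have "act n (mub X Y K L u v) (sscl (a / b) s') = sscl (a / b) (act n (mub X Y K L u v) s')"
    using w(2) by (intro act_sscl box_ok_mub l) simp
  also have "\<dots> = sscl a e0" unfolding e(2) using e(3) b by (simp add: sscl_sscl)
  finally show "act n (mub X Y K L u v) s = act n (mub X Y K L u v) (sscl (a / b) s')" using e(1) by simp
qed

text \<open>Objects related by the symmetry of the cocycle, such as \<open>S\<close> and
  \<open>S'\<close>, carry the same class with possibly different labels, so the isomorphisms
  \<open>h1\<close>, \<open>h2\<close>, \<open>h3\<close> between them are scalars. In contrast to
  the pentagon only twofold products occur, and no braiding of invertible objects appears.\<close>

lemma hexagon1_L:
  assumes l: "lab P KP uP" "lab Q KQ uQ" "lab S KS uS" "lab T KT uT" "lab S' KS uS'" "lab S2 KS2 uS2" "lab T2 KT2 uT2"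
      "lab Q' KQ uQ'" "lab T3 KT2 uT3"
    and k: "arr (P \<odot> Q) (S \<odot> T) k1" "arr (S' \<odot> T) (S2 \<odot> T2) k2" "arr (P \<odot> Q') (S2 \<odot> T3) k3"
    and h: "arr S S' h1" "arr Q Q' h2" "arr T3 T2 h3"
    and KK: "KS \<otimes>\<^bsub>G\<^esub> KT = KP \<otimes>\<^bsub>G\<^esub> KQ" "KS2 \<otimes>\<^bsub>G\<^esub> KT2 = KS \<otimes>\<^bsub>G\<^esub> KT"
    and e: "mu KS KT uS uT \<cdot> k1 = Scl C a1 (mu KP KQ uP uQ)" "mu KS2 KT2 uS2 uT2 \<cdot> k2 = Scl C a2 (mu KS KT uS' uT)"
      "mu KS2 KT2 uS2 uT3 \<cdot> k3 = Scl C a3 (mu KP KQ uP uQ')"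
    and f: "uS' \<cdot> h1 = Scl C b1 uS" "uQ' \<cdot> h2 = Scl C b2 uQ" "uT2 \<cdot> h3 = Scl C b3 uT3"
    and nz: "a3 \<noteq> 0" "b2 \<noteq> 0" "b3 \<noteq> 0" and w: "win n [P, Q] s"
  shows "act n (bx2 S' T S2 T2 k2) (act n (bx S S' h1) (act n (bx2 P Q S T k1) s))
      = sscl ((a2 * b1 * a1) / (b3 * a3 * b2)) (act (Suc n) (bx T3 T2 h3) (act n (bx2 P Q' S2 T3 k3) (act (Suc n) (bx Q Q' h2) s)))"
proof -
  note o = l(1-9)[THEN labD(2)]
  note bk = box_ok_bx2[OF o(1-4) k(1)] box_ok_bx2[OF o(5,4,6,7) k(2)] box_ok_bx2[OF o(1,8,6,9) k(3)]
    h(1-3)[THEN box_ok_bx]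
  obtain us vs where sh: "cur s = us @ [P, Q] @ vs" "length us = n" using win_shape[OF w] by blast
  note g = win_good[OF w]
  have w1: "win n [S, T] (act n (bx2 P Q S T k1) s)" "win n [S', T] (act n (bx S S' h1) (act n (bx2 P Q S T k1) s))"
    "win n [S2, T2] (act n (bx2 S' T S2 T2 k2) (act n (bx S S' h1) (act n (bx2 P Q S T k1) s)))"
    "win n [P, Q'] (act (Suc n) (bx Q Q' h2) s)" "win n [S2, T3] (act n (bx2 P Q' S2 T3 k3) (act (Suc n) (bx Q Q' h2) s))"
    "win n [S2, T2] (act (Suc n) (bx T3 T2 h3) (act n (bx2 P Q' S2 T3 k3) (act (Suc n) (bx Q Q' h2) s)))"
    using g sh bk by (simp_all add: st_simps)
  define E where "E = act n (mub P Q KP KQ uP uQ) s"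
  have gE: "good E" unfolding E_def using w by (intro good_act box_ok_mub l) simp
  show ?thesis
  proof (rule mub_compare[OF l(6,7) w1(3,6) _ _ gE])
    show "act n (mub S2 T2 KS2 KT2 uS2 uT2) (act n (bx2 S' T S2 T2 k2) (act n (bx S S' h1) (act n (bx2 P Q S T k1) s))) = sscl (a2 * b1 * a1) E"
      unfolding mub_bx2[OF l(5,4,6,7) k(2) KK(2) e(2) w1(2)] mub_bx_left[OF l(3,4,5) h(1) f(1) w1(1)]
        mub_bx2[OF l(1-4) k(1) KK(1) e(1) w] E_def[symmetric] using gE by (simp add: sscl_sscl mult.assoc)
    show "act n (mub S2 T2 KS2 KT2 uS2 uT2) (act (Suc n) (bx T3 T2 h3) (act n (bx2 P Q' S2 T3 k3) (act (Suc n) (bx Q Q' h2) s))) = sscl (b3 * a3 * b2) E"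
      unfolding mub_bx_right[OF l(6,9,7) h(3) f(3) w1(5)] mub_bx2[OF l(1,8,6,9) k(3) trans[OF KK(2) KK(1)] e(3) w1(4)]
        mub_bx_right[OF l(1,2,8) h(2) f(2) w] E_def[symmetric] using gE by (simp add: sscl_sscl mult.assoc)
  qed (use nz in simp)
qed

lemma hexagon2_L:
  assumes l: "lab P KP uP" "lab Q KQ uQ" "lab S KS uS" "lab T KT uT" "lab P' KP uP'" "lab P2 KP2 uP2" "lab Q2 KQ2 uQ2"
      "lab Q4 KQ2 uQ4" "lab T4 KT uT4"
    and k: "ip (P \<odot> Q) (S \<odot> T) k1 k1'" "ip (P2 \<odot> Q2) (P' \<odot> Q) k2 k2'" "ip (P2 \<odot> Q4) (S \<odot> T4) k3 k3'"
    and h: "arr P P' h1" "arr T T4 h2" "arr Q4 Q2 h3"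
    and KK: "KS \<otimes>\<^bsub>G\<^esub> KT = KP \<otimes>\<^bsub>G\<^esub> KQ" "KP \<otimes>\<^bsub>G\<^esub> KQ = KP2 \<otimes>\<^bsub>G\<^esub> KQ2"
    and e: "mu KS KT uS uT \<cdot> k1 = Scl C a1 (mu KP KQ uP uQ)" "mu KP KQ uP' uQ \<cdot> k2 = Scl C a2 (mu KP2 KQ2 uP2 uQ2)"
      "mu KS KT uS uT4 \<cdot> k3 = Scl C a3 (mu KP2 KQ2 uP2 uQ4)"
    and f: "uP' \<cdot> h1 = Scl C b1 uP" "uT4 \<cdot> h2 = Scl C b2 uT" "uQ2 \<cdot> h3 = Scl C b3 uQ4"
    and nz: "a1 \<noteq> 0" "a2 \<noteq> 0" "a3 \<noteq> 0" "b2 \<noteq> 0" "b3 \<noteq> 0" and w: "win n [S, T] s"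
  shows "act n (bx2 P' Q P2 Q2 k2') (act n (bx P P' h1) (act n (bx2 S T P Q k1') s))
      = sscl ((inverse a2 * b1 * inverse a1) / (b3 * inverse a3 * b2)) (act (Suc n) (bx Q4 Q2 h3) (act n (bx2 S T4 P2 Q4 k3') (act (Suc n) (bx T T4 h2) s)))"
proof -
  \<comment> \<open>Relative to the same labels the inverse isomorphism has the inverse
    scalar.\<close>
  have inv: "mu K L u v \<cdot> k' = Scl C (inverse a) (mu K' L' u' v')"
    if "lab X K u" "lab Y L v" "lab X' K' u'" "lab Y' L' v'" "ip (X \<odot> Y) (X' \<odot> Y') k k'" "mu K' L' u' v' \<cdot> k = Scl C a (mu K L u v)" "a \<noteq> 0"
      "K' \<otimes>\<^bsub>G\<^esub> L' = K \<otimes>\<^bsub>G\<^esub> L"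
    for X Y X' Y' K L K' L' u v u' v' k k' a
  proof -
    note m = arr_mu[OF that(1,2)] and m' = arr_mu[OF that(3,4), unfolded that(8)] and i = ipD[OF that(5)]
    have "mu K' L' u' v' = (mu K' L' u' v' \<cdot> k) \<cdot> k'"
      using arr_assoc[OF i(2,1) m'] i(4) arr_Cmp_Idt[OF m'] by simp
    also have "\<dots> = Scl C a (mu K L u v \<cdot> k')" unfolding that(6) by (rule arr_Scl_left[OF i(2) m])
    finally show ?thesis using arr_Scl_Scl[OF arr_Cmp[OF m i(2)], of "inverse a" a] arr_Scl_one[OF arr_Cmp[OF m i(2)]] that(7) by simp
  qed
  note o = l(1-9)[THEN labD(2)]
  note kk = k(1-3)[THEN ipD(2)]
  note bk = box_ok_bx2[OF o(3,4,1,2) kk(1)] box_ok_bx2[OF o(5,2,6,7) kk(2)] box_ok_bx2[OF o(3,9,6,8) kk(3)]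
    h(1-3)[THEN box_ok_bx]
  note e' = inv[OF l(1-4) k(1) e(1) nz(1) KK(1)] inv[OF l(6,7,5,2) k(2) e(2) nz(2) KK(2)] inv[OF l(6,8,3,9) k(3) e(3) nz(3) trans[OF KK]]
  obtain us vs where sh: "cur s = us @ [S, T] @ vs" "length us = n" using win_shape[OF w] by blast
  note g = win_good[OF w]
  have w1: "win n [P, Q] (act n (bx2 S T P Q k1') s)" "win n [P', Q] (act n (bx P P' h1) (act n (bx2 S T P Q k1') s))"
    "win n [P2, Q2] (act n (bx2 P' Q P2 Q2 k2') (act n (bx P P' h1) (act n (bx2 S T P Q k1') s)))"
    "win n [S, T4] (act (Suc n) (bx T T4 h2) s)" "win n [P2, Q4] (act n (bx2 S T4 P2 Q4 k3') (act (Suc n) (bx T T4 h2) s))"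
    "win n [P2, Q2] (act (Suc n) (bx Q4 Q2 h3) (act n (bx2 S T4 P2 Q4 k3') (act (Suc n) (bx T T4 h2) s)))"
    using g sh bk by (simp_all add: st_simps)
  define E where "E = act n (mub S T KS KT uS uT) s"
  have gE: "good E" unfolding E_def using w by (intro good_act box_ok_mub l) simp
  show ?thesis
  proof (rule mub_compare[OF l(6,7) w1(3,6) _ _ gE])
    show "act n (mub P2 Q2 KP2 KQ2 uP2 uQ2) (act n (bx2 P' Q P2 Q2 k2') (act n (bx P P' h1) (act n (bx2 S T P Q k1') s))) = sscl (inverse a2 * b1 * inverse a1) E"
      unfolding mub_bx2[OF l(5,2,6,7) kk(2) KK(2)[symmetric] e'(2) w1(2)] mub_bx_left[OF l(1,2,5) h(1) f(1) w1(1)]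
        mub_bx2[OF l(3,4,1,2) kk(1) KK(1)[symmetric] e'(1) w] E_def[symmetric] using gE by (simp add: sscl_sscl mult.assoc)
    show "act n (mub P2 Q2 KP2 KQ2 uP2 uQ2) (act (Suc n) (bx Q4 Q2 h3) (act n (bx2 S T4 P2 Q4 k3') (act (Suc n) (bx T T4 h2) s))) = sscl (b3 * inverse a3 * b2) E"
      unfolding mub_bx_right[OF l(6,8,7) h(3) f(3) w1(5)] mub_bx2[OF l(3,9,6,8) kk(3) trans[OF KK, symmetric] e'(3) w1(4)]
        mub_bx_right[OF l(3,4,9) h(2) f(2) w] E_def[symmetric] using gE by (simp add: sscl_sscl mult.assoc)
  qed (use nz in simp)
qed

text \<open>Multiplying one label by \<open>a\<close> and composing with the inverse of the other
  realises every nonzero scalar; this turns cochains back into isomorphisms.\<close>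

lemma exists_iso_scalar:
  assumes l: "lab X K u" "lab Y L v" "lab X' K' u'" "lab Y' L' v'" and KL: "K' \<otimes>\<^bsub>G\<^esub> L' = K \<otimes>\<^bsub>G\<^esub> L" and a: "a \<noteq> 0"
  shows "\<exists>k. iso_mor C (X \<odot> Y) (X' \<odot> Y') k \<and> mu K' L' u' v' \<cdot> k = Scl C a (mu K L u v)"
proof -
  obtain g g' where g: "ip (X \<odot> Y) (r (K \<otimes>\<^bsub>G\<^esub> L)) (mu K L u v) g" "ip (X' \<odot> Y') (r (K \<otimes>\<^bsub>G\<^esub> L)) (mu K' L' u' v') g'"
    using ip_mu[OF l(1,2)] ip_mu[OF l(3,4), unfolded KL] by blast
  note i = ip_Cmp[OF ip_Scl[OF g(1) a] ip_sym[OF g(2)]]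
  have "mu K' L' u' v' \<cdot> g' \<cdot> Scl C a (mu K L u v) = Scl C a (mu K L u v)"
    using arr_assoc[OF arr_Scl[OF ipD(1)[OF g(1)]] ipD(2,1)[OF g(2)]] ipD(4)[OF g(2)] arr_Idt_Cmp[OF arr_Scl[OF ipD(1)[OF g(1)]]] by metis
  then show ?thesis using i ipD(5,6)[OF i] iso_mor_ip by blast
qed

text \<open>Through \<open>k\<close> the label of the target becomes a second label of the source by
  the same class, and two such labels differ by a scalar.\<close>

lemma exists_scalar:
  assumes l: "lab X K u" "lab Y L v" "lab X' K' u'" "lab Y' L' v'" and KL: "K' \<otimes>\<^bsub>G\<^esub> L' = K \<otimes>\<^bsub>G\<^esub> L"
    and k: "iso_mor C (X \<odot> Y) (X' \<odot> Y') k"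
  shows "\<exists>a. a \<noteq> 0 \<and> mu K' L' u' v' \<cdot> k = Scl C a (mu K L u v)"
proof -
  obtain k' where "ip (X \<odot> Y) (X' \<odot> Y') k k'"
    using k iso_mor_ip TObj_in l(1-4)[THEN labD(2)] by blast
  then have "lab (X \<odot> Y) (K \<otimes>\<^bsub>G\<^esub> L) (mu K' L' u' v' \<cdot> k)" using lab_Cmp[OF lab_mu[OF l(3,4)]] KL by simp
  then show ?thesis using lab_scalar[OF lab_mu[OF l(1,2)]] by blast
qed

lemma exists_iso_scalar1:
  assumes l: "lab X K u" "lab X' K u'" and b: "b \<noteq> 0"
  shows "\<exists>h. iso_mor C X X' h \<and> u' \<cdot> h = Scl C b u"
proof -
  obtain g g' where g: "ip X (r K) u g" "ip X' (r K) u' g'" using l unfolding lab_def by blast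
  note i = ip_Cmp[OF ip_Scl[OF g(1) b] ip_sym[OF g(2)]]
  have "u' \<cdot> g' \<cdot> Scl C b u = Scl C b u"
    using arr_assoc[OF arr_Scl[OF ipD(1)[OF g(1)]] ipD(2,1)[OF g(2)]] ipD(4)[OF g(2)] arr_Idt_Cmp[OF arr_Scl[OF ipD(1)[OF g(1)]]] by metis
  then show ?thesis using i ipD(5,6)[OF i] iso_mor_ip by blast
qed

lemma exists_scalar1:
  assumes l: "lab X K u" "lab X' K u'" and h: "iso_mor C X X' h"
  shows "\<exists>b. b \<noteq> 0 \<and> u' \<cdot> h = Scl C b u"
proof -
  obtain h' where "ip X X' h h'" using h iso_mor_ip l(1-2)[THEN labD(2)] by blast
  then show ?thesis using lab_scalar[OF l(1)] lab_Cmp[OF l(2)] by blast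
qed

end

section \<open>The axioms as equations between scalars\<close>

text \<open>The labels \<open>u\<close> fix the identifications relative to which isomorphisms
  become scalars, and \<open>pr x y z\<close> stands for the pairing of the component
  \<open>Cg x\<close> with \<open>L y z\<close>.\<close>

locale twisted_data = skeletal_data C G r \<phi> + A: comm_monoid A
  for C :: "('o, 'm, 'k::alg_closed_field, 'z) braided_cat_scheme" (structure)
    and G :: "('g, 'd) monoid_scheme" and r :: "'g \<Rightarrow> 'o" and \<phi> :: "'g \<Rightarrow> 'g \<Rightarrow> 'm"
    and A :: "('a, 'c) monoid_scheme" +
  fixes Cg :: "'a \<Rightarrow> 'o set" and L :: "'a \<Rightarrow> 'a \<Rightarrow> 'g" and R :: "'a \<Rightarrow> 'a \<Rightarrow> 'o" and u :: "'a \<Rightarrow> 'a \<Rightarrow> 'm"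
    and pr :: "'a \<Rightarrow> 'a \<Rightarrow> 'a \<Rightarrow> 'k"
  assumes Cg_Obj: "x \<in> carrier A \<Longrightarrow> Cg x \<subseteq> Obj C"
    and Cg_nonzero: "x \<in> carrier A \<Longrightarrow> \<exists>X\<in>Cg x. \<not> zero_object C X"
    and L_sym: "\<lbrakk>x \<in> carrier A; y \<in> carrier A\<rbrakk> \<Longrightarrow> L x y = L y x"
    and L_cocycle: "\<lbrakk>x \<in> carrier A; y \<in> carrier A; z \<in> carrier A\<rbrakk>
      \<Longrightarrow> L (x \<otimes>\<^bsub>A\<^esub> y) z \<otimes>\<^bsub>G\<^esub> L x y = L x (y \<otimes>\<^bsub>A\<^esub> z) \<otimes>\<^bsub>G\<^esub> L y z"
    and lab_R: "\<lbrakk>x \<in> carrier A; y \<in> carrier A\<rbrakk> \<Longrightarrow> lab (R x y) (L x y) (u x y)"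
    and pairing: "\<lbrakk>x \<in> carrier A; y \<in> carrier A; z \<in> carrier A; X \<in> Cg x\<rbrakk>
      \<Longrightarrow> dbl (R y z) X = Scl C (pr x y z) (Idt C (R y z \<odot> X))"
begin

lemma R_in: "\<lbrakk>x \<in> carrier A; y \<in> carrier A\<rbrakk> \<Longrightarrow> R x y \<in> Obj C"
  using labD(2)[OF lab_R] .

lemma L_in: "\<lbrakk>x \<in> carrier A; y \<in> carrier A\<rbrakk> \<Longrightarrow> L x y \<in> carrier G"
  using labD(1)[OF lab_R] .

lemma tw_assoc_tassoc: "tw_assoc A C R \<xi> x y z X Y Z
    = tassoc (R (x \<otimes>\<^bsub>A\<^esub> y) z) (R x y) (R x (y \<otimes>\<^bsub>A\<^esub> z)) (R y z) (\<xi> x y z) X Y Z"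
  by (simp add: tw_assoc_def tassoc_def Let_def)

lemma tw_braid_tbraid: "tw_braid C R \<kappa> x y X Y = tbraid (R x y) (R y x) (\<kappa> x y) X Y"
  by (simp add: tw_braid_def tbraid_def)

text \<open>This is what makes the scalar equations necessary and not only sufficient.\<close>

lemma nonzero_rigid: "\<lbrakk>ip X Y f g; \<not> zero_object C X; f = Scl C t f\<rbrakk> \<Longrightarrow> t = 1"
  using Scl_cancel[of X Y f t 1] ip_nonzero[of X Y f g] arr_Scl_one[of X Y f] ipD(1)[of X Y f g] by metis

text \<open>By the cocycle condition source and target of \<open>\<xi> x y z\<close> have the same
  product class, so relative to the labels it is a scalar \<open>a x y z\<close>.\<close>

definition xi_scalar :: "('a \<Rightarrow> 'a \<Rightarrow> 'a \<Rightarrow> 'm) \<Rightarrow> ('a \<Rightarrow> 'a \<Rightarrow> 'a \<Rightarrow> 'k) \<Rightarrow> bool"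
  where "xi_scalar \<xi> a \<longleftrightarrow> (\<forall>x\<in>carrier A. \<forall>y\<in>carrier A. \<forall>z\<in>carrier A. a x y z \<noteq> 0
    \<and> iso_mor C (R (x \<otimes>\<^bsub>A\<^esub> y) z \<odot> R x y) (R x (y \<otimes>\<^bsub>A\<^esub> z) \<odot> R y z) (\<xi> x y z)
    \<and> mu (L x (y \<otimes>\<^bsub>A\<^esub> z)) (L y z) (u x (y \<otimes>\<^bsub>A\<^esub> z)) (u y z) \<cdot> \<xi> x y z
      = Scl C (a x y z) (mu (L (x \<otimes>\<^bsub>A\<^esub> y) z) (L x y) (u (x \<otimes>\<^bsub>A\<^esub> y) z) (u x y)))"

definition kappa_scalar :: "('a \<Rightarrow> 'a \<Rightarrow> 'm) \<Rightarrow> ('a \<Rightarrow> 'a \<Rightarrow> 'k) \<Rightarrow> bool"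
  where "kappa_scalar \<kappa> b \<longleftrightarrow> (\<forall>x\<in>carrier A. \<forall>y\<in>carrier A. b x y \<noteq> 0
    \<and> iso_mor C (R x y) (R y x) (\<kappa> x y) \<and> u y x \<cdot> \<kappa> x y = Scl C (b x y) (u x y))"

lemma xi_scalarD:
  assumes "xi_scalar \<xi> a" "x \<in> carrier A" "y \<in> carrier A" "z \<in> carrier A"
  shows "a x y z \<noteq> 0" "\<exists>g. ip (R (x \<otimes>\<^bsub>A\<^esub> y) z \<odot> R x y) (R x (y \<otimes>\<^bsub>A\<^esub> z) \<odot> R y z) (\<xi> x y z) g"
    "mu (L x (y \<otimes>\<^bsub>A\<^esub> z)) (L y z) (u x (y \<otimes>\<^bsub>A\<^esub> z)) (u y z) \<cdot> \<xi> x y z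
      = Scl C (a x y z) (mu (L (x \<otimes>\<^bsub>A\<^esub> y) z) (L x y) (u (x \<otimes>\<^bsub>A\<^esub> y) z) (u x y))"
proof -
  have c: "R (x \<otimes>\<^bsub>A\<^esub> y) z \<odot> R x y \<in> Obj C" "R x (y \<otimes>\<^bsub>A\<^esub> z) \<odot> R y z \<in> Obj C"
    using assms(2-4) R_in TObj_in by auto
  show "a x y z \<noteq> 0" "\<exists>g. ip (R (x \<otimes>\<^bsub>A\<^esub> y) z \<odot> R x y) (R x (y \<otimes>\<^bsub>A\<^esub> z) \<odot> R y z) (\<xi> x y z) g"
    "mu (L x (y \<otimes>\<^bsub>A\<^esub> z)) (L y z) (u x (y \<otimes>\<^bsub>A\<^esub> z)) (u y z) \<cdot> \<xi> x y z
      = Scl C (a x y z) (mu (L (x \<otimes>\<^bsub>A\<^esub> y) z) (L x y) (u (x \<otimes>\<^bsub>A\<^esub> y) z) (u x y))"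
    using assms iso_mor_ip[OF c] unfolding xi_scalar_def by blast+
qed

lemma kappa_scalarD:
  assumes "kappa_scalar \<kappa> b" "x \<in> carrier A" "y \<in> carrier A"
  shows "b x y \<noteq> 0" "\<exists>g. ip (R x y) (R y x) (\<kappa> x y) g" "u y x \<cdot> \<kappa> x y = Scl C (b x y) (u x y)"
  using assms iso_mor_ip[OF R_in[OF assms(2,3)] R_in[OF assms(3,2)]] unfolding kappa_scalar_def by blast+

lemma pentagon_scalar:
  assumes xi: "xi_scalar \<xi> a"
  shows "tw_pentagon A C Cg R \<xi> \<longleftrightarrow> (\<forall>x\<in>carrier A. \<forall>y\<in>carrier A. \<forall>z\<in>carrier A. \<forall>w\<in>carrier A.
    a x y (z \<otimes>\<^bsub>A\<^esub> w) * beta (L z w) (L x y) * a (x \<otimes>\<^bsub>A\<^esub> y) z w = a y z w * a x (y \<otimes>\<^bsub>A\<^esub> z) w * a x y z)"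
  (is "?P \<longleftrightarrow> (\<forall>x\<in>_. \<forall>y\<in>_. \<forall>z\<in>_. \<forall>w\<in>_. ?E x y z w)")
proof -
  \<comment> \<open>The factor by which the two sides differ; the pentagon says that it is
    1.\<close>
  let ?t = "\<lambda>x y z w. (a x y (z \<otimes>\<^bsub>A\<^esub> w) * beta (L z w) (L x y) * a (x \<otimes>\<^bsub>A\<^esub> y) z w) / (a y z w * a x (y \<otimes>\<^bsub>A\<^esub> z) w * a x y z)"
  let ?l = "\<lambda>x y z w X Y Z W. tw_assoc A C R \<xi> x y (z \<otimes>\<^bsub>A\<^esub> w) X Y (tw_obj C R z w Z W)
        \<cdot> tw_assoc A C R \<xi> (x \<otimes>\<^bsub>A\<^esub> y) z w (tw_obj C R x y X Y) Z W"
  let ?r = "\<lambda>x y z w X Y Z W. tw_mor C R x (y \<otimes>\<^bsub>A\<^esub> z \<otimes>\<^bsub>A\<^esub> w) (Idt C X) (tw_assoc A C R \<xi> y z w Y Z W)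
        \<cdot> tw_assoc A C R \<xi> x (y \<otimes>\<^bsub>A\<^esub> z) w X (tw_obj C R y z Y Z) W
        \<cdot> tw_mor C R (x \<otimes>\<^bsub>A\<^esub> y \<otimes>\<^bsub>A\<^esub> z) w (tw_assoc A C R \<xi> x y z X Y Z) (Idt C W)"
  \<comment> \<open>Besides the comparison up to \<open>?t\<close>, the right side is recorded as an
    isomorphism out of an object that is nonzero for nonzero arguments, as
    \<open>nonzero_rigid\<close> requires.\<close>
  have main: "?l x y z w X Y Z W = Scl C (?t x y z w) (?r x y z w X Y Z W)
      \<and> (\<exists>S T g. ip S T (?r x y z w X Y Z W) g \<and> (\<not> zero_object C X \<longrightarrow> \<not> zero_object C Y \<longrightarrow> \<not> zero_object C Z \<longrightarrow> \<not> zero_object C W \<longrightarrow> \<not> zero_object C S))"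
    if c: "x \<in> carrier A" "y \<in> carrier A" "z \<in> carrier A" "w \<in> carrier A"
      and O: "X \<in> Obj C" "Y \<in> Obj C" "Z \<in> Obj C" "W \<in> Obj C" for x y z w X Y Z W
  proof -
    have cc: "x \<otimes>\<^bsub>A\<^esub> y \<in> carrier A" "y \<otimes>\<^bsub>A\<^esub> z \<in> carrier A" "z \<otimes>\<^bsub>A\<^esub> w \<in> carrier A" "x \<otimes>\<^bsub>A\<^esub> y \<otimes>\<^bsub>A\<^esub> z \<in> carrier A"
      "y \<otimes>\<^bsub>A\<^esub> z \<otimes>\<^bsub>A\<^esub> w \<in> carrier A" using c by auto
    \<comment> \<open>Products in \<open>A\<close> are brought to one bracketing, so that objects
      which the axiom identifies become syntactically equal.\<close>
    have as: "x \<otimes>\<^bsub>A\<^esub> (y \<otimes>\<^bsub>A\<^esub> z) = x \<otimes>\<^bsub>A\<^esub> y \<otimes>\<^bsub>A\<^esub> z" "y \<otimes>\<^bsub>A\<^esub> (z \<otimes>\<^bsub>A\<^esub> w) = y \<otimes>\<^bsub>A\<^esub> z \<otimes>\<^bsub>A\<^esub> w"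
      "x \<otimes>\<^bsub>A\<^esub> y \<otimes>\<^bsub>A\<^esub> (z \<otimes>\<^bsub>A\<^esub> w) = x \<otimes>\<^bsub>A\<^esub> y \<otimes>\<^bsub>A\<^esub> z \<otimes>\<^bsub>A\<^esub> w"
      "x \<otimes>\<^bsub>A\<^esub> (y \<otimes>\<^bsub>A\<^esub> z \<otimes>\<^bsub>A\<^esub> w) = x \<otimes>\<^bsub>A\<^esub> y \<otimes>\<^bsub>A\<^esub> z \<otimes>\<^bsub>A\<^esub> w"
      using c by (simp_all add: A.m_assoc)
    define P Q N S1 T1 S2 T2 S' T' U where
      "P = R (x \<otimes>\<^bsub>A\<^esub> y \<otimes>\<^bsub>A\<^esub> z) w" and "Q = R (x \<otimes>\<^bsub>A\<^esub> y) z" and "N = R x y" and "S1 = R (x \<otimes>\<^bsub>A\<^esub> y) (z \<otimes>\<^bsub>A\<^esub> w)"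
      and "T1 = R z w" and "S2 = R x (y \<otimes>\<^bsub>A\<^esub> z \<otimes>\<^bsub>A\<^esub> w)" and "T2 = R y (z \<otimes>\<^bsub>A\<^esub> w)" and "S' = R x (y \<otimes>\<^bsub>A\<^esub> z)"
      and "T' = R y z" and "U = R (y \<otimes>\<^bsub>A\<^esub> z) w"
    note ds = P_def Q_def N_def S1_def T1_def S2_def T2_def S'_def T'_def U_def
    note l = lab_R[OF cc(4) c(4), folded P_def] lab_R[OF cc(1) c(3), folded Q_def] lab_R[OF c(1,2), folded N_def]
      lab_R[OF cc(1,3), folded S1_def] lab_R[OF c(3,4), folded T1_def] lab_R[OF c(1) cc(5), folded S2_def]
      lab_R[OF c(2) cc(3), folded T2_def] lab_R[OF c(1) cc(2), folded S'_def] lab_R[OF c(2,3), folded T'_def] lab_R[OF cc(2) c(4), folded U_def]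
    note o = l(1-10)[THEN labD(2)]
    note x1 = xi_scalarD[OF xi cc(1) c(3,4)] and x2 = xi_scalarD[OF xi c(1,2) cc(3)] and x3 = xi_scalarD[OF xi c(1-3)]
      and x4 = xi_scalarD[OF xi c(1) cc(2) c(4)] and x5 = xi_scalarD[OF xi c(2-4)]
    obtain g1 g2 g3 g4 g5 where g: "ip (P \<odot> Q) (S1 \<odot> T1) (\<xi> (x \<otimes>\<^bsub>A\<^esub> y) z w) g1"
      "ip (S1 \<odot> N) (S2 \<odot> T2) (\<xi> x y (z \<otimes>\<^bsub>A\<^esub> w)) g2" "ip (Q \<odot> N) (S' \<odot> T') (\<xi> x y z) g3"
      "ip (P \<odot> S') (S2 \<odot> U) (\<xi> x (y \<otimes>\<^bsub>A\<^esub> z) w) g4" "ip (U \<odot> T') (T2 \<odot> T1) (\<xi> y z w) g5"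
      using x1(2) x2(2) x3(2) x4(2) x5(2) unfolding ds as by blast
    note kk = g(1-5)[THEN ipD(1)]
    note KK = L_cocycle[OF cc(1) c(3,4)] L_cocycle[OF c(1,2) cc(3)] L_cocycle[OF c(1-3)] L_cocycle[OF c(1) cc(2) c(4)] L_cocycle[OF c(2-4)]
    have eq: "act n (bx2 S1 N S2 T2 (\<xi> x y (z \<otimes>\<^bsub>A\<^esub> w))) (act (Suc n) (brd T1 N) (act n (bx2 P Q S1 T1 (\<xi> (x \<otimes>\<^bsub>A\<^esub> y) z w)) s))
      = sscl (?t x y z w) (act (Suc n) (bx2 U T' T2 T1 (\<xi> y z w)) (act n (bx2 P S' S2 U (\<xi> x (y \<otimes>\<^bsub>A\<^esub> z) w)) (act (Suc n) (bx2 Q N S' T' (\<xi> x y z)) s)))"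
      if "win n [P, Q, N] s" for n s
      by (rule pentagon_L[OF l kk KK[symmetric, unfolded as] x1(3)[unfolded as] x2(3)[unfolded as] x3(3)[unfolded as] x4(3)[unfolded as] x5(3)[unfolded as]
            x3(1) x4(1)[unfolded as] x5(1)[unfolded as] that])
    note main = twisted_pentagon[OF o O g eq]
    have e1: "?l x y z w X Y Z W = Scl C (?t x y z w) (?r x y z w X Y Z W)"
      unfolding tw_assoc_tassoc tw_obj_def tw_mor_def as ds[symmetric] by (rule main)
    note XY = TObj_in[OF O(1,2)] and YZ = TObj_in[OF O(2,3)] note NXY = TObj_in[OF o(3) XY] and TYZ = TObj_in[OF o(9) YZ]
    obtain h3 h4 h5 where h: "ip (Q \<odot> ((N \<odot> (X \<odot> Y)) \<odot> Z)) (S' \<odot> (X \<odot> (T' \<odot> (Y \<odot> Z)))) (tassoc Q N S' T' (\<xi> x y z) X Y Z) h3"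
      "ip (P \<odot> ((S' \<odot> (X \<odot> (T' \<odot> (Y \<odot> Z)))) \<odot> W)) (S2 \<odot> (X \<odot> (U \<odot> ((T' \<odot> (Y \<odot> Z)) \<odot> W)))) (tassoc P S' S2 U (\<xi> x (y \<otimes>\<^bsub>A\<^esub> z) w) X (T' \<odot> (Y \<odot> Z)) W) h4"
      "ip (U \<odot> ((T' \<odot> (Y \<odot> Z)) \<odot> W)) (T2 \<odot> (Y \<odot> (T1 \<odot> (Z \<odot> W)))) (tassoc U T' T2 T1 (\<xi> y z w) Y Z W) h5"
      using ip_tassoc[OF o(2,3,8,9) O(1-3) g(3)] ip_tassoc[OF o(1,8,6,10) O(1) TYZ O(4) g(4)] ip_tassoc[OF o(10,9,7,5) O(2-4) g(5)] by blast
    have "\<exists>T' g. ip (P \<odot> ((Q \<odot> ((N \<odot> (X \<odot> Y)) \<odot> Z)) \<odot> W)) T' (?r x y z w X Y Z W) g"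
      unfolding tw_assoc_tassoc tw_obj_def tw_mor_def as ds[symmetric]
      using ip_Cmp[OF ip_Cmp[OF ip_TMor[OF ip_Idt[OF o(1)] ip_TMor[OF h(1) ip_Idt[OF O(4)]]] h(2)] ip_TMor[OF ip_Idt[OF o(6)] ip_TMor[OF ip_Idt[OF O(1)] h(3)]]] by blast
    moreover have "\<not> zero_object C (P \<odot> ((Q \<odot> ((N \<odot> (X \<odot> Y)) \<odot> Z)) \<odot> W))"
      if "\<not> zero_object C X" "\<not> zero_object C Y" "\<not> zero_object C Z" "\<not> zero_object C W"
      using that O o lab_nonzero(2)[OF l(1)] lab_nonzero(2)[OF l(2)] lab_nonzero(2)[OF l(3)] by (simp add: nonzero_TObj TObj_in)
    ultimately show ?thesis using e1 by blast
  qed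
  have nz: "a y z w * a x (y \<otimes>\<^bsub>A\<^esub> z) w * a x y z \<noteq> 0" if "x \<in> carrier A" "y \<in> carrier A" "z \<in> carrier A" "w \<in> carrier A" for x y z w
    using xi_scalarD(1)[OF xi] that by simp
  have tE: "?t x y z w = 1 \<longleftrightarrow> ?E x y z w" if "x \<in> carrier A" "y \<in> carrier A" "z \<in> carrier A" "w \<in> carrier A" for x y z w
    using nz[OF that] by (simp only: divide_eq_1_iff) blast
  show ?thesis
  proof
    assume P: ?P
    show "\<forall>x\<in>carrier A. \<forall>y\<in>carrier A. \<forall>z\<in>carrier A. \<forall>w\<in>carrier A. ?E x y z w"
    proof (intro ballI)
      fix x y z w assume c: "x \<in> carrier A" "y \<in> carrier A" "z \<in> carrier A" "w \<in> carrier A"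
      obtain X Y Z W where X: "X \<in> Cg x" "Y \<in> Cg y" "Z \<in> Cg z" "W \<in> Cg w"
        "\<not> zero_object C X" "\<not> zero_object C Y" "\<not> zero_object C Z" "\<not> zero_object C W"
        using Cg_nonzero c by metis
      have O: "X \<in> Obj C" "Y \<in> Obj C" "Z \<in> Obj C" "W \<in> Obj C" using X Cg_Obj c by blast+
      have "?l x y z w X Y Z W = ?r x y z w X Y Z W" using P c X unfolding tw_pentagon_def by blast
      moreover note main[OF c O]
      moreover obtain S T g where "ip S T (?r x y z w X Y Z W) g" "\<not> zero_object C S" using main[OF c O] X by blast
      ultimately have "?t x y z w = 1" by (intro nonzero_rigid) auto
      then show "?E x y z w" using tE[OF c] by blast
    qed
  next
    assume E: "\<forall>x\<in>carrier A. \<forall>y\<in>carrier A. \<forall>z\<in>carrier A. \<forall>w\<in>carrier A. ?E x y z w"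
    show ?P unfolding tw_pentagon_def
    proof (intro ballI)
      fix x y z w X Y Z W assume c: "x \<in> carrier A" "y \<in> carrier A" "z \<in> carrier A" "w \<in> carrier A"
        and X: "X \<in> Cg x" "Y \<in> Cg y" "Z \<in> Cg z" "W \<in> Cg w"
      have O: "X \<in> Obj C" "Y \<in> Obj C" "Z \<in> Obj C" "W \<in> Obj C" using X Cg_Obj c by blast+
      have "?t x y z w = 1" using tE[OF c] E c by blast
      moreover obtain S T g where "ip S T (?r x y z w X Y Z W) g" using main[OF c O] by blast
      ultimately show "?l x y z w X Y Z W = ?r x y z w X Y Z W"
        using main[OF c O] arr_Scl_one ipD(1) by metis
    qed
  qed
qed

lemma hexagon1_scalar:
  assumes xi: "xi_scalar \<xi> a" and ka: "kappa_scalar \<kappa> b"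
  shows "tw_hexagon1 A C Cg R \<xi> \<kappa> \<longleftrightarrow> (\<forall>x\<in>carrier A. \<forall>y\<in>carrier A. \<forall>z\<in>carrier A.
    pr x y z * (a y z x * b x (y \<otimes>\<^bsub>A\<^esub> z) * a x y z) = b x z * a y x z * b x y)"
  (is "?P \<longleftrightarrow> (\<forall>x\<in>_. \<forall>y\<in>_. \<forall>z\<in>_. ?E x y z)")
proof -
  let ?t = "\<lambda>x y z. pr x y z * ((a y z x * b x (y \<otimes>\<^bsub>A\<^esub> z) * a x y z) / (b x z * a y x z * b x y))"
  let ?l = "\<lambda>x y z X Y Z. tw_assoc A C R \<xi> y z x Y Z X
        \<cdot> tw_braid C R \<kappa> x (y \<otimes>\<^bsub>A\<^esub> z) X (tw_obj C R y z Y Z)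
        \<cdot> tw_assoc A C R \<xi> x y z X Y Z"
  let ?r = "\<lambda>x y z X Y Z. tw_mor C R y (z \<otimes>\<^bsub>A\<^esub> x) (Idt C Y) (tw_braid C R \<kappa> x z X Z)
        \<cdot> tw_assoc A C R \<xi> y x z Y X Z
        \<cdot> tw_mor C R (x \<otimes>\<^bsub>A\<^esub> y) z (tw_braid C R \<kappa> x y X Y) (Idt C Z)"
  have main: "?l x y z X Y Z = Scl C (?t x y z) (?r x y z X Y Z)
      \<and> (\<exists>S T g. ip S T (?r x y z X Y Z) g \<and> (\<not> zero_object C X \<longrightarrow> \<not> zero_object C Y \<longrightarrow> \<not> zero_object C Z \<longrightarrow> \<not> zero_object C S))"
    if c: "x \<in> carrier A" "y \<in> carrier A" "z \<in> carrier A"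
      and X: "X \<in> Cg x" and O: "X \<in> Obj C" "Y \<in> Obj C" "Z \<in> Obj C" for x y z X Y Z
  proof -
    have cc: "x \<otimes>\<^bsub>A\<^esub> y \<in> carrier A" "y \<otimes>\<^bsub>A\<^esub> z \<in> carrier A" "z \<otimes>\<^bsub>A\<^esub> x \<in> carrier A" using c by auto
    have as: "y \<otimes>\<^bsub>A\<^esub> x = x \<otimes>\<^bsub>A\<^esub> y" "x \<otimes>\<^bsub>A\<^esub> z = z \<otimes>\<^bsub>A\<^esub> x"
      using c by (simp_all add: A.m_comm)
    \<comment> \<open>Symmetry of \<open>L\<close> gives a common class to the objects that the
      twisted braiding connects, as \<open>hexagon1_L\<close> demands.\<close>
    have Ls: "L (y \<otimes>\<^bsub>A\<^esub> z) x = L x (y \<otimes>\<^bsub>A\<^esub> z)" "L y x = L x y" "L x z = L z x"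
      using c cc L_sym by auto
    define P Q S T S' S2 T2 Q' T3 where
      "P = R (x \<otimes>\<^bsub>A\<^esub> y) z" and "Q = R x y" and "S = R x (y \<otimes>\<^bsub>A\<^esub> z)" and "T = R y z" and "S' = R (y \<otimes>\<^bsub>A\<^esub> z) x"
      and "S2 = R y (z \<otimes>\<^bsub>A\<^esub> x)" and "T2 = R z x" and "Q' = R y x" and "T3 = R x z"
    note ds = P_def Q_def S_def T_def S'_def S2_def T2_def Q'_def T3_def
    note l = lab_R[OF cc(1) c(3), folded P_def] lab_R[OF c(1,2), folded Q_def] lab_R[OF c(1) cc(2), folded S_def]
      lab_R[OF c(2,3), folded T_def] lab_R[OF cc(2) c(1), folded S'_def, unfolded Ls] lab_R[OF c(2) cc(3), folded S2_def]
      lab_R[OF c(3,1), folded T2_def] lab_R[OF c(2,1), folded Q'_def, unfolded Ls] lab_R[OF c(1,3), folded T3_def, unfolded Ls]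
    note o = l(1-9)[THEN labD(2)]
    note x1 = xi_scalarD[OF xi c] and x2 = xi_scalarD[OF xi c(2,3,1)] and x3 = xi_scalarD[OF xi c(2,1,3)]
      and k1 = kappa_scalarD[OF ka c(1) cc(2)] and k2 = kappa_scalarD[OF ka c(1,2)] and k3 = kappa_scalarD[OF ka c(1,3)]
    obtain g1 g2 g3 h1 h2 h3 where g: "ip (P \<odot> Q) (S \<odot> T) (\<xi> x y z) g1"
      "ip (S' \<odot> T) (S2 \<odot> T2) (\<xi> y z x) g2" "ip (P \<odot> Q') (S2 \<odot> T3) (\<xi> y x z) g3"
      and h: "ip S S' (\<kappa> x (y \<otimes>\<^bsub>A\<^esub> z)) h1" "ip Q Q' (\<kappa> x y) h2" "ip T3 T2 (\<kappa> x z) h3"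
      using x1(2) x2(2) x3(2) k1(2) k2(2) k3(2) unfolding ds as by blast
    note kk = g(1-3)[THEN ipD(1)] and hh = h(1-3)[THEN ipD(1)]
    note KK = L_cocycle[OF c] L_cocycle[OF c(2,3,1), unfolded Ls]
    have eq: "act n (bx2 S' T S2 T2 (\<xi> y z x)) (act n (bx S S' (\<kappa> x (y \<otimes>\<^bsub>A\<^esub> z))) (act n (bx2 P Q S T (\<xi> x y z)) s))
      = sscl ((a y z x * b x (y \<otimes>\<^bsub>A\<^esub> z) * a x y z) / (b x z * a y x z * b x y))
         (act (Suc n) (bx T3 T2 (\<kappa> x z)) (act n (bx2 P Q' S2 T3 (\<xi> y x z)) (act (Suc n) (bx Q Q' (\<kappa> x y)) s)))"
      if "win n [P, Q] s" for n s
      by (rule hexagon1_L[OF l kk hh KK(1)[symmetric] KK(2)[symmetric] x1(3) x2(3)[unfolded Ls] x3(3)[unfolded as Ls]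
            k1(3) k2(3) k3(3) x3(1) k2(1) k3(1) that])
    note main = twisted_hexagon1[OF o O g h pairing[OF c X, folded T_def] eq]
    have e1: "?l x y z X Y Z = Scl C (?t x y z) (?r x y z X Y Z)"
      unfolding tw_assoc_tassoc tw_braid_tbraid tw_obj_def tw_mor_def as ds[symmetric] by (rule main)
    obtain p1 p2 p3 where p: "ip (Q \<odot> (X \<odot> Y)) (Q' \<odot> (Y \<odot> X)) (tbraid Q Q' (\<kappa> x y) X Y) p1"
      "ip (P \<odot> ((Q' \<odot> (Y \<odot> X)) \<odot> Z)) (S2 \<odot> (Y \<odot> (T3 \<odot> (X \<odot> Z)))) (tassoc P Q' S2 T3 (\<xi> y x z) Y X Z) p2"
      "ip (T3 \<odot> (X \<odot> Z)) (T2 \<odot> (Z \<odot> X)) (tbraid T3 T2 (\<kappa> x z) X Z) p3"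
      using ip_tbraid[OF o(2,8) O(1,2) h(2)] ip_tassoc[OF o(1,8,6,9) O(2,1,3) g(3)] ip_tbraid[OF o(9,7) O(1,3) h(3)] by blast
    have "\<exists>T' g. ip (P \<odot> ((Q \<odot> (X \<odot> Y)) \<odot> Z)) T' (?r x y z X Y Z) g"
      unfolding tw_assoc_tassoc tw_braid_tbraid tw_obj_def tw_mor_def as ds[symmetric]
      using ip_Cmp[OF ip_Cmp[OF ip_TMor[OF ip_Idt[OF o(1)] ip_TMor[OF p(1) ip_Idt[OF O(3)]]] p(2)] ip_TMor[OF ip_Idt[OF o(6)] ip_TMor[OF ip_Idt[OF O(2)] p(3)]]] by blast
    moreover have "\<not> zero_object C (P \<odot> ((Q \<odot> (X \<odot> Y)) \<odot> Z))"
      if "\<not> zero_object C X" "\<not> zero_object C Y" "\<not> zero_object C Z"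
      using that O o lab_nonzero(2)[OF l(1)] lab_nonzero(2)[OF l(2)] by (simp add: nonzero_TObj TObj_in)
    ultimately show ?thesis using e1 by blast
  qed
  have tE: "?t x y z = 1 \<longleftrightarrow> ?E x y z" if "x \<in> carrier A" "y \<in> carrier A" "z \<in> carrier A" for x y z
    using xi_scalarD(1)[OF xi that(2,1,3)] kappa_scalarD(1)[OF ka that(1,3)] kappa_scalarD(1)[OF ka that(1,2)]
    by (simp add: divide_simps)
  show ?thesis
  proof
    assume P: ?P
    show "\<forall>x\<in>carrier A. \<forall>y\<in>carrier A. \<forall>z\<in>carrier A. ?E x y z"
    proof (intro ballI)
      fix x y z assume c: "x \<in> carrier A" "y \<in> carrier A" "z \<in> carrier A"
      obtain X Y Z where X: "X \<in> Cg x" "Y \<in> Cg y" "Z \<in> Cg z"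
        "\<not> zero_object C X" "\<not> zero_object C Y" "\<not> zero_object C Z"
        using Cg_nonzero c by metis
      have O: "X \<in> Obj C" "Y \<in> Obj C" "Z \<in> Obj C" using X Cg_Obj c by blast+
      have "?l x y z X Y Z = ?r x y z X Y Z" using P c X unfolding tw_hexagon1_def by blast
      moreover note main[OF c X(1) O]
      moreover obtain S T g where "ip S T (?r x y z X Y Z) g" "\<not> zero_object C S" using main[OF c X(1) O] X by blast
      ultimately have "?t x y z = 1" by (intro nonzero_rigid) auto
      then show "?E x y z" using tE[OF c] by blast
    qed
  next
    assume E: "\<forall>x\<in>carrier A. \<forall>y\<in>carrier A. \<forall>z\<in>carrier A. ?E x y z"
    show ?P unfolding tw_hexagon1_def
    proof (intro ballI)
      fix x y z X Y Z assume c: "x \<in> carrier A" "y \<in> carrier A" "z \<in> carrier A"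
        and X: "X \<in> Cg x" "Y \<in> Cg y" "Z \<in> Cg z"
      have O: "X \<in> Obj C" "Y \<in> Obj C" "Z \<in> Obj C" using X Cg_Obj c by blast+
      have "?t x y z = 1" using tE[OF c] E c by blast
      moreover obtain S T g where "ip S T (?r x y z X Y Z) g" using main[OF c X(1) O] by blast
      ultimately show "?l x y z X Y Z = ?r x y z X Y Z"
        using main[OF c X(1) O] arr_Scl_one ipD(1) by metis
    qed
  qed
qed

lemma hexagon2_scalar:
  assumes xi: "xi_scalar \<xi> a" and ka: "kappa_scalar \<kappa> b"
  shows "tw_hexagon2 A C Cg R \<xi> \<kappa> \<longleftrightarrow> (\<forall>x\<in>carrier A. \<forall>y\<in>carrier A. \<forall>z\<in>carrier A.
    b (x \<otimes>\<^bsub>A\<^esub> y) z * a x z y = b x z * b y z * a z x y * a x y z)"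
  (is "?P \<longleftrightarrow> (\<forall>x\<in>_. \<forall>y\<in>_. \<forall>z\<in>_. ?E x y z)")
proof -
  \<comment> \<open>The second hexagon is stated with inverse associators, hence the inverse
    scalars; they are cleared in \<open>tE\<close>.\<close>
  let ?t = "\<lambda>x y z. (inverse (a z x y) * b (x \<otimes>\<^bsub>A\<^esub> y) z * inverse (a x y z)) / (b x z * inverse (a x z y) * b y z)"
  let ?l = "\<lambda>x y z X Y Z. tw_inv_assoc A C R \<xi> z x y Z X Y
        \<cdot> tw_braid C R \<kappa> (x \<otimes>\<^bsub>A\<^esub> y) z (tw_obj C R x y X Y) Z
        \<cdot> tw_inv_assoc A C R \<xi> x y z X Y Z"
  let ?r = "\<lambda>x y z X Y Z. tw_mor C R (z \<otimes>\<^bsub>A\<^esub> x) y (tw_braid C R \<kappa> x z X Z) (Idt C Y)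
        \<cdot> tw_inv_assoc A C R \<xi> x z y X Z Y
        \<cdot> tw_mor C R x (y \<otimes>\<^bsub>A\<^esub> z) (Idt C X) (tw_braid C R \<kappa> y z Y Z)"
  have main: "?l x y z X Y Z = Scl C (?t x y z) (?r x y z X Y Z)
      \<and> (\<exists>S T g. ip S T (?r x y z X Y Z) g \<and> (\<not> zero_object C X \<longrightarrow> \<not> zero_object C Y \<longrightarrow> \<not> zero_object C Z \<longrightarrow> \<not> zero_object C S))"
    if c: "x \<in> carrier A" "y \<in> carrier A" "z \<in> carrier A"
      and O: "X \<in> Obj C" "Y \<in> Obj C" "Z \<in> Obj C" for x y z X Y Z
  proof -
    have cc: "x \<otimes>\<^bsub>A\<^esub> y \<in> carrier A" "y \<otimes>\<^bsub>A\<^esub> z \<in> carrier A" "z \<otimes>\<^bsub>A\<^esub> x \<in> carrier A" using c by auto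
    have as: "z \<otimes>\<^bsub>A\<^esub> y = y \<otimes>\<^bsub>A\<^esub> z" "x \<otimes>\<^bsub>A\<^esub> z = z \<otimes>\<^bsub>A\<^esub> x"
      using c by (simp_all add: A.m_comm)
    have Ls: "L z (x \<otimes>\<^bsub>A\<^esub> y) = L (x \<otimes>\<^bsub>A\<^esub> y) z" "L z y = L y z" "L x z = L z x"
      using c cc L_sym by auto
    define P Q S T P' P2 Q2 Q4 T4 where
      "P = R (x \<otimes>\<^bsub>A\<^esub> y) z" and "Q = R x y" and "S = R x (y \<otimes>\<^bsub>A\<^esub> z)" and "T = R y z" and "P' = R z (x \<otimes>\<^bsub>A\<^esub> y)"
      and "P2 = R (z \<otimes>\<^bsub>A\<^esub> x) y" and "Q2 = R z x" and "Q4 = R x z" and "T4 = R z y"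
    note ds = P_def Q_def S_def T_def P'_def P2_def Q2_def Q4_def T4_def
    note l = lab_R[OF cc(1) c(3), folded P_def] lab_R[OF c(1,2), folded Q_def] lab_R[OF c(1) cc(2), folded S_def]
      lab_R[OF c(2,3), folded T_def] lab_R[OF c(3) cc(1), folded P'_def, unfolded Ls] lab_R[OF cc(3) c(2), folded P2_def]
      lab_R[OF c(3,1), folded Q2_def] lab_R[OF c(1,3), folded Q4_def, unfolded Ls] lab_R[OF c(3,2), folded T4_def, unfolded Ls]
    note o = l(1-9)[THEN labD(2)]
    note x1 = xi_scalarD[OF xi c] and x2 = xi_scalarD[OF xi c(3,1,2)] and x3 = xi_scalarD[OF xi c(1,3,2)]
      and k1 = kappa_scalarD[OF ka cc(1) c(3)] and k2 = kappa_scalarD[OF ka c(2,3)] and k3 = kappa_scalarD[OF ka c(1,3)]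
    obtain g1 g2 g3 h1 h2 h3 where g: "ip (P \<odot> Q) (S \<odot> T) (\<xi> x y z) g1"
      "ip (P2 \<odot> Q2) (P' \<odot> Q) (\<xi> z x y) g2" "ip (P2 \<odot> Q4) (S \<odot> T4) (\<xi> x z y) g3"
      and h: "ip P P' (\<kappa> (x \<otimes>\<^bsub>A\<^esub> y) z) h1" "ip T T4 (\<kappa> y z) h2" "ip Q4 Q2 (\<kappa> x z) h3"
      using x1(2) x2(2) x3(2) k1(2) k2(2) k3(2) unfolding ds as by blast
    note hh = h(1-3)[THEN ipD(1)]
    note KK = L_cocycle[OF c] L_cocycle[OF c(3,1,2), unfolded Ls]
    have eq: "act n (bx2 P' Q P2 Q2 g2) (act n (bx P P' (\<kappa> (x \<otimes>\<^bsub>A\<^esub> y) z)) (act n (bx2 S T P Q g1) s))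
      = sscl (?t x y z)
         (act (Suc n) (bx Q4 Q2 (\<kappa> x z)) (act n (bx2 S T4 P2 Q4 g3) (act (Suc n) (bx T T4 (\<kappa> y z)) s)))"
      if "win n [S, T] s" for n s
      by (rule hexagon2_L[OF l g hh KK(1)[symmetric] KK(2)[symmetric] x1(3) x2(3)[unfolded Ls] x3(3)[unfolded as Ls]
            k1(3) k2(3) k3(3) x1(1) x2(1) x3(1) k2(1) k3(1) that])
    obtain p1 p2 p3 where p: "ip (P \<odot> ((Q \<odot> (X \<odot> Y)) \<odot> Z)) (S \<odot> (X \<odot> (T \<odot> (Y \<odot> Z)))) (tassoc P Q S T (\<xi> x y z) X Y Z) p1"
      "ip (P2 \<odot> ((Q2 \<odot> (Z \<odot> X)) \<odot> Y)) (P' \<odot> (Z \<odot> (Q \<odot> (X \<odot> Y)))) (tassoc P2 Q2 P' Q (\<xi> z x y) Z X Y) p2"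
      "ip (P2 \<odot> ((Q4 \<odot> (X \<odot> Z)) \<odot> Y)) (S \<odot> (X \<odot> (T4 \<odot> (Z \<odot> Y)))) (tassoc P2 Q4 S T4 (\<xi> x z y) X Z Y) p3"
      using ip_tassoc[OF o(1-4) O g(1)] ip_tassoc[OF o(6,7,5,2) O(3,1,2) g(2)] ip_tassoc[OF o(6,8,3,9) O(1,3,2) g(3)] by blast
    note main = twisted_hexagon2[OF o O g h p eq]
    note inv = inv_mor_eq[OF p(1)] inv_mor_eq[OF p(2)] inv_mor_eq[OF p(3)]
    have e1: "?l x y z X Y Z = Scl C (?t x y z) (?r x y z X Y Z)"
      unfolding tw_inv_assoc_def tw_assoc_tassoc tw_braid_tbraid tw_obj_def tw_mor_def as ds[symmetric] inv by (rule main)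
    obtain q1 q2 where q: "ip (T \<odot> (Y \<odot> Z)) (T4 \<odot> (Z \<odot> Y)) (tbraid T T4 (\<kappa> y z) Y Z) q1"
      "ip (Q4 \<odot> (X \<odot> Z)) (Q2 \<odot> (Z \<odot> X)) (tbraid Q4 Q2 (\<kappa> x z) X Z) q2"
      using ip_tbraid[OF o(4,9) O(2,3) h(2)] ip_tbraid[OF o(8,7) O(1,3) h(3)] by blast
    have "\<exists>T' g. ip (S \<odot> (X \<odot> (T \<odot> (Y \<odot> Z)))) T' (?r x y z X Y Z) g"
      unfolding tw_inv_assoc_def tw_assoc_tassoc tw_braid_tbraid tw_obj_def tw_mor_def as ds[symmetric] inv
      using ip_Cmp[OF ip_Cmp[OF ip_TMor[OF ip_Idt[OF o(3)] ip_TMor[OF ip_Idt[OF O(1)] q(1)]] ip_sym[OF p(3)]] ip_TMor[OF ip_Idt[OF o(6)] ip_TMor[OF q(2) ip_Idt[OF O(2)]]]] by blast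
    moreover have "\<not> zero_object C (S \<odot> (X \<odot> (T \<odot> (Y \<odot> Z))))"
      if "\<not> zero_object C X" "\<not> zero_object C Y" "\<not> zero_object C Z"
      using that O o lab_nonzero(2)[OF l(3)] lab_nonzero(2)[OF l(4)] by (simp add: nonzero_TObj TObj_in)
    ultimately show ?thesis using e1 by blast
  qed
  have tE: "?t x y z = 1 \<longleftrightarrow> ?E x y z" if "x \<in> carrier A" "y \<in> carrier A" "z \<in> carrier A" for x y z
  proof -
    have nz: "a x y z \<noteq> 0" "a z x y \<noteq> 0" "a x z y \<noteq> 0" "b x z \<noteq> 0" "b y z \<noteq> 0"
      using xi_scalarD(1)[OF xi] kappa_scalarD(1)[OF ka] that by auto
    have "?t x y z = (b (x \<otimes>\<^bsub>A\<^esub> y) z * a x z y) / (b x z * b y z * a z x y * a x y z)"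
      using nz by (simp add: field_simps)
    then show ?thesis using nz by (simp add: divide_eq_1_iff)
  qed
  show ?thesis
  proof
    assume P: ?P
    show "\<forall>x\<in>carrier A. \<forall>y\<in>carrier A. \<forall>z\<in>carrier A. ?E x y z"
    proof (intro ballI)
      fix x y z assume c: "x \<in> carrier A" "y \<in> carrier A" "z \<in> carrier A"
      obtain X Y Z where X: "X \<in> Cg x" "Y \<in> Cg y" "Z \<in> Cg z"
        "\<not> zero_object C X" "\<not> zero_object C Y" "\<not> zero_object C Z"
        using Cg_nonzero c by metis
      have O: "X \<in> Obj C" "Y \<in> Obj C" "Z \<in> Obj C" using X Cg_Obj c by blast+
      have "?l x y z X Y Z = ?r x y z X Y Z" using P c X unfolding tw_hexagon2_def by blast
      moreover note main[OF c O]
      moreover obtain S T g where "ip S T (?r x y z X Y Z) g" "\<not> zero_object C S" using main[OF c O] X by blast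
      ultimately have "?t x y z = 1" by (intro nonzero_rigid) auto
      then show "?E x y z" using tE[OF c] by blast
    qed
  next
    assume E: "\<forall>x\<in>carrier A. \<forall>y\<in>carrier A. \<forall>z\<in>carrier A. ?E x y z"
    show ?P unfolding tw_hexagon2_def
    proof (intro ballI)
      fix x y z X Y Z assume c: "x \<in> carrier A" "y \<in> carrier A" "z \<in> carrier A"
        and X: "X \<in> Cg x" "Y \<in> Cg y" "Z \<in> Cg z"
      have O: "X \<in> Obj C" "Y \<in> Obj C" "Z \<in> Obj C" using X Cg_Obj c by blast+
      have "?t x y z = 1" using tE[OF c] E c by blast
      moreover obtain S T g where "ip S T (?r x y z X Y Z) g" using main[OF c O] by blast
      ultimately show "?l x y z X Y Z = ?r x y z X Y Z"
        using main[OF c O] arr_Scl_one ipD(1) by metis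
    qed
  qed
qed

section \<open>From isomorphisms to scalars and back\<close>

lemma xi_scalar_exists:
  assumes "\<forall>x\<in>carrier A. \<forall>y\<in>carrier A. \<forall>z\<in>carrier A.
        iso_mor C (R (x \<otimes>\<^bsub>A\<^esub> y) z \<odot> R x y) (R x (y \<otimes>\<^bsub>A\<^esub> z) \<odot> R y z) (\<xi> x y z)"
  shows "\<exists>a. xi_scalar \<xi> a"
proof -
  define p where "p x y z a \<longleftrightarrow> a \<noteq> 0 \<and> mu (L x (y \<otimes>\<^bsub>A\<^esub> z)) (L y z) (u x (y \<otimes>\<^bsub>A\<^esub> z)) (u y z) \<cdot> \<xi> x y z
      = Scl C a (mu (L (x \<otimes>\<^bsub>A\<^esub> y) z) (L x y) (u (x \<otimes>\<^bsub>A\<^esub> y) z) (u x y))" for x y z a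
  have "p x y z (SOME a. p x y z a)" if c: "x \<in> carrier A" "y \<in> carrier A" "z \<in> carrier A" for x y z
  proof (rule someI_ex)
    have cc: "x \<otimes>\<^bsub>A\<^esub> y \<in> carrier A" "y \<otimes>\<^bsub>A\<^esub> z \<in> carrier A" using c by auto
    show "\<exists>a. p x y z a"
      unfolding p_def
      by (rule exists_scalar[OF lab_R[OF cc(1) c(3)] lab_R[OF c(1,2)] lab_R[OF c(1) cc(2)] lab_R[OF c(2,3)] L_cocycle[OF c, symmetric]])
        (use assms c in blast)
  qed
  then have "xi_scalar \<xi> (\<lambda>x y z. SOME a. p x y z a)"
    using assms unfolding xi_scalar_def p_def by blast
  then show ?thesis by blast
qed

lemma kappa_scalar_exists:
  assumes "\<forall>x\<in>carrier A. \<forall>y\<in>carrier A. iso_mor C (R x y) (R y x) (\<kappa> x y)"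
  shows "\<exists>b. kappa_scalar \<kappa> b"
proof -
  define p where "p x y b \<longleftrightarrow> b \<noteq> 0 \<and> u y x \<cdot> \<kappa> x y = Scl C b (u x y)" for x y b
  have "p x y (SOME b. p x y b)" if c: "x \<in> carrier A" "y \<in> carrier A" for x y
  proof (rule someI_ex)
    show "\<exists>b. p x y b"
      unfolding p_def
      by (rule exists_scalar1[OF lab_R[OF c] lab_R[OF c(2,1), unfolded L_sym[OF c(2,1)]]]) (use assms c in blast)
  qed
  then have "kappa_scalar \<kappa> (\<lambda>x y. SOME b. p x y b)"
    using assms unfolding kappa_scalar_def p_def by blast
  then show ?thesis by blast
qed

lemma xi_exists:
  assumes nz: "\<And>x y z. \<lbrakk>x \<in> carrier A; y \<in> carrier A; z \<in> carrier A\<rbrakk> \<Longrightarrow> a x y z \<noteq> 0"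
  shows "\<exists>\<xi>. xi_scalar \<xi> a"
proof -
  define p where "p x y z k \<longleftrightarrow> iso_mor C (R (x \<otimes>\<^bsub>A\<^esub> y) z \<odot> R x y) (R x (y \<otimes>\<^bsub>A\<^esub> z) \<odot> R y z) k
    \<and> mu (L x (y \<otimes>\<^bsub>A\<^esub> z)) (L y z) (u x (y \<otimes>\<^bsub>A\<^esub> z)) (u y z) \<cdot> k
      = Scl C (a x y z) (mu (L (x \<otimes>\<^bsub>A\<^esub> y) z) (L x y) (u (x \<otimes>\<^bsub>A\<^esub> y) z) (u x y))" for x y z k
  have "p x y z (SOME k. p x y z k)" if c: "x \<in> carrier A" "y \<in> carrier A" "z \<in> carrier A" for x y z
  proof (rule someI_ex)
    have cc: "x \<otimes>\<^bsub>A\<^esub> y \<in> carrier A" "y \<otimes>\<^bsub>A\<^esub> z \<in> carrier A" using c by auto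
    show "\<exists>k. p x y z k"
      unfolding p_def
      by (rule exists_iso_scalar[OF lab_R[OF cc(1) c(3)] lab_R[OF c(1,2)] lab_R[OF c(1) cc(2)] lab_R[OF c(2,3)] L_cocycle[OF c, symmetric] nz[OF c]])
  qed
  then have "xi_scalar (\<lambda>x y z. SOME k. p x y z k) a"
    using nz unfolding xi_scalar_def p_def by blast
  then show ?thesis by blast
qed

lemma kappa_exists:
  assumes nz: "\<And>x y. \<lbrakk>x \<in> carrier A; y \<in> carrier A\<rbrakk> \<Longrightarrow> b x y \<noteq> 0"
  shows "\<exists>\<kappa>. kappa_scalar \<kappa> b"
proof -
  define p where "p x y h \<longleftrightarrow> iso_mor C (R x y) (R y x) h \<and> u y x \<cdot> h = Scl C (b x y) (u x y)" for x y h
  have "p x y (SOME h. p x y h)" if c: "x \<in> carrier A" "y \<in> carrier A" for x y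
  proof (rule someI_ex)
    show "\<exists>h. p x y h"
      unfolding p_def
      by (rule exists_iso_scalar1[OF lab_R[OF c] lab_R[OF c(2,1), unfolded L_sym[OF c(2,1)]] nz[OF c]])
  qed
  then have "kappa_scalar (\<lambda>x y. SOME h. p x y h) b"
    using nz unfolding kappa_scalar_def p_def by blast
  then show ?thesis by blast
qed

text \<open>The pentagon, the first and the second hexagon, in this order and free of
  divisions.\<close>

definition scalar_eqs :: "('a \<Rightarrow> 'a \<Rightarrow> 'a \<Rightarrow> 'k) \<Rightarrow> ('a \<Rightarrow> 'a \<Rightarrow> 'k) \<Rightarrow> bool"
  where "scalar_eqs a b \<longleftrightarrow>
    (\<forall>x\<in>carrier A. \<forall>y\<in>carrier A. \<forall>z\<in>carrier A. \<forall>w\<in>carrier A.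
      a x y (z \<otimes>\<^bsub>A\<^esub> w) * beta (L z w) (L x y) * a (x \<otimes>\<^bsub>A\<^esub> y) z w = a y z w * a x (y \<otimes>\<^bsub>A\<^esub> z) w * a x y z)
    \<and> (\<forall>x\<in>carrier A. \<forall>y\<in>carrier A. \<forall>z\<in>carrier A.
      pr x y z * (a y z x * b x (y \<otimes>\<^bsub>A\<^esub> z) * a x y z) = b x z * a y x z * b x y)
    \<and> (\<forall>x\<in>carrier A. \<forall>y\<in>carrier A. \<forall>z\<in>carrier A.
      b (x \<otimes>\<^bsub>A\<^esub> y) z * a x z y = b x z * b y z * a z x y * a x y z)"

lemma C3_br_iff: "(a, b) \<in> C3_br A \<longleftrightarrow> (\<forall>x\<in>carrier A. \<forall>y\<in>carrier A. \<forall>z\<in>carrier A. a x y z \<noteq> 0)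
    \<and> (\<forall>x\<in>carrier A. \<forall>y\<in>carrier A. b x y \<noteq> 0)"
  by (simp add: C3_br_def)

text \<open>Given isomorphisms have scalars relative to the labels, and given nonzero scalars are
  realised by isomorphisms, so the choice of isomorphisms is the choice of a 3-cochain.\<close>

lemma structure_iff_scalar_eqs:
  "(\<exists>\<xi> \<kappa>.
      (\<forall>x\<in>carrier A. \<forall>y\<in>carrier A. \<forall>z\<in>carrier A.
        iso_mor C (R (x \<otimes>\<^bsub>A\<^esub> y) z \<odot> R x y) (R x (y \<otimes>\<^bsub>A\<^esub> z) \<odot> R y z) (\<xi> x y z))
      \<and> (\<forall>x\<in>carrier A. \<forall>y\<in>carrier A. iso_mor C (R x y) (R y x) (\<kappa> x y))
      \<and> tw_pentagon A C Cg R \<xi>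
      \<and> tw_hexagon1 A C Cg R \<xi> \<kappa>
      \<and> tw_hexagon2 A C Cg R \<xi> \<kappa>)
    \<longleftrightarrow> (\<exists>a b. (a, b) \<in> C3_br A \<and> scalar_eqs a b)"
  (is "?l \<longleftrightarrow> ?r")
proof
  assume ?l
  then obtain \<xi> \<kappa> where x: "\<forall>x\<in>carrier A. \<forall>y\<in>carrier A. \<forall>z\<in>carrier A.
        iso_mor C (R (x \<otimes>\<^bsub>A\<^esub> y) z \<odot> R x y) (R x (y \<otimes>\<^bsub>A\<^esub> z) \<odot> R y z) (\<xi> x y z)"
    and k: "\<forall>x\<in>carrier A. \<forall>y\<in>carrier A. iso_mor C (R x y) (R y x) (\<kappa> x y)"
    and e: "tw_pentagon A C Cg R \<xi>" "tw_hexagon1 A C Cg R \<xi> \<kappa>" "tw_hexagon2 A C Cg R \<xi> \<kappa>" by blast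
  obtain a b where ab: "xi_scalar \<xi> a" "kappa_scalar \<kappa> b"
    using xi_scalar_exists[OF x] kappa_scalar_exists[OF k] by blast
  have "(a, b) \<in> C3_br A" using xi_scalarD(1)[OF ab(1)] kappa_scalarD(1)[OF ab(2)] unfolding C3_br_iff by blast
  moreover have "scalar_eqs a b"
    unfolding scalar_eqs_def
    using e(1)[unfolded pentagon_scalar[OF ab(1)]] e(2)[unfolded hexagon1_scalar[OF ab]] e(3)[unfolded hexagon2_scalar[OF ab]] by (intro conjI)
  ultimately show ?r by blast
next
  assume ?r
  then obtain a b where ab: "(a, b) \<in> C3_br A" "scalar_eqs a b" by blast
  obtain \<xi> where x: "xi_scalar \<xi> a" using xi_exists[of a] ab(1) unfolding C3_br_iff by blast
  obtain \<kappa> where k: "kappa_scalar \<kappa> b" using kappa_exists[of b] ab(1) unfolding C3_br_iff by blast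
  show ?l
  proof (intro exI conjI)
    show "\<forall>x\<in>carrier A. \<forall>y\<in>carrier A. \<forall>z\<in>carrier A.
        iso_mor C (R (x \<otimes>\<^bsub>A\<^esub> y) z \<odot> R x y) (R x (y \<otimes>\<^bsub>A\<^esub> z) \<odot> R y z) (\<xi> x y z)"
      using x unfolding xi_scalar_def by blast
    show "\<forall>x\<in>carrier A. \<forall>y\<in>carrier A. iso_mor C (R x y) (R y x) (\<kappa> x y)"
      using k unfolding kappa_scalar_def by blast
    note e = ab(2)[unfolded scalar_eqs_def]
    show "tw_pentagon A C Cg R \<xi>" unfolding pentagon_scalar[OF x] by (rule e[THEN conjunct1])
    show "tw_hexagon1 A C Cg R \<xi> \<kappa>" unfolding hexagon1_scalar[OF x k] by (rule e[THEN conjunct2, THEN conjunct1])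
    show "tw_hexagon2 A C Cg R \<xi> \<kappa>" unfolding hexagon2_scalar[OF x k] by (rule e[THEN conjunct2, THEN conjunct2])
  qed
qed

text \<open>
  The pentagon produces the braiding of \<open>L z w\<close> with \<open>L x y\<close>, whereas the first component of the
  Pontryagin--Whitehead cocycle is the braiding of \<open>L x y\<close> with \<open>L z w\<close>. Both cocycles differ by the
  coboundary of \<open>(sigma, 1)\<close>.
\<close>

definition sigma :: "'a \<Rightarrow> 'a \<Rightarrow> 'a \<Rightarrow> 'k"
  where "sigma x y z = beta (L (x \<otimes>\<^bsub>A\<^esub> y) z) (L x y) * inverse (beta (L x (y \<otimes>\<^bsub>A\<^esub> z)) (L y z))"

lemma sigma_nonzero: "\<lbrakk>x \<in> carrier A; y \<in> carrier A; z \<in> carrier A\<rbrakk> \<Longrightarrow> sigma x y z \<noteq> 0"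
  using beta(1) L_in unfolding sigma_def by simp

text \<open>There are five instances of the cocycle condition among four degrees. Braiding each of
  them with a suitable value of \<open>L\<close> and using bimultiplicativity expresses five of the
  braidings through the others; after substitution both sides coincide.\<close>

lemma sigma_pentagon:
  assumes c: "x \<in> carrier A" "y \<in> carrier A" "z \<in> carrier A" "w \<in> carrier A"
  shows "sigma y z w * sigma x (y \<otimes>\<^bsub>A\<^esub> z) w * sigma x y z * beta (L x y) (L z w)
    = sigma x y (z \<otimes>\<^bsub>A\<^esub> w) * sigma (x \<otimes>\<^bsub>A\<^esub> y) z w * beta (L z w) (L x y)"
proof -
  have cc: "x \<otimes>\<^bsub>A\<^esub> y \<in> carrier A" "y \<otimes>\<^bsub>A\<^esub> z \<in> carrier A" "z \<otimes>\<^bsub>A\<^esub> w \<in> carrier A" "x \<otimes>\<^bsub>A\<^esub> y \<otimes>\<^bsub>A\<^esub> z \<in> carrier A"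
    "y \<otimes>\<^bsub>A\<^esub> z \<otimes>\<^bsub>A\<^esub> w \<in> carrier A" using c by auto
  have as: "x \<otimes>\<^bsub>A\<^esub> (y \<otimes>\<^bsub>A\<^esub> z) = x \<otimes>\<^bsub>A\<^esub> y \<otimes>\<^bsub>A\<^esub> z" "y \<otimes>\<^bsub>A\<^esub> (z \<otimes>\<^bsub>A\<^esub> w) = y \<otimes>\<^bsub>A\<^esub> z \<otimes>\<^bsub>A\<^esub> w"
    using c by (simp_all add: A.m_assoc)
  define p q s m m' n n' P Q S where "p = L x y" and "q = L y z" and "s = L z w" and "m = L (x \<otimes>\<^bsub>A\<^esub> y) z" and "m' = L x (y \<otimes>\<^bsub>A\<^esub> z)"
    and "n = L (y \<otimes>\<^bsub>A\<^esub> z) w" and "n' = L y (z \<otimes>\<^bsub>A\<^esub> w)" and "P = L (x \<otimes>\<^bsub>A\<^esub> y \<otimes>\<^bsub>A\<^esub> z) w" and "Q = L x (y \<otimes>\<^bsub>A\<^esub> z \<otimes>\<^bsub>A\<^esub> w)"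
    and "S = L (x \<otimes>\<^bsub>A\<^esub> y) (z \<otimes>\<^bsub>A\<^esub> w)"
  note ds = p_def q_def s_def m_def m'_def n_def n'_def P_def Q_def S_def
  have i: "p \<in> carrier G" "q \<in> carrier G" "s \<in> carrier G" "m \<in> carrier G" "m' \<in> carrier G" "n \<in> carrier G" "n' \<in> carrier G"
    "P \<in> carrier G" "Q \<in> carrier G" "S \<in> carrier G"
    unfolding ds using c cc L_in by auto
  note nz = beta(1)
  have "beta P m * beta P p = beta P m' * beta P q"
    using L_cocycle[OF c(1-3)] beta_mult_right[OF i(8,4,1)] beta_mult_right[OF i(8,5,2)] unfolding ds by simp
  then have 1: "beta P m' = beta P m * beta P p / beta P q" using nz[OF i(8,2)] by (simp add: eq_divide_eq)
  have "beta Q n * beta Q q = beta Q n' * beta Q s"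
    using L_cocycle[OF c(2-4)] beta_mult_right[OF i(9,6,2)] beta_mult_right[OF i(9,7,3)] unfolding ds by simp
  then have 2: "beta Q n = beta Q n' * beta Q s / beta Q q" using nz[OF i(9,2)] by (simp add: eq_divide_eq)
  have "beta P p * beta m p = beta S p * beta s p"
    using L_cocycle[OF cc(1) c(3,4)] beta_mult_left[OF i(8,4,1)] beta_mult_left[OF i(10,3,1)] unfolding ds by simp
  then have 3: "beta m p = beta S p * beta s p / beta P p" using nz[OF i(8,1)] by (simp add: eq_divide_eq mult.commute)
  have "beta P q * beta m' q = beta Q q * beta n q"
    using L_cocycle[OF c(1) cc(2) c(4)] beta_mult_left[OF i(8,5,2)] beta_mult_left[OF i(9,6,2)] unfolding ds as by simp
  then have 4: "beta n q = beta P q * beta m' q / beta Q q" using nz[OF i(9,2)] by (simp add: eq_divide_eq mult.commute)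
  have "beta S s * beta p s = beta Q s * beta n' s"
    using L_cocycle[OF c(1,2) cc(3)] beta_mult_left[OF i(10,1,3)] beta_mult_left[OF i(9,7,3)] unfolding ds as by simp
  then have 5: "beta p s = beta Q s * beta n' s / beta S s" using nz[OF i(10,3)] by (simp add: eq_divide_eq mult.commute)
  have z: "beta P p \<noteq> 0" "beta P q \<noteq> 0" "beta Q q \<noteq> 0" "beta Q s \<noteq> 0" "beta S s \<noteq> 0" "beta n' s \<noteq> 0" "beta m' q \<noteq> 0"
    "beta Q n' \<noteq> 0" "beta P m \<noteq> 0"
    using nz i by auto
  show ?thesis
    unfolding sigma_def as ds[symmetric] 2 3 4 5 1 using z by (simp add: field_simps)
qed

text \<open>By symmetry of \<open>L\<close>, the scalar \<open>sigma x y z\<close> is the quotient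
  of a term attached to \<open>z\<close> by one attached to \<open>x\<close>, so the product
  telescopes.\<close>

lemma sigma_hexagon1:
  assumes c: "x \<in> carrier A" "y \<in> carrier A" "z \<in> carrier A"
  shows "sigma y x z = sigma x y z * sigma y z x"
proof -
  have cc: "x \<otimes>\<^bsub>A\<^esub> y \<in> carrier A" "y \<otimes>\<^bsub>A\<^esub> z \<in> carrier A" "z \<otimes>\<^bsub>A\<^esub> x \<in> carrier A" using c by auto
  have as: "y \<otimes>\<^bsub>A\<^esub> x = x \<otimes>\<^bsub>A\<^esub> y" "x \<otimes>\<^bsub>A\<^esub> z = z \<otimes>\<^bsub>A\<^esub> x" using c by (simp_all add: A.m_comm)
  have Ls: "L (y \<otimes>\<^bsub>A\<^esub> z) x = L x (y \<otimes>\<^bsub>A\<^esub> z)" "L y x = L x y" "L x z = L z x" using c cc L_sym by auto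
  have "beta (L x (y \<otimes>\<^bsub>A\<^esub> z)) (L y z) \<noteq> 0" using beta(1) L_in c cc by simp
  then show ?thesis unfolding sigma_def as Ls by simp
qed

text \<open>The same telescoping in another order of the degrees.\<close>

lemma sigma_hexagon2:
  assumes c: "x \<in> carrier A" "y \<in> carrier A" "z \<in> carrier A"
  shows "sigma x z y = sigma z x y * sigma x y z"
proof -
  have cc: "x \<otimes>\<^bsub>A\<^esub> y \<in> carrier A" "y \<otimes>\<^bsub>A\<^esub> z \<in> carrier A" "z \<otimes>\<^bsub>A\<^esub> x \<in> carrier A" using c by auto
  have as: "z \<otimes>\<^bsub>A\<^esub> y = y \<otimes>\<^bsub>A\<^esub> z" "x \<otimes>\<^bsub>A\<^esub> z = z \<otimes>\<^bsub>A\<^esub> x" using c by (simp_all add: A.m_comm)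
  have Ls: "L z (x \<otimes>\<^bsub>A\<^esub> y) = L (x \<otimes>\<^bsub>A\<^esub> y) z" "L z y = L y z" "L x z = L z x" using c cc L_sym by auto
  have "beta (L (x \<otimes>\<^bsub>A\<^esub> y) z) (L x y) \<noteq> 0" using beta(1) L_in c cc by simp
  then show ?thesis unfolding sigma_def as Ls by simp
qed

definition pw :: "('a, 'k) cochain4"
  where "pw = (\<lambda>x y z w. beta (L x y) (L z w), \<lambda>x y z. 1, \<lambda>x y z. pr x y z)"

text \<open>Multiplication by \<open>sigma\<close> exchanges the arguments of the braiding in the
  pentagon equation and cancels from both hexagon equations. What remains is clearing denominators;
  the third component of the coboundary matches the first hexagon and the second component the
  second hexagon.\<close>

lemma eq_d3_iff:
  assumes ab: "(a, b) \<in> C3_br A"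
  shows "eq_cochain4 A pw (d3_br A (a, b)) \<longleftrightarrow> scalar_eqs (\<lambda>x y z. a x y z * sigma x y z) b"
proof -
  have na: "a x y z \<noteq> 0" if "x \<in> carrier A" "y \<in> carrier A" "z \<in> carrier A" for x y z using ab that unfolding C3_br_iff by blast
  have nb: "b x y \<noteq> 0" if "x \<in> carrier A" "y \<in> carrier A" for x y using ab that unfolding C3_br_iff by blast
  let ?P = "\<lambda>x y z w. beta (L x y) (L z w) = a y z w * inverse (a (x \<otimes>\<^bsub>A\<^esub> y) z w) * a x (y \<otimes>\<^bsub>A\<^esub> z) w * inverse (a x y (z \<otimes>\<^bsub>A\<^esub> w)) * a x y z"
  let ?P' = "\<lambda>x y z w. (a x y (z \<otimes>\<^bsub>A\<^esub> w) * sigma x y (z \<otimes>\<^bsub>A\<^esub> w)) * beta (L z w) (L x y) * (a (x \<otimes>\<^bsub>A\<^esub> y) z w * sigma (x \<otimes>\<^bsub>A\<^esub> y) z w)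
      = (a y z w * sigma y z w) * (a x (y \<otimes>\<^bsub>A\<^esub> z) w * sigma x (y \<otimes>\<^bsub>A\<^esub> z) w) * (a x y z * sigma x y z)"
  let ?H1 = "\<lambda>x y z. pr x y z = b x y * inverse (b x (y \<otimes>\<^bsub>A\<^esub> z)) * b x z * inverse (a x y z) * a y x z * inverse (a y z x)"
  let ?H1' = "\<lambda>x y z. pr x y z * ((a y z x * sigma y z x) * b x (y \<otimes>\<^bsub>A\<^esub> z) * (a x y z * sigma x y z)) = b x z * (a y x z * sigma y x z) * b x y"
  let ?H2 = "\<lambda>x y z. 1 = b y z * inverse (b (x \<otimes>\<^bsub>A\<^esub> y) z) * b x z * a x y z * inverse (a x z y) * a z x y"
  let ?H2' = "\<lambda>x y z. b (x \<otimes>\<^bsub>A\<^esub> y) z * (a x z y * sigma x z y) = b x z * b y z * (a z x y * sigma z x y) * (a x y z * sigma x y z)"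
  have P: "?P x y z w \<longleftrightarrow> ?P' x y z w"
    if c: "x \<in> carrier A" "y \<in> carrier A" "z \<in> carrier A" "w \<in> carrier A" for x y z w
  proof -
    have cc: "x \<otimes>\<^bsub>A\<^esub> y \<in> carrier A" "y \<otimes>\<^bsub>A\<^esub> z \<in> carrier A" "z \<otimes>\<^bsub>A\<^esub> w \<in> carrier A" using c by auto
    \<comment> \<open>The factor that \<open>sigma\<close> contributes to either side.\<close>
    define s where "s = sigma y z w * sigma x (y \<otimes>\<^bsub>A\<^esub> z) w * sigma x y z"
    have s: "s \<noteq> 0" unfolding s_def using sigma_nonzero c cc by simp
    have z: "a (x \<otimes>\<^bsub>A\<^esub> y) z w \<noteq> 0" "a x y (z \<otimes>\<^bsub>A\<^esub> w) \<noteq> 0" using na c cc by auto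
    have e1: "(a x y (z \<otimes>\<^bsub>A\<^esub> w) * sigma x y (z \<otimes>\<^bsub>A\<^esub> w)) * beta (L z w) (L x y) * (a (x \<otimes>\<^bsub>A\<^esub> y) z w * sigma (x \<otimes>\<^bsub>A\<^esub> y) z w)
      = a x y (z \<otimes>\<^bsub>A\<^esub> w) * a (x \<otimes>\<^bsub>A\<^esub> y) z w * (s * beta (L x y) (L z w))"
      using sigma_pentagon[OF c, folded s_def] by (simp add: mult_ac)
    have e2: "(a y z w * sigma y z w) * (a x (y \<otimes>\<^bsub>A\<^esub> z) w * sigma x (y \<otimes>\<^bsub>A\<^esub> z) w) * (a x y z * sigma x y z)
      = s * (a y z w * a x (y \<otimes>\<^bsub>A\<^esub> z) w * a x y z)"
      unfolding s_def by (simp add: mult_ac)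
    show ?thesis unfolding e1 e2 using s z by (simp add: field_simps)
  qed
  have H1: "?H1 x y z \<longleftrightarrow> ?H1' x y z"
    if c: "x \<in> carrier A" "y \<in> carrier A" "z \<in> carrier A" for x y z
  proof -
    have "sigma x y z \<noteq> 0" "sigma y z x \<noteq> 0" "a x y z \<noteq> 0" "a y z x \<noteq> 0" "b x (y \<otimes>\<^bsub>A\<^esub> z) \<noteq> 0"
      using sigma_nonzero na nb c by auto
    then show ?thesis unfolding sigma_hexagon1[OF c] by (simp add: field_simps)
  qed
  have H2: "?H2 x y z \<longleftrightarrow> ?H2' x y z"
    if c: "x \<in> carrier A" "y \<in> carrier A" "z \<in> carrier A" for x y z
  proof -
    have "sigma x y z \<noteq> 0" "sigma z x y \<noteq> 0" "a x z y \<noteq> 0" "b (x \<otimes>\<^bsub>A\<^esub> y) z \<noteq> 0"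
      using sigma_nonzero na nb c by auto
    then show ?thesis unfolding sigma_hexagon2[OF c] by (simp add: field_simps) (rule eq_commute)
  qed
  show ?thesis
    unfolding eq_cochain4_def pw_def d3_br_def scalar_eqs_def prod.case
  proof
    assume h: "\<forall>x\<in>carrier A. \<forall>y\<in>carrier A. \<forall>z\<in>carrier A. (\<forall>w\<in>carrier A. ?P x y z w) \<and> ?H2 x y z \<and> ?H1 x y z"
    show "(\<forall>x\<in>carrier A. \<forall>y\<in>carrier A. \<forall>z\<in>carrier A. \<forall>w\<in>carrier A. ?P' x y z w)
      \<and> (\<forall>x\<in>carrier A. \<forall>y\<in>carrier A. \<forall>z\<in>carrier A. ?H1' x y z) \<and> (\<forall>x\<in>carrier A. \<forall>y\<in>carrier A. \<forall>z\<in>carrier A. ?H2' x y z)"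
    proof (intro conjI ballI, goal_cases)
      case (1 x y z w)
      show ?case by (rule iffD1[OF P[OF 1] h[THEN bspec, OF 1(1), THEN bspec, OF 1(2), THEN bspec, OF 1(3), THEN conjunct1, THEN bspec, OF 1(4)]])
    next
      case (2 x y z)
      show ?case by (rule iffD1[OF H1[OF 2] h[THEN bspec, OF 2(1), THEN bspec, OF 2(2), THEN bspec, OF 2(3), THEN conjunct2, THEN conjunct2]])
    next
      case (3 x y z)
      show ?case by (rule iffD1[OF H2[OF 3] h[THEN bspec, OF 3(1), THEN bspec, OF 3(2), THEN bspec, OF 3(3), THEN conjunct2, THEN conjunct1]])
    qed
  next
    assume h: "(\<forall>x\<in>carrier A. \<forall>y\<in>carrier A. \<forall>z\<in>carrier A. \<forall>w\<in>carrier A. ?P' x y z w)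
      \<and> (\<forall>x\<in>carrier A. \<forall>y\<in>carrier A. \<forall>z\<in>carrier A. ?H1' x y z) \<and> (\<forall>x\<in>carrier A. \<forall>y\<in>carrier A. \<forall>z\<in>carrier A. ?H2' x y z)"
    show "\<forall>x\<in>carrier A. \<forall>y\<in>carrier A. \<forall>z\<in>carrier A. (\<forall>w\<in>carrier A. ?P x y z w) \<and> ?H2 x y z \<and> ?H1 x y z"
    proof (intro conjI ballI, goal_cases)
      case (1 x y z w)
      show ?case by (rule iffD2[OF P[OF 1] h[THEN conjunct1, THEN bspec, OF 1(1), THEN bspec, OF 1(2), THEN bspec, OF 1(3), THEN bspec, OF 1(4)]])
    next
      case (2 x y z)
      show ?case by (rule iffD2[OF H2[OF 2] h[THEN conjunct2, THEN conjunct2, THEN bspec, OF 2(1), THEN bspec, OF 2(2), THEN bspec, OF 2(3)]])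
    next
      case (3 x y z)
      show ?case by (rule iffD2[OF H1[OF 3] h[THEN conjunct2, THEN conjunct1, THEN bspec, OF 3(1), THEN bspec, OF 3(2), THEN bspec, OF 3(3)]])
    qed
  qed
qed

text \<open>Multiplication by \<open>sigma\<close> is a bijection of cochains, with division by
  \<open>sigma\<close> as inverse.\<close>

lemma trivial_iff_scalar_eqs: "trivial_in_H4_br A pw \<longleftrightarrow> (\<exists>a b. (a, b) \<in> C3_br A \<and> scalar_eqs a b)"
proof
  assume "trivial_in_H4_br A pw"
  then obtain a b where ab: "(a, b) \<in> C3_br A" "eq_cochain4 A pw (d3_br A (a, b))" unfolding trivial_in_H4_br_def by fast
  then have "scalar_eqs (\<lambda>x y z. a x y z * sigma x y z) b" using eq_d3_iff[OF ab(1)] by blast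
  moreover have "(\<lambda>x y z. a x y z * sigma x y z, b) \<in> C3_br A"
    using ab(1) sigma_nonzero unfolding C3_br_iff by simp
  ultimately show "\<exists>a b. (a, b) \<in> C3_br A \<and> scalar_eqs a b" by blast
next
  assume "\<exists>a b. (a, b) \<in> C3_br A \<and> scalar_eqs a b"
  then obtain a b where ab: "(a, b) \<in> C3_br A" "scalar_eqs a b" by blast
  define a' where "a' = (\<lambda>x y z. a x y z * inverse (sigma x y z))"
  have c': "(a', b) \<in> C3_br A" using ab(1) sigma_nonzero unfolding C3_br_iff a'_def by simp
  have e: "a' x y z * sigma x y z = a x y z" if "x \<in> carrier A" "y \<in> carrier A" "z \<in> carrier A" for x y z
    using sigma_nonzero[OF that] by (simp add: a'_def)
  have "scalar_eqs (\<lambda>x y z. a' x y z * sigma x y z) b"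
    using ab(2) unfolding scalar_eqs_def by (simp add: e)
  then show "trivial_in_H4_br A pw" using eq_d3_iff[OF c'] c' unfolding trivial_in_H4_br_def by blast
qed

end

section \<open>Braided extensions\<close>

context braided_tensor_category
begin

lemma isomorphic_refl: "X \<in> Obj C \<Longrightarrow> isomorphic C X X"
  using ip_Idt isomorphic_ip by blast

lemma isomorphic_sym: "\<lbrakk>X \<in> Obj C; Y \<in> Obj C; isomorphic C X Y\<rbrakk> \<Longrightarrow> isomorphic C Y X"
  using ip_sym isomorphic_ip by meson

lemma isomorphic_trans:
  "\<lbrakk>X \<in> Obj C; Y \<in> Obj C; Z \<in> Obj C; isomorphic C X Y; isomorphic C Y Z\<rbrakk> \<Longrightarrow> isomorphic C X Z"
  using ip_Cmp isomorphic_ip by meson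

lemma isomorphic_TObj:
  "\<lbrakk>X \<in> Obj C; X' \<in> Obj C; Y \<in> Obj C; Y' \<in> Obj C; isomorphic C X X'; isomorphic C Y Y'\<rbrakk>
    \<Longrightarrow> isomorphic C (X \<odot> Y) (X' \<odot> Y')"
  using ip_TMor isomorphic_ip TObj_in by meson

text \<open>The inverses are multiplied in the opposite order, so that the inner pair cancels
  first.\<close>

lemma inverse_objects_TObj:
  assumes i: "inverse_objects Z W" and i': "inverse_objects Z' W'"
  shows "inverse_objects (Z \<odot> Z') (W' \<odot> W)"
proof -
  have cancel: "isomorphic C ((X \<odot> X') \<odot> (Y' \<odot> Y)) (Unit C)"
    if o: "X \<in> Obj C" "X' \<in> Obj C" "Y \<in> Obj C" "Y' \<in> Obj C"
      and ij: "isomorphic C (X \<odot> Y) (Unit C)" "isomorphic C (X' \<odot> Y') (Unit C)" for X X' Y Y'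
  proof -
    obtain j j' k k' where j: "ip (X \<odot> Y) (Unit C) j j'" and k: "ip (X' \<odot> Y') (Unit C) k k'"
      using ij isomorphic_ip TObj_in o Unit_in by meson
    note YY = TObj_in[OF o(4,3)] and iX = ip_Idt[OF o(1)]
    note 1 = ip_Assoc[OF o(1,2) YY]
    note 2 = ip_TMor[OF iX ip_sym[OF ip_Assoc[OF o(2,4,3)]]]
    note 3 = ip_TMor[OF iX ip_TMor[OF k ip_Idt[OF o(3)]]]
    note 4 = ip_TMor[OF iX ip_LUnit[OF o(3)]]
    note f = ip_Cmp[OF ip_Cmp[OF ip_Cmp[OF ip_Cmp[OF 1 2] 3] 4] j]
    then show ?thesis using isomorphic_ip[OF ipD(5,6)[OF f]] by blast
  qed
  have o: "Z \<in> Obj C" "Z' \<in> Obj C" "W \<in> Obj C" "W' \<in> Obj C" using i i' by (auto simp: inverse_objects_def)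
  show ?thesis
    using cancel[OF o] cancel[OF o(4,3,2,1)] i i' o TObj_in by (simp add: inverse_objects_def)
qed

lemma inverse_objects_iso:
  assumes "Z \<in> Obj C" "isomorphic C Z Z'" "inverse_objects Z' W" shows "inverse_objects Z W"
proof -
  have o: "Z' \<in> Obj C" "W \<in> Obj C" using assms by (auto simp: inverse_objects_def)
  have 1: "isomorphic C (Z \<odot> W) (Z' \<odot> W)" "isomorphic C (W \<odot> Z) (W \<odot> Z')"
    using assms o isomorphic_TObj isomorphic_refl by auto
  have 2: "isomorphic C (Z' \<odot> W) (Unit C)" "isomorphic C (W \<odot> Z') (Unit C)" using assms(3) by (auto simp: inverse_objects_def)
  show ?thesis unfolding inverse_objects_def
    using isomorphic_trans[OF _ _ _ 1(1) 2(1)] isomorphic_trans[OF _ _ _ 1(2) 2(2)] assms(1) o TObj_in Unit_in by simp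
qed

text \<open>The converse of \<open>dbl_one\<close>: brings triviality of a double braiding back from
  states to morphisms.\<close>

lemma dbl_one_iff:
  assumes o: "Z \<in> Obj C" "X \<in> Obj C"
    and e: "\<And>s. win 0 [Z, X] s \<Longrightarrow> act 0 (brd X Z) (act 0 (brd Z X) s) = s"
  shows "dbl Z X = Idt C (Z \<odot> X)"
proof -
  note ZX = TObj_in[OF o] and d = arr_dbl[OF o]
  define i where "i = idst [Z \<odot> X] (Unit C)"
  have i: "good i" "cur i = [Z \<odot> X]" using ZX Unit_in by (simp_all add: i_def good_idst)
  have wi: "win 0 [Z \<odot> X] i" using i by (simp add: win_iff)
  have w: "win 0 [Z, X] (act 0 (mm Z X) i)" using win_act_same[OF box_ok_mm[OF o]] wi by simp
  have "act 0 (mm Z X) (act 0 (bx (Z \<odot> X) (Z \<odot> X) (dbl Z X)) i) = act 0 (bx2 Z X Z X (dbl Z X)) (act 0 (mm Z X) i)"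
    by (rule act_bx2_mm[OF o o d wi, symmetric])
  also have "\<dots> = act 0 (mm Z X) i" using act_dbl[OF o w] e[OF w] by simp
  finally have "act 0 (mi Z X) (act 0 (mm Z X) (act 0 (bx (Z \<odot> X) (Z \<odot> X) (dbl Z X)) i)) = act 0 (mi Z X) (act 0 (mm Z X) i)" by simp
  then have "act 0 (bx (Z \<odot> X) (Z \<odot> X) (dbl Z X)) i = i"
    using act_mi_mm[OF o wi] act_mi_mm[OF o act_bx_ok[OF d wi]] by simp
  then have "act 0 (bx (Z \<odot> X) (Z \<odot> X) (dbl Z X)) i = sscl 1 (act 0 (bx (Z \<odot> X) (Z \<odot> X) (Idt C (Z \<odot> X))) i)"
    using act_bx_Idt[OF wi] sscl_one[OF i(1)] by simp
  then have "dbl Z X = Scl C 1 (Idt C (Z \<odot> X))" unfolding i_def by (rule act_bx_faithful[OF d arr_Idt[OF ZX]])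
  then show ?thesis using arr_Scl_one[OF arr_Idt[OF ZX]] by simp
qed

text \<open>The hexagons decompose both braidings of \<open>Z \<odot> Z'\<close> with
  \<open>X\<close>; the inner double braiding with \<open>Z\<close> cancels first, then the one with
  \<open>Z'\<close>. This closes the symmetric centre under tensor products.\<close>

lemma dbl_TObj_left:
  assumes o: "Z \<in> Obj C" "Z' \<in> Obj C" "X \<in> Obj C"
    and d: "dbl Z X = Idt C (Z \<odot> X)" "dbl Z' X = Idt C (Z' \<odot> X)"
  shows "dbl (Z \<odot> Z') X = Idt C ((Z \<odot> Z') \<odot> X)"
proof (rule dbl_one_iff[OF TObj_in[OF o(1,2)] o(3)])
  fix s assume w: "win 0 [Z \<odot> Z', X] s"
  note ZZ = TObj_in[OF o(1,2)]
  obtain vs where sh: "cur s = [Z \<odot> Z', X] @ vs" using win_shape[OF w] by auto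
  note g = win_good[OF w]
  define t where "t = act 0 (brd (Z \<odot> Z') X) s"
  have t: "good t" "cur t = [X, Z \<odot> Z'] @ vs" unfolding t_def using g sh o ZZ by (simp_all add: st_simps)
  define m where "m = act 0 (mm Z Z') s"
  have m: "good m" "cur m = [Z, Z', X] @ vs" unfolding m_def using g sh o by (simp_all add: st_simps)
  define m1 where "m1 = act 1 (brd Z' X) m"
  have m1: "good m1" "cur m1 = [Z, X, Z'] @ vs" unfolding m1_def using m o by (simp_all add: st_simps)
  have "act 0 (mm Z Z') (act 0 (brd X (Z \<odot> Z')) t) = act 1 (brd X Z') (act 0 (brd X Z) (act 1 (mm Z Z') t))"
    using brd_hex1[OF o(3,1,2), of 0 t] t by (simp add: win_iff)
  also have "act 1 (mm Z Z') t = act 0 (brd Z X) m1"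
    unfolding t_def m1_def m_def using brd_hex2[OF o w] by simp
  also have "act 0 (brd X Z) (act 0 (brd Z X) m1) = m1"
    using m1 by (intro dbl_one o d) (simp add: win_iff)
  also have "act 1 (brd X Z') m1 = m"
    unfolding m1_def using m by (intro dbl_one o d) (simp add: win_iff)
  finally have "act 0 (mi Z Z') (act 0 (mm Z Z') (act 0 (brd X (Z \<odot> Z')) t)) = act 0 (mi Z Z') m" by simp
  then show "act 0 (brd X (Z \<odot> Z')) (act 0 (brd (Z \<odot> Z') X) s) = s"
    unfolding m_def t_def[symmetric] using t g sh o ZZ by (simp add: act_mi_mm st_simps)
qed

text \<open>Naturality of both braidings; it makes the pairing a function of the isomorphism
  class.\<close>

lemma dbl_scalar_iso:
  assumes v: "ip Z Z' v v'" and X: "X \<in> Obj C" and d: "dbl Z X = Scl C t (Idt C (Z \<odot> X))"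
  shows "dbl Z' X = Scl C t (Idt C (Z' \<odot> X))"
proof -
  note i = ipD[OF v] and iX = arr_Idt[OF X] note vX = ip_TMor[OF v ip_Idt[OF X]]
  note Zo = i(5,6) note ZX = TObj_in[OF Zo(1) X] TObj_in[OF Zo(2) X]
  note B = arr_Braid[OF Zo(1) X] arr_Braid[OF X Zo(1)] arr_Braid[OF Zo(2) X] arr_Braid[OF X Zo(2)]
  note a = ipD(1)[OF vX] and Xv = arr_TMor[OF iX i(1)]
  have "dbl Z' X \<cdot> (v \<star> Idt C X) = Braid C X Z' \<cdot> Braid C Z' X \<cdot> (v \<star> Idt C X)"
    unfolding dbl_def by (rule arr_assoc[OF a B(3,4)])
  also have "Braid C Z' X \<cdot> (v \<star> Idt C X) = (Idt C X \<star> v) \<cdot> Braid C Z X"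
    by (rule Braid_natural[OF Zo X X arr_Hom[OF i(1)] arr_Hom[OF iX]])
  also have "Braid C X Z' \<cdot> (Idt C X \<star> v) \<cdot> Braid C Z X = (Braid C X Z' \<cdot> (Idt C X \<star> v)) \<cdot> Braid C Z X"
    by (rule arr_assoc[OF B(1) Xv B(4), symmetric])
  also have "Braid C X Z' \<cdot> (Idt C X \<star> v) = (v \<star> Idt C X) \<cdot> Braid C X Z"
    by (rule Braid_natural[OF X X Zo arr_Hom[OF iX] arr_Hom[OF i(1)]])
  also have "((v \<star> Idt C X) \<cdot> Braid C X Z) \<cdot> Braid C Z X = (v \<star> Idt C X) \<cdot> dbl Z X"
    unfolding dbl_def by (rule arr_assoc[OF B(1,2) a])
  also have "\<dots> = Scl C t (v \<star> Idt C X)"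
    unfolding d using arr_Scl_right[OF arr_Idt[OF ZX(1)] a] arr_Cmp_Idt[OF a] by simp
  also have "\<dots> = Scl C t (Idt C (Z' \<odot> X)) \<cdot> (v \<star> Idt C X)"
    using arr_Scl_left[OF a arr_Idt[OF ZX(2)]] arr_Idt_Cmp[OF a] by simp
  finally show ?thesis by (rule ip_cancel_right[OF vX arr_dbl[OF Zo(2) X] arr_Scl[OF arr_Idt[OF ZX(2)]]])
qed

end

section \<open>The symmetric centre and its group of invertible objects\<close>

locale extension_data = A: comm_group A
  for A :: "('a, 'c) monoid_scheme" +
  fixes B C :: "('o, 'm, 'k::alg_closed_field) braided_cat" and Cg :: "'a \<Rightarrow> 'o set"
  assumes ext: "braided_extension A B C Cg"
begin

sublocale braided_tensor_category C
  using ext by (simp add: braided_extension_def)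

abbreviation D where "D \<equiv> sym_center B"

lemma B_eq: "B = full_sub C (Cg \<one>\<^bsub>A\<^esub>)"
  using ext by (simp add: braided_extension_def)

text \<open>A full subcategory changes only the set of objects, so computations in the symmetric
  centre take place in \<open>C\<close>.\<close>

lemma D_simps [simp]:
  "Hom D = Hom C" "Idt D = Idt C" "Cmp D = Cmp C" "Scl D = Scl C" "TObj D = TObj C" "TMor D = TMor C"
  "Unit D = Unit C" "Assoc D = Assoc C" "Braid D = Braid C"
  by (simp_all add: sym_center_def full_sub_def B_eq)

lemma Cg_Obj: "x \<in> carrier A \<Longrightarrow> Cg x \<subseteq> Obj C"
  and Cg_nonzero: "x \<in> carrier A \<Longrightarrow> \<exists>X\<in>Cg x. \<not> zero_object C X"
  and Cg_TObj: "\<lbrakk>x \<in> carrier A; y \<in> carrier A; X \<in> Cg x; Y \<in> Cg y\<rbrakk> \<Longrightarrow> TObj C X Y \<in> Cg (x \<otimes>\<^bsub>A\<^esub> y)"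
  using ext by (simp_all add: braided_extension_def)

text \<open>Centrality is tested in the neutral component only; with objects of other degrees the
  double braiding may be a nontrivial scalar.\<close>

lemma Obj_D: "Z \<in> Obj D \<longleftrightarrow> Z \<in> Cg \<one>\<^bsub>A\<^esub> \<and> (\<forall>X\<in>Cg \<one>\<^bsub>A\<^esub>. dbl Z X = Idt C (TObj C Z X))"
  by (simp add: sym_center_def full_sub_def B_eq dbl_def)

lemma D_in_C: "Z \<in> Obj D \<Longrightarrow> Z \<in> Obj C"
  using Cg_Obj[OF A.one_closed] Obj_D by auto

lemma isomorphic_D [simp]: "isomorphic D X Y \<longleftrightarrow> isomorphic C X Y"
  by (simp add: isomorphic_def iso_mor_def inverse_pair_def)

lemma iso_mor_D [simp]: "iso_mor D X Y f \<longleftrightarrow> iso_mor C X Y f"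
  by (simp add: iso_mor_def inverse_pair_def)

lemma TObj_D: "\<lbrakk>Z \<in> Obj D; Z' \<in> Obj D\<rbrakk> \<Longrightarrow> TObj C Z Z' \<in> Obj D"
proof -
  assume Z: "Z \<in> Obj D" "Z' \<in> Obj D"
  have "TObj C Z Z' \<in> Cg \<one>\<^bsub>A\<^esub>"
    using Cg_TObj[OF A.one_closed A.one_closed, of Z Z'] Z by (simp add: Obj_D)
  moreover have "dbl (TObj C Z Z') X = Idt C (TObj C (TObj C Z Z') X)" if "X \<in> Cg \<one>\<^bsub>A\<^esub>" for X
    using dbl_TObj_left[OF D_in_C[OF Z(1)] D_in_C[OF Z(2)] subsetD[OF Cg_Obj[OF A.one_closed] that]] Z that
    by (simp add: Obj_D)
  ultimately show ?thesis by (simp add: Obj_D)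
qed

text \<open>The inverse has to lie in the symmetric centre, while the isomorphisms may be taken in
  \<open>C\<close>.\<close>

lemma invertible_D: "invertible_object D Z \<longleftrightarrow> Z \<in> Obj D \<and> (\<exists>W\<in>Obj D. inverse_objects Z W)"
  using D_in_C by (auto simp: invertible_object_def inverse_objects_def)

lemma invertible_TObj: "\<lbrakk>invertible_object D Z; invertible_object D Z'\<rbrakk> \<Longrightarrow> invertible_object D (TObj C Z Z')"
  unfolding invertible_D by (blast intro: TObj_D inverse_objects_TObj)

abbreviation G where "G \<equiv> Inv_group D"

lemma carrier_G: "carrier G = {iso_class D Z | Z. invertible_object D Z}"
  and mult_G: "K \<otimes>\<^bsub>G\<^esub> K' = {W \<in> Obj D. \<exists>Z\<in>K. \<exists>Z'\<in>K'. isomorphic C (TObj C Z Z') W}"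
  by (simp_all add: Inv_group_def)

text \<open>The product of classes collects all objects isomorphic to a product of members;
  compatibility of the tensor product with isomorphisms makes it the class of any one such
  product.\<close>

lemma iso_class_mult:
  assumes "Z \<in> Obj D" "Z' \<in> Obj D"
  shows "iso_class D Z \<otimes>\<^bsub>G\<^esub> iso_class D Z' = iso_class D (TObj C Z Z')"
proof -
  have c: "Z \<in> Obj C" "Z' \<in> Obj C" using assms D_in_C by auto
  have "isomorphic C (TObj C Z Z') W"
    if "W \<in> Obj D" "Y \<in> Obj D" "isomorphic C Z Y" "Y' \<in> Obj D" "isomorphic C Z' Y'" "isomorphic C (TObj C Y Y') W" for W Y Y'
  proof -
    have cY: "W \<in> Obj C" "Y \<in> Obj C" "Y' \<in> Obj C" using that D_in_C by auto
    show ?thesis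
      using isomorphic_trans[OF TObj_in[OF c] TObj_in[OF cY(2,3)] cY(1) isomorphic_TObj[OF c(1) cY(2) c(2) cY(3) that(3,5)] that(6)] .
  qed
  then show ?thesis
    unfolding mult_G iso_class_def isomorphic_D using assms isomorphic_refl[OF c(1)] isomorphic_refl[OF c(2)] by blast
qed

lemma iso_class_eq:
  assumes "Z \<in> Obj D" "Z' \<in> Obj D" "isomorphic C Z Z'" shows "iso_class D Z = iso_class D Z'"
proof -
  have c: "Z \<in> Obj C" "Z' \<in> Obj C" using assms D_in_C by auto
  show ?thesis
    unfolding iso_class_def isomorphic_D
    using isomorphic_trans[OF c _ assms(3)] isomorphic_trans[OF c(2,1) _ isomorphic_sym[OF c assms(3)]] isomorphic_trans[OF c(2,1)]
      isomorphic_trans[OF c] isomorphic_sym[OF c assms(3)] assms(3) D_in_C by blast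
qed

lemma G_closed: "\<lbrakk>K \<in> carrier G; K' \<in> carrier G\<rbrakk> \<Longrightarrow> K \<otimes>\<^bsub>G\<^esub> K' \<in> carrier G"
  unfolding carrier_G using iso_class_mult invertible_TObj invertible_D by blast

lemma G_comm:
  assumes "K \<in> carrier G" "K' \<in> carrier G" shows "K \<otimes>\<^bsub>G\<^esub> K' = K' \<otimes>\<^bsub>G\<^esub> K"
proof -
  obtain Z Z' where K: "K = iso_class D Z" "K' = iso_class D Z'" and Z: "Z \<in> Obj D" "Z' \<in> Obj D"
    using assms unfolding carrier_G invertible_D by blast
  have c: "Z \<in> Obj C" "Z' \<in> Obj C" using Z D_in_C by auto
  have "isomorphic C (TObj C Z Z') (TObj C Z' Z)"
    using isomorphic_ip[OF TObj_in[OF c] TObj_in[OF c(2,1)]] ip_Braid[OF c] by blast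
  then show ?thesis
    unfolding K iso_class_mult[OF Z] iso_class_mult[OF Z(2,1)] by (rule iso_class_eq[OF TObj_D[OF Z] TObj_D[OF Z(2,1)]])
qed

lemma G_assoc:
  assumes "K \<in> carrier G" "K' \<in> carrier G" "K'' \<in> carrier G"
  shows "K \<otimes>\<^bsub>G\<^esub> K' \<otimes>\<^bsub>G\<^esub> K'' = K \<otimes>\<^bsub>G\<^esub> (K' \<otimes>\<^bsub>G\<^esub> K'')"
proof -
  obtain Z Z' Z'' where K: "K = iso_class D Z" "K' = iso_class D Z'" "K'' = iso_class D Z''"
    and Z: "Z \<in> Obj D" "Z' \<in> Obj D" "Z'' \<in> Obj D"
    using assms unfolding carrier_G invertible_D by blast
  have c: "Z \<in> Obj C" "Z' \<in> Obj C" "Z'' \<in> Obj C" using Z D_in_C by auto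
  have "isomorphic C (TObj C (TObj C Z Z') Z'') (TObj C Z (TObj C Z' Z''))"
    using isomorphic_ip[OF TObj_in[OF TObj_in[OF c(1,2)] c(3)] TObj_in[OF c(1) TObj_in[OF c(2,3)]]] ip_Assoc[OF c] by blast
  then show ?thesis
    unfolding K iso_class_mult[OF Z(1,2)] iso_class_mult[OF Z(2,3)] iso_class_mult[OF TObj_D[OF Z(1,2)] Z(3)] iso_class_mult[OF Z(1) TObj_D[OF Z(2,3)]]
    by (rule iso_class_eq[OF TObj_D[OF TObj_D[OF Z(1,2)] Z(3)] TObj_D[OF Z(1) TObj_D[OF Z(2,3)]]])
qed

text \<open>Invertibility is invariant under isomorphism, so it holds for every member and not just
  for the one that presents the class.\<close>

lemma class_member: "\<lbrakk>K \<in> carrier G; Z \<in> K\<rbrakk> \<Longrightarrow> Z \<in> Obj D \<and> (\<exists>W. inverse_objects Z W)"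
  unfolding carrier_G invertible_D iso_class_def
  using inverse_objects_iso isomorphic_sym D_in_C by auto blast

lemma class_members_iso: "\<lbrakk>K \<in> carrier G; Z \<in> K; Z' \<in> K\<rbrakk> \<Longrightarrow> \<exists>v v'. ip Z Z' v v'"
proof -
  assume K: "K \<in> carrier G" "Z \<in> K" "Z' \<in> K"
  obtain Y where Y: "Y \<in> Obj D" "isomorphic C Y Z" "isomorphic C Y Z'" "Z \<in> Obj D" "Z' \<in> Obj D"
    using K unfolding carrier_G invertible_D iso_class_def by auto
  then have c: "Y \<in> Obj C" "Z \<in> Obj C" "Z' \<in> Obj C" using D_in_C by auto
  show ?thesis
    using isomorphic_trans[OF c(2,1,3) isomorphic_sym[OF c(1,2) Y(2)] Y(3)] isomorphic_ip[OF c(2,3)] by blast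
qed

text \<open>Shows that the definite description is met: a scalar exists by
  \<open>pairing_scalar\<close>, it serves all members of \<open>K\<close> by
  \<open>dbl_scalar_iso\<close>, and it is unique because some \<open>M0\<close> in the component is
  nonzero.\<close>

lemma component_pairing:
  assumes x: "x \<in> carrier A" and K: "K \<in> carrier G" and Z: "Z \<in> K" and M: "M \<in> Cg x"
  shows "dbl Z M = Scl C (component_pairing C (Cg x) K) (Idt C (TObj C Z M))"
proof -
  have Z': "Z \<in> Obj D" using class_member[OF K Z] by blast
  obtain W where W: "inverse_objects Z W" using class_member[OF K Z] by blast
  have ix: "inv\<^bsub>A\<^esub> x \<in> carrier A" using x by simp
  obtain M0 N0 where nz: "M0 \<in> Cg x" "\<not> zero_object C M0" "N0 \<in> Cg (inv\<^bsub>A\<^esub> x)" "\<not> zero_object C N0"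
    using Cg_nonzero[OF x] Cg_nonzero[OF ix] by blast
  have tr: "dbl Z (TObj C M N) = Idt C (TObj C Z (TObj C M N))" if "M \<in> Cg x" "N \<in> Cg (inv\<^bsub>A\<^esub> x)" for M N
    using Cg_TObj[OF x ix that] Z' x unfolding Obj_D by simp
  obtain t where t: "t \<noteq> 0" "\<forall>M\<in>Cg x. dbl Z M = Scl C t (Idt C (TObj C Z M))"
    using pairing_scalar[OF W Cg_Obj[OF x] Cg_Obj[OF ix] nz tr] by blast
  have all: "dbl Y M = Scl C t (Idt C (TObj C Y M))" if "Y \<in> K" "M \<in> Cg x" for Y M
    using class_members_iso[OF K Z that(1)] dbl_scalar_iso[of Z Y] t(2) that(2) Cg_Obj[OF x] by blast
  have "component_pairing C (Cg x) K = t"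
    unfolding component_pairing_def dbl_def[symmetric]
  proof (rule the_equality)
    show "t \<noteq> 0 \<and> (\<forall>Z\<in>K. \<forall>M\<in>Cg x. dbl Z M = Scl C t (Idt C (TObj C Z M)))" using t(1) all by blast
    fix t' assume "t' \<noteq> 0 \<and> (\<forall>Z\<in>K. \<forall>M\<in>Cg x. dbl Z M = Scl C t' (Idt C (TObj C Z M)))"
    then have e: "Scl C t' (Idt C (TObj C Z M0)) = Scl C t (Idt C (TObj C Z M0))" using all Z nz(1) by metis
    have M0: "M0 \<in> Obj C" using nz(1) Cg_Obj[OF x] by blast
    note ZM = TObj_in[OF D_in_C[OF Z'] M0]
    have "\<not> zero_object C (TObj C Z M0)" by (rule nonzero_TObj[OF D_in_C[OF Z'] M0 inverse_objects_nonzero(1)[OF W] nz(2)])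
    then show "t' = t" by (rule Scl_cancel[OF arr_Idt[OF ZM] Idt_nonzero[OF ZM] e])
  qed
  then show ?thesis using all[OF Z M] by simp
qed

end

theorem proposition8p32:
  fixes A :: "('a, 'c) monoid_scheme"
    and B C :: "('o, 'm, 'k::alg_closed_field) braided_cat"
    and Cg :: "'a \<Rightarrow> 'o set"
    and L :: "'a \<Rightarrow> 'a \<Rightarrow> 'o set"
    and R :: "'a \<Rightarrow> 'a \<Rightarrow> 'o"
    and r :: "'o set \<Rightarrow> 'o"
    and \<phi> :: "'o set \<Rightarrow> 'o set \<Rightarrow> 'm"
  assumes "braided_tensor_category B"
    and "comm_group A" and "finite (carrier A)"
    and "braided_extension A B C Cg"
    and "L \<in> Z2_br A (Inv_group (sym_center B))"
    and "\<forall>x\<in>carrier A. \<forall>y\<in>carrier A. R x y \<in> L x y"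
    and "skeletal_model (sym_center B) r \<phi>"
  shows "(\<exists>\<xi> \<kappa>.
      (\<forall>x\<in>carrier A. \<forall>y\<in>carrier A. \<forall>z\<in>carrier A.
        iso_mor C (R (x \<otimes>\<^bsub>A\<^esub> y) z \<odot>\<^bsub>C\<^esub> R x y) (R x (y \<otimes>\<^bsub>A\<^esub> z) \<odot>\<^bsub>C\<^esub> R y z) (\<xi> x y z))
      \<and> (\<forall>x\<in>carrier A. \<forall>y\<in>carrier A. iso_mor C (R x y) (R y x) (\<kappa> x y))
      \<and> tw_pentagon A C Cg R \<xi>
      \<and> tw_hexagon1 A C Cg R \<xi> \<kappa>
      \<and> tw_hexagon2 A C Cg R \<xi> \<kappa>)
    \<longleftrightarrow> trivial_in_H4_br A (PW2 B C Cg r \<phi> L)"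
proof -
  interpret A: comm_group A by (rule assms(2))
  interpret E: extension_data A B C Cg
    by unfold_locales (rule assms(4))
  have Lx: "L x y \<in> carrier E.G" "L x y = L y x" if "x \<in> carrier A" "y \<in> carrier A" for x y
    using assms(5) that by (auto simp: Z2_br_def)
  have Lc: "L (x \<otimes>\<^bsub>A\<^esub> y) z \<otimes>\<^bsub>E.G\<^esub> L x y = L x (y \<otimes>\<^bsub>A\<^esub> z) \<otimes>\<^bsub>E.G\<^esub> L y z"
    if "x \<in> carrier A" "y \<in> carrier A" "z \<in> carrier A" for x y z
    using assms(5) that by (auto simp: Z2_br_def)
  have rK: "r K \<in> K" if "K \<in> carrier E.G" for K
    using assms(7) that by (simp add: skeletal_model_def)
  have rO: "r K \<in> Obj E.D" if "K \<in> carrier E.G" for K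
    using E.class_member[OF that rK[OF that]] by blast
  \<comment> \<open>The tensor structure \<open>\<phi>\<close> lives in the symmetric centre, whose
    isomorphisms are those of \<open>C\<close> and whose objects have trivial double braidings with
    one another.\<close>
  interpret S: skeletal_data C E.G r \<phi>
  proof
    fix K K' K'' assume K: "K \<in> carrier E.G"
    show "\<exists>W. E.inverse_objects (r K) W" using E.class_member[OF K rK[OF K]] by blast
    assume K': "K' \<in> carrier E.G"
    show "K \<otimes>\<^bsub>E.G\<^esub> K' \<in> carrier E.G" "K \<otimes>\<^bsub>E.G\<^esub> K' = K' \<otimes>\<^bsub>E.G\<^esub> K" by (rule E.G_closed[OF K K'] E.G_comm[OF K K'])+
    have "iso_mor C (r K \<odot>\<^bsub>C\<^esub> r K') (r (K \<otimes>\<^bsub>E.G\<^esub> K')) (\<phi> K K')"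
      using assms(7) K K' by (simp add: skeletal_model_def)
    then show "\<exists>g. E.ip (r K \<odot>\<^bsub>C\<^esub> r K') (r (K \<otimes>\<^bsub>E.G\<^esub> K')) (\<phi> K K') g"
      using E.iso_mor_ip[OF E.TObj_in[OF E.D_in_C[OF rO[OF K]] E.D_in_C[OF rO[OF K']]] E.D_in_C[OF rO[OF E.G_closed[OF K K']]]] by blast
    show "E.dbl (r K) (r K') = Idt C (r K \<odot>\<^bsub>C\<^esub> r K')"
      using rO[OF K] rO[OF K'] by (simp add: E.Obj_D)
    assume K'': "K'' \<in> carrier E.G"
    show "K \<otimes>\<^bsub>E.G\<^esub> K' \<otimes>\<^bsub>E.G\<^esub> K'' = K \<otimes>\<^bsub>E.G\<^esub> (K' \<otimes>\<^bsub>E.G\<^esub> K'')" by (rule E.G_assoc[OF K K' K''])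
    show "\<phi> (K \<otimes>\<^bsub>E.G\<^esub> K') K'' \<cdot>\<^bsub>C\<^esub> (\<phi> K K' \<star>\<^bsub>C\<^esub> Idt C (r K''))
        = \<phi> K (K' \<otimes>\<^bsub>E.G\<^esub> K'') \<cdot>\<^bsub>C\<^esub> (Idt C (r K) \<star>\<^bsub>C\<^esub> \<phi> K' K'') \<cdot>\<^bsub>C\<^esub> Assoc C (r K) (r K') (r K'')"
      using assms(7) K K' K'' by (simp add: skeletal_model_def)
  qed
  \<comment> \<open>The chosen \<open>R x y\<close> and the representative \<open>r (L x y)\<close>
    lie in one class; any isomorphism between them may serve as label.\<close>
  define u where "u = (\<lambda>x y. SOME v. S.lab (R x y) (L x y) v)"
  have u: "S.lab (R x y) (L x y) (u x y)" if "x \<in> carrier A" "y \<in> carrier A" for x y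
  proof -
    have "\<exists>v. S.lab (R x y) (L x y) v"
      using E.class_members_iso[OF Lx(1)[OF that] _ rK[OF Lx(1)[OF that]], of "R x y"] assms(6) that Lx(1)[OF that]
      unfolding S.lab_def by blast
    then show ?thesis unfolding u_def by (rule someI_ex)
  qed
  interpret T: twisted_data C E.G r \<phi> A Cg L R u "\<lambda>x y z. component_pairing C (Cg x) (L y z)"
  proof
    fix x assume x: "x \<in> carrier A"
    show "Cg x \<subseteq> Obj C" "\<exists>X\<in>Cg x. \<not> zero_object C X" by (rule E.Cg_Obj[OF x] E.Cg_nonzero[OF x])+
    fix y assume y: "y \<in> carrier A"
    show "L x y = L y x" "S.lab (R x y) (L x y) (u x y)" using Lx x y u by auto
    fix z assume z: "z \<in> carrier A"
    show "L (x \<otimes>\<^bsub>A\<^esub> y) z \<otimes>\<^bsub>E.G\<^esub> L x y = L x (y \<otimes>\<^bsub>A\<^esub> z) \<otimes>\<^bsub>E.G\<^esub> L y z" by (rule Lc[OF x y z])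
    fix X assume "X \<in> Cg x"
    then show "E.dbl (R y z) X = Scl C (component_pairing C (Cg x) (L y z)) (Idt C (R y z \<odot>\<^bsub>C\<^esub> X))"
      using E.component_pairing[OF x Lx(1)[OF y z]] assms(6) y z by blast
  qed
  \<comment> \<open>The braiding of the symmetric centre is that of \<open>C\<close>, so
    \<open>skeletal_braiding\<close> and \<open>beta\<close> are the same definite
    description.\<close>
  have "PW2 B C Cg r \<phi> L = T.pw"
    by (simp add: PW2_def T.pw_def skeletal_braiding_def S.beta_def)
  then show ?thesis
    using T.structure_iff_scalar_eqs T.trivial_iff_scalar_eqs by simp
qed

end
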